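(* Let $R$ be a commutative Noetherian ring, and let $M$ and $N$ be nonzero $R$-modules with $M$ finitely generated and $\operatorname{qpd}_RN<\infty$. Let $n>0$ be an integer, and $P$ a finite quasi-projective resolution of $N$. Assume $\operatorname{G-dim}_RM<n$. (a) If $\operatorname{Tor}_i^R(M,N)=0$ for all $n\le i\le n+\operatorname{hsup} P-\operatorname{hinf} P$, then $\operatorname{Tor}_i^R(M,N)=0$ for all $i>\operatorname{G-dim}_RM$. (b) If $\operatorname{Ext}^i_R(M,N)=0$ for all $n\le i\le n+\operatorname{hsup} P-\operatorname{hinf} P$, then $\operatorname{Ext}^i_R(M,N)=0$ for all $i>\operatorname{G-dim}_RM$.
   Context: For a complex $X$ of $R$-modules put $\sup X=\sup\{i: X_i\neq 0\}$, $\inf X=\inf\{i: X_i\neq0\}$, $\operatorname{hsup}X=\sup\{i: H_i(X)\neq0\}$ and $\operatorname{hinf}X=\inf\{i: H_i(X)\neq0\}$. A quasi-projective resolution of an $R$-module $N$ is a bounded below complex $P$ of projective $R$-modules such that for all $i\ge\inf P$ there are integers $a_i\ge0$, not all zero, with $H_i(P)\cong N^{\oplus a_i}$; it is finite if $P$ is bounded. For $N\neq0$, $\operatorname{qpd}_RN=\inf\{\sup P-\operatorname{hsup}P : P \text{ a finite quasi-projective resolution of } N\}$ (which is $\infty$ if no such $P$ exists). A finitely generated $R$-module $M$ is totally reflexive if, with $(-)^*=\operatorname{Hom}_R(-,R)$, the natural map $M\to M^{**}$ is an isomorphism and $\operatorname{Ext}^i_R(M,R)=0=\operatorname{Ext}^i_R(M^*,R)$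 for all $i>0$. The Gorenstein dimension $\operatorname{G-dim}_RM$ of a finitely generated module $M$ is the infimum of the $n\ge0$ for which there is an exact sequence $0\to G_n\to\cdots\to G_0\to M\to0$ with each $G_i$ totally reflexive. *)

theory Defs
  imports
    "HOL-Algebra.Module"
    "HOL-Algebra.AbelCoset"
    "HOL-Algebra.Ring_Divisibility"
    "HOL-Library.FuncSet"
    "HOL-Library.Extended_Nat"
    "HOL-Library.Extended_Real"
begin

section \<open>Modules\<close>

text \<open>The record type of modules extends that of rings; the two multiplicative
  fields play no role for modules and are left undefined.\<close>

definition mk_module ::
  "'b set \<Rightarrow> 'b \<Rightarrow> ('b \<Rightarrow> 'b \<Rightarrow> 'b) \<Rightarrow> ('a \<Rightarrow> 'b \<Rightarrow> 'b) \<Rightarrow> ('a, 'b) module" where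
  "mk_module C z p s =
    \<lparr>carrier = C, monoid.mult = undefined, one = undefined, zero = z, add = p, smult = s\<rparr>"

definition zero_module :: "('a, 'b) module \<Rightarrow> bool" where
  "zero_module M \<longleftrightarrow> carrier M = {\<zero>\<^bsub>M\<^esub>}"

definition regular_module :: "('a, 'r) ring_scheme \<Rightarrow> ('a, 'a) module" where
  "regular_module R = mk_module (carrier R) \<zero>\<^bsub>R\<^esub> (\<lambda>x y. x \<oplus>\<^bsub>R\<^esub> y) (\<lambda>a x. a \<otimes>\<^bsub>R\<^esub> x)"

definition module_hom ::
  "('a, 'r) ring_scheme \<Rightarrow> ('a, 'b) module \<Rightarrow> ('a, 'c) module \<Rightarrow> ('b \<Rightarrow> 'c) set" where
  "module_hom R M N =
    {f. f \<in> carrier M \<rightarrow> carrier N \<and>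
        (\<forall>x\<in>carrier M. \<forall>y\<in>carrier M. f (x \<oplus>\<^bsub>M\<^esub> y) = f x \<oplus>\<^bsub>N\<^esub> f y) \<and>
        (\<forall>a\<in>carrier R. \<forall>x\<in>carrier M. f (a \<odot>\<^bsub>M\<^esub> x) = a \<odot>\<^bsub>N\<^esub> f x)}"

definition module_isomorphic ::
  "('a, 'r) ring_scheme \<Rightarrow> ('a, 'b) module \<Rightarrow> ('a, 'c) module \<Rightarrow> bool" where
  "module_isomorphic R M N \<longleftrightarrow> (\<exists>f\<in>module_hom R M N. bij_betw f (carrier M) (carrier N))"

definition span_module :: "('a, 'r) ring_scheme \<Rightarrow> ('a, 'b) module \<Rightarrow> 'b set \<Rightarrow> 'b set" where
  "span_module R M S = \<Inter>{H. submodule H R M \<and> S \<subseteq> H}"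

definition fin_gen_module :: "('a, 'r) ring_scheme \<Rightarrow> ('a, 'b) module \<Rightarrow> bool" where
  "fin_gen_module R M \<longleftrightarrow>
    (\<exists>S. finite S \<and> S \<subseteq> carrier M \<and> span_module R M S = carrier M)"

definition quotient_module :: "('a, 'b) module \<Rightarrow> 'b set \<Rightarrow> ('a, 'b set) module" where
  "quotient_module M H =
    mk_module (a_rcosets\<^bsub>M\<^esub> H) H (\<lambda>C D. C <+>\<^bsub>M\<^esub> D) (\<lambda>a C. H <+>\<^bsub>M\<^esub> ((\<lambda>x. a \<odot>\<^bsub>M\<^esub> x) ` C))"

definition direct_power :: "('a, 'b) module \<Rightarrow> nat \<Rightarrow> ('a, nat \<Rightarrow> 'b) module" where
  "direct_power N k =
    mk_module ({..<k} \<rightarrow>\<^sub>E carrier N) (\<lambda>i\<in>{..<k}. \<zero>\<^bsub>N\<^esub>)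
      (\<lambda>x y. \<lambda>i\<in>{..<k}. x i \<oplus>\<^bsub>N\<^esub> y i) (\<lambda>a x. \<lambda>i\<in>{..<k}. a \<odot>\<^bsub>N\<^esub> x i)"

text \<open>Homomorphisms are made extensional here, so that equality in the carrier is
  equality of maps.\<close>

definition hom_module ::
  "('a, 'r) ring_scheme \<Rightarrow> ('a, 'b) module \<Rightarrow> ('a, 'c) module \<Rightarrow> ('a, 'b \<Rightarrow> 'c) module" where
  "hom_module R M N =
    mk_module (module_hom R M N \<inter> extensional (carrier M)) (\<lambda>x\<in>carrier M. \<zero>\<^bsub>N\<^esub>)
      (\<lambda>f g. \<lambda>x\<in>carrier M. f x \<oplus>\<^bsub>N\<^esub> g x) (\<lambda>a f. \<lambda>x\<in>carrier M. a \<odot>\<^bsub>N\<^esub> f x)"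

definition free_module :: "('a, 'r) ring_scheme \<Rightarrow> 'x set \<Rightarrow> ('a, 'x \<Rightarrow> 'a) module" where
  "free_module R X =
    mk_module {f. range f \<subseteq> carrier R \<and> finite {x. f x \<noteq> \<zero>\<^bsub>R\<^esub>} \<and> {x. f x \<noteq> \<zero>\<^bsub>R\<^esub>} \<subseteq> X}
      (\<lambda>_. \<zero>\<^bsub>R\<^esub>) (\<lambda>f g x. f x \<oplus>\<^bsub>R\<^esub> g x) (\<lambda>a f x. a \<otimes>\<^bsub>R\<^esub> f x)"

definition unit_vector :: "('a, 'r) ring_scheme \<Rightarrow> 'x \<Rightarrow> 'x \<Rightarrow> 'a" where
  "unit_vector R x = (\<lambda>y. if y = x then \<one>\<^bsub>R\<^esub> else \<zero>\<^bsub>R\<^esub>)"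

text \<open>The linear extension to a free module of a map on its basis.\<close>

definition linear_extension ::
  "('a, 'r) ring_scheme \<Rightarrow> ('a, 'b) module \<Rightarrow> ('x \<Rightarrow> 'b) \<Rightarrow> ('x \<Rightarrow> 'a) \<Rightarrow> 'b" where
  "linear_extension R M g f = (\<Oplus>\<^bsub>M\<^esub>x\<in>{x. f x \<noteq> \<zero>\<^bsub>R\<^esub>}. f x \<odot>\<^bsub>M\<^esub> g x)"

text \<open>Projectivity is the lifting property. A quantifier cannot range over types, so
  the property is tested on surjections \<open>A \<rightarrow> B\<close> with \<open>B\<close> carried by the type \<open>'p\<close>
  of \<open>P\<close> and \<open>A\<close> carried by \<open>'p \<Rightarrow> 'a\<close>. This includes the surjection from the free
  module on the set \<open>P\<close> onto \<open>P\<close>; lifting the identity along it exhibits \<open>P\<close> as a direct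
  summand of a free module, whence the lifting property along arbitrary surjections.\<close>

definition projective_module :: "('a, 'r) ring_scheme \<Rightarrow> ('a, 'p) module \<Rightarrow> bool" where
  "projective_module R P \<longleftrightarrow> module R P \<and>
    (\<forall>(A :: ('a, 'p \<Rightarrow> 'a) module) (B :: ('a, 'p) module).
      module R A \<longrightarrow> module R B \<longrightarrow>
      (\<forall>g\<in>module_hom R A B. g ` carrier A = carrier B \<longrightarrow>
        (\<forall>f\<in>module_hom R P B. \<exists>h\<in>module_hom R P A. \<forall>x\<in>carrier P. g (h x) = f x)))"


section \<open>Tensor products\<close>

definition tensor_relations ::
  "('a, 'r) ring_scheme \<Rightarrow> ('a, 'b) module \<Rightarrow> ('a, 'c) module \<Rightarrow> ('b \<times> 'c \<Rightarrow> 'a) set" where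
  "tensor_relations R M N =
    (let F = free_module R (carrier M \<times> carrier N); e = unit_vector R in
      {e (x \<oplus>\<^bsub>M\<^esub> x', y) \<ominus>\<^bsub>F\<^esub> (e (x, y) \<oplus>\<^bsub>F\<^esub> e (x', y)) | x x' y.
         x \<in> carrier M \<and> x' \<in> carrier M \<and> y \<in> carrier N} \<union>
      {e (x, y \<oplus>\<^bsub>N\<^esub> y') \<ominus>\<^bsub>F\<^esub> (e (x, y) \<oplus>\<^bsub>F\<^esub> e (x, y')) | x y y'.
         x \<in> carrier M \<and> y \<in> carrier N \<and> y' \<in> carrier N} \<union>
      {e (a \<odot>\<^bsub>M\<^esub> x, y) \<ominus>\<^bsub>F\<^esub> a \<odot>\<^bsub>F\<^esub> e (x, y) | a x y.
         a \<in> carrier R \<and> x \<in> carrier M \<and> y \<in> carrier N} \<union>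
      {e (x, a \<odot>\<^bsub>N\<^esub> y) \<ominus>\<^bsub>F\<^esub> a \<odot>\<^bsub>F\<^esub> e (x, y) | a x y.
         a \<in> carrier R \<and> x \<in> carrier M \<and> y \<in> carrier N})"

definition tensor_kernel ::
  "('a, 'r) ring_scheme \<Rightarrow> ('a, 'b) module \<Rightarrow> ('a, 'c) module \<Rightarrow> ('b \<times> 'c \<Rightarrow> 'a) set" where
  "tensor_kernel R M N =
    span_module R (free_module R (carrier M \<times> carrier N)) (tensor_relations R M N)"

definition tensor_module ::
  "('a, 'r) ring_scheme \<Rightarrow> ('a, 'b) module \<Rightarrow> ('a, 'c) module \<Rightarrow>
    ('a, ('b \<times> 'c \<Rightarrow> 'a) set) module" where
  "tensor_module R M N =
    quotient_module (free_module R (carrier M \<times> carrier N)) (tensor_kernel R M N)"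

definition pure_tensor ::
  "('a, 'r) ring_scheme \<Rightarrow> ('a, 'b) module \<Rightarrow> ('a, 'c) module \<Rightarrow>
    'b \<Rightarrow> 'c \<Rightarrow> ('b \<times> 'c \<Rightarrow> 'a) set" where
  "pure_tensor R M N x y =
    tensor_kernel R M N +>\<^bsub>free_module R (carrier M \<times> carrier N)\<^esub> unit_vector R (x, y)"

text \<open>The map induced by \<open>f : M \<rightarrow> M'\<close> on tensor products with \<open>N\<close>.\<close>

definition tensor_map ::
  "('a, 'r) ring_scheme \<Rightarrow> ('a, 'b) module \<Rightarrow> ('a, 'd) module \<Rightarrow> ('a, 'c) module \<Rightarrow>
    ('b \<Rightarrow> 'd) \<Rightarrow> ('b \<times> 'c \<Rightarrow> 'a) set \<Rightarrow> ('d \<times> 'c \<Rightarrow> 'a) set" where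
  "tensor_map R M M' N f =
    (THE h. h \<in> carrier (hom_module R (tensor_module R M N) (tensor_module R M' N)) \<and>
       (\<forall>x\<in>carrier M. \<forall>y\<in>carrier N. h (pure_tensor R M N x y) = pure_tensor R M' N (f x) y))"


section \<open>Complexes and homology\<close>

text \<open>Complexes are graded homologically: \<open>cdiff X i\<close> maps degree \<open>i\<close> to degree \<open>i - 1\<close>.\<close>

record ('a, 'b) cpx =
  cobj :: "int \<Rightarrow> ('a, 'b) module"
  cdiff :: "int \<Rightarrow> 'b \<Rightarrow> 'b"

definition chain_complex :: "('a, 'r) ring_scheme \<Rightarrow> ('a, 'b) cpx \<Rightarrow> bool" where
  "chain_complex R X \<longleftrightarrow>
    (\<forall>i. module R (cobj X i) \<and> cdiff X i \<in> module_hom R (cobj X i) (cobj X (i - 1)) \<and>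
      (\<forall>x\<in>carrier (cobj X i). cdiff X (i - 1) (cdiff X i x) = \<zero>\<^bsub>cobj X (i - 2)\<^esub>))"

definition cycles :: "('a, 'b) cpx \<Rightarrow> int \<Rightarrow> 'b set" where
  "cycles X i = {x \<in> carrier (cobj X i). cdiff X i x = \<zero>\<^bsub>cobj X (i - 1)\<^esub>}"

definition boundaries :: "('a, 'b) cpx \<Rightarrow> int \<Rightarrow> 'b set" where
  "boundaries X i = cdiff X (i + 1) ` carrier (cobj X (i + 1))"

definition homology :: "('a, 'b) cpx \<Rightarrow> int \<Rightarrow> ('a, 'b set) module" where
  "homology X i = quotient_module (cobj X i \<lparr>carrier := cycles X i\<rparr>) (boundaries X i)"

definition csup :: "('a, 'b) cpx \<Rightarrow> ereal" where
  "csup X = Sup {ereal (of_int i) | i. \<not> zero_module (cobj X i)}"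

definition cinf :: "('a, 'b) cpx \<Rightarrow> ereal" where
  "cinf X = Inf {ereal (of_int i) | i. \<not> zero_module (cobj X i)}"

definition hsup :: "('a, 'b) cpx \<Rightarrow> ereal" where
  "hsup X = Sup {ereal (of_int i) | i. \<not> zero_module (homology X i)}"

definition hinf :: "('a, 'b) cpx \<Rightarrow> ereal" where
  "hinf X = Inf {ereal (of_int i) | i. \<not> zero_module (homology X i)}"

definition bounded_below :: "('a, 'b) cpx \<Rightarrow> bool" where
  "bounded_below X \<longleftrightarrow> (\<exists>b. \<forall>i<b. zero_module (cobj X i))"

definition bounded_above :: "('a, 'b) cpx \<Rightarrow> bool" where
  "bounded_above X \<longleftrightarrow> (\<exists>b. \<forall>i>b. zero_module (cobj X i))"

definition tensor_complex ::
  "('a, 'r) ring_scheme \<Rightarrow> ('a, 'b) cpx \<Rightarrow> ('a, 'c) module \<Rightarrow>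
    ('a, ('b \<times> 'c \<Rightarrow> 'a) set) cpx" where
  "tensor_complex R X N =
    \<lparr>cobj = (\<lambda>i. tensor_module R (cobj X i) N),
     cdiff = (\<lambda>i. tensor_map R (cobj X i) (cobj X (i - 1)) N (cdiff X i))\<rparr>"

text \<open>Degree \<open>i\<close> of the complex \<open>Hom(X, N)\<close> is \<open>Hom(X\<^bsub>- i\<^esub>, N)\<close>, so its cohomology in
  degree \<open>i\<close> is the homology in degree \<open>- i\<close>.\<close>

definition hom_complex ::
  "('a, 'r) ring_scheme \<Rightarrow> ('a, 'b) cpx \<Rightarrow> ('a, 'c) module \<Rightarrow> ('a, 'b \<Rightarrow> 'c) cpx" where
  "hom_complex R X N =
    \<lparr>cobj = (\<lambda>i. hom_module R (cobj X (- i)) N),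
     cdiff = (\<lambda>i f. \<lambda>x\<in>carrier (cobj X (1 - i)). f (cdiff X (1 - i) x))\<rparr>"

text \<open>The exact sequence \<open>\<dots> \<rightarrow> X\<^sub>1 \<rightarrow> X\<^sub>0 \<rightarrow> M \<rightarrow> 0\<close>, with augmentation \<open>\<epsilon>\<close>.\<close>

definition left_resolution ::
  "('a, 'r) ring_scheme \<Rightarrow> ('a, 'b) cpx \<Rightarrow> ('b \<Rightarrow> 'm) \<Rightarrow> ('a, 'm) module \<Rightarrow> bool" where
  "left_resolution R X \<epsilon> M \<longleftrightarrow> chain_complex R X \<and> (\<forall>i<0. zero_module (cobj X i)) \<and>
    \<epsilon> \<in> module_hom R (cobj X 0) M \<and> \<epsilon> ` carrier (cobj X 0) = carrier M \<and>
    {x \<in> carrier (cobj X 0). \<epsilon> x = \<zero>\<^bsub>M\<^esub>} = boundaries X 0 \<and>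
    (\<forall>i>0. cycles X i = boundaries X i)"


section \<open>The standard free resolution, Tor and Ext\<close>

text \<open>Tor and Ext are computed from one functorial free resolution \<open>F\<close> of \<open>M\<close>. The basis of
  \<open>F\<^sub>0\<close> consists of the elements of \<open>M\<close>, and the basis of \<open>F\<^bsub>n + 1\<^esub>\<close> consists of all formal
  linear combinations of basis elements of \<open>F\<^sub>n\<close> whose value lies in the kernel of
  \<open>F\<^sub>n \<rightarrow> F\<^bsub>n - 1\<^esub>\<close> (of \<open>F\<^sub>0 \<rightarrow> M\<close> for \<open>n = 0\<close>), the differential sending such a
  combination to its value. Using formal combinations in place of the kernel elements
  themselves keeps all degrees inside one type.\<close>

datatype ('a, 'm) syz = Gen 'm | Syz "('a \<times> ('a, 'm) syz) list"

definition combination_value :: "('a, 'r) ring_scheme \<Rightarrow> ('a \<times> 'x) list \<Rightarrow> 'x \<Rightarrow> 'a" where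
  "combination_value R l = foldr (\<lambda>(a, b) f. f(b := a \<oplus>\<^bsub>R\<^esub> f b)) l (\<lambda>_. \<zero>\<^bsub>R\<^esub>)"

text \<open>The value of \<open>syz_boundary\<close> on \<open>Gen\<close> makes the differential out of \<open>F\<^sub>0\<close> vanish;
  the value of \<open>syz_aug\<close> on \<open>Syz\<close> is never used.\<close>

definition syz_boundary ::
  "('a, 'r) ring_scheme \<Rightarrow> ('a, 'm) syz \<Rightarrow> ('a, 'm) syz \<Rightarrow> 'a" where
  "syz_boundary R s = (case s of Gen m \<Rightarrow> \<lambda>_. \<zero>\<^bsub>R\<^esub> | Syz l \<Rightarrow> combination_value R l)"

definition std_diff ::
  "('a, 'r) ring_scheme \<Rightarrow> (('a, 'm) syz \<Rightarrow> 'a) \<Rightarrow> ('a, 'm) syz \<Rightarrow> 'a" where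
  "std_diff R = linear_extension R (free_module R UNIV) (syz_boundary R)"

definition std_aug ::
  "('a, 'r) ring_scheme \<Rightarrow> ('a, 'm) module \<Rightarrow> (('a, 'm) syz \<Rightarrow> 'a) \<Rightarrow> 'm" where
  "std_aug R M = linear_extension R M (\<lambda>s. case s of Gen m \<Rightarrow> m | Syz l \<Rightarrow> \<zero>\<^bsub>M\<^esub>)"

primrec syz_basis ::
  "('a, 'r) ring_scheme \<Rightarrow> ('a, 'm) module \<Rightarrow> nat \<Rightarrow> ('a, 'm) syz set" where
  "syz_basis R M 0 = Gen ` carrier M"
| "syz_basis R M (Suc n) =
    Syz ` {l \<in> lists (carrier R \<times> syz_basis R M n).
      if n = 0 then std_aug R M (combination_value R l) = \<zero>\<^bsub>M\<^esub>
      else std_diff R (combination_value R l) = (\<lambda>_. \<zero>\<^bsub>R\<^esub>)}"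

definition std_resolution ::
  "('a, 'r) ring_scheme \<Rightarrow> ('a, 'm) module \<Rightarrow> ('a, ('a, 'm) syz \<Rightarrow> 'a) cpx" where
  "std_resolution R M =
    \<lparr>cobj = (\<lambda>i. free_module R (if i < 0 then {} else syz_basis R M (nat i))),
     cdiff = (\<lambda>i. std_diff R)\<rparr>"

definition Tor ::
  "('a, 'r) ring_scheme \<Rightarrow> nat \<Rightarrow> ('a, 'm) module \<Rightarrow> ('a, 'n) module \<Rightarrow>
    ('a, ((('a, 'm) syz \<Rightarrow> 'a) \<times> 'n \<Rightarrow> 'a) set set) module" where
  "Tor R i M N = homology (tensor_complex R (std_resolution R M) N) (int i)"

definition Ext ::
  "('a, 'r) ring_scheme \<Rightarrow> nat \<Rightarrow> ('a, 'm) module \<Rightarrow> ('a, 'n) module \<Rightarrow>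
    ('a, ((('a, 'm) syz \<Rightarrow> 'a) \<Rightarrow> 'n) set) module" where
  "Ext R i M N = homology (hom_complex R (std_resolution R M) N) (- int i)"


section \<open>Quasi-projective dimension\<close>

definition quasi_projective_resolution ::
  "('a, 'r) ring_scheme \<Rightarrow> ('a, 'p) cpx \<Rightarrow> ('a, 'n) module \<Rightarrow> bool" where
  "quasi_projective_resolution R P N \<longleftrightarrow>
    chain_complex R P \<and> bounded_below P \<and> (\<forall>i. projective_module R (cobj P i)) \<and>
    (\<exists>a :: int \<Rightarrow> nat. (\<exists>i. cinf P \<le> ereal (of_int i) \<and> a i \<noteq> 0) \<and>
      (\<forall>i. cinf P \<le> ereal (of_int i) \<longrightarrow>
        module_isomorphic R (homology P i) (direct_power N (a i))))"

definition finite_quasi_projective_resolution ::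
  "('a, 'r) ring_scheme \<Rightarrow> ('a, 'p) cpx \<Rightarrow> ('a, 'n) module \<Rightarrow> bool" where
  "finite_quasi_projective_resolution R P N \<longleftrightarrow>
    quasi_projective_resolution R P N \<and> bounded_above P"

text \<open>The infimum ranges over complexes whose modules are carried by the type \<open>'p\<close>, which is
  a parameter because a quantifier cannot range over types.\<close>

definition qpd :: "'p itself \<Rightarrow> ('a, 'r) ring_scheme \<Rightarrow> ('a, 'n) module \<Rightarrow> ereal" where
  "qpd _ R N =
    Inf {csup P - hsup P | P :: ('a, 'p) cpx. finite_quasi_projective_resolution R P N}"


section \<open>Gorenstein dimension\<close>

definition dual_module :: "('a, 'r) ring_scheme \<Rightarrow> ('a, 'm) module \<Rightarrow> ('a, 'm \<Rightarrow> 'a) module" where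
  "dual_module R M = hom_module R M (regular_module R)"

definition biduality_map ::
  "('a, 'r) ring_scheme \<Rightarrow> ('a, 'm) module \<Rightarrow> 'm \<Rightarrow> ('m \<Rightarrow> 'a) \<Rightarrow> 'a" where
  "biduality_map R M x = (\<lambda>f\<in>carrier (dual_module R M). f x)"

definition totally_reflexive :: "('a, 'r) ring_scheme \<Rightarrow> ('a, 'm) module \<Rightarrow> bool" where
  "totally_reflexive R M \<longleftrightarrow> module R M \<and> fin_gen_module R M \<and>
    bij_betw (biduality_map R M) (carrier M) (carrier (dual_module R (dual_module R M))) \<and>
    (\<forall>i>0. zero_module (Ext R i M (regular_module R))) \<and>
    (\<forall>i>0. zero_module (Ext R i (dual_module R M) (regular_module R)))"

text \<open>The modules of the resolution are carried by the type \<open>(nat \<Rightarrow> 'a) set\<close>. This is no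
  restriction: a finitely generated module is isomorphic to a quotient of some
  \<open>R\<^sup>n\<close>, whose elements are cosets in \<open>nat \<Rightarrow> 'a\<close>.\<close>

definition Gdim :: "('a, 'r) ring_scheme \<Rightarrow> ('a, 'm) module \<Rightarrow> enat" where
  "Gdim R M =
    Inf {enat n | n. \<exists>(G :: ('a, (nat \<Rightarrow> 'a) set) cpx) \<epsilon>.
      left_resolution R G \<epsilon> M \<and> (\<forall>i>int n. zero_module (cobj G i)) \<and>
      (\<forall>i\<in>{0..int n}. totally_reflexive R (cobj G i))}"

end

theory Submission
  imports Defs
begin


text \<open>
  Write \<open>g\<close> for the Gorenstein dimension of \<open>M\<close>, and let \<open>s = hsup P\<close>, \<open>t = hinf P\<close>. All derived functors are
  read off one finite free resolution \<open>L\<close> of \<open>M\<close>, so that \<open>Tor\<close> and \<open>Ext\<close> with coefficients in a module are the homology of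
  \<open>L\<close>, respectively of its transpose, with these coefficients, and have long exact sequences in the coefficients.

  Let \<open>Z\<close>, \<open>B\<close> be the cycles and boundaries of \<open>P\<close>. The sequences \<open>0 \<rightarrow> B\<^sub>q \<rightarrow> Z\<^sub>q \<rightarrow> H\<^sub>q \<rightarrow> 0\<close> and
  \<open>0 \<rightarrow> Z\<^sub>q \<rightarrow> P\<^sub>q \<rightarrow> B\<^bsub>q - 1\<^esub> \<rightarrow> 0\<close>, in which every nonzero \<open>H\<^sub>q\<close> is a power of \<open>N\<close>, let a window of
  \<open>s - t + 1\<close> vanishing degrees move up and down by one, provided that the two ends of \<open>P\<close> contribute nothing.
  At the bottom this holds because \<open>Z\<^sub>t\<close> is a direct summand of \<open>P\<^sub>t\<close>. At the top, \<open>P\<^sub>s / B\<^sub>s\<close> has finite projective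
  dimension, and one needs that \<open>Tor\<^sub>i(M, P\<^sub>s / B\<^sub>s)\<close> and \<open>Ext\<^sup>i(M, Q)\<close>, for projective \<open>Q\<close>, vanish for \<open>i > g\<close>. Taking mapping cones
  along a resolution of \<open>M\<close> by totally reflexive modules reduces this to a totally reflexive \<open>G\<close>. There,
  a resolution of \<open>G\<close> continued by the transpose of a resolution of the dual of \<open>G\<close> is an acyclic complex of finite free
  modules, which stays acyclic with coefficients in any module of finite projective dimension.
\<close>

section \<open>Exactness with coefficients in a subquotient\<close>

text \<open>Passing from one homology module of \<open>P\<close> to the next trades one degree of
  \<open>P\<close> for one degree of \<open>Tor\<close> or \<open>Ext\<close>, so a run between
  \<open>t\<close> and \<open>s\<close> that starts inside a window of width s - t + 1 comes out in
  a degree adjacent to it. The two functors behave differently above \<open>s\<close>. For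
  \<open>Ext\<close> the shift along the projective modules above \<open>s\<close> raises the
  cohomological degree and stays above the Gorenstein dimension, so coefficients in projectives
  suffice. For \<open>Tor\<close> the same shift lowers the degree and would reach the left end of a
  resolution; in a complete resolution, exact in all degrees, there is no end to reach. That is the
  reason for splicing. The projectives in \<open>P\<close> may be infinitely generated. Since the
  bases of the resolution of \<open>M\<close> are finite, each chain meets only finitely many
  coordinates of a free module, and coefficients reduce to the ring. Complexes are stored as
  matrices because the coefficients change at every step: a matrix acts on tuples from any module,
  and after transposition \<open>Ext\<close> takes the same form as \<open>Tor\<close>.\<close>

definition mat_act :: "('a, 'b, 'z) module_scheme \<Rightarrow> 'x set \<Rightarrow> ('x \<Rightarrow> 'y \<Rightarrow> 'a) \<Rightarrow> ('x \<Rightarrow> 'b) \<Rightarrow> 'y \<Rightarrow> 'b" where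
  "mat_act M X d f y = (\<Oplus>\<^bsub>M\<^esub>x\<in>X. d x y \<odot>\<^bsub>M\<^esub> f x)"

text \<open>The set \<open>X i\<close> is a basis in degree \<open>i\<close>, and \<open>D i x y\<close> is the coefficient of \<open>y \<in> X (i - 1)\<close> in the boundary
  of \<open>x \<in> X i\<close>.\<close>

definition fin_free_complex ::
  "('a, 'r) ring_scheme \<Rightarrow> (int \<Rightarrow> 'x set) \<Rightarrow> (int \<Rightarrow> 'x \<Rightarrow> 'x \<Rightarrow> 'a) \<Rightarrow> bool" where
  "fin_free_complex R X D \<longleftrightarrow> (\<forall>i. finite (X i) \<and>
     (\<forall>x\<in>X i. \<forall>y\<in>X (i - 1). D i x y \<in> carrier R) \<and>
     (\<forall>x\<in>X i. \<forall>z\<in>X (i - 2). (\<Oplus>\<^bsub>R\<^esub>y\<in>X (i - 1). D i x y \<otimes>\<^bsub>R\<^esub> D (i - 1) y z) = \<zero>\<^bsub>R\<^esub>))"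

text \<open>This is exactness in degree \<open>i\<close> with coefficients in \<open>A / S\<close>, expressed by representatives so that no quotient
  modules, and hence no new types, are needed.\<close>

definition exact_at ::
  "('a, 'b, 'z) module_scheme \<Rightarrow> (int \<Rightarrow> 'x set) \<Rightarrow> (int \<Rightarrow> 'x \<Rightarrow> 'x \<Rightarrow> 'a) \<Rightarrow> 'b set \<Rightarrow> 'b set \<Rightarrow> int \<Rightarrow> bool" where
  "exact_at M X D A S i \<longleftrightarrow>
    (\<forall>f\<in>X i \<rightarrow> A. (\<forall>y\<in>X (i - 1). mat_act M (X i) (D i) f y \<in> S) \<longrightarrow>
      (\<exists>g\<in>X (i + 1) \<rightarrow> A. \<forall>x\<in>X i. f x \<ominus>\<^bsub>M\<^esub> mat_act M (X (i + 1)) (D (i + 1)) g x \<in> S))"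

context module
begin

lemma submoduleD:
  assumes "submodule H R M"
  shows "\<And>x. x \<in> H \<Longrightarrow> x \<in> carrier M"
    and "\<zero>\<^bsub>M\<^esub> \<in> H"
    and "\<And>x y. x \<in> H \<Longrightarrow> y \<in> H \<Longrightarrow> x \<oplus>\<^bsub>M\<^esub> y \<in> H"
    and "\<And>x. x \<in> H \<Longrightarrow> \<ominus>\<^bsub>M\<^esub> x \<in> H"
    and "\<And>x y. x \<in> H \<Longrightarrow> y \<in> H \<Longrightarrow> x \<ominus>\<^bsub>M\<^esub> y \<in> H"
    and "\<And>a x. a \<in> carrier R \<Longrightarrow> x \<in> H \<Longrightarrow> a \<odot>\<^bsub>M\<^esub> x \<in> H"
proof -
  note E = submoduleE[OF assms]
  show "\<zero>\<^bsub>M\<^esub> \<in> H"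
    using subgroup.one_closed[OF submodule.axioms(1)[OF assms]] by simp
qed (use submoduleE[OF assms] in \<open>auto simp: a_minus_def\<close>)

lemma minus_zero_right [simp]: "x \<in> carrier M \<Longrightarrow> x \<ominus>\<^bsub>M\<^esub> \<zero>\<^bsub>M\<^esub> = x"
  by (simp add: a_minus_def)

lemma minus_self [simp]: "x \<in> carrier M \<Longrightarrow> x \<ominus>\<^bsub>M\<^esub> x = \<zero>\<^bsub>M\<^esub>"
  by (simp add: a_minus_def M.r_neg)

lemma minus_eq_zero_iff: "x \<in> carrier M \<Longrightarrow> y \<in> carrier M \<Longrightarrow> x \<ominus>\<^bsub>M\<^esub> y = \<zero>\<^bsub>M\<^esub> \<longleftrightarrow> x = y"
  unfolding a_minus_def by (metis M.minus_equality M.minus_minus M.r_neg M.a_inv_closed)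

lemma zero_submodule: "submodule {\<zero>\<^bsub>M\<^esub>} R M"
  by (rule submoduleI) auto

lemma finsum_in_submodule:
  assumes "submodule H R M" "f \<in> A \<rightarrow> H"
  shows "finsum M f A \<in> H"
proof (cases "finite A")
  case True
  then show ?thesis using assms(2)
  proof (induction A rule: finite_induct)
    case empty
    then show ?case using submoduleD[OF assms(1)] by simp
  next
    case (insert x F)
    moreover have "f \<in> F \<rightarrow> carrier M" "f x \<in> carrier M"
      using insert.prems submoduleD(1)[OF assms(1)] by auto
    ultimately show ?case using submoduleD[OF assms(1)] by auto
  qed
next
  case False
  then show ?thesis using submoduleD[OF assms(1)] M.finsum_infinite by simp
qed

lemma smult_finsum_l:
  assumes "finite A" "a \<in> A \<rightarrow> carrier R" "x \<in> carrier M"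
  shows "(\<Oplus>\<^bsub>R\<^esub>i\<in>A. a i) \<odot>\<^bsub>M\<^esub> x = (\<Oplus>\<^bsub>M\<^esub>i\<in>A. a i \<odot>\<^bsub>M\<^esub> x)"
  using assms
proof (induction A rule: finite_induct)
  case (insert i F)
  then have "a \<in> F \<rightarrow> carrier R" "a i \<in> carrier R" by auto
  with insert show ?case by (simp add: smult_l_distr Pi_def)
qed simp

lemma finsum_swap:
  assumes "finite A" "finite B" "\<And>i j. i \<in> A \<Longrightarrow> j \<in> B \<Longrightarrow> f i j \<in> carrier M"
  shows "(\<Oplus>\<^bsub>M\<^esub>i\<in>A. \<Oplus>\<^bsub>M\<^esub>j\<in>B. f i j) = (\<Oplus>\<^bsub>M\<^esub>j\<in>B. \<Oplus>\<^bsub>M\<^esub>i\<in>A. f i j)"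
  using assms(1,3)
proof (induction A rule: finite_induct)
  case (insert i F)
  have "(\<Oplus>\<^bsub>M\<^esub>j\<in>B. \<Oplus>\<^bsub>M\<^esub>k\<in>insert i F. f k j) = (\<Oplus>\<^bsub>M\<^esub>j\<in>B. f i j \<oplus>\<^bsub>M\<^esub> (\<Oplus>\<^bsub>M\<^esub>k\<in>F. f k j))"
    using insert by (intro M.finsum_cong') (auto simp: Pi_def)
  also have "\<dots> = (\<Oplus>\<^bsub>M\<^esub>j\<in>B. f i j) \<oplus>\<^bsub>M\<^esub> (\<Oplus>\<^bsub>M\<^esub>j\<in>B. \<Oplus>\<^bsub>M\<^esub>k\<in>F. f k j)"
    using insert.prems by (intro M.finsum_addf) auto
  finally show ?case using insert by (simp add: Pi_def)
qed simp

lemma finsum_minus: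
  assumes "f \<in> A \<rightarrow> carrier M" "g \<in> A \<rightarrow> carrier M"
  shows "(\<Oplus>\<^bsub>M\<^esub>i\<in>A. f i \<ominus>\<^bsub>M\<^esub> g i) = finsum M f A \<ominus>\<^bsub>M\<^esub> finsum M g A"
proof -
  have "(\<Oplus>\<^bsub>M\<^esub>i\<in>A. f i \<ominus>\<^bsub>M\<^esub> g i) \<oplus>\<^bsub>M\<^esub> finsum M g A = (\<Oplus>\<^bsub>M\<^esub>i\<in>A. (f i \<ominus>\<^bsub>M\<^esub> g i) \<oplus>\<^bsub>M\<^esub> g i)"
    using assms by (intro M.finsum_addf[symmetric]) auto
  also have "\<dots> = finsum M f A"
  proof (intro M.finsum_cong')
    fix i assume "i \<in> A"
    then have "f i \<in> carrier M" "g i \<in> carrier M" using assms by auto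
    then show "f i \<ominus>\<^bsub>M\<^esub> g i \<oplus>\<^bsub>M\<^esub> g i = f i"
      by (simp add: a_minus_def M.a_assoc M.l_neg)
  qed (use assms in auto)
  finally have 1: "(\<Oplus>\<^bsub>M\<^esub>i\<in>A. f i \<ominus>\<^bsub>M\<^esub> g i) \<oplus>\<^bsub>M\<^esub> finsum M g A = finsum M f A" .
  have "(\<Oplus>\<^bsub>M\<^esub>i\<in>A. f i \<ominus>\<^bsub>M\<^esub> g i) \<in> carrier M" "finsum M g A \<in> carrier M"
    using assms by (auto intro!: M.finsum_closed)
  then show ?thesis unfolding 1[symmetric]
    by (simp add: a_minus_def M.a_assoc M.r_neg)
qed

lemma mat_act_in:
  assumes "submodule A R M" "\<And>x. x \<in> X \<Longrightarrow> d x y \<in> carrier R" "f \<in> X \<rightarrow> A"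
  shows "mat_act M X d f y \<in> A"
  unfolding mat_act_def using assms(2,3) submoduleD(6)[OF assms(1)]
  by (intro finsum_in_submodule[OF assms(1)]) (auto simp: Pi_def)

lemma mat_act_closed:
  assumes "\<And>x. x \<in> X \<Longrightarrow> d x y \<in> carrier R" "f \<in> X \<rightarrow> carrier M"
  shows "mat_act M X d f y \<in> carrier M"
  using assms by (intro mat_act_in[OF carrier_is_submodule])

lemma mat_act_add:
  assumes "\<And>x. x \<in> X \<Longrightarrow> d x y \<in> carrier R" "f \<in> X \<rightarrow> carrier M" "g \<in> X \<rightarrow> carrier M"
  shows "mat_act M X d (\<lambda>x. f x \<oplus>\<^bsub>M\<^esub> g x) y = mat_act M X d f y \<oplus>\<^bsub>M\<^esub> mat_act M X d g y"
proof -
  have "mat_act M X d (\<lambda>x. f x \<oplus>\<^bsub>M\<^esub> g x) y = (\<Oplus>\<^bsub>M\<^esub>x\<in>X. d x y \<odot>\<^bsub>M\<^esub> f x \<oplus>\<^bsub>M\<^esub> d x y \<odot>\<^bsub>M\<^esub> g x)"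
    unfolding mat_act_def using assms
    by (intro M.finsum_cong') (auto simp: smult_r_distr Pi_def)
  then show ?thesis unfolding mat_act_def using assms by (subst (asm) M.finsum_addf) (auto simp: Pi_def)
qed

lemma mat_act_minus:
  assumes "\<And>x. x \<in> X \<Longrightarrow> d x y \<in> carrier R" "f \<in> X \<rightarrow> carrier M" "g \<in> X \<rightarrow> carrier M"
  shows "mat_act M X d (\<lambda>x. f x \<ominus>\<^bsub>M\<^esub> g x) y = mat_act M X d f y \<ominus>\<^bsub>M\<^esub> mat_act M X d g y"
proof -
  have "mat_act M X d (\<lambda>x. f x \<ominus>\<^bsub>M\<^esub> g x) y = (\<Oplus>\<^bsub>M\<^esub>x\<in>X. d x y \<odot>\<^bsub>M\<^esub> f x \<ominus>\<^bsub>M\<^esub> d x y \<odot>\<^bsub>M\<^esub> g x)"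
    unfolding mat_act_def using assms
    by (intro M.finsum_cong') (auto simp: smult_r_distr smult_r_minus a_minus_def Pi_def)
  then show ?thesis unfolding mat_act_def using assms by (subst (asm) finsum_minus) (auto simp: Pi_def)
qed

lemma mat_act_cong:
  assumes "\<And>x. x \<in> X \<Longrightarrow> d x y \<in> carrier R" "g \<in> X \<rightarrow> carrier M" "\<And>x. x \<in> X \<Longrightarrow> f x = g x"
  shows "mat_act M X d f y = mat_act M X d g y"
  unfolding mat_act_def using assms by (intro M.finsum_cong') (auto simp: Pi_def)

lemma mat_act_zero:
  assumes "\<And>x. x \<in> X \<Longrightarrow> d x y \<in> carrier R" "\<And>x. x \<in> X \<Longrightarrow> f x = \<zero>\<^bsub>M\<^esub>"
  shows "mat_act M X d f y = \<zero>\<^bsub>M\<^esub>"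
proof -
  have "mat_act M X d f y = (\<Oplus>\<^bsub>M\<^esub>x\<in>X. \<zero>\<^bsub>M\<^esub>)"
    unfolding mat_act_def using assms by (intro M.finsum_cong') (auto simp: Pi_def)
  then show ?thesis by simp
qed

text \<open>The source basis is the first index of a matrix, so composition multiplies
  \<open>d x y\<close> by \<open>d' y z\<close>; commutativity of the ring allows the scalars to be
  reordered.\<close>

lemma mat_act_mat_act:
  assumes "finite X" "finite Y" "\<And>x y. x \<in> X \<Longrightarrow> y \<in> Y \<Longrightarrow> d x y \<in> carrier R"
    "\<And>y. y \<in> Y \<Longrightarrow> d' y z \<in> carrier R" "f \<in> X \<rightarrow> carrier M"
  shows "mat_act M Y d' (mat_act M X d f) z = (\<Oplus>\<^bsub>M\<^esub>x\<in>X. (\<Oplus>\<^bsub>R\<^esub>y\<in>Y. d x y \<otimes> d' y z) \<odot>\<^bsub>M\<^esub> f x)"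
proof -
  have "mat_act M Y d' (mat_act M X d f) z = (\<Oplus>\<^bsub>M\<^esub>y\<in>Y. \<Oplus>\<^bsub>M\<^esub>x\<in>X. d' y z \<odot>\<^bsub>M\<^esub> (d x y \<odot>\<^bsub>M\<^esub> f x))"
    unfolding mat_act_def using assms
    by (intro M.finsum_cong') (auto intro!: finsum_smult_ldistr M.finsum_closed simp: Pi_def)
  also have "\<dots> = (\<Oplus>\<^bsub>M\<^esub>x\<in>X. \<Oplus>\<^bsub>M\<^esub>y\<in>Y. d' y z \<odot>\<^bsub>M\<^esub> (d x y \<odot>\<^bsub>M\<^esub> f x))"
    using assms by (intro finsum_swap) (auto simp: Pi_def)
  also have "\<dots> = (\<Oplus>\<^bsub>M\<^esub>x\<in>X. \<Oplus>\<^bsub>M\<^esub>y\<in>Y. (d x y \<otimes> d' y z) \<odot>\<^bsub>M\<^esub> f x)"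
    using assms
    by (intro M.finsum_cong' M.finsum_closed refl)
       (auto simp: smult_assoc1[symmetric] m_comm Pi_def intro!: M.finsum_closed M.finsum_cong')
  also have "\<dots> = (\<Oplus>\<^bsub>M\<^esub>x\<in>X. (\<Oplus>\<^bsub>R\<^esub>y\<in>Y. d x y \<otimes> d' y z) \<odot>\<^bsub>M\<^esub> f x)"
    using assms
    by (intro M.finsum_cong' refl smult_finsum_l[symmetric])
       (auto simp: Pi_def intro!: R.finsum_closed)
  finally show ?thesis .
qed

end

text \<open>Linearity is demanded only on the submodule \<open>A\<close>, because maps such as the
  projection from cycles to homology exist only there.\<close>

lemma mat_act_hom:
  assumes "module R M" "module R M'" "submodule A R M" "\<phi> \<in> module_hom R (M\<lparr>carrier := A\<rparr>) M'"
    "finite X" "\<And>x. x \<in> X \<Longrightarrow> d x y \<in> carrier R" "f \<in> X \<rightarrow> A"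
  shows "\<phi> (mat_act M X d f y) = mat_act M' X d (\<lambda>x. \<phi> (f x)) y"
proof -
  interpret M: module R M by fact
  interpret M': module R M' by fact
  note A = M.submoduleD[OF assms(3)]
  have add: "\<And>x y. x \<in> A \<Longrightarrow> y \<in> A \<Longrightarrow> \<phi> (x \<oplus>\<^bsub>M\<^esub> y) = \<phi> x \<oplus>\<^bsub>M'\<^esub> \<phi> y"
    and smult: "\<And>a x. a \<in> carrier R \<Longrightarrow> x \<in> A \<Longrightarrow> \<phi> (a \<odot>\<^bsub>M\<^esub> x) = a \<odot>\<^bsub>M'\<^esub> \<phi> x"
    and cl: "\<And>x. x \<in> A \<Longrightarrow> \<phi> x \<in> carrier M'"
    using assms(4) by (auto simp: module_hom_def)
  have "\<phi> \<zero>\<^bsub>M\<^esub> = \<phi> (\<zero>\<^bsub>R\<^esub> \<odot>\<^bsub>M\<^esub> \<zero>\<^bsub>M\<^esub>)" by simp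
  also have "\<dots> = \<zero>\<^bsub>M'\<^esub>" using smult[of "\<zero>\<^bsub>R\<^esub>" "\<zero>\<^bsub>M\<^esub>"] A cl by simp
  finally have z: "\<phi> \<zero>\<^bsub>M\<^esub> = \<zero>\<^bsub>M'\<^esub>" .
  show ?thesis unfolding mat_act_def using assms(5-7)
  proof (induction X rule: finite_induct)
    case (insert x F)
    have *: "(\<Oplus>\<^bsub>M\<^esub>x\<in>F. d x y \<odot>\<^bsub>M\<^esub> f x) \<in> A"
      using insert.prems A(6) by (intro M.finsum_in_submodule[OF assms(3)]) (auto simp: Pi_def)
    have "(\<lambda>x. d x y \<odot>\<^bsub>M\<^esub> f x) \<in> F \<rightarrow> carrier M" "d x y \<odot>\<^bsub>M\<^esub> f x \<in> A"
      "(\<lambda>x. d x y \<odot>\<^bsub>M'\<^esub> \<phi> (f x)) \<in> F \<rightarrow> carrier M'" "\<phi> (f x) \<in> carrier M'" "f x \<in> A"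
      using insert.prems A(1,6) cl by (auto simp: Pi_def)
    moreover have "\<phi> (d x y \<odot>\<^bsub>M\<^esub> f x) = d x y \<odot>\<^bsub>M'\<^esub> \<phi> (f x)"
      using insert.prems smult by auto
    ultimately show ?case using insert * A add by auto
  qed (simp add: z)
qed

locale module_complex = module R M for R (structure) and M (structure) +
  fixes X :: "int \<Rightarrow> 'x set" and D :: "int \<Rightarrow> 'x \<Rightarrow> 'x \<Rightarrow> 'a"
  assumes cpx: "fin_free_complex R X D"
begin

abbreviation "diff i f \<equiv> mat_act M (X i) (D i) f"

lemma finite_X [simp]: "finite (X i)"
  and D_closed: "x \<in> X i \<Longrightarrow> y \<in> X (i - 1) \<Longrightarrow> D i x y \<in> carrier R"
  and DD: "x \<in> X i \<Longrightarrow> z \<in> X (i - 2) \<Longrightarrow> (\<Oplus>\<^bsub>R\<^esub>y\<in>X (i - 1). D i x y \<otimes>\<^bsub>R\<^esub> D (i - 1) y z) = \<zero>\<^bsub>R\<^esub>"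
  using cpx by (auto simp: fin_free_complex_def)

lemma D_closed': "x \<in> X (i + 1) \<Longrightarrow> y \<in> X i \<Longrightarrow> D (i + 1) x y \<in> carrier R"
  using D_closed[of x "i + 1" y] by simp

lemma diff_in: "submodule A R M \<Longrightarrow> f \<in> X i \<rightarrow> A \<Longrightarrow> y \<in> X (i - 1) \<Longrightarrow> diff i f y \<in> A"
  by (rule mat_act_in) (auto intro: D_closed)

lemma diff_in': "submodule A R M \<Longrightarrow> f \<in> X (i + 1) \<rightarrow> A \<Longrightarrow> y \<in> X i \<Longrightarrow> diff (i + 1) f y \<in> A"
  by (rule mat_act_in) (auto intro: D_closed')

lemma diff_diff:
  assumes "f \<in> X (i + 1) \<rightarrow> carrier M" "z \<in> X (i - 1)"
  shows "diff i (diff (i + 1) f) z = \<zero>\<^bsub>M\<^esub>"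
proof -
  have "diff i (diff (i + 1) f) z = (\<Oplus>\<^bsub>M\<^esub>x\<in>X (i + 1). (\<Oplus>\<^bsub>R\<^esub>y\<in>X i. D (i + 1) x y \<otimes> D i y z) \<odot>\<^bsub>M\<^esub> f x)"
    using assms by (intro mat_act_mat_act) (auto intro: D_closed D_closed')
  also have "\<dots> = (\<Oplus>\<^bsub>M\<^esub>x\<in>X (i + 1). \<zero>\<^bsub>M\<^esub>)"
    using assms DD[of _ "i + 1" z] by (intro M.finsum_cong') (auto simp: Pi_def)
  finally show ?thesis by simp
qed

lemma diff_minus:
  assumes "f \<in> X i \<rightarrow> carrier M" "g \<in> X i \<rightarrow> carrier M" "y \<in> X (i - 1)"
  shows "diff i (\<lambda>x. f x \<ominus>\<^bsub>M\<^esub> g x) y = diff i f y \<ominus>\<^bsub>M\<^esub> diff i g y"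
  using assms by (intro mat_act_minus) (auto intro: D_closed)

lemma diff_minus':
  assumes "f \<in> X (i + 1) \<rightarrow> carrier M" "g \<in> X (i + 1) \<rightarrow> carrier M" "y \<in> X i"
  shows "diff (i + 1) (\<lambda>x. f x \<ominus>\<^bsub>M\<^esub> g x) y = diff (i + 1) f y \<ominus>\<^bsub>M\<^esub> diff (i + 1) g y"
  using assms by (intro mat_act_minus) (auto intro: D_closed')

lemma diff_add':
  assumes "f \<in> X (i + 1) \<rightarrow> carrier M" "g \<in> X (i + 1) \<rightarrow> carrier M" "y \<in> X i"
  shows "diff (i + 1) (\<lambda>x. f x \<oplus>\<^bsub>M\<^esub> g x) y = diff (i + 1) f y \<oplus>\<^bsub>M\<^esub> diff (i + 1) g y"
  using assms by (intro mat_act_add) (auto intro: D_closed')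

lemma exact_atD:
  assumes "exact_at M X D A S i" "f \<in> X i \<rightarrow> A" "\<And>y. y \<in> X (i - 1) \<Longrightarrow> diff i f y \<in> S"
  obtains g where "g \<in> X (i + 1) \<rightarrow> A" "\<And>x. x \<in> X i \<Longrightarrow> f x \<ominus>\<^bsub>M\<^esub> diff (i + 1) g x \<in> S"
  using assms unfolding exact_at_def by blast

lemma minus_minus_eq:
  assumes "x \<in> carrier M" "y \<in> carrier M" "z \<in> carrier M"
  shows "x \<ominus>\<^bsub>M\<^esub> y \<ominus>\<^bsub>M\<^esub> z = x \<ominus>\<^bsub>M\<^esub> (y \<oplus>\<^bsub>M\<^esub> z)"
    "(x \<ominus>\<^bsub>M\<^esub> y \<ominus>\<^bsub>M\<^esub> z) \<oplus>\<^bsub>M\<^esub> y = x \<ominus>\<^bsub>M\<^esub> z"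
    "x \<ominus>\<^bsub>M\<^esub> (x \<ominus>\<^bsub>M\<^esub> y) = y"
  using assms M.a_lcomm[of x y "\<ominus>\<^bsub>M\<^esub> x"] M.a_lcomm[of x "\<ominus>\<^bsub>M\<^esub> x" y] by (simp_all add: a_minus_def M.minus_add M.a_ac M.r_neg M.r_neg1 M.minus_minus M.r_neg2)

text \<open>This lemma and the next two are the vanishing consequences of the long exact sequence
  for 0 -> A/S -> N/S -> N/A -> 0. Here a cycle is first filled modulo \<open>A\<close>; the
  remainder has values in \<open>A\<close> and is filled there modulo \<open>S\<close>.\<close>

lemma exact_at_extension:
  assumes S: "submodule S R M" and A: "submodule A R M" and N: "submodule N R M" and sub: "S \<subseteq> A" "A \<subseteq> N"
    and "exact_at M X D A S i" "exact_at M X D N A i"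
  shows "exact_at M X D N S i"
  unfolding exact_at_def
proof safe
  fix f assume f: "f \<in> X i \<rightarrow> N" and df: "\<forall>y\<in>X (i - 1). diff i f y \<in> S"
  have fM: "f \<in> X i \<rightarrow> carrier M" using f submoduleD[OF N] by auto
  obtain g where g: "g \<in> X (i + 1) \<rightarrow> N" "\<And>x. x \<in> X i \<Longrightarrow> f x \<ominus>\<^bsub>M\<^esub> diff (i + 1) g x \<in> A"
    using exact_atD[OF assms(7) f] df sub by blast
  have gM: "g \<in> X (i + 1) \<rightarrow> carrier M" using g submoduleD[OF N] by auto
  have dgM: "diff (i + 1) g \<in> X i \<rightarrow> carrier M"
    using diff_in'[OF carrier_is_submodule gM] by auto
  have "diff i (\<lambda>x. f x \<ominus>\<^bsub>M\<^esub> diff (i + 1) g x) y \<in> S" if "y \<in> X (i - 1)" for y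
    using that diff_minus[OF fM dgM that] diff_diff[OF gM that] df diff_in[OF carrier_is_submodule fM that]
    by auto
  then obtain k where k: "k \<in> X (i + 1) \<rightarrow> A"
    "\<And>x. x \<in> X i \<Longrightarrow> f x \<ominus>\<^bsub>M\<^esub> diff (i + 1) g x \<ominus>\<^bsub>M\<^esub> diff (i + 1) k x \<in> S"
    using exact_atD[OF assms(6), of "\<lambda>x. f x \<ominus>\<^bsub>M\<^esub> diff (i + 1) g x"] g(2) by auto
  have kM: "k \<in> X (i + 1) \<rightarrow> carrier M" using k submoduleD[OF A] by auto
  show "\<exists>g\<in>X (i + 1) \<rightarrow> N. \<forall>x\<in>X i. f x \<ominus>\<^bsub>M\<^esub> diff (i + 1) g x \<in> S"
  proof (intro bexI ballI)
    fix x assume x: "x \<in> X i"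
    show "f x \<ominus>\<^bsub>M\<^esub> diff (i + 1) (\<lambda>x. g x \<oplus>\<^bsub>M\<^esub> k x) x \<in> S"
      using k(2)[OF x] diff_add'[OF gM kM x] diff_in'[OF carrier_is_submodule gM x]
        diff_in'[OF carrier_is_submodule kM x] fM x minus_minus_eq by (auto simp: Pi_def)
  qed (use g(1) k(1) sub submoduleD(3)[OF N] in \<open>auto simp: Pi_def subset_iff\<close>)
qed

text \<open>This is the connecting homomorphism: the boundary of a cycle modulo \<open>A\<close> has
  values in \<open>A\<close> and is a cycle modulo \<open>S\<close> one degree lower. If it is
  filled by \<open>g\<close> with values in \<open>A\<close>, then \<open>f - g\<close> is a cycle
  modulo \<open>S\<close> in the same class modulo \<open>A\<close>.\<close>

lemma exact_at_quotient:
  assumes S: "submodule S R M" and A: "submodule A R M" and N: "submodule N R M" and sub: "S \<subseteq> A" "A \<subseteq> N"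
    and "exact_at M X D N S i" "exact_at M X D A S (i - 1)"
  shows "exact_at M X D N A i"
  unfolding exact_at_def
proof safe
  fix f assume f: "f \<in> X i \<rightarrow> N" and df: "\<forall>y\<in>X (i - 1). diff i f y \<in> A"
  have fM: "f \<in> X i \<rightarrow> carrier M" using f submoduleD[OF N] by auto
  have ddf: "diff (i - 1) (diff i f) z \<in> S" if "z \<in> X (i - 1 - 1)" for z
    using diff_diff[of f "i - 1" z] fM that submoduleD[OF S] by simp
  obtain g where g: "g \<in> X i \<rightarrow> A" "\<And>x. x \<in> X (i - 1) \<Longrightarrow> diff i f x \<ominus>\<^bsub>M\<^esub> diff i g x \<in> S"
    using exact_atD[OF assms(7), of "diff i f"] df ddf by auto
  have gM: "g \<in> X i \<rightarrow> carrier M" using g submoduleD[OF A] by auto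
  have "diff i (\<lambda>x. f x \<ominus>\<^bsub>M\<^esub> g x) y \<in> S" if "y \<in> X (i - 1)" for y
    using that diff_minus[OF fM gM that] g by auto
  moreover have "(\<lambda>x. f x \<ominus>\<^bsub>M\<^esub> g x) \<in> X i \<rightarrow> N"
    using f g(1) sub submoduleD(5)[OF N] by (auto simp: Pi_def subset_iff)
  ultimately obtain k where k: "k \<in> X (i + 1) \<rightarrow> N"
    "\<And>x. x \<in> X i \<Longrightarrow> f x \<ominus>\<^bsub>M\<^esub> g x \<ominus>\<^bsub>M\<^esub> diff (i + 1) k x \<in> S"
    using exact_atD[OF assms(6), of "\<lambda>x. f x \<ominus>\<^bsub>M\<^esub> g x"] by auto
  have kM: "k \<in> X (i + 1) \<rightarrow> carrier M" using k submoduleD[OF N] by auto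
  show "\<exists>g\<in>X (i + 1) \<rightarrow> N. \<forall>x\<in>X i. f x \<ominus>\<^bsub>M\<^esub> diff (i + 1) g x \<in> A"
  proof (intro bexI ballI)
    fix x assume x: "x \<in> X i"
    have "f x \<ominus>\<^bsub>M\<^esub> g x \<ominus>\<^bsub>M\<^esub> diff (i + 1) k x \<oplus>\<^bsub>M\<^esub> g x \<in> A"
      using k(2)[OF x] g(1) x sub by (intro submoduleD(3)[OF A]) auto
    then show "f x \<ominus>\<^bsub>M\<^esub> diff (i + 1) k x \<in> A"
      using minus_minus_eq(2)[of "f x" "g x" "diff (i + 1) k x"] fM gM x diff_in'[OF carrier_is_submodule kM x]
      by (auto simp: Pi_def)
  qed (use k in auto)
qed

text \<open>A cycle with values in \<open>A\<close> is filled by some \<open>g\<close> with values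
  in \<open>N\<close>, and this \<open>g\<close> is a cycle modulo \<open>A\<close>. Subtracting a
  boundary moves \<open>g\<close> into \<open>A\<close> and leaves its own boundary
  unchanged.\<close>

lemma exact_at_sub:
  assumes S: "submodule S R M" and A: "submodule A R M" and N: "submodule N R M" and sub: "S \<subseteq> A" "A \<subseteq> N"
    and "exact_at M X D N A (i + 1)" "exact_at M X D N S i"
  shows "exact_at M X D A S i"
  unfolding exact_at_def
proof safe
  fix f assume f: "f \<in> X i \<rightarrow> A" and df: "\<forall>y\<in>X (i - 1). diff i f y \<in> S"
  have fN: "f \<in> X i \<rightarrow> N" using f sub by auto
  obtain g where g: "g \<in> X (i + 1) \<rightarrow> N" "\<And>x. x \<in> X i \<Longrightarrow> f x \<ominus>\<^bsub>M\<^esub> diff (i + 1) g x \<in> S"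
    using exact_atD[OF assms(7) fN] df by blast
  have gM: "g \<in> X (i + 1) \<rightarrow> carrier M" using g submoduleD[OF N] by auto
  have fM: "f \<in> X i \<rightarrow> carrier M" using f submoduleD[OF A] by auto
  have "diff (i + 1) g y \<in> A" if y: "y \<in> X i" for y
  proof -
    have "f y \<ominus>\<^bsub>M\<^esub> (f y \<ominus>\<^bsub>M\<^esub> diff (i + 1) g y) \<in> A"
      using f g(2)[OF y] y sub by (intro submoduleD(5)[OF A, of "f y" "f y \<ominus>\<^bsub>M\<^esub> _"]) auto
    moreover have "f y \<in> carrier M" using fM y by auto
    ultimately show ?thesis using minus_minus_eq(3) diff_in'[OF carrier_is_submodule gM y] by simp
  qed
  then obtain k where k: "k \<in> X (i + 2) \<rightarrow> N"
    "\<And>x. x \<in> X (i + 1) \<Longrightarrow> g x \<ominus>\<^bsub>M\<^esub> diff (i + 2) k x \<in> A"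
    using exact_atD[OF assms(6) g(1)] by (auto simp: add.assoc)
  have kM: "k \<in> X (i + 2) \<rightarrow> carrier M" using k submoduleD[OF N] by auto
  have dk: "diff (i + 2) k \<in> X (i + 1) \<rightarrow> carrier M"
    using diff_in'[OF carrier_is_submodule, of k "i + 1"] kM by (auto simp: add.assoc)
  show "\<exists>g\<in>X (i + 1) \<rightarrow> A. \<forall>x\<in>X i. f x \<ominus>\<^bsub>M\<^esub> diff (i + 1) g x \<in> S"
  proof (intro bexI ballI)
    fix x assume x: "x \<in> X i"
    have "diff (i + 1) (diff (i + 2) k) x = \<zero>\<^bsub>M\<^esub>"
      using diff_diff[of k "i + 1" x] kM x by (simp add: add.assoc)
    then have "diff (i + 1) (\<lambda>x. g x \<ominus>\<^bsub>M\<^esub> diff (i + 2) k x) x = diff (i + 1) g x"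
      using diff_minus'[OF gM dk x] diff_in'[OF carrier_is_submodule gM x] by (simp add: a_minus_def)
    then show "f x \<ominus>\<^bsub>M\<^esub> diff (i + 1) (\<lambda>x. g x \<ominus>\<^bsub>M\<^esub> diff (i + 2) k x) x \<in> S"
      using g(2)[OF x] by simp
  qed (use k in auto)
qed

end


section \<open>Homomorphisms of modules\<close>

lemma mk_module_simps [simp]:
  "carrier (mk_module C z p s) = C" "\<zero>\<^bsub>mk_module C z p s\<^esub> = z"
  "add (mk_module C z p s) = p" "smult (mk_module C z p s) = s"
  by (simp_all add: mk_module_def)

lemma module_homD:
  assumes "f \<in> module_hom R M N"
  shows "\<And>x. x \<in> carrier M \<Longrightarrow> f x \<in> carrier N"
    and "\<And>x y. x \<in> carrier M \<Longrightarrow> y \<in> carrier M \<Longrightarrow> f (x \<oplus>\<^bsub>M\<^esub> y) = f x \<oplus>\<^bsub>N\<^esub> f y"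
    and "\<And>a x. a \<in> carrier R \<Longrightarrow> x \<in> carrier M \<Longrightarrow> f (a \<odot>\<^bsub>M\<^esub> x) = a \<odot>\<^bsub>N\<^esub> f x"
  using assms by (auto simp: module_hom_def)

lemma module_homI:
  assumes "\<And>x. x \<in> carrier M \<Longrightarrow> f x \<in> carrier N"
    and "\<And>x y. x \<in> carrier M \<Longrightarrow> y \<in> carrier M \<Longrightarrow> f (x \<oplus>\<^bsub>M\<^esub> y) = f x \<oplus>\<^bsub>N\<^esub> f y"
    and "\<And>a x. a \<in> carrier R \<Longrightarrow> x \<in> carrier M \<Longrightarrow> f (a \<odot>\<^bsub>M\<^esub> x) = a \<odot>\<^bsub>N\<^esub> f x"
  shows "f \<in> module_hom R M N"
  using assms by (auto simp: module_hom_def)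

lemma module_hom_zero:
  assumes "module R M" "module R N" "f \<in> module_hom R M N"
  shows "f \<zero>\<^bsub>M\<^esub> = \<zero>\<^bsub>N\<^esub>"
proof -
  interpret M: module R M by fact
  interpret N: module R N by fact
  have "f \<zero>\<^bsub>M\<^esub> = f (\<zero>\<^bsub>R\<^esub> \<odot>\<^bsub>M\<^esub> \<zero>\<^bsub>M\<^esub>)" by simp
  also have "\<dots> = \<zero>\<^bsub>N\<^esub>"
    using module_homD(3)[OF assms(3), of "\<zero>\<^bsub>R\<^esub>" "\<zero>\<^bsub>M\<^esub>"] module_homD(1)[OF assms(3), of "\<zero>\<^bsub>M\<^esub>"] by simp
  finally show ?thesis .
qed

lemma module_hom_minus:
  assumes "module R M" "module R N" "submodule A R M" "f \<in> module_hom R (M\<lparr>carrier := A\<rparr>) N"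
    and xy: "x \<in> A" "y \<in> A"
  shows "f (x \<ominus>\<^bsub>M\<^esub> y) = f x \<ominus>\<^bsub>N\<^esub> f y"
proof -
  interpret M: module R M by fact
  interpret N: module R N by fact
  note A = M.submoduleD[OF assms(3)]
  note f = module_homD[OF assms(4), simplified]
  have "f x = f ((x \<ominus>\<^bsub>M\<^esub> y) \<oplus>\<^bsub>M\<^esub> y)" using xy A(1) by (simp add: a_minus_def M.a_assoc M.l_neg)
  also have "\<dots> = f (x \<ominus>\<^bsub>M\<^esub> y) \<oplus>\<^bsub>N\<^esub> f y" using f(2) xy A(5) by simp
  finally show ?thesis using f(1) xy A(5) by (simp add: a_minus_def N.a_assoc N.r_neg)
qed

lemma module_hom_minus':
  assumes "module R M" "module R N" "f \<in> module_hom R M N" "x \<in> carrier M" "y \<in> carrier M"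
  shows "f (x \<ominus>\<^bsub>M\<^esub> y) = f x \<ominus>\<^bsub>N\<^esub> f y"
  using module_hom_minus[OF assms(1,2) module.carrier_is_submodule[OF assms(1)]] assms by simp

lemma module_hom_comp:
  assumes "f \<in> module_hom R M N" "g \<in> module_hom R N K"
  shows "(\<lambda>x. g (f x)) \<in> module_hom R M K"
  using module_homD[OF assms(1)] module_homD[OF assms(2)] by (intro module_homI) auto

lemma module_hom_add_hom:
  assumes "module R N" "f \<in> module_hom R M N" "g \<in> module_hom R M N"
  shows "(\<lambda>x. f x \<oplus>\<^bsub>N\<^esub> g x) \<in> module_hom R M N"
proof -
  interpret N: module R N by fact
  note f = module_homD[OF assms(2)] and g = module_homD[OF assms(3)]
  show ?thesis by (intro module_homI) (auto simp: f g N.a_ac N.smult_r_distr)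
qed

lemma module_hom_minus_hom:
  assumes "module R N" "f \<in> module_hom R M N" "g \<in> module_hom R M N"
  shows "(\<lambda>x. f x \<ominus>\<^bsub>N\<^esub> g x) \<in> module_hom R M N"
proof -
  interpret N: module R N by fact
  note f = module_homD[OF assms(2)] and g = module_homD[OF assms(3)]
  show ?thesis
    by (intro module_homI)
       (auto simp: f g a_minus_def N.a_ac N.smult_r_distr N.minus_add N.smult_r_minus)
qed

lemma module_hom_id: "(\<lambda>x. x) \<in> module_hom R M M"
  by (auto simp: module_hom_def)

section \<open>Standard modules\<close>

lemma (in cring) module_regular: "module R (regular_module R)"
  unfolding regular_module_def
proof (rule moduleI)
  show "abelian_group (mk_module (carrier R) \<zero> (\<oplus>) (\<otimes>))"
    by (rule abelian_groupI) (auto simp: a_ac intro: bexI[of _ "\<ominus> x" for x] l_neg)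
qed (auto simp: l_distr r_distr m_assoc cring_axioms)

lemma regular_module_simps [simp]:
  "carrier (regular_module R) = carrier R" "\<zero>\<^bsub>regular_module R\<^esub> = \<zero>\<^bsub>R\<^esub>"
  "x \<oplus>\<^bsub>regular_module R\<^esub> y = x \<oplus>\<^bsub>R\<^esub> y" "a \<odot>\<^bsub>regular_module R\<^esub> x = a \<otimes>\<^bsub>R\<^esub> x"
  by (simp_all add: regular_module_def)

lemma direct_power_simps [simp]:
  "carrier (direct_power N k) = ({..<k} \<rightarrow>\<^sub>E carrier N)"
  "\<zero>\<^bsub>direct_power N k\<^esub> = (\<lambda>i\<in>{..<k}. \<zero>\<^bsub>N\<^esub>)"
  "x \<oplus>\<^bsub>direct_power N k\<^esub> y = (\<lambda>i\<in>{..<k}. x i \<oplus>\<^bsub>N\<^esub> y i)"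
  "a \<odot>\<^bsub>direct_power N k\<^esub> x = (\<lambda>i\<in>{..<k}. a \<odot>\<^bsub>N\<^esub> x i)"
  by (simp_all add: direct_power_def)

lemma module_direct_power:
  assumes "module R N" shows "module R (direct_power N k)"
proof -
  interpret module R N by fact
  let ?N = "direct_power N k"
  have mem: "x i \<in> carrier N" if "x \<in> carrier ?N" "i < k" for x i
    using that by auto
  have ext: "x = y" if "x \<in> carrier ?N" "y \<in> carrier ?N" "\<And>i. i < k \<Longrightarrow> x i = y i" for x y
  proof (rule PiE_ext)
    show "x \<in> {..<k} \<rightarrow>\<^sub>E carrier N" "y \<in> {..<k} \<rightarrow>\<^sub>E carrier N" using that by simp_all
  qed (use that in simp)
  have add: "x \<oplus>\<^bsub>?N\<^esub> y \<in> carrier ?N" if "x \<in> carrier ?N" "y \<in> carrier ?N" for x y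
    using mem[OF that(1)] mem[OF that(2)] by simp
  have smult: "a \<odot>\<^bsub>?N\<^esub> x \<in> carrier ?N" if "a \<in> carrier R" "x \<in> carrier ?N" for a x
    using mem[OF that(2)] that(1) by simp
  show ?thesis
  proof (rule moduleI)
    show "abelian_group ?N"
    proof (rule abelian_groupI)
      fix x assume x: "x \<in> carrier ?N"
      show "\<exists>y\<in>carrier ?N. y \<oplus>\<^bsub>?N\<^esub> x = \<zero>\<^bsub>?N\<^esub>"
        using mem[OF x] by (intro bexI[of _ "\<lambda>i\<in>{..<k}. \<ominus>\<^bsub>N\<^esub> x i"]) (simp_all add: M.l_neg cong: restrict_cong)
      show "\<zero>\<^bsub>?N\<^esub> \<oplus>\<^bsub>?N\<^esub> x = x"
        using mem[OF x] by (intro ext add x) simp_all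
      fix y assume y: "y \<in> carrier ?N"
      show "x \<oplus>\<^bsub>?N\<^esub> y = y \<oplus>\<^bsub>?N\<^esub> x"
        using mem[OF x] mem[OF y] by (intro ext add x y) (simp_all add: M.a_comm)
      fix z assume z: "z \<in> carrier ?N"
      show "x \<oplus>\<^bsub>?N\<^esub> y \<oplus>\<^bsub>?N\<^esub> z = x \<oplus>\<^bsub>?N\<^esub> (y \<oplus>\<^bsub>?N\<^esub> z)"
        using mem[OF x] mem[OF y] mem[OF z] by (intro ext add x y z) (simp_all add: M.a_assoc)
    qed (rule add, simp_all)
  next
    fix a x y assume a: "a \<in> carrier R" and x: "x \<in> carrier ?N" and y: "y \<in> carrier ?N"
    show "a \<odot>\<^bsub>?N\<^esub> (x \<oplus>\<^bsub>?N\<^esub> y) = a \<odot>\<^bsub>?N\<^esub> x \<oplus>\<^bsub>?N\<^esub> a \<odot>\<^bsub>?N\<^esub> y"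
      using mem[OF x] mem[OF y] a by (intro ext add smult x y) (simp_all add: smult_r_distr)
  next
    fix a b x assume ab: "a \<in> carrier R" "b \<in> carrier R" and x: "x \<in> carrier ?N"
    show "(a \<oplus>\<^bsub>R\<^esub> b) \<odot>\<^bsub>?N\<^esub> x = a \<odot>\<^bsub>?N\<^esub> x \<oplus>\<^bsub>?N\<^esub> b \<odot>\<^bsub>?N\<^esub> x"
      using mem[OF x] ab by (intro ext add smult x) (simp_all add: smult_l_distr)
    show "(a \<otimes>\<^bsub>R\<^esub> b) \<odot>\<^bsub>?N\<^esub> x = a \<odot>\<^bsub>?N\<^esub> (b \<odot>\<^bsub>?N\<^esub> x)"
      using mem[OF x] ab by (intro ext add smult x) (simp_all add: smult_assoc1)
  next
    fix x assume x: "x \<in> carrier ?N"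
    show "\<one>\<^bsub>R\<^esub> \<odot>\<^bsub>?N\<^esub> x = x"
      using mem[OF x] by (intro ext smult x) simp_all
  qed (rule R.cring_axioms, rule smult)
qed

lemma free_module_carrier:
  "f \<in> carrier (free_module R X) \<longleftrightarrow>
    (\<forall>x. f x \<in> carrier R) \<and> finite {x. f x \<noteq> \<zero>\<^bsub>R\<^esub>} \<and> (\<forall>x. x \<notin> X \<longrightarrow> f x = \<zero>\<^bsub>R\<^esub>)"
  by (auto simp: free_module_def)

lemma free_module_simps [simp]:
  "\<zero>\<^bsub>free_module R X\<^esub> = (\<lambda>_. \<zero>\<^bsub>R\<^esub>)"
  "f \<oplus>\<^bsub>free_module R X\<^esub> g = (\<lambda>x. f x \<oplus>\<^bsub>R\<^esub> g x)"
  "a \<odot>\<^bsub>free_module R X\<^esub> f = (\<lambda>x. a \<otimes>\<^bsub>R\<^esub> f x)"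
  by (simp_all add: free_module_def)

lemma (in cring) module_free: "module R (free_module R X)"
proof (rule moduleI)
  have supp: "finite {x. f x \<oplus> g x \<noteq> \<zero>}" if "finite {x. f x \<noteq> \<zero>}" "finite {x. g x \<noteq> \<zero>}" for f g :: "'c \<Rightarrow> 'a"
    by (rule finite_subset[OF _ finite_UnI[OF that]]) auto
  have supp2: "finite {x. a \<otimes> f x \<noteq> \<zero>}" if "finite {x. f x \<noteq> \<zero>}" "a \<in> carrier R" for f :: "'c \<Rightarrow> 'a" and a
    by (rule finite_subset[OF _ that(1)]) (use that(2) in auto)
  show "abelian_group (free_module R X)"
  proof (rule abelian_groupI)
    fix f assume f: "f \<in> carrier (free_module R X)"
    have "{x. \<ominus> f x \<noteq> \<zero>} \<subseteq> {x. f x \<noteq> \<zero>}" by auto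
    then show "\<exists>y\<in>carrier (free_module R X). y \<oplus>\<^bsub>free_module R X\<^esub> f = \<zero>\<^bsub>free_module R X\<^esub>"
      using f finite_subset by (intro bexI[of _ "\<lambda>i. \<ominus> f i"]) (auto simp: free_module_carrier l_neg)
  next
    fix f g assume "f \<in> carrier (free_module R X)" "g \<in> carrier (free_module R X)"
    then show "f \<oplus>\<^bsub>free_module R X\<^esub> g \<in> carrier (free_module R X)"
      using supp[of f g] by (simp add: free_module_carrier)
  qed (auto simp: free_module_carrier a_ac)
  show "a \<odot>\<^bsub>free_module R X\<^esub> f \<in> carrier (free_module R X)"
    if "a \<in> carrier R" "f \<in> carrier (free_module R X)" for a f
    using that supp2[of f a] by (simp add: free_module_carrier)
qed (auto simp: free_module_carrier l_distr r_distr m_assoc cring_axioms)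

lemma (in cring) unit_vector_closed: "x \<in> X \<Longrightarrow> unit_vector R x \<in> carrier (free_module R X)"
  by (auto simp: free_module_carrier unit_vector_def intro: finite_subset[of _ "{x}"])

lemma free_module_mono: "X \<subseteq> Y \<Longrightarrow> carrier (free_module R X) \<subseteq> carrier (free_module R Y)"
  unfolding subset_iff free_module_carrier by blast

text \<open>The locale \<open>module\<close> admits record extensions, whereas
  \<open>linear_extension\<close> and the other constructions of the development take the record
  type \<open>module\<close> itself; here the type of \<open>M\<close> is fixed accordingly.\<close>

locale plain_module = module R M
  for R :: "('a, 'r) ring_scheme" (structure) and M :: "('a, 'b) module" (structure)
begin

text \<open>The defining sum runs over the support, which varies with \<open>f\<close>. Replacing it
  by any finite set of basis elements that contains it gives two elements a common index set, as
  additivity requires.\<close>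

lemma linear_extension_eq:
  assumes "f \<in> carrier (free_module R X)" "g \<in> X \<rightarrow> carrier M" "finite T" "T \<subseteq> X" "{x. f x \<noteq> \<zero>} \<subseteq> T"
  shows "linear_extension R M g f = (\<Oplus>\<^bsub>M\<^esub>x\<in>T. f x \<odot>\<^bsub>M\<^esub> g x)"
  unfolding linear_extension_def
  by (rule M.add.finprod_mono_neutral_cong_left)
     (use assms in \<open>auto simp: free_module_carrier Pi_iff subset_iff\<close>)

lemma linear_extension_eq_finite:
  assumes "f \<in> carrier (free_module R X)" "g \<in> X \<rightarrow> carrier M" "finite X"
  shows "linear_extension R M g f = (\<Oplus>\<^bsub>M\<^esub>x\<in>X. f x \<odot>\<^bsub>M\<^esub> g x)"
  using assms by (intro linear_extension_eq) (auto simp: free_module_carrier)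

lemma linear_extension_unit:
  assumes "x \<in> X" "g \<in> X \<rightarrow> carrier M"
  shows "linear_extension R M g (unit_vector R x) = g x"
proof -
  have "linear_extension R M g (unit_vector R x) = (\<Oplus>\<^bsub>M\<^esub>y\<in>{x}. unit_vector R x y \<odot>\<^bsub>M\<^esub> g y)"
    using assms R.unit_vector_closed[OF assms(1)] by (intro linear_extension_eq) (auto simp: unit_vector_def)
  also have "\<dots> = g x" using assms by (subst M.finsum_insert) (auto simp: unit_vector_def Pi_iff)
  finally show ?thesis .
qed

lemma linear_extension_hom:
  assumes g: "g \<in> X \<rightarrow> carrier M"
  shows "linear_extension R M g \<in> module_hom R (free_module R X) M"
proof -
  interpret F: module R "free_module R X" by (rule module_free)
  note C = free_module_carrier[of _ R X]
  show ?thesis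
  proof (rule module_homI)
    fix f assume f: "f \<in> carrier (free_module R X)"
    then show "linear_extension R M g f \<in> carrier M"
      using g unfolding linear_extension_def by (intro M.finsum_closed) (auto simp: C Pi_iff)
    fix a assume a: "a \<in> carrier R"
    let ?T = "{x. f x \<noteq> \<zero>}"
    have T: "finite ?T" "?T \<subseteq> X" using f by (auto simp: C)
    have "linear_extension R M g (a \<odot>\<^bsub>free_module R X\<^esub> f) = (\<Oplus>\<^bsub>M\<^esub>x\<in>?T. (a \<odot>\<^bsub>free_module R X\<^esub> f) x \<odot>\<^bsub>M\<^esub> g x)"
      using T f a by (intro linear_extension_eq[OF F.smult_closed g]) auto
    also have "\<dots> = (\<Oplus>\<^bsub>M\<^esub>x\<in>?T. a \<odot>\<^bsub>M\<^esub> (f x \<odot>\<^bsub>M\<^esub> g x))"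
    proof (intro M.finsum_cong')
      fix x assume "x \<in> ?T"
      then have "g x \<in> carrier M" "f x \<in> carrier R" using T g f by (auto simp: C)
      then show "(a \<odot>\<^bsub>free_module R X\<^esub> f) x \<odot>\<^bsub>M\<^esub> g x = a \<odot>\<^bsub>M\<^esub> (f x \<odot>\<^bsub>M\<^esub> g x)"
        using a by (simp add: smult_assoc1)
    qed (use f a g T in \<open>auto simp: C Pi_iff subset_iff\<close>)
    also have "\<dots> = a \<odot>\<^bsub>M\<^esub> linear_extension R M g f"
      unfolding linear_extension_def using f a g T
      by (intro finsum_smult_ldistr[symmetric]) (auto simp: C Pi_iff subset_iff)
    finally show "linear_extension R M g (a \<odot>\<^bsub>free_module R X\<^esub> f) = a \<odot>\<^bsub>M\<^esub> linear_extension R M g f" .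
  next
    fix f h assume f: "f \<in> carrier (free_module R X)" and h: "h \<in> carrier (free_module R X)"
    let ?T = "{x. f x \<noteq> \<zero>} \<union> {x. h x \<noteq> \<zero>}"
    have T: "finite ?T" "?T \<subseteq> X" using f h by (auto simp: C)
    have gT: "g x \<in> carrier M" if "x \<in> ?T" for x using g T that by blast
    have "linear_extension R M g (f \<oplus>\<^bsub>free_module R X\<^esub> h) = (\<Oplus>\<^bsub>M\<^esub>x\<in>?T. (f \<oplus>\<^bsub>free_module R X\<^esub> h) x \<odot>\<^bsub>M\<^esub> g x)"
      using T f h by (intro linear_extension_eq[OF F.a_closed g]) auto
    also have "\<dots> = (\<Oplus>\<^bsub>M\<^esub>x\<in>?T. f x \<odot>\<^bsub>M\<^esub> g x \<oplus>\<^bsub>M\<^esub> h x \<odot>\<^bsub>M\<^esub> g x)"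
      using f h gT by (intro M.finsum_cong') (auto simp: C smult_l_distr Pi_iff)
    also have "\<dots> = (\<Oplus>\<^bsub>M\<^esub>x\<in>?T. f x \<odot>\<^bsub>M\<^esub> g x) \<oplus>\<^bsub>M\<^esub> (\<Oplus>\<^bsub>M\<^esub>x\<in>?T. h x \<odot>\<^bsub>M\<^esub> g x)"
      using f h gT by (intro M.finsum_addf) (auto simp: C Pi_iff)
    also have "\<dots> = linear_extension R M g f \<oplus>\<^bsub>M\<^esub> linear_extension R M g h"
      using linear_extension_eq[OF f g T] linear_extension_eq[OF h g T] by simp
    finally show "linear_extension R M g (f \<oplus>\<^bsub>free_module R X\<^esub> h)
        = linear_extension R M g f \<oplus>\<^bsub>M\<^esub> linear_extension R M g h" .
  qed
qed

end

text \<open>Induction on a finite set containing the support: removing one coordinate splits off a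
  multiple of a unit vector.\<close>

lemma free_hom_eqI:
  assumes "module R M" and h: "h \<in> module_hom R (free_module R X) M" and k: "k \<in> module_hom R (free_module R X) M"
    and eq: "\<And>x. x \<in> X \<Longrightarrow> h (unit_vector R x) = k (unit_vector R x)"
    and f: "f \<in> carrier (free_module R X)"
  shows "h f = k f"
proof -
  interpret plain_module R M by (rule plain_module.intro) fact
  interpret F: module R "free_module R X" by (rule module_free)
  have "\<forall>f\<in>carrier (free_module R X). {x. f x \<noteq> \<zero>\<^bsub>R\<^esub>} \<subseteq> T \<longrightarrow> h f = k f" if "finite T" for T
    using that
  proof (induction T rule: finite_induct)
    case empty
    have "h (\<lambda>_. \<zero>\<^bsub>R\<^esub>) = k (\<lambda>_. \<zero>\<^bsub>R\<^esub>)"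
      using module_hom_zero[OF F.module_axioms module_axioms h]
        module_hom_zero[OF F.module_axioms module_axioms k] by simp
    moreover have "f = (\<lambda>_. \<zero>\<^bsub>R\<^esub>)" if "{x. f x \<noteq> \<zero>\<^bsub>R\<^esub>} \<subseteq> {}" for f :: "'c \<Rightarrow> 'a"
      using that by auto
    ultimately show ?case by auto
  next
    case (insert x T)
    show ?case
    proof (intro ballI impI)
      fix f assume f: "f \<in> carrier (free_module R X)" and sub: "{x. f x \<noteq> \<zero>\<^bsub>R\<^esub>} \<subseteq> insert x T"
      show "h f = k f"
      proof (cases "x \<in> X")
        case False
        then have "{x. f x \<noteq> \<zero>\<^bsub>R\<^esub>} \<subseteq> T" using f sub by (auto simp: free_module_carrier)
        then show ?thesis using bspec[OF insert.IH f] by simp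
      next
        case True
        let ?f = "f(x := \<zero>\<^bsub>R\<^esub>)" and ?u = "unit_vector R x"
        have f': "?f \<in> carrier (free_module R X)" using f
          by (auto simp: free_module_carrier intro: finite_subset[of _ "{x. f x \<noteq> \<zero>\<^bsub>R\<^esub>}"])
        have "{y. ?f y \<noteq> \<zero>\<^bsub>R\<^esub>} \<subseteq> T" using sub by auto
        with bspec[OF insert.IH f'] have e: "h ?f = k ?f" by (rule mp)
        have u: "?u \<in> carrier (free_module R X)" using unit_vector_closed[OF True] .
        have fx: "f x \<in> carrier R" using f by (auto simp: free_module_carrier)
        have dec: "f = ?f \<oplus>\<^bsub>free_module R X\<^esub> f x \<odot>\<^bsub>free_module R X\<^esub> ?u"
          using f by (auto simp: fun_eq_iff unit_vector_def free_module_carrier)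
        have fu: "f x \<odot>\<^bsub>free_module R X\<^esub> ?u \<in> carrier (free_module R X)"
          using F.smult_closed[OF fx u] .
        have "h f = h ?f \<oplus>\<^bsub>M\<^esub> f x \<odot>\<^bsub>M\<^esub> h ?u"
          using arg_cong[OF dec, of h] unfolding module_homD(2)[OF h f' fu] module_homD(3)[OF h fx u] .
        moreover have "k f = k ?f \<oplus>\<^bsub>M\<^esub> f x \<odot>\<^bsub>M\<^esub> k ?u"
          using arg_cong[OF dec, of k] unfolding module_homD(2)[OF k f' fu] module_homD(3)[OF k fx u] .
        ultimately show ?thesis using e eq[OF True] by simp
      qed
    qed
  qed
  then show ?thesis using f by (auto simp: free_module_carrier)
qed

lemma free_hom_eq_linear_extension:
  assumes "module R M" "h \<in> module_hom R (free_module R X) M" "f \<in> carrier (free_module R X)"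
  shows "h f = linear_extension R M (\<lambda>x. h (unit_vector R x)) f"
proof -
  interpret plain_module R M by (rule plain_module.intro) fact
  have c: "(\<lambda>x. h (unit_vector R x)) \<in> X \<rightarrow> carrier M"
    using module_homD(1)[OF assms(2) unit_vector_closed] by auto
  show ?thesis
    using linear_extension_hom[OF c] linear_extension_unit[OF _ c]
    by (intro free_hom_eqI[OF assms(1,2) _ _ assms(3)]) auto
qed

text \<open>Preimages have to be chosen for the unit vectors only, so it is enough that the image of
  \<open>p\<close> contains their values.\<close>

lemma free_hom_lift:
  assumes "module R A" "module R B" "p \<in> module_hom R A B" "h \<in> module_hom R (free_module R X) B"
    and surj: "\<And>x. x \<in> X \<Longrightarrow> h (unit_vector R x) \<in> p ` carrier A"
  obtains k where "k \<in> module_hom R (free_module R X) A"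
    "\<And>f. f \<in> carrier (free_module R X) \<Longrightarrow> p (k f) = h f"
proof -
  interpret A: plain_module R A by (rule plain_module.intro) fact
  define g where "g x = (SOME a. a \<in> carrier A \<and> p a = h (unit_vector R x))" for x
  have g: "g x \<in> carrier A \<and> p (g x) = h (unit_vector R x)" if "x \<in> X" for x
  proof -
    obtain a where "a \<in> carrier A \<and> p a = h (unit_vector R x)" using surj[OF \<open>x \<in> X\<close>] by force
    then show ?thesis unfolding g_def by (rule someI)
  qed
  then have gP: "g \<in> X \<rightarrow> carrier A" by auto
  show ?thesis
  proof
    show k: "linear_extension R A g \<in> module_hom R (free_module R X) A"
      using A.linear_extension_hom[OF gP] .
    show "p (linear_extension R A g f) = h f" if "f \<in> carrier (free_module R X)" for f
      using A.linear_extension_unit[OF _ gP] g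
      by (intro free_hom_eqI[OF assms(2) module_hom_comp[OF k assms(3)] assms(4) _ that]) auto
  qed
qed

text \<open>The free module on \<open>carrier P\<close> lives in the type \<open>'p => 'a\<close>,
  one of the types on which projectivity is tested, so the identity of \<open>P\<close> can be
  lifted along the canonical surjection.\<close>

lemma projective_module_retract:
  fixes P :: "('a, 'p) module"
  assumes "projective_module R P"
  obtains i p where "i \<in> module_hom R P (free_module R (carrier P))"
    "p \<in> module_hom R (free_module R (carrier P)) P" "\<And>x. x \<in> carrier P \<Longrightarrow> p (i x) = x"
proof -
  interpret P: plain_module R P using assms by (simp add: projective_module_def plain_module_def)
  let ?p = "linear_extension R P (\<lambda>x. x)"
  have p: "?p \<in> module_hom R (free_module R (carrier P)) P"
    by (rule P.linear_extension_hom) auto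
  have "x \<in> ?p ` carrier (free_module R (carrier P))" if "x \<in> carrier P" for x
    using P.linear_extension_unit[of x "carrier P" "\<lambda>x. x"] P.unit_vector_closed[OF that] that
    by (intro image_eqI[of _ _ "unit_vector R x"]) auto
  then have surj: "?p ` carrier (free_module R (carrier P)) = carrier P"
    using module_homD(1)[OF p] by blast
  have "\<forall>(A :: ('a, 'p \<Rightarrow> 'a) module) (B :: ('a, 'p) module). module R A \<longrightarrow> module R B \<longrightarrow>
      (\<forall>g\<in>module_hom R A B. g ` carrier A = carrier B \<longrightarrow>
        (\<forall>f\<in>module_hom R P B. \<exists>h\<in>module_hom R P A. \<forall>x\<in>carrier P. g (h x) = f x))"
    using assms by (simp add: projective_module_def)
  from this[THEN spec, THEN spec, THEN mp, OF P.module_free[of "carrier P"], THEN mp, OF P.module_axioms,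
      THEN bspec, OF p, THEN mp, OF surj, THEN bspec, OF module_hom_id]
  obtain h where "h \<in> module_hom R P (free_module R (carrier P))" "\<forall>x\<in>carrier P. ?p (h x) = x" by auto
  then show ?thesis using that[OF _ p] by simp
qed

text \<open>The retraction from a free module makes the lifting property independent of the types in
  its definition, and of surjectivity of \<open>p\<close> outside the image of
  \<open>h\<close>.\<close>

lemma projective_module_lift:
  assumes P: "projective_module R P" and "module R A" "module R B" "p \<in> module_hom R A B"
    "h \<in> module_hom R P B" and surj: "h ` carrier P \<subseteq> p ` carrier A"
  obtains k where "k \<in> module_hom R P A" "\<And>x. x \<in> carrier P \<Longrightarrow> p (k x) = h x"
proof -
  interpret P: plain_module R P using P by (simp add: projective_module_def plain_module_def)
  obtain i q where i: "i \<in> module_hom R P (free_module R (carrier P))"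
    and q: "q \<in> module_hom R (free_module R (carrier P)) P" and qi: "\<And>x. x \<in> carrier P \<Longrightarrow> q (i x) = x"
    by (rule projective_module_retract[OF P]) (rule that)
  have "h (q (unit_vector R x)) \<in> p ` carrier A" if "x \<in> carrier P" for x
    using surj imageI[OF module_homD(1)[OF q P.unit_vector_closed[OF that]], of h] by (rule subsetD)
  then obtain k where k: "k \<in> module_hom R (free_module R (carrier P)) A"
    "\<And>f. f \<in> carrier (free_module R (carrier P)) \<Longrightarrow> p (k f) = h (q f)"
    by (rule free_hom_lift[OF assms(2-4) module_hom_comp[OF q assms(5)]]) auto
  show ?thesis
    by (rule that[OF module_hom_comp[OF i k(1)]]) (simp add: k(2) module_homD(1)[OF i] qi)
qed


section \<open>Change of coefficients: isomorphisms, retracts, powers, free and projective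
  modules\<close>

lemma module_hom_sub_zero:
  assumes "module R M" "module R N" "submodule A R M" "f \<in> module_hom R (M\<lparr>carrier := A\<rparr>) N"
  shows "f \<zero>\<^bsub>M\<^esub> = \<zero>\<^bsub>N\<^esub>"
  using module_hom_zero[OF submodule.submodule_is_module[OF assms(3,1)] assms(2,4)] by simp

lemma mat_act_hom_carrier:
  assumes "module R M" "module R M'" "h \<in> module_hom R M M'" "finite X"
    "\<And>x. x \<in> X \<Longrightarrow> d x y \<in> carrier R" "f \<in> X \<rightarrow> carrier M"
  shows "h (mat_act M X d f y) = mat_act M' X d (\<lambda>x. h (f x)) y"
  by (rule mat_act_hom[OF assms(1,2) module.carrier_is_submodule[OF assms(1)]]) (use assms(3-) in auto)

text \<open>The hypotheses say that \<open>h\<close> induces an isomorphism from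
  \<open>A / S\<close> onto \<open>A' / S'\<close>. Chains are lifted by an arbitrary set-theoretic
  section: the cycle and filling conditions are tested modulo \<open>S\<close>, and
  \<open>ker\<close> detects them after applying \<open>h\<close>.\<close>

lemma exact_at_iso:
  assumes "module R M" "module R M'" "fin_free_complex R X D"
    and A: "submodule A R M" and S: "submodule S R M" and A': "submodule A' R M'" and S': "submodule S' R M'"
    and hom: "h \<in> module_hom R (M\<lparr>carrier := A\<rparr>) M'" and surj: "h ` A = A'"
    and ker: "\<And>x. x \<in> A \<Longrightarrow> h x \<in> S' \<longleftrightarrow> x \<in> S"
  shows "exact_at M X D A S i \<longleftrightarrow> exact_at M' X D A' S' i"
proof -
  interpret C: module_complex R M X D by (intro module_complex.intro module_complex_axioms.intro assms)
  interpret C': module_complex R M' X D by (intro module_complex.intro module_complex_axioms.intro assms)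
  have hd: "h (mat_act M (X i) (D i) f y) = mat_act M' (X i) (D i) (\<lambda>x. h (f x)) y"
    if "f \<in> X i \<rightarrow> A" "y \<in> X (i - 1)" for f y
    using that by (intro mat_act_hom[OF assms(1,2) A hom] C.D_closed) auto
  have hd': "h (mat_act M (X (i + 1)) (D (i + 1)) f y) = mat_act M' (X (i + 1)) (D (i + 1)) (\<lambda>x. h (f x)) y"
    if "f \<in> X (i + 1) \<rightarrow> A" "y \<in> X i" for f y
    using that by (intro mat_act_hom[OF assms(1,2) A hom] C.D_closed') auto
  have step: "h (f x \<ominus>\<^bsub>M\<^esub> mat_act M (X (i + 1)) (D (i + 1)) g x) =
      h (f x) \<ominus>\<^bsub>M'\<^esub> mat_act M' (X (i + 1)) (D (i + 1)) (\<lambda>x. h (g x)) x"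
    if "f \<in> X i \<rightarrow> A" "g \<in> X (i + 1) \<rightarrow> A" "x \<in> X i" for f g x
    using that module_hom_minus[OF assms(1,2) A hom, of "f x" "mat_act M (X (i + 1)) (D (i + 1)) g x"]
      C.diff_in'[OF A that(2,3)] hd'[OF that(2,3)] by (simp add: Pi_iff)
  have stepA: "f x \<ominus>\<^bsub>M\<^esub> mat_act M (X (i + 1)) (D (i + 1)) g x \<in> A"
    if "f \<in> X i \<rightarrow> A" "g \<in> X (i + 1) \<rightarrow> A" "x \<in> X i" for f g x
    using that C.diff_in'[OF A that(2,3)] C.submoduleD(5)[OF A] by (simp add: Pi_iff)
  define s where "s = inv_into A h"
  have s: "s y \<in> A" "h (s y) = y" if "y \<in> A'" for y
    using that surj unfolding s_def by (auto intro: inv_into_into f_inv_into_f)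
  show ?thesis
  proof
    assume E: "exact_at M X D A S i"
    show "exact_at M' X D A' S' i"
      unfolding exact_at_def
    proof safe
      fix f' assume f': "f' \<in> X i \<rightarrow> A'" and df': "\<forall>y\<in>X (i - 1). mat_act M' (X i) (D i) f' y \<in> S'"
      let ?f = "\<lambda>x. s (f' x)"
      have f: "?f \<in> X i \<rightarrow> A" using f' s by auto
      have "mat_act M (X i) (D i) ?f y \<in> S" if "y \<in> X (i - 1)" for y
      proof -
        have "mat_act M' (X i) (D i) (\<lambda>x. h (?f x)) y = mat_act M' (X i) (D i) f' y"
          using f' s C'.submoduleD(1)[OF A'] that by (intro C'.mat_act_cong) (auto intro: C.D_closed)
        then show ?thesis using hd[OF f that] df' that ker[OF C.diff_in[OF A f that]] by simp
      qed
      then obtain g where g: "g \<in> X (i + 1) \<rightarrow> A"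
        "\<And>x. x \<in> X i \<Longrightarrow> ?f x \<ominus>\<^bsub>M\<^esub> mat_act M (X (i + 1)) (D (i + 1)) g x \<in> S"
        using C.exact_atD[OF E f] by auto
      show "\<exists>g\<in>X (i + 1) \<rightarrow> A'. \<forall>x\<in>X i. f' x \<ominus>\<^bsub>M'\<^esub> mat_act M' (X (i + 1)) (D (i + 1)) g x \<in> S'"
      proof (intro bexI ballI)
        show "(\<lambda>x. h (g x)) \<in> X (i + 1) \<rightarrow> A'" using g(1) surj by auto
        fix x assume x: "x \<in> X i"
        have "f' x \<in> A'" using f' x by auto
        then show "f' x \<ominus>\<^bsub>M'\<^esub> mat_act M' (X (i + 1)) (D (i + 1)) (\<lambda>x. h (g x)) x \<in> S'"
          using step[OF f g(1) x] g(2)[OF x] ker[OF stepA[OF f g(1) x]] s by simp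
      qed
    qed
  next
    assume E: "exact_at M' X D A' S' i"
    show "exact_at M X D A S i"
      unfolding exact_at_def
    proof safe
      fix f assume f: "f \<in> X i \<rightarrow> A" and df: "\<forall>y\<in>X (i - 1). mat_act M (X i) (D i) f y \<in> S"
      have f': "(\<lambda>x. h (f x)) \<in> X i \<rightarrow> A'" using f surj by auto
      have "mat_act M' (X i) (D i) (\<lambda>x. h (f x)) y \<in> S'" if "y \<in> X (i - 1)" for y
        using hd[OF f that] df that ker[OF C.diff_in[OF A f that]] by simp
      then obtain g where g: "g \<in> X (i + 1) \<rightarrow> A'"
        "\<And>x. x \<in> X i \<Longrightarrow> h (f x) \<ominus>\<^bsub>M'\<^esub> mat_act M' (X (i + 1)) (D (i + 1)) g x \<in> S'"
        using C'.exact_atD[OF E f'] by auto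
      let ?g = "\<lambda>x. s (g x)"
      have g': "?g \<in> X (i + 1) \<rightarrow> A" using g(1) s by auto
      show "\<exists>g\<in>X (i + 1) \<rightarrow> A. \<forall>x\<in>X i. f x \<ominus>\<^bsub>M\<^esub> mat_act M (X (i + 1)) (D (i + 1)) g x \<in> S"
      proof (intro bexI[OF _ g'] ballI)
        fix x assume x: "x \<in> X i"
        have "mat_act M' (X (i + 1)) (D (i + 1)) (\<lambda>x. h (?g x)) x = mat_act M' (X (i + 1)) (D (i + 1)) g x"
          using g(1) s C'.submoduleD(1)[OF A'] x by (intro C'.mat_act_cong) (auto intro: C.D_closed')
        then show "f x \<ominus>\<^bsub>M\<^esub> mat_act M (X (i + 1)) (D (i + 1)) ?g x \<in> S"
          using step[OF f g' x] g(2)[OF x] ker[OF stepA[OF f g' x]] by simp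
      qed
    qed
  qed
qed

text \<open>The retraction \<open>r\<close> carries a filling of \<open>e f\<close> to a filling of
  \<open>f\<close>, so vanishing passes to direct summands.\<close>

lemma exact_at_retract:
  assumes "module R M" "module R M'" "fin_free_complex R X D"
    and A: "submodule A R M" and A': "submodule A' R M'"
    and e: "e \<in> module_hom R (M\<lparr>carrier := A\<rparr>) M'" and eA: "e ` A \<subseteq> A'"
    and r: "r \<in> module_hom R (M'\<lparr>carrier := A'\<rparr>) M" and rA: "r ` A' \<subseteq> A"
    and re: "\<And>x. x \<in> A \<Longrightarrow> r (e x) = x"
    and E: "exact_at M' X D A' {\<zero>\<^bsub>M'\<^esub>} i"
  shows "exact_at M X D A {\<zero>\<^bsub>M\<^esub>} i"
proof -
  interpret C: module_complex R M X D by (intro module_complex.intro module_complex_axioms.intro assms)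
  interpret C': module_complex R M' X D by (intro module_complex.intro module_complex_axioms.intro assms)
  show ?thesis
    unfolding exact_at_def
  proof safe
    fix f assume f: "f \<in> X i \<rightarrow> A" and df: "\<forall>y\<in>X (i - 1). mat_act M (X i) (D i) f y \<in> {\<zero>\<^bsub>M\<^esub>}"
    have f': "(\<lambda>x. e (f x)) \<in> X i \<rightarrow> A'" using f eA by auto
    have "mat_act M' (X i) (D i) (\<lambda>x. e (f x)) y \<in> {\<zero>\<^bsub>M'\<^esub>}" if "y \<in> X (i - 1)" for y
    proof -
      have "e (mat_act M (X i) (D i) f y) = mat_act M' (X i) (D i) (\<lambda>x. e (f x)) y"
        using f that by (intro mat_act_hom[OF assms(1,2) A e] C.D_closed) auto
      then show ?thesis using df that module_hom_sub_zero[OF assms(1,2) A e] by auto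
    qed
    then obtain g where g: "g \<in> X (i + 1) \<rightarrow> A'"
      "\<And>x. x \<in> X i \<Longrightarrow> e (f x) \<ominus>\<^bsub>M'\<^esub> mat_act M' (X (i + 1)) (D (i + 1)) g x \<in> {\<zero>\<^bsub>M'\<^esub>}"
      using C'.exact_atD[OF E f'] by auto
    show "\<exists>g\<in>X (i + 1) \<rightarrow> A. \<forall>x\<in>X i. f x \<ominus>\<^bsub>M\<^esub> mat_act M (X (i + 1)) (D (i + 1)) g x \<in> {\<zero>\<^bsub>M\<^esub>}"
    proof (intro bexI ballI)
      show "(\<lambda>x. r (g x)) \<in> X (i + 1) \<rightarrow> A" using g(1) rA by auto
      fix x assume x: "x \<in> X i"
      have fx: "f x \<in> A" "e (f x) \<in> A'" using f x f' by auto
      have "r (mat_act M' (X (i + 1)) (D (i + 1)) g x) = mat_act M (X (i + 1)) (D (i + 1)) (\<lambda>x. r (g x)) x"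
        using g(1) x by (intro mat_act_hom[OF assms(2,1) A' r] C.D_closed') auto
      then have "r (e (f x) \<ominus>\<^bsub>M'\<^esub> mat_act M' (X (i + 1)) (D (i + 1)) g x) =
          f x \<ominus>\<^bsub>M\<^esub> mat_act M (X (i + 1)) (D (i + 1)) (\<lambda>x. r (g x)) x"
        using module_hom_minus[OF assms(2,1) A' r fx(2) C'.diff_in'[OF A' g(1) x]] re[OF fx(1)] by simp
      then show "f x \<ominus>\<^bsub>M\<^esub> mat_act M (X (i + 1)) (D (i + 1)) (\<lambda>x. r (g x)) x \<in> {\<zero>\<^bsub>M\<^esub>}"
        using g(2)[OF x] module_hom_sub_zero[OF assms(2,1) A' r] by simp
    qed
  qed
qed

lemma exact_at_retract_carrier:
  assumes "module R M" "module R M'" "fin_free_complex R X D"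
    and e: "e \<in> module_hom R M M'" and r: "r \<in> module_hom R M' M"
    and re: "\<And>x. x \<in> carrier M \<Longrightarrow> r (e x) = x"
    and E: "exact_at M' X D (carrier M') {\<zero>\<^bsub>M'\<^esub>} i"
  shows "exact_at M X D (carrier M) {\<zero>\<^bsub>M\<^esub>} i"
  using module_homD(1)[OF e] module_homD(1)[OF r] e r re
  by (intro exact_at_retract[OF assms(1-3) module.carrier_is_submodule[OF assms(1)]
        module.carrier_is_submodule[OF assms(2)] _ _ _ _ _ E, where e=e and r=r]) auto

text \<open>The diagonal and a projection make \<open>N\<close> a retract of its power, which takes
  at least one coordinate. Conversely the coordinates of a cycle are filled separately.\<close>

lemma exact_at_direct_power:
  assumes "module R N" "fin_free_complex R X D" "k > 0"
  shows "exact_at (direct_power N k) X D (carrier (direct_power N k)) {\<zero>\<^bsub>direct_power N k\<^esub>} i \<longleftrightarrow>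
    exact_at N X D (carrier N) {\<zero>\<^bsub>N\<^esub>} i"
proof
  let ?N = "direct_power N k"
  interpret N: module R N by fact
  interpret P: module R ?N by (rule module_direct_power) fact
  have dg: "(\<lambda>x. \<lambda>i\<in>{..<k}. x) \<in> module_hom R N ?N"
    by (rule module_homI) auto
  have pr: "(\<lambda>x. x j) \<in> module_hom R ?N N" if "j < k" for j
    using that by (intro module_homI) auto
  {
    assume "exact_at ?N X D (carrier ?N) {\<zero>\<^bsub>?N\<^esub>} i"
    then show "exact_at N X D (carrier N) {\<zero>\<^bsub>N\<^esub>} i"
      using exact_at_retract_carrier[OF N.module_axioms P.module_axioms assms(2) dg pr[OF assms(3)]] assms(3)
      by simp
  next
    assume E: "exact_at N X D (carrier N) {\<zero>\<^bsub>N\<^esub>} i"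
    interpret C: module_complex R N X D by (intro module_complex.intro module_complex_axioms.intro assms)
    interpret C': module_complex R ?N X D
      by (intro module_complex.intro module_complex_axioms.intro assms P.module_axioms)
    have cl: "x j \<in> carrier N" if "x \<in> carrier ?N" "j < k" for x j using that by auto
    show "exact_at ?N X D (carrier ?N) {\<zero>\<^bsub>?N\<^esub>} i"
      unfolding exact_at_def
    proof safe
      fix f assume f: "f \<in> X i \<rightarrow> carrier ?N" and df: "\<forall>y\<in>X (i - 1). mat_act ?N (X i) (D i) f y \<in> {\<zero>\<^bsub>?N\<^esub>}"
      have "\<exists>g. g \<in> X (i + 1) \<rightarrow> carrier N \<and>
          (\<forall>x\<in>X i. f x j \<ominus>\<^bsub>N\<^esub> mat_act N (X (i + 1)) (D (i + 1)) g x \<in> {\<zero>\<^bsub>N\<^esub>})" if j: "j < k" for j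
      proof -
        have fj: "(\<lambda>x. f x j) \<in> X i \<rightarrow> carrier N" using f cl j by blast
        have "mat_act N (X i) (D i) (\<lambda>x. f x j) y \<in> {\<zero>\<^bsub>N\<^esub>}" if y: "y \<in> X (i - 1)" for y
        proof -
          have "mat_act ?N (X i) (D i) f y j = mat_act N (X i) (D i) (\<lambda>x. f x j) y"
            using f y mat_act_hom_carrier[OF P.module_axioms N.module_axioms _ C.finite_X, of "\<lambda>x. x j" i "D i" y f]
              pr[OF j] C.D_closed by simp
          then show ?thesis using df y j by auto
        qed
        then show ?thesis using C.exact_atD[OF E fj] by metis
      qed
      then have "\<exists>g. \<forall>j<k. g j \<in> X (i + 1) \<rightarrow> carrier N \<and>
          (\<forall>x\<in>X i. f x j \<ominus>\<^bsub>N\<^esub> mat_act N (X (i + 1)) (D (i + 1)) (g j) x \<in> {\<zero>\<^bsub>N\<^esub>})"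
        by (intro choice) auto
      then obtain g where g: "\<And>j. j < k \<Longrightarrow> g j \<in> X (i + 1) \<rightarrow> carrier N"
        "\<And>j x. j < k \<Longrightarrow> x \<in> X i \<Longrightarrow> f x j \<ominus>\<^bsub>N\<^esub> mat_act N (X (i + 1)) (D (i + 1)) (g j) x = \<zero>\<^bsub>N\<^esub>"
        by auto
      let ?g = "\<lambda>x. \<lambda>j\<in>{..<k}. g j x"
      have g': "?g \<in> X (i + 1) \<rightarrow> carrier ?N" using g(1) by (auto simp: Pi_iff)
      show "\<exists>g\<in>X (i + 1) \<rightarrow> carrier ?N. \<forall>x\<in>X i. f x \<ominus>\<^bsub>?N\<^esub> mat_act ?N (X (i + 1)) (D (i + 1)) g x \<in> {\<zero>\<^bsub>?N\<^esub>}"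
      proof (intro bexI[OF _ g'] ballI)
        fix x assume x: "x \<in> X i"
        let ?v = "mat_act ?N (X (i + 1)) (D (i + 1)) ?g x"
        have v: "?v \<in> carrier ?N" using C'.diff_in'[OF P.carrier_is_submodule g' x] .
        have fx: "f x \<in> carrier ?N" using f x by auto
        have "?v j = f x j" if j: "j < k" for j
        proof -
          have "?v j = mat_act N (X (i + 1)) (D (i + 1)) (\<lambda>x. ?g x j) x"
            using g' x mat_act_hom_carrier[OF P.module_axioms N.module_axioms _ C.finite_X, of "\<lambda>x. x j" "i + 1" "D (i + 1)" x ?g]
              pr[OF j] C.D_closed' by simp
          also have "\<dots> = mat_act N (X (i + 1)) (D (i + 1)) (g j) x" using j by simp
          finally have "f x j \<ominus>\<^bsub>N\<^esub> ?v j = \<zero>\<^bsub>N\<^esub>" using g(2)[OF j x] by simp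
          then show ?thesis using cl[OF v j] cl[OF fx j] N.minus_eq_zero_iff by simp
        qed
        then have "?v = f x" using v fx by (intro PiE_ext[of _ "{..<k}" "\<lambda>_. carrier N"]) auto
        then show "f x \<ominus>\<^bsub>?N\<^esub> ?v \<in> {\<zero>\<^bsub>?N\<^esub>}" using P.minus_self[OF fx] by simp
      qed
    qed
  }
qed

text \<open>Each coordinate is a problem over the ring. As the bases are finite, a chain has only
  finitely many nonzero coordinates, and a filling that is zero at all the others is again finitely
  supported. Free coefficients of any rank are thus reduced to the ring.\<close>

lemma exact_at_free_module:
  assumes "cring R" "fin_free_complex R X D" "exact_at (regular_module R) X D (carrier R) {\<zero>\<^bsub>R\<^esub>} i"
  shows "exact_at (free_module R Y) X D (carrier (free_module R Y)) {\<zero>\<^bsub>free_module R Y\<^esub>} i"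
proof -
  let ?F = "free_module R Y" and ?R = "regular_module R"
  interpret cring R by fact
  interpret P: module R ?F by (rule module_free)
  interpret N: module R ?R by (rule module_regular)
  interpret C: module_complex R ?R X D by (intro module_complex.intro module_complex_axioms.intro assms module_regular)
  interpret C': module_complex R ?F X D by (intro module_complex.intro module_complex_axioms.intro assms module_free)
  have pr: "(\<lambda>v. v y) \<in> module_hom R ?F ?R" for y
    by (intro module_homI) (auto simp: free_module_carrier)
  have cl: "v y \<in> carrier R" if "v \<in> carrier ?F" for v y using that by (auto simp: free_module_carrier)
  have coord: "mat_act ?F (X i) (D i) f z y = mat_act ?R (X i) (D i) (\<lambda>x. f x y) z"
    if "f \<in> X i \<rightarrow> carrier ?F" "z \<in> X (i - 1)" for f y z
    using that mat_act_hom_carrier[OF P.module_axioms N.module_axioms _ C.finite_X, of "\<lambda>x. x y" i "D i" z f]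
      pr C.D_closed by simp
  have coord': "mat_act ?F (X (i + 1)) (D (i + 1)) f z y = mat_act ?R (X (i + 1)) (D (i + 1)) (\<lambda>x. f x y) z"
    if "f \<in> X (i + 1) \<rightarrow> carrier ?F" "z \<in> X i" for f y z
    using that mat_act_hom_carrier[OF P.module_axioms N.module_axioms _ C.finite_X, of "\<lambda>x. x y" "i + 1" "D (i + 1)" z f]
      pr C.D_closed' by simp
  show ?thesis
    unfolding exact_at_def
  proof safe
    fix f assume f: "f \<in> X i \<rightarrow> carrier ?F" and df: "\<forall>y\<in>X (i - 1). mat_act ?F (X i) (D i) f y \<in> {\<zero>\<^bsub>?F\<^esub>}"
    \<comment> \<open>The last conjunct forces the zero filling at coordinates where all values of
      \<open>f\<close> vanish; it keeps the assembled filling inside the free module.\<close>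
    define Q where "Q y g \<longleftrightarrow> g \<in> X (i + 1) \<rightarrow> carrier R \<and>
        (\<forall>x\<in>X i. mat_act ?R (X (i + 1)) (D (i + 1)) g x = f x y) \<and>
        ((\<forall>x\<in>X i. f x y = \<zero>\<^bsub>R\<^esub>) \<longrightarrow> g = (\<lambda>_. \<zero>\<^bsub>R\<^esub>))" for y g
    have "\<exists>g. Q y g" for y
    proof (cases "\<forall>x\<in>X i. f x y = \<zero>\<^bsub>R\<^esub>")
      case True
      have "mat_act ?R (X (i + 1)) (D (i + 1)) (\<lambda>_. \<zero>\<^bsub>R\<^esub>) x = \<zero>\<^bsub>R\<^esub>" if "x \<in> X i" for x
        using N.mat_act_zero[of "X (i + 1)" "D (i + 1)" x "\<lambda>_. \<zero>\<^bsub>R\<^esub>"] that C.D_closed' by simp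
      then show ?thesis using True by (intro exI[of _ "\<lambda>_. \<zero>\<^bsub>R\<^esub>"]) (auto simp: Q_def)
    next
      case False
      have fy: "(\<lambda>x. f x y) \<in> X i \<rightarrow> carrier R" using f cl by blast
      have "mat_act ?R (X i) (D i) (\<lambda>x. f x y) z \<in> {\<zero>\<^bsub>R\<^esub>}" if z: "z \<in> X (i - 1)" for z
        using coord[OF f z, of y, symmetric] df z by auto
      then obtain g where g: "g \<in> X (i + 1) \<rightarrow> carrier R"
        "\<And>x. x \<in> X i \<Longrightarrow> f x y \<ominus>\<^bsub>?R\<^esub> mat_act ?R (X (i + 1)) (D (i + 1)) g x \<in> {\<zero>\<^bsub>R\<^esub>}"
        using C.exact_atD[OF assms(3) fy] by auto
      have "mat_act ?R (X (i + 1)) (D (i + 1)) g x = f x y" if x: "x \<in> X i" for x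
      proof -
        have "mat_act ?R (X (i + 1)) (D (i + 1)) g x \<in> carrier ?R"
          using C.diff_in'[OF N.carrier_is_submodule _ x] g(1) by simp
        then show ?thesis using g(2)[OF x] N.minus_eq_zero_iff[of "f x y"] fy x by (simp add: Pi_iff)
      qed
      then show ?thesis using g(1) False by (intro exI[of _ g]) (auto simp: Q_def)
    qed
    then obtain g where g: "\<And>y. Q y (g y)" by metis
    let ?g = "\<lambda>x y. g y x"
    have g': "?g x \<in> carrier ?F" if x: "x \<in> X (i + 1)" for x
    proof -
      have "{y. g y x \<noteq> \<zero>\<^bsub>R\<^esub>} \<subseteq> (\<Union>z\<in>X i. {y. f z y \<noteq> \<zero>\<^bsub>R\<^esub>})" using g by (fastforce simp: Q_def)
      moreover have "finite (\<Union>z\<in>X i. {y. f z y \<noteq> \<zero>\<^bsub>R\<^esub>})"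
        using f by (auto simp: free_module_carrier)
      ultimately have "finite {y. g y x \<noteq> \<zero>\<^bsub>R\<^esub>}" by (rule finite_subset)
      moreover have "g y x = \<zero>\<^bsub>R\<^esub>" if "y \<notin> Y" for y
        using f that g[of y] by (auto simp: free_module_carrier Q_def Pi_iff)
      moreover have "g y x \<in> carrier R" for y using g[of y] x by (auto simp: Q_def)
      ultimately show ?thesis by (auto simp: free_module_carrier)
    qed
    then have g'': "?g \<in> X (i + 1) \<rightarrow> carrier ?F" by auto
    show "\<exists>g\<in>X (i + 1) \<rightarrow> carrier ?F. \<forall>x\<in>X i. f x \<ominus>\<^bsub>?F\<^esub> mat_act ?F (X (i + 1)) (D (i + 1)) g x \<in> {\<zero>\<^bsub>?F\<^esub>}"
    proof (intro bexI[OF _ g''] ballI)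
      fix x assume x: "x \<in> X i"
      have "mat_act ?F (X (i + 1)) (D (i + 1)) ?g x = f x"
        using coord'[OF g'' x] g x by (auto simp: Q_def)
      moreover have "f x \<in> carrier ?F" using f x by (rule funcset_mem)
      ultimately show "f x \<ominus>\<^bsub>?F\<^esub> mat_act ?F (X (i + 1)) (D (i + 1)) ?g x \<in> {\<zero>\<^bsub>?F\<^esub>}"
        using P.minus_self[of "f x"] by simp
    qed
  qed
qed

lemma exact_at_projective_module:
  assumes "cring R" "fin_free_complex R X D" "exact_at (regular_module R) X D (carrier R) {\<zero>\<^bsub>R\<^esub>} i"
    and "projective_module R P"
  shows "exact_at P X D (carrier P) {\<zero>\<^bsub>P\<^esub>} i"
proof -
  interpret P: module R P using assms(4) by (simp add: projective_module_def)
  interpret F: module R "free_module R (carrier P)" by (rule P.module_free)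
  obtain i' p where "i' \<in> module_hom R P (free_module R (carrier P))"
    "p \<in> module_hom R (free_module R (carrier P)) P" "\<And>x. x \<in> carrier P \<Longrightarrow> p (i' x) = x"
    by (rule projective_module_retract[OF assms(4)]) (rule that)
  then show ?thesis
    by (rule exact_at_retract_carrier[OF P.module_axioms F.module_axioms assms(2) _ _ _ exact_at_free_module[OF assms(1-3)]])
qed


section \<open>Transposed complexes and extensions of complexes\<close>

definition transpose_basis :: "(int \<Rightarrow> 'x set) \<Rightarrow> int \<Rightarrow> 'x set" where
  "transpose_basis X i = X (- i)"

text \<open>In the dual complex the differential from degree \<open>i\<close> to
  \<open>i - 1\<close> goes from the basis \<open>X (- i)\<close> to \<open>X (1 - i)\<close>, so it
  is the transpose of \<open>D (1 - i)\<close>. With this grading, exactness in degree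
  \<open>- i\<close> is vanishing of cohomology in degree \<open>i\<close>.\<close>

definition transpose_diff :: "(int \<Rightarrow> 'x \<Rightarrow> 'x \<Rightarrow> 'a) \<Rightarrow> int \<Rightarrow> 'x \<Rightarrow> 'x \<Rightarrow> 'a" where
  "transpose_diff D i x y = D (1 - i) y x"

lemma fin_free_complex_transpose:
  assumes "cring R" "fin_free_complex R X D"
  shows "fin_free_complex R (transpose_basis X) (transpose_diff D)"
proof -
  interpret cring R by fact
  interpret C: module_complex R "regular_module R" X D
    by (intro module_complex.intro module_complex_axioms.intro assms module_regular)
  have cl: "D (1 - i) y x \<in> carrier R" if "x \<in> X (- i)" "y \<in> X (1 - i)" for i x y
    using C.D_closed[of y "1 - i" x] that by simp
  have "(\<Oplus>\<^bsub>R\<^esub>y\<in>X (1 - i). D (1 - i) y x \<otimes>\<^bsub>R\<^esub> D (2 - i) z y) = \<zero>\<^bsub>R\<^esub>"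
    if x: "x \<in> X (- i)" and z: "z \<in> X (2 - i)" for i x z
  proof -
    have "(\<Oplus>\<^bsub>R\<^esub>y\<in>X (1 - i). D (1 - i) y x \<otimes>\<^bsub>R\<^esub> D (2 - i) z y)
        = (\<Oplus>\<^bsub>R\<^esub>y\<in>X (1 - i). D (2 - i) z y \<otimes>\<^bsub>R\<^esub> D (1 - i) y x)"
      using cl[OF x] C.D_closed[OF z] by (intro finsum_cong') (auto intro: m_comm)
    also have "\<dots> = \<zero>\<^bsub>R\<^esub>" using C.DD[OF z, of x] x by simp
    finally show ?thesis .
  qed
  then show ?thesis
    unfolding fin_free_complex_def transpose_basis_def transpose_diff_def
    using cl by (auto simp: algebra_simps)
qed

text \<open>Exactness in one degree sees only three bases and two matrices on them. This transfers
  it between complexes that agree locally up to an index shift, such as a resolution and a complete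
  resolution extending it.\<close>

lemma exact_at_shift:
  assumes "module R M" "submodule A R M" "fin_free_complex R X D"
    and X': "X' i = X j" "X' (i + 1) = X (j + 1)" "X' (i - 1) = X (j - 1)"
    and D': "\<And>x y. x \<in> X j \<Longrightarrow> y \<in> X (j - 1) \<Longrightarrow> D' i x y = D j x y"
    "\<And>x y. x \<in> X (j + 1) \<Longrightarrow> y \<in> X j \<Longrightarrow> D' (i + 1) x y = D (j + 1) x y"
    and E: "exact_at M X D A S j"
  shows "exact_at M X' D' A S i"
proof -
  interpret C: module_complex R M X D
    by (intro module_complex.intro module_complex_axioms.intro assms)
  note A = C.submoduleD(1)[OF assms(2)]
  have d: "mat_act M (X' i) (D' i) f y = mat_act M (X j) (D j) f y"
    if "f \<in> X j \<rightarrow> A" "y \<in> X (j - 1)" for f y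
    unfolding mat_act_def X'(1) using that A
    by (intro C.M.finsum_cong') (auto simp: D' Pi_iff intro!: C.smult_closed C.D_closed)
  have d': "mat_act M (X' (i + 1)) (D' (i + 1)) f y = mat_act M (X (j + 1)) (D (j + 1)) f y"
    if "f \<in> X (j + 1) \<rightarrow> A" "y \<in> X j" for f y
    unfolding mat_act_def X'(2) using that A
    by (intro C.M.finsum_cong') (auto simp: D' Pi_iff intro!: C.smult_closed C.D_closed')
  show ?thesis
    unfolding exact_at_def X'
  proof safe
    fix f assume f: "f \<in> X j \<rightarrow> A" and df: "\<forall>y\<in>X (j - 1). mat_act M (X j) (D' i) f y \<in> S"
    have "mat_act M (X j) (D j) f y \<in> S" if "y \<in> X (j - 1)" for y
      using bspec[OF df that] unfolding d[OF f that, unfolded X'] .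
    then obtain g where g: "g \<in> X (j + 1) \<rightarrow> A"
      "\<And>x. x \<in> X j \<Longrightarrow> f x \<ominus>\<^bsub>M\<^esub> mat_act M (X (j + 1)) (D (j + 1)) g x \<in> S"
      using C.exact_atD[OF E f] by auto
    show "\<exists>g\<in>X (j + 1) \<rightarrow> A. \<forall>x\<in>X j. f x \<ominus>\<^bsub>M\<^esub> mat_act M (X (j + 1)) (D' (i + 1)) g x \<in> S"
    proof (intro bexI[OF _ g(1)] ballI)
      fix x assume "x \<in> X j"
      then show "f x \<ominus>\<^bsub>M\<^esub> mat_act M (X (j + 1)) (D' (i + 1)) g x \<in> S"
        using d'[OF g(1)] g(2) unfolding X' by simp
    qed
  qed
qed

lemma (in module) finsum_Un_zero:
  assumes "finite X" "finite Y" "X \<inter> Y = {}" "f \<in> X \<rightarrow> carrier M" "\<And>y. y \<in> Y \<Longrightarrow> f y = \<zero>\<^bsub>M\<^esub>"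
  shows "finsum M f (X \<union> Y) = finsum M f X"
proof -
  have "finsum M f Y = (\<Oplus>\<^bsub>M\<^esub>y\<in>Y. \<zero>\<^bsub>M\<^esub>)" using assms(5) by (intro M.finsum_cong') auto
  moreover have "f \<in> Y \<rightarrow> carrier M" using assms(5) by auto
  ultimately show ?thesis using assms by (subst M.finsum_Un_disjoint) (auto intro!: M.r_zero M.finsum_closed)
qed

text \<open>By \<open>sub\<close> the bases \<open>X1\<close> span a subcomplex with quotient
  spanned by \<open>X2\<close>; the entries from \<open>X2\<close> to \<open>X1\<close> are
  arbitrary. A cycle is first filled in its \<open>X2\<close> coordinates. What remains has its
  \<open>X2\<close> coordinates in \<open>S\<close> and is filled within \<open>X1\<close>.\<close>

lemma exact_at_extension_of_complexes:
  fixes X :: "int \<Rightarrow> 'x set"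
  assumes "module R M" and A: "submodule A R M" and S: "submodule S R M" and SA: "S \<subseteq> A"
    and "fin_free_complex R X D"
    and X: "\<And>i. X i = X1 i \<union> X2 i" "\<And>i. X1 i \<inter> X2 i = {}"
    and sub: "\<And>i x y. x \<in> X1 i \<Longrightarrow> y \<in> X2 (i - 1) \<Longrightarrow> D i x y = \<zero>\<^bsub>R\<^esub>"
    and E1: "exact_at M X1 D A S i" and E2: "exact_at M X2 D A S i"
  shows "exact_at M X D A S i"
proof -
  interpret C: module_complex R M X D
    by (intro module_complex.intro module_complex_axioms.intro assms)
  have fin: "finite (X1 j)" "finite (X2 j)" for j using C.finite_X[of j] unfolding X(1)[of j] by auto
  note AD = C.submoduleD[OF A] and SD = C.submoduleD[OF S]
  note carr = C.carrier_is_submodule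
  have cl1: "D j x y \<in> carrier R" if "x \<in> X j" "y \<in> X (j - 1)" for j x y using that by (rule C.D_closed)
  have fA: "f \<in> Y \<rightarrow> carrier M" if "f \<in> Y \<rightarrow> A" for f and Y :: "'x set" using that AD(1) by auto
  have on2: "mat_act M (X j) (D j) f y = mat_act M (X2 j) (D j) f y"
    if f: "f \<in> X j \<rightarrow> carrier M" and y: "y \<in> X2 (j - 1)" for f j y
  proof -
    have "D j x y \<odot>\<^bsub>M\<^esub> f x \<in> carrier M" if "x \<in> X2 j" for x
      using that f y cl1[of x j y] X by auto
    moreover have "D j x y \<odot>\<^bsub>M\<^esub> f x = \<zero>\<^bsub>M\<^esub>" if "x \<in> X1 j" for x
    proof -
      have "f x \<in> carrier M" using that f X(1)[of j] by auto
      then show ?thesis using sub[OF that y] by simp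
    qed
    ultimately have "(\<Oplus>\<^bsub>M\<^esub>x\<in>X2 j \<union> X1 j. D j x y \<odot>\<^bsub>M\<^esub> f x) = (\<Oplus>\<^bsub>M\<^esub>x\<in>X2 j. D j x y \<odot>\<^bsub>M\<^esub> f x)"
      using X(2)[of j] by (intro C.finsum_Un_zero fin) auto
    then show ?thesis unfolding mat_act_def X(1)[of j] by (simp add: Un_commute)
  qed
  have on1: "mat_act M (X j) (D j) f y = mat_act M (X1 j) (D j) f y \<oplus>\<^bsub>M\<^esub> mat_act M (X2 j) (D j) f y"
    if f: "f \<in> X j \<rightarrow> carrier M" and y: "y \<in> X (j - 1)" for f j y
    unfolding mat_act_def X(1)[of j] using fin X(2)[of j] f cl1[OF _ y] X(1)[of j]
    by (intro C.M.finsum_Un_disjoint) (auto intro!: C.smult_closed)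
  show ?thesis
    unfolding exact_at_def
  proof safe
    fix f assume f: "f \<in> X i \<rightarrow> A" and df: "\<forall>y\<in>X (i - 1). mat_act M (X i) (D i) f y \<in> S"
    have f2: "f \<in> X2 i \<rightarrow> A" using f X(1)[of i] by auto
    have "mat_act M (X2 i) (D i) f y \<in> S" if "y \<in> X2 (i - 1)" for y
      using bspec[OF df, of y] that X(1)[of "i - 1"] unfolding on2[OF fA[OF f] that] by simp
    then obtain g2 where g2: "g2 \<in> X2 (i + 1) \<rightarrow> A"
      "\<And>x. x \<in> X2 i \<Longrightarrow> f x \<ominus>\<^bsub>M\<^esub> mat_act M (X2 (i + 1)) (D (i + 1)) g2 x \<in> S"
      using E2 f2 unfolding exact_at_def by blast
    define h2 where "h2 x = (if x \<in> X2 (i + 1) then g2 x else \<zero>\<^bsub>M\<^esub>)" for x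
    have h2: "h2 \<in> X (i + 1) \<rightarrow> A" using g2(1) AD(2) by (auto simp: h2_def)
    have h2M: "h2 \<in> X (i + 1) \<rightarrow> carrier M" using fA[OF h2] .
    define f' where "f' x = f x \<ominus>\<^bsub>M\<^esub> mat_act M (X (i + 1)) (D (i + 1)) h2 x" for x
    have f': "f' \<in> X i \<rightarrow> A"
      using f C.diff_in'[OF A h2] AD(5) by (auto simp: f'_def Pi_iff)
    have f'2: "f' x \<in> S" if x: "x \<in> X2 i" for x
    proof -
      have "mat_act M (X (i + 1)) (D (i + 1)) h2 x = mat_act M (X2 (i + 1)) (D (i + 1)) h2 x"
        using on2[OF h2M, of x] x by simp
      also have "\<dots> = mat_act M (X2 (i + 1)) (D (i + 1)) g2 x"
        using fA[OF g2(1)] x C.D_closed' X(1)[of "i + 1"] X(1)[of i]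
        by (intro C.mat_act_cong) (auto simp: h2_def)
      finally show ?thesis using g2(2)[OF x] by (simp add: f'_def)
    qed
    have df': "mat_act M (X i) (D i) f' y \<in> S" if y: "y \<in> X (i - 1)" for y
    proof -
      have "mat_act M (X (i + 1)) (D (i + 1)) h2 \<in> X i \<rightarrow> carrier M"
        using C.diff_in'[OF carr h2M] by auto
      then have "mat_act M (X i) (D i) f' y = mat_act M (X i) (D i) f y \<ominus>\<^bsub>M\<^esub> \<zero>\<^bsub>M\<^esub>"
        unfolding f'_def C.diff_diff[OF h2M y, symmetric] by (intro C.diff_minus fA[OF f] y)
      then show ?thesis using df y SD(1) by simp
    qed
    have f'1: "f' \<in> X1 i \<rightarrow> A" using f' X(1)[of i] by auto
    have "mat_act M (X1 i) (D i) f' y \<in> S" if y: "y \<in> X1 (i - 1)" for y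
    proof -
      have y': "y \<in> X (i - 1)" using y X(1)[of "i - 1"] by auto
      have a: "mat_act M (X1 i) (D i) f' y \<in> carrier M"
        using y' cl1 X(1)[of i] fA[OF f'1] by (intro C.mat_act_closed) auto
      \<comment> \<open>The \<open>X2\<close> coordinates of \<open>f'\<close> lie in
        \<open>S\<close>, so they change the boundary in \<open>X1\<close> only by an element of
        \<open>S\<close>.\<close>
      have b: "mat_act M (X2 i) (D i) f' y \<in> S"
        using y' cl1 X(1)[of i] f'2 by (intro C.mat_act_in[OF S]) auto
      have "mat_act M (X1 i) (D i) f' y = mat_act M (X i) (D i) f' y \<ominus>\<^bsub>M\<^esub> mat_act M (X2 i) (D i) f' y"
        using on1[OF fA[OF f'] y'] a b SD(1) by (simp add: a_minus_def C.M.a_assoc C.M.r_neg)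
      then show ?thesis using df'[OF y'] b SD(5) by simp
    qed
    then obtain g1 where g1: "g1 \<in> X1 (i + 1) \<rightarrow> A"
      "\<And>x. x \<in> X1 i \<Longrightarrow> f' x \<ominus>\<^bsub>M\<^esub> mat_act M (X1 (i + 1)) (D (i + 1)) g1 x \<in> S"
      using E1 f'1 unfolding exact_at_def by blast
    define h1 where "h1 x = (if x \<in> X1 (i + 1) then g1 x else \<zero>\<^bsub>M\<^esub>)" for x
    have h1: "h1 \<in> X (i + 1) \<rightarrow> A" using g1(1) AD(2) by (auto simp: h1_def)
    have h1M: "h1 \<in> X (i + 1) \<rightarrow> carrier M" using fA[OF h1] .
    have z2: "mat_act M (X2 (i + 1)) (D (i + 1)) h1 x = \<zero>\<^bsub>M\<^esub>" if "x \<in> X i" for x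
      using that C.D_closed' X(1)[of "i + 1"] X(2)[of "i + 1"] by (intro C.mat_act_zero) (auto simp: h1_def)
    have c1: "mat_act M (X1 (i + 1)) (D (i + 1)) g1 x \<in> carrier M" if "x \<in> X i" for x
      using that C.D_closed' X(1)[of "i + 1"] fA[OF g1(1)] by (intro C.mat_act_closed) auto
    have h1x: "mat_act M (X (i + 1)) (D (i + 1)) h1 x = mat_act M (X1 (i + 1)) (D (i + 1)) g1 x" if x: "x \<in> X i" for x
    proof -
      have "mat_act M (X1 (i + 1)) (D (i + 1)) h1 x = mat_act M (X1 (i + 1)) (D (i + 1)) g1 x"
        using fA[OF g1(1)] x C.D_closed' X(1)[of "i + 1"]
        by (intro C.mat_act_cong) (auto simp: h1_def)
      then show ?thesis using on1[OF h1M, of x] x z2[OF x] c1[OF x] by simp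
    qed
    show "\<exists>g\<in>X (i + 1) \<rightarrow> A. \<forall>x\<in>X i. f x \<ominus>\<^bsub>M\<^esub> mat_act M (X (i + 1)) (D (i + 1)) g x \<in> S"
    proof (intro bexI ballI)
      show "(\<lambda>x. h2 x \<oplus>\<^bsub>M\<^esub> h1 x) \<in> X (i + 1) \<rightarrow> A" using h1 h2 AD(3) by (auto simp: Pi_iff)
      fix x assume x: "x \<in> X i"
      have "f x \<ominus>\<^bsub>M\<^esub> mat_act M (X (i + 1)) (D (i + 1)) (\<lambda>x. h2 x \<oplus>\<^bsub>M\<^esub> h1 x) x
          = f' x \<ominus>\<^bsub>M\<^esub> mat_act M (X (i + 1)) (D (i + 1)) h1 x"
        unfolding f'_def using C.diff_add'[OF h2M h1M x] C.diff_in'[OF carr h2M x] C.diff_in'[OF carr h1M x]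
          fA[OF f] x by (simp add: C.minus_minus_eq(1) Pi_iff)
      also have "\<dots> \<in> S"
      proof (cases "x \<in> X1 i")
        case True
        then show ?thesis using g1(2) h1x[OF x] by simp
      next
        case False
        then have x2: "x \<in> X2 i" using x X(1)[of i] by auto
        have "mat_act M (X (i + 1)) (D (i + 1)) h1 x = mat_act M (X2 (i + 1)) (D (i + 1)) h1 x"
          using on2[OF h1M, of x] x2 by simp
        then show ?thesis using z2[OF x] f'2[OF x2] SD(1) by simp
      qed
      finally show "f x \<ominus>\<^bsub>M\<^esub> mat_act M (X (i + 1)) (D (i + 1)) (\<lambda>x. h2 x \<oplus>\<^bsub>M\<^esub> h1 x) x \<in> S" .
    qed
  qed
qed


section \<open>Quotients and homology\<close>

text \<open>Here \<open>Q\<close> is merely a record with operations; each module axiom is checked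
  on preimages. This is how quotients are shown to be modules.\<close>

lemma module_surj_image:
  assumes "module R M" and surj: "h ` carrier M = carrier Q"
    and add: "\<And>x y. x \<in> carrier M \<Longrightarrow> y \<in> carrier M \<Longrightarrow> h (x \<oplus>\<^bsub>M\<^esub> y) = h x \<oplus>\<^bsub>Q\<^esub> h y"
    and smult: "\<And>a x. a \<in> carrier R \<Longrightarrow> x \<in> carrier M \<Longrightarrow> h (a \<odot>\<^bsub>M\<^esub> x) = a \<odot>\<^bsub>Q\<^esub> h x"
    and zero: "h \<zero>\<^bsub>M\<^esub> = \<zero>\<^bsub>Q\<^esub>"
  shows "module R Q"
proof -
  interpret module R M by fact
  have rep: "\<exists>x\<in>carrier M. q = h x" if "q \<in> carrier Q" for q using that surj by auto
  have hc: "h x \<in> carrier Q" if "x \<in> carrier M" for x using that surj by auto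
  show ?thesis
  proof (rule moduleI)
    show "abelian_group Q"
    proof (rule abelian_groupI)
      fix p q assume "p \<in> carrier Q" "q \<in> carrier Q"
      then obtain x y where xy: "x \<in> carrier M" "p = h x" "y \<in> carrier M" "q = h y" using rep by metis
      show "p \<oplus>\<^bsub>Q\<^esub> q \<in> carrier Q" using xy hc[of "x \<oplus>\<^bsub>M\<^esub> y"] add by simp
      show "p \<oplus>\<^bsub>Q\<^esub> q = q \<oplus>\<^bsub>Q\<^esub> p" using xy by (simp add: add[symmetric] M.a_comm)
      fix r assume "r \<in> carrier Q"
      then obtain z where z: "z \<in> carrier M" "r = h z" using rep by metis
      show "p \<oplus>\<^bsub>Q\<^esub> q \<oplus>\<^bsub>Q\<^esub> r = p \<oplus>\<^bsub>Q\<^esub> (q \<oplus>\<^bsub>Q\<^esub> r)"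
        using xy z by (simp add: add[symmetric] M.a_assoc)
    next
      show "\<zero>\<^bsub>Q\<^esub> \<in> carrier Q" using hc[of "\<zero>\<^bsub>M\<^esub>"] zero by simp
      fix p assume "p \<in> carrier Q"
      then obtain x where x: "x \<in> carrier M" "p = h x" using rep by metis
      show "\<zero>\<^bsub>Q\<^esub> \<oplus>\<^bsub>Q\<^esub> p = p" using x by (simp add: add[symmetric] zero[symmetric])
      show "\<exists>y\<in>carrier Q. y \<oplus>\<^bsub>Q\<^esub> p = \<zero>\<^bsub>Q\<^esub>"
        using x hc[of "\<ominus>\<^bsub>M\<^esub> x"] by (intro bexI[of _ "h (\<ominus>\<^bsub>M\<^esub> x)"]) (auto simp: add[symmetric] zero[symmetric] M.l_neg)
    qed
  next
    show "cring R" by (rule R.cring_axioms)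
    fix a p assume a: "a \<in> carrier R" and "p \<in> carrier Q"
    then obtain x where x: "x \<in> carrier M" "p = h x" using rep by metis
    show "a \<odot>\<^bsub>Q\<^esub> p \<in> carrier Q" using x a hc[of "a \<odot>\<^bsub>M\<^esub> x"] by (simp add: smult)
    fix q assume "q \<in> carrier Q"
    then obtain y where y: "y \<in> carrier M" "q = h y" using rep by metis
    show "a \<odot>\<^bsub>Q\<^esub> (p \<oplus>\<^bsub>Q\<^esub> q) = a \<odot>\<^bsub>Q\<^esub> p \<oplus>\<^bsub>Q\<^esub> a \<odot>\<^bsub>Q\<^esub> q"
      using x y a by (simp add: smult[symmetric] add[symmetric] smult_r_distr)
  next
    fix a b p assume ab: "a \<in> carrier R" "b \<in> carrier R" and "p \<in> carrier Q"
    then obtain x where x: "x \<in> carrier M" "p = h x" using rep by metis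
    show "(a \<oplus>\<^bsub>R\<^esub> b) \<odot>\<^bsub>Q\<^esub> p = a \<odot>\<^bsub>Q\<^esub> p \<oplus>\<^bsub>Q\<^esub> b \<odot>\<^bsub>Q\<^esub> p"
      using x ab by (simp add: smult[symmetric] add[symmetric] smult_l_distr)
    show "(a \<otimes>\<^bsub>R\<^esub> b) \<odot>\<^bsub>Q\<^esub> p = a \<odot>\<^bsub>Q\<^esub> (b \<odot>\<^bsub>Q\<^esub> p)"
      using x ab by (simp add: smult[symmetric] smult_assoc1)
  next
    fix p assume "p \<in> carrier Q"
    then obtain x where x: "x \<in> carrier M" "p = h x" using rep by metis
    show "\<one>\<^bsub>R\<^esub> \<odot>\<^bsub>Q\<^esub> p = p" using x by (simp add: smult[symmetric])
  qed
qed

lemma quotient_module_simps: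
  "carrier (quotient_module M H) = (\<lambda>x. H +>\<^bsub>M\<^esub> x) ` carrier M"
  "\<zero>\<^bsub>quotient_module M H\<^esub> = H"
  by (auto simp: quotient_module_def A_RCOSETS_def')

lemma
  assumes "module R M" "submodule H R M"
  shows quotient_module_add: "\<And>x y. x \<in> carrier M \<Longrightarrow> y \<in> carrier M \<Longrightarrow>
      H +>\<^bsub>M\<^esub> (x \<oplus>\<^bsub>M\<^esub> y) = (H +>\<^bsub>M\<^esub> x) \<oplus>\<^bsub>quotient_module M H\<^esub> (H +>\<^bsub>M\<^esub> y)"
    and quotient_module_smult: "\<And>a x. a \<in> carrier R \<Longrightarrow> x \<in> carrier M \<Longrightarrow>
      H +>\<^bsub>M\<^esub> (a \<odot>\<^bsub>M\<^esub> x) = a \<odot>\<^bsub>quotient_module M H\<^esub> (H +>\<^bsub>M\<^esub> x)"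
    and quotient_module_zero_iff: "\<And>x. x \<in> carrier M \<Longrightarrow> H +>\<^bsub>M\<^esub> x = H \<longleftrightarrow> x \<in> H"
    and quotient_module_proj: "(\<lambda>x. H +>\<^bsub>M\<^esub> x) \<in> module_hom R M (quotient_module M H)"
    and module_quotient: "module R (quotient_module M H)"
proof -
  interpret module R M by fact
  note HD = submoduleD[OF assms(2)]
  have sg: "subgroup H (add_monoid M)" using submodule.axioms(1)[OF assms(2)] .
  interpret H: abelian_subgroup H M
    by (rule abelian_subgroupI3) (auto intro: additive_subgroupI sg M.abelian_group_axioms)
  show add: "H +>\<^bsub>M\<^esub> (x \<oplus>\<^bsub>M\<^esub> y) = (H +>\<^bsub>M\<^esub> x) \<oplus>\<^bsub>quotient_module M H\<^esub> (H +>\<^bsub>M\<^esub> y)"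
    if "x \<in> carrier M" "y \<in> carrier M" for x y
    using H.a_rcos_sum[OF that] by (simp add: quotient_module_def)
  show smult: "H +>\<^bsub>M\<^esub> (a \<odot>\<^bsub>M\<^esub> x) = a \<odot>\<^bsub>quotient_module M H\<^esub> (H +>\<^bsub>M\<^esub> x)"
    if a: "a \<in> carrier R" and x: "x \<in> carrier M" for a x
  proof -
    \<comment> \<open>The multiples by \<open>a\<close> of a coset may form a proper subset of a
      coset, as for \<open>a\<close> zero. Adding \<open>H\<close>, as the definition does, fills it
      up.\<close>
    have "H <+>\<^bsub>M\<^esub> ((\<lambda>x. a \<odot>\<^bsub>M\<^esub> x) ` (H +>\<^bsub>M\<^esub> x)) = H +>\<^bsub>M\<^esub> (a \<odot>\<^bsub>M\<^esub> x)"
    proof (intro equalityI subsetI)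
      fix y assume "y \<in> H <+>\<^bsub>M\<^esub> ((\<lambda>x. a \<odot>\<^bsub>M\<^esub> x) ` (H +>\<^bsub>M\<^esub> x))"
      then obtain h h' where h: "h \<in> H" "h' \<in> H" "y = h \<oplus>\<^bsub>M\<^esub> a \<odot>\<^bsub>M\<^esub> (h' \<oplus>\<^bsub>M\<^esub> x)"
        by (auto simp: set_add_def' a_r_coset_def')
      then have "y = (h \<oplus>\<^bsub>M\<^esub> a \<odot>\<^bsub>M\<^esub> h') \<oplus>\<^bsub>M\<^esub> a \<odot>\<^bsub>M\<^esub> x"
        using a x HD(1) by (simp add: smult_r_distr M.a_assoc)
      then show "y \<in> H +>\<^bsub>M\<^esub> (a \<odot>\<^bsub>M\<^esub> x)" using h HD(3,6) a by (auto simp: a_r_coset_def')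
    next
      fix y assume "y \<in> H +>\<^bsub>M\<^esub> (a \<odot>\<^bsub>M\<^esub> x)"
      then obtain h where h: "h \<in> H" "y = h \<oplus>\<^bsub>M\<^esub> a \<odot>\<^bsub>M\<^esub> x" by (auto simp: a_r_coset_def')
      moreover have "x \<in> H +>\<^bsub>M\<^esub> x" using H.a_rcos_self[OF x] .
      ultimately show "y \<in> H <+>\<^bsub>M\<^esub> ((\<lambda>x. a \<odot>\<^bsub>M\<^esub> x) ` (H +>\<^bsub>M\<^esub> x))" by (auto simp: set_add_def')
    qed
    then show ?thesis by (simp add: quotient_module_def)
  qed
  show zero: "H +>\<^bsub>M\<^esub> x = H \<longleftrightarrow> x \<in> H" if "x \<in> carrier M" for x
    using H.a_rcos_self[OF that] H.a_rcos_const[of x] by auto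
  show "(\<lambda>x. H +>\<^bsub>M\<^esub> x) \<in> module_hom R M (quotient_module M H)"
    by (intro module_homI) (auto simp: add smult quotient_module_simps)
  show "module R (quotient_module M H)"
    by (rule module_surj_image[OF assms(1), of "\<lambda>x. H +>\<^bsub>M\<^esub> x"])
       (use HD(2) in \<open>auto simp: add smult zero quotient_module_simps\<close>)
qed

text \<open>The value at a coset is read off a chosen representative; two representatives differ by
  an element of \<open>H\<close>, which \<open>f\<close> kills.\<close>

lemma quotient_module_induced_hom:
  assumes "module R M" "submodule H R M" "module R N" and f: "f \<in> module_hom R M N"
    and H: "\<And>x. x \<in> H \<Longrightarrow> f x = \<zero>\<^bsub>N\<^esub>"
  obtains g where "g \<in> module_hom R (quotient_module M H) N"
    "\<And>x. x \<in> carrier M \<Longrightarrow> g (H +>\<^bsub>M\<^esub> x) = f x"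
proof -
  interpret M: module R M by fact
  interpret N: module R N by fact
  let ?Q = "quotient_module M H"
  note HD = M.submoduleD[OF assms(2)]
  note fD = module_homD[OF f]
  have sg: "subgroup H (add_monoid M)" using submodule.axioms(1)[OF assms(2)] .
  interpret H: abelian_subgroup H M
    by (rule abelian_subgroupI3) (auto intro: additive_subgroupI sg M.abelian_group_axioms)
  define g where "g C = f (SOME x. x \<in> C)" for C
  have g: "g (H +>\<^bsub>M\<^esub> x) = f x" if x: "x \<in> carrier M" for x
  proof -
    have "(SOME y. y \<in> H +>\<^bsub>M\<^esub> x) \<in> H +>\<^bsub>M\<^esub> x" using H.a_rcos_self[OF x] by (rule someI)
    then obtain h where h: "h \<in> H" "(SOME y. y \<in> H +>\<^bsub>M\<^esub> x) = h \<oplus>\<^bsub>M\<^esub> x" by (auto simp: a_r_coset_def')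
    then show ?thesis using fD(2)[OF HD(1)[OF h(1)] x] H[OF h(1)] fD(1)[OF x] by (simp add: g_def)
  qed
  have "g \<in> module_hom R ?Q N"
  proof (rule module_homI)
    fix p assume "p \<in> carrier ?Q"
    then obtain x where x: "x \<in> carrier M" "p = H +>\<^bsub>M\<^esub> x" by (auto simp: quotient_module_simps)
    then show "g p \<in> carrier N" using g fD(1) by simp
    fix a assume a: "a \<in> carrier R"
    show "g (a \<odot>\<^bsub>?Q\<^esub> p) = a \<odot>\<^bsub>N\<^esub> g p"
      using x a g fD(3) by (simp add: quotient_module_smult[OF assms(1,2), symmetric])
  next
    fix p q assume "p \<in> carrier ?Q" "q \<in> carrier ?Q"
    then obtain x y where x: "x \<in> carrier M" "p = H +>\<^bsub>M\<^esub> x" and y: "y \<in> carrier M" "q = H +>\<^bsub>M\<^esub> y"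
      by (auto simp: quotient_module_simps)
    then show "g (p \<oplus>\<^bsub>?Q\<^esub> q) = g p \<oplus>\<^bsub>N\<^esub> g q"
      using g fD(2) by (simp add: quotient_module_add[OF assms(1,2), symmetric])
  qed
  then show thesis using that g by blast
qed

lemma
  assumes "module R M" "module R N" "f \<in> module_hom R M N"
  shows submodule_kernel: "submodule {x \<in> carrier M. f x = \<zero>\<^bsub>N\<^esub>} R M"
    and submodule_image: "submodule (f ` carrier M) R N"
proof -
  interpret M: module R M by fact
  interpret N: module R N by fact
  note f = module_homD[OF assms(3)] and f0 = module_hom_zero[OF assms]
  have fm: "f (\<ominus>\<^bsub>M\<^esub> x) = \<ominus>\<^bsub>N\<^esub> f x" if "x \<in> carrier M" for x
    using module_hom_minus'[OF assms, of "\<zero>\<^bsub>M\<^esub>" x] that f0 f(1)[OF that] by (simp add: a_minus_def)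
  show "submodule {x \<in> carrier M. f x = \<zero>\<^bsub>N\<^esub>} R M"
    by (rule M.submoduleI) (auto simp: f f0 fm)
  show "submodule (f ` carrier M) R N"
  proof (rule N.submoduleI)
    show "\<zero>\<^bsub>N\<^esub> \<in> f ` carrier M" using f0 by (metis M.zero_closed imageI)
    show "\<ominus>\<^bsub>N\<^esub> a \<in> f ` carrier M" if "a \<in> f ` carrier M" for a
      using that by (auto simp: fm[symmetric])
    show "a \<oplus>\<^bsub>N\<^esub> b \<in> f ` carrier M" if "a \<in> f ` carrier M" "b \<in> f ` carrier M" for a b
      using that by (auto simp: f(2)[symmetric])
    show "a \<odot>\<^bsub>N\<^esub> x \<in> f ` carrier M" if "a \<in> carrier R" "x \<in> f ` carrier M" for a x
      using that by (auto simp: f(3)[symmetric])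
  qed (auto simp: f)
qed

lemma chain_complexD:
  assumes "chain_complex R X"
  shows "module R (cobj X i)" "cdiff X i \<in> module_hom R (cobj X i) (cobj X (i - 1))"
    "cdiff X (i + 1) \<in> module_hom R (cobj X (i + 1)) (cobj X i)"
    "x \<in> carrier (cobj X i) \<Longrightarrow> cdiff X (i - 1) (cdiff X i x) = \<zero>\<^bsub>cobj X (i - 2)\<^esub>"
    "x \<in> carrier (cobj X (i + 1)) \<Longrightarrow> cdiff X i (cdiff X (i + 1) x) = \<zero>\<^bsub>cobj X (i - 1)\<^esub>"
proof -
  have "\<forall>i. module R (cobj X i) \<and> cdiff X i \<in> module_hom R (cobj X i) (cobj X (i - 1)) \<and>
      (\<forall>x\<in>carrier (cobj X i). cdiff X (i - 1) (cdiff X i x) = \<zero>\<^bsub>cobj X (i - 2)\<^esub>)"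
    using assms by (simp add: chain_complex_def)
  note * = spec[OF this, of i] spec[OF this, of "i + 1"]
  show "module R (cobj X i)" "cdiff X i \<in> module_hom R (cobj X i) (cobj X (i - 1))"
    "cdiff X (i + 1) \<in> module_hom R (cobj X (i + 1)) (cobj X i)"
    "x \<in> carrier (cobj X i) \<Longrightarrow> cdiff X (i - 1) (cdiff X i x) = \<zero>\<^bsub>cobj X (i - 2)\<^esub>"
    "x \<in> carrier (cobj X (i + 1)) \<Longrightarrow> cdiff X i (cdiff X (i + 1) x) = \<zero>\<^bsub>cobj X (i - 1)\<^esub>"
    using * by (simp_all)
qed

lemma
  assumes "chain_complex R X"
  shows submodule_cycles: "submodule (cycles X i) R (cobj X i)"
    and submodule_boundaries: "submodule (boundaries X i) R (cobj X i)"
    and boundaries_subset_cycles: "boundaries X i \<subseteq> cycles X i"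
proof -
  note C = chain_complexD[OF assms]
  show "submodule (cycles X i) R (cobj X i)"
    unfolding cycles_def by (rule submodule_kernel[OF C(1) C(1) C(2)])
  show "submodule (boundaries X i) R (cobj X i)"
    unfolding boundaries_def by (rule submodule_image[OF C(1) C(1) C(3)])
  show "boundaries X i \<subseteq> cycles X i"
    unfolding boundaries_def cycles_def using C(5)[of _ i] module_homD(1)[OF C(3)[of i]] by auto
qed

lemma submodule_in_submodule:
  assumes "module R M" "submodule A R M" "submodule B R M" "B \<subseteq> A"
  shows "submodule B R (M\<lparr>carrier := A\<rparr>)"
proof -
  have "module R (M\<lparr>carrier := A\<rparr>)" by (rule submodule.submodule_is_module[OF assms(2,1)])
  moreover have "module R (M\<lparr>carrier := B\<rparr>)" by (rule submodule.submodule_is_module[OF assms(3,1)])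
  ultimately show ?thesis using assms(4) by (intro module.module_incl_imp_submodule) auto
qed

text \<open>From here on vanishing of homology is a statement about elements of the complex, without
  cosets.\<close>

lemma zero_homology_iff:
  assumes "chain_complex R X"
  shows "zero_module (homology X i) \<longleftrightarrow> cycles X i \<subseteq> boundaries X i"
proof -
  let ?Z = "cobj X i\<lparr>carrier := cycles X i\<rparr>"
  note C = chain_complexD[OF assms]
  have Z: "module R ?Z" by (rule submodule.submodule_is_module[OF submodule_cycles[OF assms] C(1)])
  have B: "submodule (boundaries X i) R ?Z"
    by (rule submodule_in_submodule[OF C(1) submodule_cycles submodule_boundaries boundaries_subset_cycles]) fact+
  have *: "carrier (homology X i) = (\<lambda>x. boundaries X i +>\<^bsub>?Z\<^esub> x) ` cycles X i"
    by (simp add: homology_def quotient_module_simps)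
  have ne: "cycles X i \<noteq> {}"
    using module.submoduleD(2)[OF C(1) submodule_cycles[OF assms]] by auto
  have "zero_module (homology X i) \<longleftrightarrow> (\<forall>x\<in>cycles X i. boundaries X i +>\<^bsub>?Z\<^esub> x = boundaries X i)"
    unfolding zero_module_def * using ne by (auto simp: homology_def quotient_module_simps)
  also have "\<dots> \<longleftrightarrow> cycles X i \<subseteq> boundaries X i"
    using quotient_module_zero_iff[OF Z B] by auto
  finally show ?thesis .
qed

section \<open>Modules of homomorphisms\<close>

lemma hom_module_simps:
  "carrier (hom_module R M N) = module_hom R M N \<inter> extensional (carrier M)"
  "\<zero>\<^bsub>hom_module R M N\<^esub> = (\<lambda>x\<in>carrier M. \<zero>\<^bsub>N\<^esub>)"
  "f \<oplus>\<^bsub>hom_module R M N\<^esub> g = (\<lambda>x\<in>carrier M. f x \<oplus>\<^bsub>N\<^esub> g x)"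
  "a \<odot>\<^bsub>hom_module R M N\<^esub> f = (\<lambda>x\<in>carrier M. a \<odot>\<^bsub>N\<^esub> f x)"
  by (simp_all add: hom_module_def)

lemma restrict_module_hom:
  assumes "module R M" "f \<in> module_hom R M N"
  shows "restrict f (carrier M) \<in> carrier (hom_module R M N)"
proof -
  interpret module R M by fact
  show ?thesis using module_homD[OF assms(2)]
    by (auto simp: hom_module_simps intro!: module_homI)
qed

text \<open>Extensional maps are determined by their values on the carrier, so each axiom reduces to
  the same axiom of \<open>N\<close> at a point.\<close>

lemma module_hom_module:
  assumes "module R M" "module R N"
  shows "module R (hom_module R M N)"
proof -
  interpret M: module R M by fact
  interpret N: module R N by fact
  let ?H = "hom_module R M N"
  have mem: "f \<in> module_hom R M N" if "f \<in> carrier ?H" for f using that by (simp add: hom_module_simps)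
  have cl: "f x \<in> carrier N" if "f \<in> carrier ?H" "x \<in> carrier M" for f x
    using module_homD(1)[OF mem[OF that(1)] that(2)] .
  have ext: "f = g" if "f \<in> carrier ?H" "g \<in> carrier ?H" "\<And>x. x \<in> carrier M \<Longrightarrow> f x = g x" for f g
    using that by (intro extensionalityI[of f "carrier M" g]) (auto simp: hom_module_simps)
  have add: "f \<oplus>\<^bsub>?H\<^esub> g \<in> carrier ?H" if "f \<in> carrier ?H" "g \<in> carrier ?H" for f g
    using restrict_module_hom[OF assms(1) module_hom_add_hom[OF assms(2) mem[OF that(1)] mem[OF that(2)]]]
    by (simp add: hom_module_simps)
  have smult_hom: "(\<lambda>x. a \<odot>\<^bsub>N\<^esub> f x) \<in> module_hom R M N" if "a \<in> carrier R" "f \<in> module_hom R M N" for a f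
    using module_homD[OF that(2)] that(1)
    by (intro module_homI) (auto simp: N.smult_r_distr N.smult_assoc1[symmetric] M.m_comm)
  have smult: "a \<odot>\<^bsub>?H\<^esub> f \<in> carrier ?H" if "a \<in> carrier R" "f \<in> carrier ?H" for a f
    using restrict_module_hom[OF assms(1) smult_hom[OF that(1) mem[OF that(2)]]]
    by (simp add: hom_module_simps)
  have zero: "\<zero>\<^bsub>?H\<^esub> \<in> carrier ?H"
    using restrict_module_hom[OF assms(1), of "\<lambda>_. \<zero>\<^bsub>N\<^esub>" N] by (simp add: hom_module_simps module_homI)
  show ?thesis
  proof (rule moduleI)
    show "abelian_group ?H"
    proof (rule abelian_groupI)
      fix f assume f: "f \<in> carrier ?H"
      have "restrict (\<lambda>x. \<zero>\<^bsub>N\<^esub> \<ominus>\<^bsub>N\<^esub> f x) (carrier M) \<in> carrier ?H"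
        using mem[OF f] by (intro restrict_module_hom assms module_hom_minus_hom) (auto intro: module_homI)
      then show "\<exists>g\<in>carrier ?H. g \<oplus>\<^bsub>?H\<^esub> f = \<zero>\<^bsub>?H\<^esub>"
        by (rule bexI[rotated]) (auto simp: hom_module_simps a_minus_def N.l_neg cl[OF f] intro!: restrict_ext)
      show "\<zero>\<^bsub>?H\<^esub> \<oplus>\<^bsub>?H\<^esub> f = f"
        by (rule ext[OF add[OF zero f] f]) (simp add: hom_module_simps cl[OF f])
      fix g assume g: "g \<in> carrier ?H"
      show "f \<oplus>\<^bsub>?H\<^esub> g = g \<oplus>\<^bsub>?H\<^esub> f"
        by (rule ext[OF add[OF f g] add[OF g f]]) (simp add: hom_module_simps cl[OF f] cl[OF g] N.a_comm)
      fix h assume h: "h \<in> carrier ?H"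
      show "f \<oplus>\<^bsub>?H\<^esub> g \<oplus>\<^bsub>?H\<^esub> h = f \<oplus>\<^bsub>?H\<^esub> (g \<oplus>\<^bsub>?H\<^esub> h)"
        by (rule ext[OF add[OF add[OF f g] h] add[OF f add[OF g h]]])
           (simp add: hom_module_simps cl[OF f] cl[OF g] cl[OF h] N.a_assoc)
    qed (rule add zero | assumption)+
  next
    fix a f g assume a: "a \<in> carrier R" and f: "f \<in> carrier ?H" and g: "g \<in> carrier ?H"
    show "a \<odot>\<^bsub>?H\<^esub> (f \<oplus>\<^bsub>?H\<^esub> g) = a \<odot>\<^bsub>?H\<^esub> f \<oplus>\<^bsub>?H\<^esub> a \<odot>\<^bsub>?H\<^esub> g"
      by (rule ext[OF smult[OF a add[OF f g]] add[OF smult[OF a f] smult[OF a g]]])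
         (simp add: hom_module_simps cl[OF f] cl[OF g] a N.smult_r_distr)
  next
    fix a b f assume ab: "a \<in> carrier R" "b \<in> carrier R" and f: "f \<in> carrier ?H"
    have ab': "a \<oplus>\<^bsub>R\<^esub> b \<in> carrier R" "a \<otimes>\<^bsub>R\<^esub> b \<in> carrier R" using ab by auto
    show "(a \<oplus>\<^bsub>R\<^esub> b) \<odot>\<^bsub>?H\<^esub> f = a \<odot>\<^bsub>?H\<^esub> f \<oplus>\<^bsub>?H\<^esub> b \<odot>\<^bsub>?H\<^esub> f"
      by (rule ext[OF smult[OF ab'(1) f] add[OF smult[OF ab(1) f] smult[OF ab(2) f]]])
         (simp add: hom_module_simps cl[OF f] ab N.smult_l_distr)
    show "(a \<otimes>\<^bsub>R\<^esub> b) \<odot>\<^bsub>?H\<^esub> f = a \<odot>\<^bsub>?H\<^esub> (b \<odot>\<^bsub>?H\<^esub> f)"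
      by (rule ext[OF smult[OF ab'(2) f] smult[OF ab(1) smult[OF ab(2) f]]])
         (simp add: hom_module_simps cl[OF f] ab N.smult_assoc1)
  next
    fix f assume f: "f \<in> carrier ?H"
    show "\<one>\<^bsub>R\<^esub> \<odot>\<^bsub>?H\<^esub> f = f"
      by (rule ext[OF smult[OF _ f] f]) (simp_all add: hom_module_simps cl[OF f])
  qed (rule M.R.cring_axioms smult | assumption)+
qed


section \<open>Cohomology of Hom complexes\<close>

lemma hom_complex_simps:
  "cobj (hom_complex R F N) i = hom_module R (cobj F (- i)) N"
  "cdiff (hom_complex R F N) i f = (\<lambda>x\<in>carrier (cobj F (1 - i)). f (cdiff F (1 - i) x))"
  by (simp_all add: hom_complex_def)

lemma chain_complex_hom_complex:
  assumes "chain_complex R F" "module R N"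
  shows "chain_complex R (hom_complex R F N)"
proof -
  interpret N: module R N by fact
  note F = chain_complexD[OF assms(1)]
  show ?thesis
    unfolding chain_complex_def
  proof (intro allI conjI ballI)
    fix i
    show "module R (cobj (hom_complex R F N) i)"
      unfolding hom_complex_simps by (rule module_hom_module[OF F(1) assms(2)])
    have d: "cdiff F (1 - i) \<in> module_hom R (cobj F (1 - i)) (cobj F (- i))"
      using F(2)[of "1 - i"] by simp
    show "cdiff (hom_complex R F N) i \<in> module_hom R (cobj (hom_complex R F N) i) (cobj (hom_complex R F N) (i - 1))"
    proof (rule module_homI)
      fix f assume f: "f \<in> carrier (cobj (hom_complex R F N) i)"
      then have f': "f \<in> module_hom R (cobj F (- i)) N" by (simp add: hom_complex_simps hom_module_simps)
      show "cdiff (hom_complex R F N) i f \<in> carrier (cobj (hom_complex R F N) (i - 1))"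
        unfolding hom_complex_simps using restrict_module_hom[OF F(1)[of "1 - i"] module_hom_comp[OF d f']]
        by simp
      show "cdiff (hom_complex R F N) i (a \<odot>\<^bsub>cobj (hom_complex R F N) i\<^esub> f) =
          a \<odot>\<^bsub>cobj (hom_complex R F N) (i - 1)\<^esub> cdiff (hom_complex R F N) i f" for a
        using module_homD(1)[OF d] by (auto simp: hom_complex_simps hom_module_simps intro!: restrict_ext)
      show "cdiff (hom_complex R F N) i (f \<oplus>\<^bsub>cobj (hom_complex R F N) i\<^esub> g) =
          cdiff (hom_complex R F N) i f \<oplus>\<^bsub>cobj (hom_complex R F N) (i - 1)\<^esub> cdiff (hom_complex R F N) i g" for g
        using module_homD(1)[OF d] by (auto simp: hom_complex_simps hom_module_simps intro!: restrict_ext)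
    qed
    fix f assume f: "f \<in> carrier (cobj (hom_complex R F N) i)"
    then have f': "f \<in> module_hom R (cobj F (- i)) N" by (simp add: hom_complex_simps hom_module_simps)
    have "f (cdiff F (1 - i) (cdiff F (2 - i) x)) = \<zero>\<^bsub>N\<^esub>" if "x \<in> carrier (cobj F (2 - i))" for x
      using F(4)[of x "2 - i"] that module_hom_zero[OF F(1) assms(2) f'] by simp
    then show "cdiff (hom_complex R F N) (i - 1) (cdiff (hom_complex R F N) i f) = \<zero>\<^bsub>cobj (hom_complex R F N) (i - 2)\<^esub>"
      using module_homD(1)[OF F(2)[of "2 - i"]]
      by (auto simp: hom_complex_simps hom_module_simps intro!: restrict_ext)
  qed
qed

text \<open>Extensionality is discharged here once and for all: maps are restricted to the carrier
  before the definitions apply, so later cocycles may take any values outside it.\<close>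

lemma zero_homology_hom_complex_iff:
  assumes "chain_complex R F" "module R N"
  shows "zero_module (homology (hom_complex R F N) (- i)) \<longleftrightarrow>
    (\<forall>f\<in>module_hom R (cobj F i) N. (\<forall>x\<in>carrier (cobj F (i + 1)). f (cdiff F (i + 1) x) = \<zero>\<^bsub>N\<^esub>) \<longrightarrow>
      (\<exists>g\<in>module_hom R (cobj F (i - 1)) N. \<forall>x\<in>carrier (cobj F i). f x = g (cdiff F i x)))"
    (is "?L \<longleftrightarrow> ?R")
proof -
  note F = chain_complexD[OF assms(1)]
  have d: "cdiff F i x \<in> carrier (cobj F (i - 1))" if "x \<in> carrier (cobj F i)" for x
    using module_homD(1)[OF F(2)] that .
  have d': "cdiff F (i + 1) x \<in> carrier (cobj F i)" if "x \<in> carrier (cobj F (i + 1))" for x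
    using module_homD(1)[OF F(3)] that .
  have "?L \<longleftrightarrow> cycles (hom_complex R F N) (- i) \<subseteq> boundaries (hom_complex R F N) (- i)"
    by (rule zero_homology_iff[OF chain_complex_hom_complex[OF assms]])
  also have "\<dots> \<longleftrightarrow> ?R"
  proof
    assume L: "cycles (hom_complex R F N) (- i) \<subseteq> boundaries (hom_complex R F N) (- i)"
    show ?R
    proof (intro ballI impI)
      fix f assume f: "f \<in> module_hom R (cobj F i) N"
        and z: "\<forall>x\<in>carrier (cobj F (i + 1)). f (cdiff F (i + 1) x) = \<zero>\<^bsub>N\<^esub>"
      have "restrict f (carrier (cobj F i)) \<in> cycles (hom_complex R F N) (- i)"
        using restrict_module_hom[OF F(1) f] z d'
        by (auto simp: cycles_def hom_complex_simps hom_module_simps add.commute intro!: restrict_ext)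
      with L obtain g where g: "g \<in> carrier (hom_module R (cobj F (i - 1)) N)"
        "restrict f (carrier (cobj F i)) = (\<lambda>x\<in>carrier (cobj F i). g (cdiff F i x))"
        by (auto simp: boundaries_def hom_complex_simps)
      show "\<exists>g\<in>module_hom R (cobj F (i - 1)) N. \<forall>x\<in>carrier (cobj F i). f x = g (cdiff F i x)"
      proof (intro bexI[of _ g] ballI)
        fix x assume "x \<in> carrier (cobj F i)"
        then show "f x = g (cdiff F i x)" using fun_cong[OF g(2), of x] by simp
      qed (use g(1) in \<open>simp add: hom_module_simps\<close>)
    qed
  next
    assume Rt: ?R
    show "cycles (hom_complex R F N) (- i) \<subseteq> boundaries (hom_complex R F N) (- i)"
    proof
      fix f assume f: "f \<in> cycles (hom_complex R F N) (- i)"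
      then have f1: "f \<in> module_hom R (cobj F i) N" "f \<in> extensional (carrier (cobj F i))"
        and eq: "(\<lambda>x\<in>carrier (cobj F (i + 1)). f (cdiff F (i + 1) x)) = (\<lambda>x\<in>carrier (cobj F (i + 1)). \<zero>\<^bsub>N\<^esub>)"
        by (auto simp: cycles_def hom_complex_simps hom_module_simps add.commute)
      have "\<forall>x\<in>carrier (cobj F (i + 1)). f (cdiff F (i + 1) x) = \<zero>\<^bsub>N\<^esub>"
      proof
        fix x assume "x \<in> carrier (cobj F (i + 1))"
        then show "f (cdiff F (i + 1) x) = \<zero>\<^bsub>N\<^esub>" using fun_cong[OF eq, of x] by simp
      qed
      from bspec[OF Rt f1(1), THEN mp, OF this]
      obtain g where g: "g \<in> module_hom R (cobj F (i - 1)) N" "\<forall>x\<in>carrier (cobj F i). f x = g (cdiff F i x)"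
        by auto
      have "f = (\<lambda>x\<in>carrier (cobj F i). restrict g (carrier (cobj F (i - 1))) (cdiff F i x))"
        using g(2) f1(2) d by (intro extensionalityI[OF f1(2)]) auto
      then show "f \<in> boundaries (hom_complex R F N) (- i)"
        unfolding boundaries_def using restrict_module_hom[OF F(1) g(1)]
        by (intro image_eqI[where x = "restrict g (carrier (cobj F (i - 1)))"]) (auto simp: hom_complex_simps)
    qed
  qed
  finally show ?thesis .
qed

section \<open>Tensor products\<close>

lemma span_module_minimal: "submodule H R M \<Longrightarrow> S \<subseteq> H \<Longrightarrow> span_module R M S \<subseteq> H"
  and span_module_superset: "S \<subseteq> span_module R M S"
  by (auto simp: span_module_def)

lemma submodule_span:
  assumes "module R M" "S \<subseteq> carrier M"
  shows "submodule (span_module R M S) R M"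
proof -
  interpret M: module R M by fact
  show ?thesis
  proof (rule M.submoduleI)
    show "span_module R M S \<subseteq> carrier M"
      using span_module_minimal[OF M.carrier_is_submodule assms(2)] .
  qed (auto simp: span_module_def M.submoduleD)
qed

definition bilinear_map ::
  "('a, 'r) ring_scheme \<Rightarrow> ('a, 'b) module \<Rightarrow> ('a, 'c) module \<Rightarrow> ('a, 'd) module \<Rightarrow> ('b \<Rightarrow> 'c \<Rightarrow> 'd) \<Rightarrow> bool" where
  "bilinear_map R M N K b \<longleftrightarrow>
    (\<forall>y\<in>carrier N. (\<lambda>x. b x y) \<in> module_hom R M K) \<and> (\<forall>x\<in>carrier M. b x \<in> module_hom R N K)"

lemma tensor_relations_subset:
  assumes "module R M" "module R N"
  shows "tensor_relations R M N \<subseteq> carrier (free_module R (carrier M \<times> carrier N))"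
proof -
  interpret M: module R M by fact
  interpret N: module R N by fact
  interpret F: module R "free_module R (carrier M \<times> carrier N)" by (rule M.module_free)
  have u: "x \<in> carrier M \<Longrightarrow> y \<in> carrier N \<Longrightarrow> unit_vector R (x, y) \<in> carrier (free_module R (carrier M \<times> carrier N))" for x y
    by (rule M.unit_vector_closed) simp
  show ?thesis
    unfolding tensor_relations_def Let_def
    by (auto intro!: F.minus_closed F.a_closed F.smult_closed u simp del: free_module_simps)
qed

lemma submodule_tensor_kernel:
  assumes "module R M" "module R N"
  shows "submodule (tensor_kernel R M N) R (free_module R (carrier M \<times> carrier N))"
  unfolding tensor_kernel_def
  by (rule submodule_span[OF cring.module_free[OF module.axioms(1)[OF assms(1)]] tensor_relations_subset[OF assms]])

lemma module_tensor:
  assumes "module R M" "module R N"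
  shows "module R (tensor_module R M N)"
  unfolding tensor_module_def
  by (rule module_quotient[OF cring.module_free[OF module.axioms(1)[OF assms(1)]] submodule_tensor_kernel[OF assms]])

lemma quotient_module_eqI:
  fixes M :: "('a, 'b) module"
  assumes "module R M" "submodule H R M" "x \<in> carrier M" "y \<in> carrier M" "x \<ominus>\<^bsub>M\<^esub> y \<in> H"
  shows "H +>\<^bsub>M\<^esub> x = H +>\<^bsub>M\<^esub> y"
proof -
  interpret M: module R M by fact
  interpret Q: module R "quotient_module M H" by (rule module_quotient) fact+
  note p = quotient_module_proj[OF assms(1,2)]
  have xy: "x \<ominus>\<^bsub>M\<^esub> y \<in> carrier M" using M.minus_closed[OF assms(3,4)] .
  have "(H +>\<^bsub>M\<^esub> x) \<ominus>\<^bsub>quotient_module M H\<^esub> (H +>\<^bsub>M\<^esub> y) = H +>\<^bsub>M\<^esub> (x \<ominus>\<^bsub>M\<^esub> y)"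
    by (rule module_hom_minus'[OF assms(1) Q.module_axioms p assms(3,4), symmetric])
  also have "\<dots> = \<zero>\<^bsub>quotient_module M H\<^esub>"
    unfolding quotient_module_simps(2) using quotient_module_zero_iff[OF assms(1,2) xy] assms(5) by (rule iffD2)
  finally show ?thesis
    by (rule iffD1[OF Q.minus_eq_zero_iff[OF module_homD(1)[OF p assms(3)] module_homD(1)[OF p assms(4)]]])
qed

lemma pure_tensor_bilinear:
  assumes "module R M" "module R N"
  shows "bilinear_map R M N (tensor_module R M N) (pure_tensor R M N)"
proof -
  interpret M: module R M by fact
  interpret N: module R N by fact
  let ?F = "free_module R (carrier M \<times> carrier N)" and ?H = "tensor_kernel R M N" and ?T = "tensor_module R M N"
  let ?e = "\<lambda>x y. unit_vector R (x, y)"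
  interpret F: module R ?F by (rule M.module_free)
  have u: "?e x y \<in> carrier ?F" if "x \<in> carrier M" "y \<in> carrier N" for x y
    by (rule M.unit_vector_closed) (simp add: that)
  have H: "tensor_relations R M N \<subseteq> ?H" unfolding tensor_kernel_def by (rule span_module_superset)
  note sub = submodule_tensor_kernel[OF assms]
  note p = quotient_module_proj[OF F.module_axioms sub]
  have P: "pure_tensor R M N x y = ?H +>\<^bsub>?F\<^esub> ?e x y" for x y by (simp add: pure_tensor_def)
  have T: "quotient_module ?F ?H = ?T" by (simp add: tensor_module_def)
  note eq = quotient_module_eqI[OF F.module_axioms sub]
  note pD = module_homD[OF p, unfolded T]
  have 1: "?e (x \<oplus>\<^bsub>M\<^esub> x') y \<ominus>\<^bsub>?F\<^esub> (?e x y \<oplus>\<^bsub>?F\<^esub> ?e x' y) \<in> ?H" if "x \<in> carrier M" "x' \<in> carrier M" "y \<in> carrier N" for x x' y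
    using that by (intro subsetD[OF H]) (auto simp: tensor_relations_def Let_def simp del: free_module_simps)
  have 2: "?e x (y \<oplus>\<^bsub>N\<^esub> y') \<ominus>\<^bsub>?F\<^esub> (?e x y \<oplus>\<^bsub>?F\<^esub> ?e x y') \<in> ?H" if "x \<in> carrier M" "y \<in> carrier N" "y' \<in> carrier N" for x y y'
    using that by (intro subsetD[OF H]) (auto simp: tensor_relations_def Let_def simp del: free_module_simps)
  have 3: "?e (a \<odot>\<^bsub>M\<^esub> x) y \<ominus>\<^bsub>?F\<^esub> (a \<odot>\<^bsub>?F\<^esub> ?e x y) \<in> ?H" if "x \<in> carrier M" "a \<in> carrier R" "y \<in> carrier N" for x a y
    using that by (intro subsetD[OF H]) (auto simp: tensor_relations_def Let_def simp del: free_module_simps)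
  have 4: "?e x (a \<odot>\<^bsub>N\<^esub> y) \<ominus>\<^bsub>?F\<^esub> (a \<odot>\<^bsub>?F\<^esub> ?e x y) \<in> ?H" if "x \<in> carrier M" "a \<in> carrier R" "y \<in> carrier N" for x a y
    using that by (intro subsetD[OF H]) (auto simp: tensor_relations_def Let_def simp del: free_module_simps)
  show ?thesis
    unfolding bilinear_map_def
  proof (intro conjI ballI module_homI)
    fix x y assume x: "x \<in> carrier M" and y: "y \<in> carrier N"
    show "pure_tensor R M N x y \<in> carrier ?T" "pure_tensor R M N x y \<in> carrier ?T"
      unfolding P using pD(1)[OF u[OF x y]] by auto
    show "pure_tensor R M N (x \<oplus>\<^bsub>M\<^esub> x') y = pure_tensor R M N x y \<oplus>\<^bsub>?T\<^esub> pure_tensor R M N x' y"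
      if x': "x' \<in> carrier M" for x'
      unfolding P pD(2)[OF u[OF x y] u[OF x' y], symmetric]
      by (rule eq) (use x x' y u 1 in \<open>auto simp del: free_module_simps\<close>)
    show "pure_tensor R M N (a \<odot>\<^bsub>M\<^esub> x) y = a \<odot>\<^bsub>?T\<^esub> pure_tensor R M N x y" if a: "a \<in> carrier R" for a
      unfolding P pD(3)[OF a u[OF x y], symmetric]
      by (rule eq) (use x a y u 3 in \<open>auto simp del: free_module_simps\<close>)
    show "pure_tensor R M N x (y \<oplus>\<^bsub>N\<^esub> y') = pure_tensor R M N x y \<oplus>\<^bsub>?T\<^esub> pure_tensor R M N x y'"
      if y': "y' \<in> carrier N" for y'
      unfolding P pD(2)[OF u[OF x y] u[OF x y'], symmetric]
      by (rule eq) (use x y y' u 2 in \<open>auto simp del: free_module_simps\<close>)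
    show "pure_tensor R M N x (a \<odot>\<^bsub>N\<^esub> y) = a \<odot>\<^bsub>?T\<^esub> pure_tensor R M N x y" if a: "a \<in> carrier R" for a
      unfolding P pD(3)[OF a u[OF x y], symmetric]
      by (rule eq) (use x a y u 4 in \<open>auto simp del: free_module_simps\<close>)
  qed
qed

text \<open>Composing with the quotient map from the free module reduces the claim to unit vectors,
  whose images are the pure tensors.\<close>

lemma tensor_hom_eqI:
  assumes "module R M" "module R N" "module R K"
    and h: "h \<in> module_hom R (tensor_module R M N) K" and k: "k \<in> module_hom R (tensor_module R M N) K"
    and eq: "\<And>x y. x \<in> carrier M \<Longrightarrow> y \<in> carrier N \<Longrightarrow> h (pure_tensor R M N x y) = k (pure_tensor R M N x y)"
    and t: "t \<in> carrier (tensor_module R M N)"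
  shows "h t = k t"
proof -
  interpret M: module R M by fact
  let ?F = "free_module R (carrier M \<times> carrier N)" and ?H = "tensor_kernel R M N"
  interpret F: module R ?F by (rule M.module_free)
  have p: "(\<lambda>f. ?H +>\<^bsub>?F\<^esub> f) \<in> module_hom R ?F (tensor_module R M N)"
    unfolding tensor_module_def
    by (rule quotient_module_proj[OF F.module_axioms submodule_tensor_kernel[OF assms(1,2)]])
  obtain f where f: "f \<in> carrier ?F" "t = ?H +>\<^bsub>?F\<^esub> f"
    using t by (auto simp: tensor_module_def quotient_module_simps)
  show ?thesis
    unfolding f(2)
    by (rule free_hom_eqI[OF assms(3) module_hom_comp[OF p h] module_hom_comp[OF p k] _ f(1)])
       (use eq in \<open>auto simp: pure_tensor_def\<close>)
qed

lemma tensor_universal: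
  assumes "module R M" "module R N" "module R K" and b: "bilinear_map R M N K b"
  obtains h where "h \<in> module_hom R (tensor_module R M N) K"
    "\<And>x y. x \<in> carrier M \<Longrightarrow> y \<in> carrier N \<Longrightarrow> h (pure_tensor R M N x y) = b x y"
proof -
  interpret M: module R M by fact
  interpret N: module R N by fact
  interpret K: plain_module R K by (rule plain_module.intro) fact
  let ?F = "free_module R (carrier M \<times> carrier N)" and ?H = "tensor_kernel R M N"
  let ?e = "\<lambda>x y. unit_vector R (x, y)"
  interpret F: module R ?F by (rule M.module_free)
  have b1: "(\<lambda>x. b x y) \<in> module_hom R M K" if "y \<in> carrier N" for y using b that by (simp add: bilinear_map_def)
  have b2: "b x \<in> module_hom R N K" if "x \<in> carrier M" for x using b that by (simp add: bilinear_map_def)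
  have u: "?e x y \<in> carrier ?F" if "x \<in> carrier M" "y \<in> carrier N" for x y
    by (rule M.unit_vector_closed) (simp add: that)
  let ?f = "linear_extension R K (\<lambda>(x, y). b x y)"
  have P: "(\<lambda>(x, y). b x y) \<in> carrier M \<times> carrier N \<rightarrow> carrier K" using module_homD(1)[OF b2] by auto
  have f: "?f \<in> module_hom R ?F K" by (rule K.linear_extension_hom[OF P])
  have fe: "?f (?e x y) = b x y" if "x \<in> carrier M" "y \<in> carrier N" for x y
    using K.linear_extension_unit[OF _ P, of "(x, y)"] that by simp
  note fD = module_homD[OF f] and fm = module_hom_minus'[OF F.module_axioms K.module_axioms f]
  have bc: "b x y \<in> carrier K" if "x \<in> carrier M" "y \<in> carrier N" for x y
    using module_homD(1)[OF b2[OF that(1)] that(2)] .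
  \<comment> \<open>The four cases are the four families of relations; each is killed by one half of
    bilinearity.\<close>
  have rel: "?f v = \<zero>\<^bsub>K\<^esub>" if "v \<in> tensor_relations R M N" for v
    using that unfolding tensor_relations_def Let_def
  proof (elim UnE CollectE exE conjE, goal_cases)
    case (1 x x' y)
    then show ?case
      using module_homD(2)[OF b1[of y]] by (simp add: fm fD fe u bc del: free_module_simps)
  next
    case (2 x y y')
    then show ?case
      using module_homD(2)[OF b2[of x]] by (simp add: fm fD fe u bc del: free_module_simps)
  next
    case (3 a x y)
    then show ?case
      using module_homD(3)[OF b1[of y]] by (simp add: fm fD fe u bc del: free_module_simps)
  next
    case (4 a x y)
    then show ?case
      using module_homD(3)[OF b2[of x]] by (simp add: fm fD fe u bc del: free_module_simps)
  qed
  have "?H \<subseteq> {v \<in> carrier ?F. ?f v = \<zero>\<^bsub>K\<^esub>}"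
    unfolding tensor_kernel_def
    by (rule span_module_minimal[OF submodule_kernel[OF F.module_axioms K.module_axioms f]])
       (use rel tensor_relations_subset[OF assms(1,2)] in auto)
  then have ker: "?f v = \<zero>\<^bsub>K\<^esub>" if "v \<in> ?H" for v using that by auto
  obtain g where g: "g \<in> module_hom R (quotient_module ?F ?H) K"
    "\<And>x. x \<in> carrier ?F \<Longrightarrow> g (?H +>\<^bsub>?F\<^esub> x) = ?f x"
    by (rule quotient_module_induced_hom[OF F.module_axioms submodule_tensor_kernel[OF assms(1,2)] K.module_axioms f ker])
       (assumption, rule that)
  show thesis
    by (rule that[of g]) (use g u fe in \<open>auto simp: tensor_module_def pure_tensor_def\<close>)
qed

lemma pure_tensor_hom:
  assumes "module R M" "module R N"
  shows "y \<in> carrier N \<Longrightarrow> (\<lambda>x. pure_tensor R M N x y) \<in> module_hom R M (tensor_module R M N)"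
    and "x \<in> carrier M \<Longrightarrow> pure_tensor R M N x \<in> module_hom R N (tensor_module R M N)"
  using pure_tensor_bilinear[OF assms] by (simp_all add: bilinear_map_def)

lemma pure_tensor_closed:
  assumes "module R M" "module R N" "x \<in> carrier M" "y \<in> carrier N"
  shows "pure_tensor R M N x y \<in> carrier (tensor_module R M N)"
  by (rule module_homD(1)[OF pure_tensor_hom(1)[OF assms(1,2,4)] assms(3)])

lemma
  assumes "module R M" "module R M'" "module R N" and f: "f \<in> module_hom R M M'"
  shows tensor_map_hom: "tensor_map R M M' N f \<in> module_hom R (tensor_module R M N) (tensor_module R M' N)"
    and tensor_map_pure: "\<And>x y. x \<in> carrier M \<Longrightarrow> y \<in> carrier N \<Longrightarrow>
      tensor_map R M M' N f (pure_tensor R M N x y) = pure_tensor R M' N (f x) y"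
proof -
  let ?T = "tensor_module R M N" and ?T' = "tensor_module R M' N"
  note mT = module_tensor[OF assms(1,3)] and mT' = module_tensor[OF assms(2,3)]
  have "bilinear_map R M N ?T' (\<lambda>x y. pure_tensor R M' N (f x) y)"
    unfolding bilinear_map_def
  proof (intro conjI ballI)
    fix y assume "y \<in> carrier N"
    then show "(\<lambda>x. pure_tensor R M' N (f x) y) \<in> module_hom R M ?T'"
      by (rule module_hom_comp[OF f pure_tensor_hom(1)[OF assms(2,3)]])
  next
    fix x assume "x \<in> carrier M"
    then show "pure_tensor R M' N (f x) \<in> module_hom R N ?T'"
      by (rule pure_tensor_hom(2)[OF assms(2,3) module_homD(1)[OF f]])
  qed
  then obtain h where h: "h \<in> module_hom R ?T ?T'"
    "\<And>x y. x \<in> carrier M \<Longrightarrow> y \<in> carrier N \<Longrightarrow> h (pure_tensor R M N x y) = pure_tensor R M' N (f x) y"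
    by (rule tensor_universal[OF assms(1,3) mT']) (rule that)
  define P where "P k \<longleftrightarrow> k \<in> carrier (hom_module R ?T ?T') \<and>
    (\<forall>x\<in>carrier M. \<forall>y\<in>carrier N. k (pure_tensor R M N x y) = pure_tensor R M' N (f x) y)" for k
  have ex: "P (restrict h (carrier ?T))"
    unfolding P_def using restrict_module_hom[OF mT h(1)] h(2) pure_tensor_closed[OF assms(1,3)] by simp
  \<comment> \<open>\<open>tensor_map\<close> is defined by \<open>THE\<close>, so uniqueness is
    needed on the whole type: pure tensors determine the values on the carrier, extensionality those
    outside.\<close>
  have uniq: "k = k'" if k: "P k" and k': "P k'" for k k'
  proof (rule extensionalityI[of k "carrier ?T" k'])
    fix t assume t: "t \<in> carrier ?T"
    have "k \<in> module_hom R ?T ?T'" "k' \<in> module_hom R ?T ?T'"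
      using k k' by (simp_all add: P_def hom_module_simps)
    then show "k t = k' t"
      by (rule tensor_hom_eqI[OF assms(1,3) mT' _ _ _ t]) (use k k' in \<open>simp add: P_def\<close>)
  qed (use k k' in \<open>simp_all add: P_def hom_module_simps\<close>)
  have "P (THE k. P k)" by (rule theI[of P, OF ex]) (rule uniq[OF _ ex])
  also have "(THE k. P k) = tensor_map R M M' N f"
    unfolding tensor_map_def P_def ..
  finally have "P (tensor_map R M M' N f)" .
  then show "tensor_map R M M' N f \<in> module_hom R ?T ?T'"
    "\<And>x y. x \<in> carrier M \<Longrightarrow> y \<in> carrier N \<Longrightarrow>
      tensor_map R M M' N f (pure_tensor R M N x y) = pure_tensor R M' N (f x) y"
    by (simp_all add: P_def hom_module_simps)
qed


text \<open>Every identity compares two homomorphisms out of a tensor product and is checked on pure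
  tensors.\<close>

lemma
  assumes "module R M" "module R M'" "module R N"
  shows tensor_map_comp: "\<And>M'' f g t. module R M'' \<Longrightarrow> f \<in> module_hom R M M' \<Longrightarrow> g \<in> module_hom R M' M'' \<Longrightarrow>
      t \<in> carrier (tensor_module R M N) \<Longrightarrow>
      tensor_map R M' M'' N g (tensor_map R M M' N f t) = tensor_map R M M'' N (\<lambda>x. g (f x)) t"
    and tensor_map_add: "\<And>f g t. f \<in> module_hom R M M' \<Longrightarrow> g \<in> module_hom R M M' \<Longrightarrow>
      t \<in> carrier (tensor_module R M N) \<Longrightarrow>
      tensor_map R M M' N (\<lambda>x. f x \<oplus>\<^bsub>M'\<^esub> g x) t = tensor_map R M M' N f t \<oplus>\<^bsub>tensor_module R M' N\<^esub> tensor_map R M M' N g t"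
    and tensor_map_cong: "\<And>f g t. f \<in> module_hom R M M' \<Longrightarrow> g \<in> module_hom R M M' \<Longrightarrow>
      (\<And>x. x \<in> carrier M \<Longrightarrow> f x = g x) \<Longrightarrow> t \<in> carrier (tensor_module R M N) \<Longrightarrow>
      tensor_map R M M' N f t = tensor_map R M M' N g t"
    and tensor_map_zero: "\<And>f t. f \<in> module_hom R M M' \<Longrightarrow> (\<And>x. x \<in> carrier M \<Longrightarrow> f x = \<zero>\<^bsub>M'\<^esub>) \<Longrightarrow>
      t \<in> carrier (tensor_module R M N) \<Longrightarrow> tensor_map R M M' N f t = \<zero>\<^bsub>tensor_module R M' N\<^esub>"
    and tensor_map_id: "\<And>t. t \<in> carrier (tensor_module R M N) \<Longrightarrow> tensor_map R M M N (\<lambda>x. x) t = t"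
proof -
  let ?T = "tensor_module R M N" and ?T' = "tensor_module R M' N"
  interpret T': module R ?T' by (rule module_tensor[OF assms(2,3)])
  note mT = module_tensor[OF assms(1,3)] and mT' = T'.module_axioms
  note hom = tensor_map_hom[OF assms] and pure = tensor_map_pure[OF assms]
  { fix M'' f g t assume M'': "module R M''" and f: "f \<in> module_hom R M M'" and g: "g \<in> module_hom R M' M''"
      and t: "t \<in> carrier ?T"
    show "tensor_map R M' M'' N g (tensor_map R M M' N f t) = tensor_map R M M'' N (\<lambda>x. g (f x)) t"
      by (rule tensor_hom_eqI[OF assms(1,3) module_tensor[OF M'' assms(3)]
            module_hom_comp[OF hom[OF f] tensor_map_hom[OF assms(2) M'' assms(3) g]]
            tensor_map_hom[OF assms(1) M'' assms(3) module_hom_comp[OF f g]] _ t])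
         (simp add: pure[OF f] tensor_map_pure[OF assms(2) M'' assms(3) g] module_homD(1)[OF f]
            tensor_map_pure[OF assms(1) M'' assms(3) module_hom_comp[OF f g]]) }
  { fix f g t assume f: "f \<in> module_hom R M M'" and g: "g \<in> module_hom R M M'" and t: "t \<in> carrier ?T"
    note fg = module_hom_add_hom[OF assms(2) f g]
    show "tensor_map R M M' N (\<lambda>x. f x \<oplus>\<^bsub>M'\<^esub> g x) t = tensor_map R M M' N f t \<oplus>\<^bsub>?T'\<^esub> tensor_map R M M' N g t"
      by (rule tensor_hom_eqI[OF assms(1,3) mT' hom[OF fg] module_hom_add_hom[OF mT' hom[OF f] hom[OF g]] _ t])
         (simp add: pure[OF f] pure[OF g] pure[OF fg] module_homD(1)[OF f] module_homD(1)[OF g]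
            module_homD(2)[OF pure_tensor_hom(1)[OF assms(2,3)]])
    assume eq: "\<And>x. x \<in> carrier M \<Longrightarrow> f x = g x"
    show "tensor_map R M M' N f t = tensor_map R M M' N g t"
      by (rule tensor_hom_eqI[OF assms(1,3) mT' hom[OF f] hom[OF g] _ t]) (simp add: pure[OF f] pure[OF g] eq) }
  { fix f t assume f: "f \<in> module_hom R M M'" and t: "t \<in> carrier ?T"
      and z: "\<And>x. x \<in> carrier M \<Longrightarrow> f x = \<zero>\<^bsub>M'\<^esub>"
    have z': "(\<lambda>_. \<zero>\<^bsub>?T'\<^esub>) \<in> module_hom R ?T ?T'" by (rule module_homI) auto
    show "tensor_map R M M' N f t = \<zero>\<^bsub>?T'\<^esub>"
      by (rule tensor_hom_eqI[OF assms(1,3) mT' hom[OF f] z' _ t])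
         (simp add: pure[OF f] z module_hom_zero[OF assms(2) mT' pure_tensor_hom(1)[OF assms(2,3)]]) }
  { fix t assume t: "t \<in> carrier ?T"
    show "tensor_map R M M N (\<lambda>x. x) t = t"
      by (rule tensor_hom_eqI[OF assms(1,3) mT tensor_map_hom[OF assms(1,1,3) module_hom_id] module_hom_id _ t])
         (simp add: tensor_map_pure[OF assms(1,1,3) module_hom_id]) }
qed

lemma tensor_complex_simps:
  "cobj (tensor_complex R F N) i = tensor_module R (cobj F i) N"
  "cdiff (tensor_complex R F N) i = tensor_map R (cobj F i) (cobj F (i - 1)) N (cdiff F i)"
  by (simp_all add: tensor_complex_def)

lemma chain_complex_tensor_complex:
  assumes "chain_complex R F" "module R N"
  shows "chain_complex R (tensor_complex R F N)"
  unfolding chain_complex_def tensor_complex_simps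
proof (intro allI conjI ballI)
  note F = chain_complexD[OF assms(1)]
  fix i
  show "module R (tensor_module R (cobj F i) N)" by (rule module_tensor[OF F(1) assms(2)])
  show "tensor_map R (cobj F i) (cobj F (i - 1)) N (cdiff F i)
      \<in> module_hom R (tensor_module R (cobj F i) N) (tensor_module R (cobj F (i - 1)) N)"
    by (rule tensor_map_hom[OF F(1) F(1) assms(2) F(2)])
  fix t assume t: "t \<in> carrier (tensor_module R (cobj F i) N)"
  have d: "cdiff F (i - 1) \<in> module_hom R (cobj F (i - 1)) (cobj F (i - 2))" using F(2)[of "i - 1"] by simp
  show "tensor_map R (cobj F (i - 1)) (cobj F (i - 1 - 1)) N (cdiff F (i - 1))
      (tensor_map R (cobj F i) (cobj F (i - 1)) N (cdiff F i) t) = \<zero>\<^bsub>tensor_module R (cobj F (i - 2)) N\<^esub>"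
    using tensor_map_comp[OF F(1) F(1) assms(2) F(1) F(2) d t]
      tensor_map_zero[OF F(1) F(1) assms(2) module_hom_comp[OF F(2) d] F(4) t] by simp
qed

lemma zero_homology_tensor_complex_iff:
  assumes "chain_complex R F" "module R N"
  shows "zero_module (homology (tensor_complex R F N) i) \<longleftrightarrow>
    (\<forall>t\<in>carrier (tensor_module R (cobj F i) N).
      tensor_map R (cobj F i) (cobj F (i - 1)) N (cdiff F i) t = \<zero>\<^bsub>tensor_module R (cobj F (i - 1)) N\<^esub> \<longrightarrow>
      (\<exists>s\<in>carrier (tensor_module R (cobj F (i + 1)) N).
        tensor_map R (cobj F (i + 1)) (cobj F i) N (cdiff F (i + 1)) s = t))"
  unfolding zero_homology_iff[OF chain_complex_tensor_complex[OF assms]]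
  by (auto simp: cycles_def boundaries_def tensor_complex_simps)

section \<open>Comparison of free resolutions\<close>

lemma left_resolutionD:
  assumes "left_resolution R F e M"
  shows "chain_complex R F" "i < 0 \<Longrightarrow> zero_module (cobj F i)" "e \<in> module_hom R (cobj F 0) M"
    "e ` carrier (cobj F 0) = carrier M"
    "x \<in> carrier (cobj F 0) \<Longrightarrow> e x = \<zero>\<^bsub>M\<^esub> \<Longrightarrow> x \<in> boundaries F 0"
    "x \<in> boundaries F 0 \<Longrightarrow> e x = \<zero>\<^bsub>M\<^esub>"
    "i > 0 \<Longrightarrow> x \<in> cycles F i \<Longrightarrow> x \<in> boundaries F i"
  using assms unfolding left_resolution_def by auto

lemma boundariesI: "x \<in> carrier (cobj F (i + 1)) \<Longrightarrow> cdiff F (i + 1) x \<in> boundaries F i"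
  by (simp add: boundaries_def)

text \<open>Exactness is needed only of \<open>F'\<close>; the source is any complex of free modules
  with an augmentation that kills boundaries. The mapping cone applies this to the negated
  resolution of a kernel.\<close>

lemma comparison_chain_map:
  assumes "cring R" and F: "chain_complex R F" and free: "\<And>i. i \<ge> 0 \<Longrightarrow> cobj F i = free_module R (X i)"
    and low: "\<And>i. i < 0 \<Longrightarrow> zero_module (cobj F i)"
    and F': "left_resolution R F' e' M'" and M': "module R M'"
    and e: "e \<in> module_hom R (cobj F 0) M'" and ed: "\<And>x. x \<in> carrier (cobj F 1) \<Longrightarrow> e (cdiff F 1 x) = \<zero>\<^bsub>M'\<^esub>"
  obtains f where "\<And>i. f i \<in> module_hom R (cobj F i) (cobj F' i)"
    "\<And>i x. x \<in> carrier (cobj F i) \<Longrightarrow> cdiff F' i (f i x) = f (i - 1) (cdiff F i x)"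
    "\<And>x. x \<in> carrier (cobj F 0) \<Longrightarrow> e' (f 0 x) = e x"
proof -
  note FD = chain_complexD[OF F]
  note R' = left_resolutionD[OF F']
  note F'D = chain_complexD[OF R'(1)]
  interpret cring R by fact
  \<comment> \<open>The invariant records that \<open>g\<close> sends boundaries of \<open>F\<close>
    to boundaries of \<open>F'\<close>, which is exactly what permits the next lift.\<close>
  define P where "P n g \<longleftrightarrow> g \<in> module_hom R (cobj F (int n)) (cobj F' (int n)) \<and>
    (\<forall>x\<in>carrier (cobj F (int n + 1)). g (cdiff F (int n + 1) x) \<in> boundaries F' (int n)) \<and>
    (n = 0 \<longrightarrow> (\<forall>x\<in>carrier (cobj F 0). e' (g x) = e x))" for n g
  define Q where "Q n g h \<longleftrightarrow> (\<forall>x\<in>carrier (cobj F (int n + 1)). cdiff F' (int n + 1) (h x) = g (cdiff F (int n + 1) x))" for n g h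
  have base: "\<exists>g. P 0 g"
  proof -
    have F0: "cobj F 0 = free_module R (X 0)" by (simp add: free)
    have u: "e (unit_vector R x) \<in> e' ` carrier (cobj F' 0)" if "x \<in> X 0" for x
      unfolding R'(4) using module_homD(1)[OF e] unit_vector_closed[OF that] F0 by simp
    obtain g where g: "g \<in> module_hom R (free_module R (X 0)) (cobj F' 0)"
      "\<And>f. f \<in> carrier (free_module R (X 0)) \<Longrightarrow> e' (g f) = e f"
      by (rule free_hom_lift[OF F'D(1) M' R'(3) e[unfolded F0] u]) (assumption, rule that)
    have "g (cdiff F 1 x) \<in> boundaries F' 0" if x: "x \<in> carrier (cobj F 1)" for x
    proof -
      have d: "cdiff F 1 x \<in> carrier (free_module R (X 0))" using module_homD(1)[OF FD(3)[of 0]] x F0 by simp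
      show ?thesis by (rule R'(5)) (use g(2)[OF d] ed[OF x] module_homD(1)[OF g(1) d] in auto)
    qed
    then show ?thesis using g F0 by (intro exI[of _ g]) (simp add: P_def)
  qed
  have step: "\<exists>h. P (Suc n) h \<and> Q n g h" if g: "P n g" for n g
  proof -
    let ?i = "int n + 1"
    have Fi: "cobj F ?i = free_module R (X ?i)" by (simp add: free)
    have g1: "g \<in> module_hom R (cobj F (int n)) (cobj F' (int n))"
      and g2: "\<And>x. x \<in> carrier (cobj F ?i) \<Longrightarrow> g (cdiff F ?i x) \<in> boundaries F' (int n)"
      using g by (auto simp: P_def)
    have gd: "(\<lambda>x. g (cdiff F ?i x)) \<in> module_hom R (free_module R (X ?i)) (cobj F' (int n))"
      using module_hom_comp[OF FD(3) g1] Fi by simp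
    have u: "g (cdiff F ?i (unit_vector R x)) \<in> cdiff F' ?i ` carrier (cobj F' ?i)" if "x \<in> X ?i" for x
      using g2[of "unit_vector R x"] unit_vector_closed[OF that] unfolding boundaries_def Fi by simp
    obtain h where h: "h \<in> module_hom R (free_module R (X ?i)) (cobj F' ?i)"
      "\<And>f. f \<in> carrier (free_module R (X ?i)) \<Longrightarrow> cdiff F' ?i (h f) = g (cdiff F ?i f)"
      by (rule free_hom_lift[OF F'D(1) F'D(1) F'D(3) gd u]) (assumption, rule that)
    have "h (cdiff F (?i + 1) x) \<in> boundaries F' ?i" if x: "x \<in> carrier (cobj F (?i + 1))" for x
    proof -
      have d: "cdiff F (?i + 1) x \<in> carrier (free_module R (X ?i))"
        using module_homD(1)[OF FD(3) x] Fi by simp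
      have "cdiff F' ?i (h (cdiff F (?i + 1) x)) = g (cdiff F ?i (cdiff F (?i + 1) x))" using h(2)[OF d] .
      also have "\<dots> = g \<zero>\<^bsub>cobj F (int n)\<^esub>" using FD(5)[OF x] by simp
      also have "\<dots> = \<zero>\<^bsub>cobj F' (int n)\<^esub>" by (rule module_hom_zero[OF FD(1) F'D(1) g1])
      finally have "h (cdiff F (?i + 1) x) \<in> cycles F' ?i"
        using module_homD(1)[OF h(1) d] by (simp add: cycles_def)
      then show ?thesis by (intro R'(7)) auto
    qed
    then have "P (Suc n) h" unfolding P_def using h(1) Fi by (simp add: add.commute)
    moreover have "Q n g h" unfolding Q_def using h(2) Fi by simp
    ultimately show ?thesis by (intro exI conjI)
  qed
  obtain g where g: "\<And>n. P n (g n)" "\<And>n. Q n (g n) (g (Suc n))"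
    using dependent_nat_choice[of P Q, OF base step] by auto
  define f where "f i = (if i < 0 then (\<lambda>_. \<zero>\<^bsub>cobj F' i\<^esub>) else g (nat i))" for i
  have zM: "\<zero>\<^bsub>cobj F' i\<^esub> \<in> carrier (cobj F' i)" for i
    using F'D(1)[of i] by (simp add: module_def abelian_group_def abelian_monoid.zero_closed)
  have fhom: "f i \<in> module_hom R (cobj F i) (cobj F' i)" for i
  proof (cases "i < 0")
    case True
    interpret A: module R "cobj F' i" by (rule F'D(1))
    show ?thesis using True by (auto simp: f_def intro!: module_homI)
  next
    case False
    then show ?thesis using g(1)[of "nat i"] by (simp add: f_def P_def)
  qed
  show thesis
  proof (rule that[of f])
    show "f i \<in> module_hom R (cobj F i) (cobj F' i)" for i by (rule fhom)
    show "e' (f 0 x) = e x" if "x \<in> carrier (cobj F 0)" for x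
      using g(1)[of 0] that by (simp add: f_def P_def)
    fix i x assume x: "x \<in> carrier (cobj F i)"
    have a: "cdiff F' i (f i x) \<in> carrier (cobj F' (i - 1))"
      by (rule module_homD(1)[OF F'D(2) module_homD(1)[OF fhom x]])
    have b: "f (i - 1) (cdiff F i x) \<in> carrier (cobj F' (i - 1))"
      by (rule module_homD(1)[OF fhom module_homD(1)[OF FD(2) x]])
    show "cdiff F' i (f i x) = f (i - 1) (cdiff F i x)"
    proof (cases "i \<le> 0")
      case True
      then have "zero_module (cobj F' (i - 1))" by (intro R'(2)) simp
      then show ?thesis using a b by (simp add: zero_module_def)
    next
      case False
      define n where "n = nat (i - 1)"
      have i: "i = int n + 1" using False by (simp add: n_def)
      have "f i = g (Suc n)" "f (i - 1) = g n" unfolding i by (simp_all add: f_def nat_add_distrib)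
      then show ?thesis using g(2)[of n] x unfolding Q_def i by simp
    qed
  qed
qed

text \<open>Since \<open>e'\<close> kills \<open>u 0\<close>, that map lifts through the first
  differential. Afterwards \<open>u - h d\<close> is a cycle by the homotopy relation one degree
  lower, hence a boundary by exactness of \<open>F'\<close>, and lifts again.\<close>

lemma comparison_homotopy:
  assumes "cring R" and F: "chain_complex R F" and free: "\<And>i. i \<ge> 0 \<Longrightarrow> cobj F i = free_module R (X i)"
    and low: "\<And>i. i < 0 \<Longrightarrow> zero_module (cobj F i)"
    and F': "left_resolution R F' e' M'"
    and u: "\<And>i. u i \<in> module_hom R (cobj F i) (cobj F' i)"
    and ud: "\<And>i x. x \<in> carrier (cobj F i) \<Longrightarrow> cdiff F' i (u i x) = u (i - 1) (cdiff F i x)"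
    and eu: "\<And>x. x \<in> carrier (cobj F 0) \<Longrightarrow> e' (u 0 x) = \<zero>\<^bsub>M'\<^esub>"
  obtains h where "\<And>i. h i \<in> module_hom R (cobj F i) (cobj F' (i + 1))"
    "\<And>i x. x \<in> carrier (cobj F i) \<Longrightarrow>
      u i x = cdiff F' (i + 1) (h i x) \<oplus>\<^bsub>cobj F' i\<^esub> h (i - 1) (cdiff F i x)"
proof -
  note FD = chain_complexD[OF F]
  note R' = left_resolutionD[OF F']
  note F'D = chain_complexD[OF R'(1)]
  interpret cring R by fact
  define P where "P n h \<longleftrightarrow> h \<in> module_hom R (cobj F (int n)) (cobj F' (int n + 1)) \<and>
    (\<forall>x\<in>carrier (cobj F (int n + 1)).
      u (int n + 1) x \<ominus>\<^bsub>cobj F' (int n + 1)\<^esub> h (cdiff F (int n + 1) x) \<in> boundaries F' (int n + 1)) \<and>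
    (n = 0 \<longrightarrow> (\<forall>x\<in>carrier (cobj F 0). cdiff F' 1 (h x) = u 0 x))" for n h
  define Q where "Q n h k \<longleftrightarrow> (\<forall>x\<in>carrier (cobj F (int n + 1)). cdiff F' (int n + 2) (k x) =
      u (int n + 1) x \<ominus>\<^bsub>cobj F' (int n + 1)\<^esub> h (cdiff F (int n + 1) x))" for n h k
  have obstr: "u i x \<ominus>\<^bsub>cobj F' i\<^esub> h (cdiff F i x) \<in> boundaries F' i"
    if i: "i > 0" and x: "x \<in> carrier (cobj F i)" and h: "h \<in> module_hom R (cobj F (i - 1)) (cobj F' i)"
      and hd: "cdiff F' i (h (cdiff F i x)) = u (i - 1) (cdiff F i x)" for i x h
  proof (rule R'(7)[OF i])
    interpret A: module R "cobj F' i" by (rule F'D(1))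
    interpret B: module R "cobj F' (i - 1)" by (rule F'D(1))
    have c: "u i x \<in> carrier (cobj F' i)" "h (cdiff F i x) \<in> carrier (cobj F' i)"
      using module_homD(1)[OF u x] module_homD(1)[OF h module_homD(1)[OF FD(2) x]] by auto
    have "u (i - 1) (cdiff F i x) \<in> carrier (cobj F' (i - 1))"
      by (rule module_homD(1)[OF u module_homD(1)[OF FD(2) x]])
    then show "u i x \<ominus>\<^bsub>cobj F' i\<^esub> h (cdiff F i x) \<in> cycles F' i"
      using c module_hom_minus'[OF F'D(1) F'D(1) F'D(2) c] by (simp add: cycles_def ud[OF x] hd)
  qed
  have base: "\<exists>h. P 0 h"
  proof -
    have F0: "cobj F 0 = free_module R (X 0)" by (simp add: free)
    have b: "u 0 x \<in> boundaries F' 0" if "x \<in> carrier (cobj F 0)" for x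
      by (rule R'(5)[OF module_homD(1)[OF u that] eu[OF that]])
    have v: "u 0 (unit_vector R x) \<in> cdiff F' 1 ` carrier (cobj F' 1)" if "x \<in> X 0" for x
      using b[of "unit_vector R x"] unit_vector_closed[OF that] F0 by (simp add: boundaries_def)
    have d1: "cdiff F' 1 \<in> module_hom R (cobj F' 1) (cobj F' 0)" using F'D(3)[of 0] by simp
    obtain h where h: "h \<in> module_hom R (free_module R (X 0)) (cobj F' 1)"
      "\<And>f. f \<in> carrier (free_module R (X 0)) \<Longrightarrow> cdiff F' 1 (h f) = u 0 f"
      by (rule free_hom_lift[OF F'D(1) F'D(1) d1 u[of 0, unfolded F0] v]) (assumption, rule that)
    have "u 1 x \<ominus>\<^bsub>cobj F' 1\<^esub> h (cdiff F 1 x) \<in> boundaries F' 1" if x: "x \<in> carrier (cobj F 1)" for x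
    proof (rule obstr)
      have "cdiff F 1 x \<in> carrier (cobj F 0)" using module_homD(1)[OF FD(3)[of 0]] x by simp
      then show "cdiff F' 1 (h (cdiff F 1 x)) = u (1 - 1) (cdiff F 1 x)" using h(2) F0 by simp
    qed (use x h F0 in auto)
    then show ?thesis using h F0 by (intro exI[of _ h]) (simp add: P_def)
  qed
  have step: "\<exists>k. P (Suc n) k \<and> Q n h k" if h: "P n h" for n h
  proof -
    let ?i = "int n + 1"
    have Fi: "cobj F ?i = free_module R (X ?i)" by (simp add: free)
    have h1: "h \<in> module_hom R (cobj F (int n)) (cobj F' ?i)"
      and h2: "\<And>x. x \<in> carrier (cobj F ?i) \<Longrightarrow> u ?i x \<ominus>\<^bsub>cobj F' ?i\<^esub> h (cdiff F ?i x) \<in> boundaries F' ?i"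
      using h by (auto simp: P_def)
    interpret A: module R "cobj F' ?i" by (rule F'D(1))
    let ?w = "\<lambda>x. u ?i x \<ominus>\<^bsub>cobj F' ?i\<^esub> h (cdiff F ?i x)"
    have w: "?w \<in> module_hom R (free_module R (X ?i)) (cobj F' ?i)"
      using module_hom_minus_hom[OF F'D(1) u module_hom_comp[OF FD(3) h1]] Fi by simp
    have v: "?w (unit_vector R x) \<in> cdiff F' (?i + 1) ` carrier (cobj F' (?i + 1))" if "x \<in> X ?i" for x
      using h2[of "unit_vector R x"] unit_vector_closed[OF that] unfolding boundaries_def Fi by simp
    obtain k where k: "k \<in> module_hom R (free_module R (X ?i)) (cobj F' (?i + 1))"
      "\<And>f. f \<in> carrier (free_module R (X ?i)) \<Longrightarrow> cdiff F' (?i + 1) (k f) = ?w f"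
      by (rule free_hom_lift[OF F'D(1) F'D(1) F'D(3) w v]) (assumption, rule that)
    have "u (?i + 1) x \<ominus>\<^bsub>cobj F' (?i + 1)\<^esub> k (cdiff F (?i + 1) x) \<in> boundaries F' (?i + 1)"
      if x: "x \<in> carrier (cobj F (?i + 1))" for x
    proof (rule obstr[OF _ x])
      have d: "cdiff F (?i + 1) x \<in> carrier (cobj F ?i)" by (rule module_homD(1)[OF FD(3) x])
      have "h (cdiff F ?i (cdiff F (?i + 1) x)) = \<zero>\<^bsub>cobj F' ?i\<^esub>"
        using FD(5)[OF x] module_hom_zero[OF FD(1) F'D(1) h1] by simp
      then have "?w (cdiff F (?i + 1) x) = u ?i (cdiff F (?i + 1) x)"
        using module_homD(1)[OF u d] by simp
      then have "cdiff F' (?i + 1) (k (cdiff F (?i + 1) x)) = u ?i (cdiff F (?i + 1) x)"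
        using k(2)[of "cdiff F (?i + 1) x"] d Fi by simp
      then show "cdiff F' (?i + 1) (k (cdiff F (?i + 1) x)) = u (?i + 1 - 1) (cdiff F (?i + 1) x)"
        by (simp only: add_diff_cancel_right')
      show "0 < ?i + 1" by simp
      show "k \<in> module_hom R (cobj F (?i + 1 - 1)) (cobj F' (?i + 1))"
        unfolding add_diff_cancel_right' Fi by (rule k(1))
    qed
    then have "P (Suc n) k" unfolding P_def using k(1) Fi by (simp add: add.commute)
    moreover have "Q n h k" unfolding Q_def using k(2) Fi by (simp add: add.assoc)
    ultimately show ?thesis by (intro exI conjI)
  qed
  obtain k where k: "\<And>n. P n (k n)" "\<And>n. Q n (k n) (k (Suc n))"
    using dependent_nat_choice[of P Q, OF base step] by auto
  define h where "h i = (if i < 0 then (\<lambda>_. \<zero>\<^bsub>cobj F' (i + 1)\<^esub>) else k (nat i))" for i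
  have hhom: "h i \<in> module_hom R (cobj F i) (cobj F' (i + 1))" for i
  proof (cases "i < 0")
    case True
    interpret A: module R "cobj F' (i + 1)" by (rule F'D(1))
    show ?thesis using True by (auto simp: h_def intro!: module_homI)
  next
    case False
    then show ?thesis using k(1)[of "nat i"] by (simp add: h_def P_def)
  qed
  show thesis
  proof (rule that[of h])
    show "h i \<in> module_hom R (cobj F i) (cobj F' (i + 1))" for i by (rule hhom)
    fix i x assume x: "x \<in> carrier (cobj F i)"
    interpret A: module R "cobj F' i" by (rule F'D(1))
    have a: "cdiff F' (i + 1) (h i x) \<in> carrier (cobj F' i)"
      by (rule module_homD(1)[OF F'D(3) module_homD(1)[OF hhom x]])
    have b: "h (i - 1) (cdiff F i x) \<in> carrier (cobj F' i)"
      using module_homD(1)[OF hhom module_homD(1)[OF FD(2) x]] by simp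
    have c: "u i x \<in> carrier (cobj F' i)" by (rule module_homD(1)[OF u x])
    consider "i < 0" | "i = 0" | "i > 0" by linarith
    then show "u i x = cdiff F' (i + 1) (h i x) \<oplus>\<^bsub>cobj F' i\<^esub> h (i - 1) (cdiff F i x)"
    proof cases
      case 1
      then have "zero_module (cobj F' i)" by (rule R'(2))
      then show ?thesis using A.a_closed[OF a b] c by (simp add: zero_module_def)
    next
      case 2
      then have "h (i - 1) (cdiff F i x) = \<zero>\<^bsub>cobj F' i\<^esub>" by (simp add: h_def)
      then show ?thesis using k(1)[of 0] x A.r_zero[OF c] 2 by (simp add: h_def P_def)
    next
      case 3
      define n where "n = nat (i - 1)"
      have i: "i = int n + 1" using 3 by (simp add: n_def)
      have hh: "h i = k (Suc n)" "h (i - 1) = k n" unfolding i by (simp_all add: h_def nat_add_distrib)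
      have "cdiff F' (i + 1) (h i x) = u i x \<ominus>\<^bsub>cobj F' i\<^esub> h (i - 1) (cdiff F i x)"
        using k(2)[of n] x unfolding Q_def hh unfolding i by (simp add: add.assoc)
      then show ?thesis using b c by (simp add: a_minus_def A.a_assoc A.l_neg)
    qed
  qed
qed


text \<open>The difference of \<open>g f\<close> and the identity covers zero on \<open>M\<close>,
  so it is null-homotopic. This composite is what transfers vanishing from \<open>F\<close> to
  \<open>F'\<close>; exchanging the two resolutions gives the other direction.\<close>

lemma comparison_equivalence:
  assumes "cring R" "module R M"
    and F: "left_resolution R F e M" and F': "left_resolution R F' e' M"
    and free: "\<And>i. i \<ge> 0 \<Longrightarrow> cobj F i = free_module R (X i)" "\<And>i. i \<ge> 0 \<Longrightarrow> cobj F' i = free_module R (X' i)"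
  obtains f g h where "\<And>i. f i \<in> module_hom R (cobj F' i) (cobj F i)"
    "\<And>i x. x \<in> carrier (cobj F' i) \<Longrightarrow> cdiff F i (f i x) = f (i - 1) (cdiff F' i x)"
    "\<And>i. g i \<in> module_hom R (cobj F i) (cobj F' i)"
    "\<And>i x. x \<in> carrier (cobj F i) \<Longrightarrow> cdiff F' i (g i x) = g (i - 1) (cdiff F i x)"
    "\<And>i. h i \<in> module_hom R (cobj F' i) (cobj F' (i + 1))"
    "\<And>i x. x \<in> carrier (cobj F' i) \<Longrightarrow> g i (f i x) =
      x \<oplus>\<^bsub>cobj F' i\<^esub> (cdiff F' (i + 1) (h i x) \<oplus>\<^bsub>cobj F' i\<^esub> h (i - 1) (cdiff F' i x))"
proof -
  note R = left_resolutionD[OF F] and R' = left_resolutionD[OF F']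
  note FD = chain_complexD[OF R(1)] and F'D = chain_complexD[OF R'(1)]
  have ed: "e (cdiff F 1 x) = \<zero>\<^bsub>M\<^esub>" if "x \<in> carrier (cobj F 1)" for x
    using R(6) boundariesI[of x F 0] that by simp
  have ed': "e' (cdiff F' 1 x) = \<zero>\<^bsub>M\<^esub>" if "x \<in> carrier (cobj F' 1)" for x
    using R'(6) boundariesI[of x F' 0] that by simp
  interpret M: module R M by fact
  obtain f where f: "\<And>i. f i \<in> module_hom R (cobj F' i) (cobj F i)"
    "\<And>i x. x \<in> carrier (cobj F' i) \<Longrightarrow> cdiff F i (f i x) = f (i - 1) (cdiff F' i x)"
    "\<And>x. x \<in> carrier (cobj F' 0) \<Longrightarrow> e (f 0 x) = e' x"
    by (rule comparison_chain_map[OF assms(1) R'(1) free(2) R'(2) F assms(2) R'(3) ed']) (assumption | rule that)+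
  obtain g where g: "\<And>i. g i \<in> module_hom R (cobj F i) (cobj F' i)"
    "\<And>i x. x \<in> carrier (cobj F i) \<Longrightarrow> cdiff F' i (g i x) = g (i - 1) (cdiff F i x)"
    "\<And>x. x \<in> carrier (cobj F 0) \<Longrightarrow> e' (g 0 x) = e x"
    by (rule comparison_chain_map[OF assms(1) R(1) free(1) R(2) F' assms(2) R(3) ed]) (assumption | rule that)+
  note gf = module_hom_comp[OF f(1) g(1)]
  define u where "u i x = g i (f i x) \<ominus>\<^bsub>cobj F' i\<^esub> x" for i x
  have u: "u i \<in> module_hom R (cobj F' i) (cobj F' i)" for i
    unfolding u_def by (rule module_hom_minus_hom[OF F'D(1) gf module_hom_id])
  have ud: "cdiff F' i (u i x) = u (i - 1) (cdiff F' i x)" if x: "x \<in> carrier (cobj F' i)" for i x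
    unfolding u_def using module_hom_minus'[OF F'D(1) F'D(1) F'D(2) module_homD(1)[OF gf x] x]
    by (simp add: g(2)[OF module_homD(1)[OF f(1) x]] f(2)[OF x])
  have eu: "e' (u 0 x) = \<zero>\<^bsub>M\<^esub>" if x: "x \<in> carrier (cobj F' 0)" for x
    unfolding u_def using module_hom_minus'[OF F'D(1) assms(2) R'(3) module_homD(1)[OF gf x] x]
    by (simp add: g(3)[OF module_homD(1)[OF f(1) x]] f(3)[OF x] module_homD(1)[OF R'(3) x])
  obtain h where h: "\<And>i. h i \<in> module_hom R (cobj F' i) (cobj F' (i + 1))"
    "\<And>i x. x \<in> carrier (cobj F' i) \<Longrightarrow>
      u i x = cdiff F' (i + 1) (h i x) \<oplus>\<^bsub>cobj F' i\<^esub> h (i - 1) (cdiff F' i x)"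
    by (rule comparison_homotopy[where u = u and X = X' and e' = e', OF assms(1) R'(1) free(2) R'(2) F' u ud eu])
       (assumption | rule that)+
  show thesis
  proof (rule that[OF f(1,2) g(1,2) h(1)])
    fix i x assume x: "x \<in> carrier (cobj F' i)"
    interpret A: module R "cobj F' i" by (rule F'D(1))
    have "g i (f i x) = x \<oplus>\<^bsub>cobj F' i\<^esub> u i x"
      using module_homD(1)[OF gf x] x A.a_lcomm[of x "g i (f i x)" "\<ominus>\<^bsub>cobj F' i\<^esub> x"]
      unfolding u_def by (simp add: a_minus_def A.r_neg)
    then show "g i (f i x) = x \<oplus>\<^bsub>cobj F' i\<^esub> (cdiff F' (i + 1) (h i x) \<oplus>\<^bsub>cobj F' i\<^esub> h (i - 1) (cdiff F' i x))"
      by (simp add: h(2)[OF x])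
  qed
qed

text \<open>A cocycle \<open>c\<close> on \<open>F'\<close> pulls back along \<open>g\<close> to a
  coboundary \<open>k d\<close>. Composing with \<open>f\<close> and inserting the homotopy yields
  \<open>c = (k f - c h) d\<close>.\<close>

lemma hom_complex_independent_of_resolution:
  assumes "cring R" "module R M" "module R N"
    and F: "left_resolution R F e M" and F': "left_resolution R F' e' M"
    and free: "\<And>i. i \<ge> 0 \<Longrightarrow> cobj F i = free_module R (X i)" "\<And>i. i \<ge> 0 \<Longrightarrow> cobj F' i = free_module R (X' i)"
    and zero: "zero_module (homology (hom_complex R F N) (- i))"
  shows "zero_module (homology (hom_complex R F' N) (- i))"
proof -
  note R = left_resolutionD[OF F] and R' = left_resolutionD[OF F']
  note FD = chain_complexD[OF R(1)] and F'D = chain_complexD[OF R'(1)]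
  interpret N: module R N by fact
  obtain f g h where f: "\<And>i. f i \<in> module_hom R (cobj F' i) (cobj F i)"
    "\<And>i x. x \<in> carrier (cobj F' i) \<Longrightarrow> cdiff F i (f i x) = f (i - 1) (cdiff F' i x)"
    and g: "\<And>i. g i \<in> module_hom R (cobj F i) (cobj F' i)"
    "\<And>i x. x \<in> carrier (cobj F i) \<Longrightarrow> cdiff F' i (g i x) = g (i - 1) (cdiff F i x)"
    and h: "\<And>i. h i \<in> module_hom R (cobj F' i) (cobj F' (i + 1))"
    "\<And>i x. x \<in> carrier (cobj F' i) \<Longrightarrow> g i (f i x) =
      x \<oplus>\<^bsub>cobj F' i\<^esub> (cdiff F' (i + 1) (h i x) \<oplus>\<^bsub>cobj F' i\<^esub> h (i - 1) (cdiff F' i x))"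
    by (rule comparison_equivalence[OF assms(1,2) F F' free]) (assumption | rule that)+
  show ?thesis
    unfolding zero_homology_hom_complex_iff[OF R'(1) assms(3)]
  proof (intro ballI impI)
    fix c assume c: "c \<in> module_hom R (cobj F' i) N"
      and cd: "\<forall>x\<in>carrier (cobj F' (i + 1)). c (cdiff F' (i + 1) x) = \<zero>\<^bsub>N\<^esub>"
    have "\<forall>x\<in>carrier (cobj F (i + 1)). c (g i (cdiff F (i + 1) x)) = \<zero>\<^bsub>N\<^esub>"
    proof
      fix x assume x: "x \<in> carrier (cobj F (i + 1))"
      have "g i (cdiff F (i + 1) x) = cdiff F' (i + 1) (g (i + 1) x)" using g(2)[OF x] by simp
      then show "c (g i (cdiff F (i + 1) x)) = \<zero>\<^bsub>N\<^esub>" using bspec[OF cd module_homD(1)[OF g(1) x]] by simp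
    qed
    with bspec[OF zero[unfolded zero_homology_hom_complex_iff[OF R(1) assms(3)]] module_hom_comp[OF g(1) c]]
    obtain k where k: "k \<in> module_hom R (cobj F (i - 1)) N" "\<forall>x\<in>carrier (cobj F i). c (g i x) = k (cdiff F i x)"
      by auto
    have hi: "h (i - 1) \<in> module_hom R (cobj F' (i - 1)) (cobj F' i)" using h(1)[of "i - 1"] by simp
    note kf = module_hom_comp[OF f(1) k(1)] and ch = module_hom_comp[OF hi c]
    show "\<exists>g\<in>module_hom R (cobj F' (i - 1)) N. \<forall>x\<in>carrier (cobj F' i). c x = g (cdiff F' i x)"
    proof (intro bexI[OF _ module_hom_minus_hom[OF assms(3) kf ch]] ballI)
      fix x assume x: "x \<in> carrier (cobj F' i)"
      let ?d = "cdiff F' i x"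
      have d: "?d \<in> carrier (cobj F' (i - 1))" by (rule module_homD(1)[OF F'D(2) x])
      interpret A: module R "cobj F' i" by (rule F'D(1))
      have a: "cdiff F' (i + 1) (h i x) \<in> carrier (cobj F' i)" "h (i - 1) ?d \<in> carrier (cobj F' i)"
        using module_homD(1)[OF F'D(3) module_homD(1)[OF h(1) x]] module_homD(1)[OF hi d] by auto
      have cl: "c x \<in> carrier N" "c (h (i - 1) ?d) \<in> carrier N"
        using module_homD(1)[OF c] x a by auto
      have "k (f (i - 1) ?d) = c (g i (f i x))"
        using bspec[OF k(2) module_homD(1)[OF f(1) x]] f(2)[OF x] by simp
      also have "\<dots> = c x \<oplus>\<^bsub>N\<^esub> (c (cdiff F' (i + 1) (h i x)) \<oplus>\<^bsub>N\<^esub> c (h (i - 1) ?d))"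
        unfolding h(2)[OF x] using module_homD(2)[OF c x A.a_closed[OF a]] module_homD(2)[OF c a] by simp
      also have "c (cdiff F' (i + 1) (h i x)) = \<zero>\<^bsub>N\<^esub>" using bspec[OF cd module_homD(1)[OF h(1) x]] .
      finally have "k (f (i - 1) ?d) = c x \<oplus>\<^bsub>N\<^esub> c (h (i - 1) ?d)" using cl by simp
      then show "c x = k (f (i - 1) ?d) \<ominus>\<^bsub>N\<^esub> c (h (i - 1) ?d)"
        using cl by (simp add: a_minus_def N.a_assoc N.r_neg)
    qed
  qed
qed

text \<open>A cycle \<open>t\<close> is sent by \<open>f\<close> to a boundary \<open>d w\<close>,
  and the homotopy gives \<open>t = d (g w - h t)\<close>. The relations pass to tensor products
  because \<open>tensor_map\<close> respects composition and addition.\<close>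

lemma tensor_complex_independent_of_resolution:
  assumes "cring R" "module R M" "module R N"
    and F: "left_resolution R F e M" and F': "left_resolution R F' e' M"
    and free: "\<And>i. i \<ge> 0 \<Longrightarrow> cobj F i = free_module R (X i)" "\<And>i. i \<ge> 0 \<Longrightarrow> cobj F' i = free_module R (X' i)"
    and zero: "zero_module (homology (tensor_complex R F N) i)"
  shows "zero_module (homology (tensor_complex R F' N) i)"
proof -
  note R = left_resolutionD[OF F] and R' = left_resolutionD[OF F']
  note FD = chain_complexD[OF R(1)] and F'D = chain_complexD[OF R'(1)]
  interpret N: module R N by fact
  obtain f g h where f: "\<And>i. f i \<in> module_hom R (cobj F' i) (cobj F i)"
    "\<And>i x. x \<in> carrier (cobj F' i) \<Longrightarrow> cdiff F i (f i x) = f (i - 1) (cdiff F' i x)"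
    and g: "\<And>i. g i \<in> module_hom R (cobj F i) (cobj F' i)"
    "\<And>i x. x \<in> carrier (cobj F i) \<Longrightarrow> cdiff F' i (g i x) = g (i - 1) (cdiff F i x)"
    and h: "\<And>i. h i \<in> module_hom R (cobj F' i) (cobj F' (i + 1))"
    "\<And>i x. x \<in> carrier (cobj F' i) \<Longrightarrow> g i (f i x) =
      x \<oplus>\<^bsub>cobj F' i\<^esub> (cdiff F' (i + 1) (h i x) \<oplus>\<^bsub>cobj F' i\<^esub> h (i - 1) (cdiff F' i x))"
    by (rule comparison_equivalence[OF assms(1,2) F F' free]) (assumption | rule that)+
  let ?T = "\<lambda>j. tensor_module R (cobj F j) N" and ?T' = "\<lambda>j. tensor_module R (cobj F' j) N"
  let ?d = "\<lambda>j. tensor_map R (cobj F j) (cobj F (j - 1)) N (cdiff F j)"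
  let ?d' = "\<lambda>j. tensor_map R (cobj F' j) (cobj F' (j - 1)) N (cdiff F' j)"
  let ?d1 = "tensor_map R (cobj F (i + 1)) (cobj F i) N (cdiff F (i + 1))"
  let ?d1' = "tensor_map R (cobj F' (i + 1)) (cobj F' i) N (cdiff F' (i + 1))"
  let ?f = "\<lambda>j. tensor_map R (cobj F' j) (cobj F j) N (f j)" and ?g = "\<lambda>j. tensor_map R (cobj F j) (cobj F' j) N (g j)"
  show ?thesis
    unfolding zero_homology_tensor_complex_iff[OF R'(1) assms(3)]
  proof (intro ballI impI)
    fix t assume t: "t \<in> carrier (?T' i)" and dt: "?d' i t = \<zero>\<^bsub>?T' (i - 1)\<^esub>"
    interpret T': module R "?T' i" by (rule module_tensor[OF F'D(1) assms(3)])
    have ft: "?f i t \<in> carrier (?T i)"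
      by (rule module_homD(1)[OF tensor_map_hom[OF F'D(1) FD(1) assms(3) f(1)] t])
    have "?d i (?f i t) = tensor_map R (cobj F' i) (cobj F (i - 1)) N (\<lambda>x. cdiff F i (f i x)) t"
      by (rule tensor_map_comp[OF F'D(1) FD(1) assms(3) FD(1) f(1) FD(2) t])
    also have "\<dots> = tensor_map R (cobj F' i) (cobj F (i - 1)) N (\<lambda>x. f (i - 1) (cdiff F' i x)) t"
      by (rule tensor_map_cong[OF F'D(1) FD(1) assms(3) module_hom_comp[OF f(1) FD(2)] module_hom_comp[OF F'D(2) f(1)] f(2) t])
    also have "\<dots> = ?f (i - 1) (?d' i t)"
      by (rule tensor_map_comp[OF F'D(1) F'D(1) assms(3) FD(1) F'D(2) f(1) t, symmetric])
    also have "\<dots> = \<zero>\<^bsub>?T (i - 1)\<^esub>" unfolding dt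
      by (rule module_hom_zero[OF module_tensor[OF F'D(1) assms(3)] module_tensor[OF FD(1) assms(3)]
            tensor_map_hom[OF F'D(1) FD(1) assms(3) f(1)]])
    finally obtain w where w: "w \<in> carrier (?T (i + 1))" "?d1 w = ?f i t"
      using bspec[OF zero[unfolded zero_homology_tensor_complex_iff[OF R(1) assms(3)]] ft] by auto
    have gw: "?g (i + 1) w \<in> carrier (?T' (i + 1))"
      by (rule module_homD(1)[OF tensor_map_hom[OF FD(1) F'D(1) assms(3) g(1)] w(1)])
    have "?d1' (?g (i + 1) w) = tensor_map R (cobj F (i + 1)) (cobj F' i) N (\<lambda>x. cdiff F' (i + 1) (g (i + 1) x)) w"
      by (rule tensor_map_comp[OF FD(1) F'D(1) assms(3) F'D(1) g(1) F'D(3) w(1)])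
    also have "\<dots> = tensor_map R (cobj F (i + 1)) (cobj F' i) N (\<lambda>x. g i (cdiff F (i + 1) x)) w"
      by (rule tensor_map_cong[OF FD(1) F'D(1) assms(3) module_hom_comp[OF g(1) F'D(3)] module_hom_comp[OF FD(3) g(1)] _ w(1)])
         (simp add: g(2))
    also have "\<dots> = ?g i (?d1 w)"
      by (rule tensor_map_comp[OF FD(1) FD(1) assms(3) F'D(1) FD(3) g(1) w(1), symmetric])
    finally have e1: "?d1' (?g (i + 1) w) = ?g i (?f i t)" unfolding w(2) .
    have hi: "h (i - 1) \<in> module_hom R (cobj F' (i - 1)) (cobj F' i)" using h(1)[of "i - 1"] by simp
    let ?h = "tensor_map R (cobj F' i) (cobj F' (i + 1)) N (h i)"
    let ?h1 = "tensor_map R (cobj F' (i - 1)) (cobj F' i) N (h (i - 1))"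
    have ht: "?h t \<in> carrier (?T' (i + 1))"
      by (rule module_homD(1)[OF tensor_map_hom[OF F'D(1) F'D(1) assms(3) h(1)] t])
    note dh = module_hom_comp[OF h(1) F'D(3)] and hd = module_hom_comp[OF F'D(2) hi]
    note dhhd = module_hom_add_hom[OF F'D(1) dh hd]
    have "?g i (?f i t) = tensor_map R (cobj F' i) (cobj F' i) N (\<lambda>x. g i (f i x)) t"
      by (rule tensor_map_comp[OF F'D(1) FD(1) assms(3) F'D(1) f(1) g(1) t])
    also have "\<dots> = tensor_map R (cobj F' i) (cobj F' i) N
        (\<lambda>x. x \<oplus>\<^bsub>cobj F' i\<^esub> (cdiff F' (i + 1) (h i x) \<oplus>\<^bsub>cobj F' i\<^esub> h (i - 1) (cdiff F' i x))) t"
      by (rule tensor_map_cong[OF F'D(1) F'D(1) assms(3) module_hom_comp[OF f(1) g(1)]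
            module_hom_add_hom[OF F'D(1) module_hom_id dhhd] h(2) t])
    also have "\<dots> = tensor_map R (cobj F' i) (cobj F' i) N (\<lambda>x. x) t \<oplus>\<^bsub>?T' i\<^esub>
        (tensor_map R (cobj F' i) (cobj F' i) N (\<lambda>x. cdiff F' (i + 1) (h i x)) t \<oplus>\<^bsub>?T' i\<^esub>
         tensor_map R (cobj F' i) (cobj F' i) N (\<lambda>x. h (i - 1) (cdiff F' i x)) t)"
      using tensor_map_add[OF F'D(1) F'D(1) assms(3) module_hom_id dhhd t]
        tensor_map_add[OF F'D(1) F'D(1) assms(3) dh hd t] by simp
    also have "tensor_map R (cobj F' i) (cobj F' i) N (\<lambda>x. x) t = t"
      by (rule tensor_map_id[OF F'D(1) F'D(1) assms(3) t])
    also have "tensor_map R (cobj F' i) (cobj F' i) N (\<lambda>x. cdiff F' (i + 1) (h i x)) t = ?d1' (?h t)"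
      by (rule tensor_map_comp[OF F'D(1) F'D(1) assms(3) F'D(1) h(1) F'D(3) t, symmetric])
    also have "tensor_map R (cobj F' i) (cobj F' i) N (\<lambda>x. h (i - 1) (cdiff F' i x)) t = ?h1 (?d' i t)"
      by (rule tensor_map_comp[OF F'D(1) F'D(1) assms(3) F'D(1) F'D(2) hi t, symmetric])
    also have "?h1 (?d' i t) = \<zero>\<^bsub>?T' i\<^esub>" unfolding dt
      by (rule module_hom_zero[OF module_tensor[OF F'D(1) assms(3)] module_tensor[OF F'D(1) assms(3)]
            tensor_map_hom[OF F'D(1) F'D(1) assms(3) hi]])
    finally have e2: "?g i (?f i t) = t \<oplus>\<^bsub>?T' i\<^esub> (?d1' (?h t) \<oplus>\<^bsub>?T' i\<^esub> \<zero>\<^bsub>?T' i\<^esub>)" .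
    note d1hom = tensor_map_hom[OF F'D(1) F'D(1) assms(3) F'D(3)]
    have c: "?d1' (?h t) \<in> carrier (?T' i)" by (rule module_homD(1)[OF d1hom ht])
    have "?d1' (?g (i + 1) w \<ominus>\<^bsub>?T' (i + 1)\<^esub> ?h t) = ?d1' (?g (i + 1) w) \<ominus>\<^bsub>?T' i\<^esub> ?d1' (?h t)"
      by (rule module_hom_minus'[OF module_tensor[OF F'D(1) assms(3)] module_tensor[OF F'D(1) assms(3)] d1hom gw ht])
    also have "\<dots> = t" unfolding e1 e2 using c t by (simp add: a_minus_def T'.a_assoc T'.r_neg)
    finally have e3: "?d1' (?g (i + 1) w \<ominus>\<^bsub>?T' (i + 1)\<^esub> ?h t) = t" .
    interpret T1: module R "?T' (i + 1)" by (rule module_tensor[OF F'D(1) assms(3)])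
    show "\<exists>s\<in>carrier (?T' (i + 1)). ?d1' s = t"
      by (intro bexI[of _ "?g (i + 1) w \<ominus>\<^bsub>?T' (i + 1)\<^esub> ?h t"] e3 T1.minus_closed gw ht)
  qed
qed


section \<open>Complexes of finitely generated free modules\<close>

text \<open>Elements of a free module are functions on the whole index type that vanish off the
  basis. The differential is cut off accordingly, since \<open>mat_act\<close> by itself may be
  nonzero there.\<close>

definition fin_cpx ::
  "('a, 'r) ring_scheme \<Rightarrow> (int \<Rightarrow> 'x set) \<Rightarrow> (int \<Rightarrow> 'x \<Rightarrow> 'x \<Rightarrow> 'a) \<Rightarrow> ('a, 'x \<Rightarrow> 'a) cpx" where
  "fin_cpx R X D = \<lparr>cobj = (\<lambda>i. free_module R (X i)),
     cdiff = (\<lambda>i f y. if y \<in> X (i - 1) then mat_act (regular_module R) (X i) (D i) f y else \<zero>\<^bsub>R\<^esub>)\<rparr>"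

lemma fin_cpx_simps:
  "cobj (fin_cpx R X D) i = free_module R (X i)"
  "cdiff (fin_cpx R X D) i f = (\<lambda>y. if y \<in> X (i - 1) then mat_act (regular_module R) (X i) (D i) f y else \<zero>\<^bsub>R\<^esub>)"
  by (simp_all add: fin_cpx_def)

text \<open>The two records differ in their multiplicative fields, but finite sums read only the
  additive ones.\<close>

lemma finsum_regular: "finsum (regular_module R) = finsum R"
  by (intro ext) (simp add: finsum_def finprod_def regular_module_def mk_module_def)

lemma finite_free_carrier:
  assumes "cring R" "finite Y"
  shows "f \<in> carrier (free_module R Y) \<longleftrightarrow> f \<in> Y \<rightarrow> carrier R \<and> (\<forall>x. x \<notin> Y \<longrightarrow> f x = \<zero>\<^bsub>R\<^esub>)"
proof -
  interpret cring R by fact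
  have "f x \<in> carrier R" if "f \<in> Y \<rightarrow> carrier R" "\<forall>x. x \<notin> Y \<longrightarrow> f x = \<zero>\<^bsub>R\<^esub>" for x
    using that by (cases "x \<in> Y") auto
  then show ?thesis
    using finite_subset[OF _ assms(2), of "{x. f x \<noteq> \<zero>\<^bsub>R\<^esub>}"] by (auto simp: free_module_carrier)
qed

lemma free_hom_value:
  assumes "module R N" "c \<in> module_hom R (free_module R Y) N" "finite Y" "f \<in> carrier (free_module R Y)"
  shows "c f = (\<Oplus>\<^bsub>N\<^esub>x\<in>Y. f x \<odot>\<^bsub>N\<^esub> c (unit_vector R x))"
proof -
  interpret plain_module R N by (rule plain_module.intro) fact
  have "(\<lambda>x. c (unit_vector R x)) \<in> Y \<rightarrow> carrier N"
    using module_homD(1)[OF assms(2) unit_vector_closed] by auto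
  then show ?thesis
    unfolding free_hom_eq_linear_extension[OF assms(1,2,4)]
    by (rule linear_extension_eq_finite[OF assms(4) _ assms(3)])
qed

lemma chain_complex_fin_cpx:
  assumes "cring R" "fin_free_complex R X D"
  shows "chain_complex R (fin_cpx R X D)"
proof -
  interpret cring R by fact
  interpret C: module_complex R "regular_module R" X D
    by (intro module_complex.intro module_complex_axioms.intro assms module_regular)
  note carr = finite_free_carrier[OF assms(1) C.finite_X]
  have cl: "mat_act (regular_module R) (X i) (D i) f y \<in> carrier R"
    if "f \<in> carrier (free_module R (X i))" "y \<in> X (i - 1)" for i f y
    using C.diff_in[OF C.carrier_is_submodule, of f i y] that carr by simp
  show ?thesis
    unfolding chain_complex_def fin_cpx_simps
  proof (intro allI conjI ballI)
    fix i
    show "module R (free_module R (X i))" by (rule module_free)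
    show "(\<lambda>f y. if y \<in> X (i - 1) then mat_act (regular_module R) (X i) (D i) f y else \<zero>\<^bsub>R\<^esub>)
        \<in> module_hom R (free_module R (X i)) (free_module R (X (i - 1)))"
    proof (rule module_homI)
      fix f assume f: "f \<in> carrier (free_module R (X i))"
      then have f': "f \<in> X i \<rightarrow> carrier (regular_module R)" using carr by simp
      show "(\<lambda>y. if y \<in> X (i - 1) then mat_act (regular_module R) (X i) (D i) f y else \<zero>\<^bsub>R\<^esub>)
          \<in> carrier (free_module R (X (i - 1)))"
        unfolding carr using cl[OF f] by auto
      show "(\<lambda>y. if y \<in> X (i - 1) then mat_act (regular_module R) (X i) (D i) (f \<oplus>\<^bsub>free_module R (X i)\<^esub> g) y else \<zero>\<^bsub>R\<^esub>) =
        (\<lambda>y. if y \<in> X (i - 1) then mat_act (regular_module R) (X i) (D i) f y else \<zero>\<^bsub>R\<^esub>) \<oplus>\<^bsub>free_module R (X (i - 1))\<^esub>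
        (\<lambda>y. if y \<in> X (i - 1) then mat_act (regular_module R) (X i) (D i) g y else \<zero>\<^bsub>R\<^esub>)"
        if g: "g \<in> carrier (free_module R (X i))" for g
      proof -
        have g': "g \<in> X i \<rightarrow> carrier (regular_module R)" using carr g by simp
        show ?thesis
          using C.mat_act_add[where d = "D i", OF _ f' g'] C.D_closed by (intro HOL.ext) simp
      qed
      show "(\<lambda>y. if y \<in> X (i - 1) then mat_act (regular_module R) (X i) (D i) (a \<odot>\<^bsub>free_module R (X i)\<^esub> f) y else \<zero>\<^bsub>R\<^esub>) =
        a \<odot>\<^bsub>free_module R (X (i - 1))\<^esub> (\<lambda>y. if y \<in> X (i - 1) then mat_act (regular_module R) (X i) (D i) f y else \<zero>\<^bsub>R\<^esub>)"
        if a: "a \<in> carrier R" for a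
      proof (rule HOL.ext)
        fix y
        have h: "(\<lambda>x. a \<otimes>\<^bsub>R\<^esub> x) \<in> module_hom R (regular_module R) (regular_module R)"
          using a by (intro module_homI) (auto simp: r_distr m_lcomm)
        show "(if y \<in> X (i - 1) then mat_act (regular_module R) (X i) (D i) (a \<odot>\<^bsub>free_module R (X i)\<^esub> f) y else \<zero>\<^bsub>R\<^esub>) =
          (a \<odot>\<^bsub>free_module R (X (i - 1))\<^esub> (\<lambda>y. if y \<in> X (i - 1) then mat_act (regular_module R) (X i) (D i) f y else \<zero>\<^bsub>R\<^esub>)) y"
          using mat_act_hom_carrier[where d = "D i" and y = y, OF module_regular module_regular h C.finite_X _ f'] C.D_closed a
          by simp
      qed
    qed
    fix f assume f: "f \<in> carrier (free_module R (X i))"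
    then have f': "f \<in> X i \<rightarrow> carrier (regular_module R)" using carr by simp
    let ?g = "\<lambda>y. if y \<in> X (i - 1) then mat_act (regular_module R) (X i) (D i) f y else \<zero>\<^bsub>R\<^esub>"
    have "mat_act (regular_module R) (X (i - 1)) (D (i - 1)) ?g z = \<zero>\<^bsub>R\<^esub>" if z: "z \<in> X (i - 2)" for z
    proof -
      have "mat_act (regular_module R) (X (i - 1)) (D (i - 1)) ?g z
          = mat_act (regular_module R) (X (i - 1)) (D (i - 1)) (mat_act (regular_module R) (X i) (D i) f) z"
        using z cl[OF f] C.D_closed[of _ "i - 1" z] by (intro C.mat_act_cong) auto
      also have "\<dots> = \<zero>\<^bsub>R\<^esub>" using C.diff_diff[of f "i - 1" z] f' z by simp
      finally show ?thesis .
    qed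
    then show "(\<lambda>y. if y \<in> X (i - 1 - 1) then mat_act (regular_module R) (X (i - 1)) (D (i - 1)) ?g y else \<zero>\<^bsub>R\<^esub>)
        = \<zero>\<^bsub>free_module R (X (i - 2))\<^esub>" by (intro HOL.ext) simp
  qed
qed

lemma fin_cpx_diff_unit:
  assumes "cring R" "fin_free_complex R X D" "x \<in> X i"
  shows "cdiff (fin_cpx R X D) i (unit_vector R x) = (\<lambda>y. if y \<in> X (i - 1) then D i x y else \<zero>\<^bsub>R\<^esub>)"
proof -
  interpret cring R by fact
  interpret C: module_complex R "regular_module R" X D
    by (intro module_complex.intro module_complex_axioms.intro assms module_regular)
  have "mat_act (regular_module R) (X i) (D i) (unit_vector R x) y = D i x y" if y: "y \<in> X (i - 1)" for y
  proof -
    have "mat_act (regular_module R) (X i) (D i) (unit_vector R x) y = (\<Oplus>\<^bsub>R\<^esub>z\<in>X i. if x = z then D i z y else \<zero>\<^bsub>R\<^esub>)"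
      unfolding mat_act_def finsum_regular using y C.D_closed
      by (intro finsum_cong') (auto simp: unit_vector_def)
    also have "\<dots> = D i x y" using y assms(3) C.D_closed by (intro finsum_singleton) auto
    finally show ?thesis .
  qed
  then show ?thesis unfolding fin_cpx_simps by (intro HOL.ext) simp
qed

lemma fin_cpx_hom_diff_unit:
  assumes "cring R" "fin_free_complex R X D" "x \<in> X i" "module R N"
    and c: "c \<in> module_hom R (free_module R (X (i - 1))) N"
  shows "c (cdiff (fin_cpx R X D) i (unit_vector R x)) = (\<Oplus>\<^bsub>N\<^esub>y\<in>X (i - 1). D i x y \<odot>\<^bsub>N\<^esub> c (unit_vector R y))"
proof -
  interpret module R N by fact
  interpret C: module_complex R N X D
    by (intro module_complex.intro module_complex_axioms.intro assms)
  let ?f = "\<lambda>y. if y \<in> X (i - 1) then D i x y else \<zero>\<^bsub>R\<^esub>"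
  have f: "?f \<in> carrier (free_module R (X (i - 1)))"
    unfolding finite_free_carrier[OF assms(1) C.finite_X] using C.D_closed[OF assms(3)] by auto
  have u: "c (unit_vector R y) \<in> carrier N" if "y \<in> X (i - 1)" for y
    by (rule module_homD(1)[OF c unit_vector_closed[OF that]])
  show ?thesis
    unfolding fin_cpx_diff_unit[OF assms(1-3)] free_hom_value[OF assms(4) c C.finite_X f]
    using C.D_closed[OF assms(3)] u by (intro M.finsum_cong') auto
qed

text \<open>A homomorphism from a finite free module is the tuple of its values on unit vectors, and
  precomposition with the differential acts on such tuples by the transposed matrix.\<close>

lemma zero_homology_hom_fin_cpx_iff:
  assumes "cring R" "fin_free_complex R X D" "module R N"
  shows "zero_module (homology (hom_complex R (fin_cpx R X D) N) (- i)) \<longleftrightarrow>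
    exact_at N (transpose_basis X) (transpose_diff D) (carrier N) {\<zero>\<^bsub>N\<^esub>} (- i)"
proof -
  interpret N: plain_module R N by (rule plain_module.intro) fact
  interpret C: module_complex R N X D
    by (intro module_complex.intro module_complex_axioms.intro assms)
  let ?F = "fin_cpx R X D"
  note ch = chain_complex_fin_cpx[OF assms(1,2)]
  note FD = chain_complexD[OF ch, unfolded fin_cpx_simps(1)]
  have val: "c (cdiff ?F (i + 1) (unit_vector R z)) = mat_act N (X i) (\<lambda>x z. D (1 + i) z x) (\<lambda>x. c (unit_vector R x)) z"
    if "z \<in> X (i + 1)" "c \<in> module_hom R (free_module R (X i)) N" for z c
    using fin_cpx_hom_diff_unit[OF assms(1,2) that(1) assms(3), of c] that(2) by (simp add: mat_act_def add.commute)
  have val': "c (cdiff ?F i (unit_vector R z)) = mat_act N (X (i - 1)) (\<lambda>x z. D i z x) (\<lambda>x. c (unit_vector R x)) z"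
    if "z \<in> X i" "c \<in> module_hom R (free_module R (X (i - 1))) N" for z c
    using fin_cpx_hom_diff_unit[OF assms(1,2) that(1) assms(3), of c] that(2) by (simp add: mat_act_def)
  have zhom: "(\<lambda>_. \<zero>\<^bsub>N\<^esub>) \<in> module_hom R (free_module R Y) N" for Y :: "'c set" by (rule module_homI) auto
  have tr: "transpose_basis X (- i) = X i" "transpose_basis X (- i + 1) = X (i - 1)" "transpose_basis X (- i - 1) = X (i + 1)"
    "transpose_diff D (- i) = (\<lambda>x z. D (1 + i) z x)" "transpose_diff D (- i + 1) = (\<lambda>x z. D i z x)"
    by (auto simp: transpose_basis_def transpose_diff_def fun_eq_iff add.commute)
  have cl: "mat_act N (X (i - 1)) (\<lambda>y x. D i x y) g x \<in> carrier N" if "g \<in> X (i - 1) \<rightarrow> carrier N" "x \<in> X i" for g x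
    using that C.D_closed by (intro N.mat_act_closed) auto
  show ?thesis
    unfolding zero_homology_hom_complex_iff[OF ch assms(3)] fin_cpx_simps(1) exact_at_def tr
  proof (intro iffI ballI impI, goal_cases)
    case (1 f)
    have f: "f \<in> X i \<rightarrow> carrier N" by fact
    let ?c = "linear_extension R N f"
    have c: "?c \<in> module_hom R (free_module R (X i)) N" by (rule N.linear_extension_hom[OF f])
    have cu: "?c (unit_vector R x) = f x" if "x \<in> X i" for x by (rule N.linear_extension_unit[OF that f])
    have "?c (cdiff ?F (i + 1) x) = \<zero>\<^bsub>N\<^esub>" if "x \<in> carrier (free_module R (X (i + 1)))" for x
    proof (rule free_hom_eqI[OF assms(3) module_hom_comp[OF FD(3) c] zhom _ that])
      fix z assume z: "z \<in> X (i + 1)"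
      have "?c (cdiff ?F (i + 1) (unit_vector R z)) = mat_act N (X i) (\<lambda>x z. D (1 + i) z x) f z"
        unfolding val[OF z c] using f z C.D_closed'[of z i] cu by (intro N.mat_act_cong) (auto simp: add.commute)
      then show "?c (cdiff ?F (i + 1) (unit_vector R z)) = \<zero>\<^bsub>N\<^esub>" using 1(3) z by simp
    qed
    then obtain k where k: "k \<in> module_hom R (free_module R (X (i - 1))) N"
      "\<forall>x\<in>carrier (free_module R (X i)). ?c x = k (cdiff ?F i x)"
      using bspec[OF 1(1) c] by auto
    have ku: "(\<lambda>y. k (unit_vector R y)) \<in> X (i - 1) \<rightarrow> carrier N"
      using module_homD(1)[OF k(1) N.unit_vector_closed] by auto
    show ?case
    proof (intro bexI[OF _ ku] ballI)
      fix x assume x: "x \<in> X i"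
      have "f x = k (cdiff ?F i (unit_vector R x))"
        using cu[OF x] bspec[OF k(2) N.unit_vector_closed[OF x]] by simp
      then show "f x \<ominus>\<^bsub>N\<^esub> mat_act N (X (i - 1)) (\<lambda>y x. D i x y) (\<lambda>y. k (unit_vector R y)) x \<in> {\<zero>\<^bsub>N\<^esub>}"
        using cl[OF ku x] val'[OF x k(1)] by simp
    qed
  next
    case (2 c)
    have c: "c \<in> module_hom R (free_module R (X i)) N" by fact
    let ?f = "\<lambda>x. c (unit_vector R x)"
    have f: "?f \<in> X i \<rightarrow> carrier N" using module_homD(1)[OF c N.unit_vector_closed] by auto
    have "\<forall>y\<in>X (i + 1). mat_act N (X i) (\<lambda>x z. D (1 + i) z x) ?f y \<in> {\<zero>\<^bsub>N\<^esub>}"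
      using val[OF _ c] 2(3) N.unit_vector_closed[of _ "X (i + 1)"] by simp
    with bspec[OF 2(1) f] obtain g where g: "g \<in> X (i - 1) \<rightarrow> carrier N"
      "\<forall>x\<in>X i. ?f x \<ominus>\<^bsub>N\<^esub> mat_act N (X (i - 1)) (\<lambda>y x. D i x y) g x \<in> {\<zero>\<^bsub>N\<^esub>}" by auto
    let ?k = "linear_extension R N g"
    have k: "?k \<in> module_hom R (free_module R (X (i - 1))) N" by (rule N.linear_extension_hom[OF g(1)])
    show ?case
    proof (intro bexI[OF _ k] ballI)
      fix x assume x: "x \<in> carrier (free_module R (X i))"
      show "c x = ?k (cdiff ?F i x)"
      proof (rule free_hom_eqI[OF assms(3) c module_hom_comp[OF FD(2) k] _ x])
        fix z assume z: "z \<in> X i"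
        have "?k (cdiff ?F i (unit_vector R z)) = mat_act N (X (i - 1)) (\<lambda>y x. D i x y) g z"
          unfolding val'[OF z k] using g(1) z C.D_closed N.linear_extension_unit[OF _ g(1)]
          by (intro N.mat_act_cong) auto
        moreover have "c (unit_vector R z) = mat_act N (X (i - 1)) (\<lambda>y x. D i x y) g z"
          using bspec[OF g(2) z] N.minus_eq_zero_iff[OF funcset_mem[OF f z] cl[OF g(1) z]] by simp
        ultimately show "c (unit_vector R z) = ?k (cdiff ?F i (unit_vector R z))" by simp
      qed
    qed
  qed
qed

text \<open>Tensoring the free module on \<open>X j\<close> with \<open>N\<close> gives tuples of
  elements of \<open>N\<close>, and under this identification the induced differential is the action
  of the same matrix.\<close>

lemma zero_homology_tensor_fin_cpx_iff:
  assumes "cring R" "fin_free_complex R X D" "module R N"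
  shows "zero_module (homology (tensor_complex R (fin_cpx R X D) N) i) \<longleftrightarrow>
    exact_at N X D (carrier N) {\<zero>\<^bsub>N\<^esub>} i"
proof -
  interpret N: plain_module R N by (rule plain_module.intro) fact
  interpret C: module_complex R N X D
    by (intro module_complex.intro module_complex_axioms.intro assms)
  let ?F = "fin_cpx R X D"
  note ch = chain_complex_fin_cpx[OF assms(1,2)]
  note FD = chain_complexD[OF ch]
  let ?L = "\<lambda>j. free_module R (X j)"
  let ?T = "\<lambda>j. tensor_module R (?L j) N" and ?e = "unit_vector R"
  let ?p = "\<lambda>j. pure_tensor R (?L j) N"
  have mL: "module R (?L j)" for j by (rule N.module_free)
  have mT: "module R (?T j)" for j by (rule module_tensor[OF mL assms(3)])
  let ?d = "\<lambda>j. tensor_map R (?L j) (?L (j - 1)) N (cdiff ?F j)"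
  have dhom: "cdiff ?F j \<in> module_hom R (?L j) (?L (j - 1))" for j using FD(2)[of j] by (simp add: fin_cpx_simps(1))
  have Td: "?d j \<in> module_hom R (?T j) (?T (j - 1))" for j by (rule tensor_map_hom[OF mL mL assms(3) dhom])
  have u: "?e x \<in> carrier (?L j)" if "x \<in> X j" for x j by (rule N.unit_vector_closed[OF that])
  \<comment> \<open>\<open>\<theta> j\<close> sends a tuple to the sum of the tensors of unit
    vectors with its entries. The components of its inverse are the maps \<open>\<eta> j x\<close>
    below, induced by the bilinear map taking \<open>v\<close> and \<open>n\<close> to
    \<open>v x\<close> times \<open>n\<close>.\<close>
  define \<theta> where "\<theta> j f = (\<Oplus>\<^bsub>?T j\<^esub>x\<in>X j. ?p j (?e x) (f x))" for j f
  have \<theta>_summand: "?p j (?e x) n \<in> carrier (?T j)" if "x \<in> X j" "n \<in> carrier N" for j x n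
    by (rule pure_tensor_closed[OF mL assms(3) u[OF that(1)] that(2)])
  have \<theta>_closed: "\<theta> j f \<in> carrier (?T j)" if f: "f \<in> X j \<rightarrow> carrier N" for j f
  proof -
    interpret T: module R "?T j" by (rule mT)
    show ?thesis unfolding \<theta>_def using f \<theta>_summand by (intro T.finsum_closed) auto
  qed
  have \<theta>_cong: "\<theta> j f = \<theta> j g" if "f \<in> X j \<rightarrow> carrier N" "\<And>x. x \<in> X j \<Longrightarrow> f x = g x" for j f g
  proof -
    interpret T: module R "?T j" by (rule mT)
    show ?thesis unfolding \<theta>_def using that \<theta>_summand
      by (intro T.finsum_cong') (auto simp: Pi_iff)
  qed
  have hom_sum: "h (\<Oplus>\<^bsub>?T j\<^esub>x\<in>Y. g x) = (\<Oplus>\<^bsub>K\<^esub>x\<in>Y. h (g x))"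
    if K: "module R K" and h: "h \<in> module_hom R (?T j) K" and Y: "finite Y" and g: "g \<in> Y \<rightarrow> carrier (?T j)"
    for j K h and Y :: "'c set" and g
  proof -
    interpret T: module R "?T j" by (rule mT)
    interpret K: module R K by (rule K)
    show ?thesis using Y g
    proof (induction Y rule: finite_induct)
      case empty
      then show ?case using module_hom_zero[OF mT K h] by simp
    next
      case (insert x Y)
      then have "(\<lambda>x. h (g x)) \<in> Y \<rightarrow> carrier K" "h (g x) \<in> carrier K" using module_homD(1)[OF h] by auto
      moreover have "g \<in> Y \<rightarrow> carrier (?T j)" "g x \<in> carrier (?T j)" using insert.prems by auto
      ultimately show ?case using insert.hyps insert.IH by (simp add: module_homD(2)[OF h])
    qed
  qed
  have ex: "\<exists>h. h \<in> module_hom R (?T j) N \<and> (\<forall>v\<in>carrier (?L j). \<forall>n\<in>carrier N. h (?p j v n) = v x \<odot>\<^bsub>N\<^esub> n)" for j x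
  proof -
    have b: "bilinear_map R (?L j) N N (\<lambda>v n. v x \<odot>\<^bsub>N\<^esub> n)"
      unfolding bilinear_map_def
    proof (intro conjI ballI)
      fix n assume "n \<in> carrier N"
      then show "(\<lambda>v. v x \<odot>\<^bsub>N\<^esub> n) \<in> module_hom R (?L j) N"
        by (intro module_homI) (auto simp: free_module_carrier N.smult_l_distr N.smult_assoc1)
    next
      fix v assume "v \<in> carrier (?L j)"
      then have "v x \<in> carrier R" by (simp add: free_module_carrier)
      then show "(\<lambda>n. v x \<odot>\<^bsub>N\<^esub> n) \<in> module_hom R N N"
        by (intro module_homI) (auto simp: N.smult_r_distr N.smult_assoc1[symmetric] N.m_comm)
    qed
    obtain h where "h \<in> module_hom R (?T j) N"
      "\<And>v n. v \<in> carrier (?L j) \<Longrightarrow> n \<in> carrier N \<Longrightarrow> h (?p j v n) = v x \<odot>\<^bsub>N\<^esub> n"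
      by (rule tensor_universal[OF mL assms(3,3) b]) (rule that)
    then show ?thesis by (intro exI[of _ h]) simp
  qed
  define \<eta> where "\<eta> j x = (SOME h. h \<in> module_hom R (?T j) N \<and>
    (\<forall>v\<in>carrier (?L j). \<forall>n\<in>carrier N. h (?p j v n) = v x \<odot>\<^bsub>N\<^esub> n))" for j x
  have \<eta>: "\<eta> j x \<in> module_hom R (?T j) N"
    "\<And>v n. v \<in> carrier (?L j) \<Longrightarrow> n \<in> carrier N \<Longrightarrow> \<eta> j x (?p j v n) = v x \<odot>\<^bsub>N\<^esub> n" for j x
    using someI_ex[OF ex[of j x]] unfolding \<eta>_def[symmetric] by simp_all
  have \<eta>\<theta>: "\<eta> j x (\<theta> j f) = f x" if f: "f \<in> X j \<rightarrow> carrier N" and x: "x \<in> X j" for j f x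
  proof -
    have "\<eta> j x (\<theta> j f) = (\<Oplus>\<^bsub>N\<^esub>z\<in>X j. \<eta> j x (?p j (?e z) (f z)))"
      unfolding \<theta>_def using f \<theta>_summand by (intro hom_sum[OF assms(3) \<eta>(1) C.finite_X]) auto
    also have "\<dots> = (\<Oplus>\<^bsub>N\<^esub>z\<in>X j. if x = z then f z else \<zero>\<^bsub>N\<^esub>)"
    proof (intro N.M.finsum_cong' refl)
      fix z assume z: "z \<in> X j"
      have fz: "f z \<in> carrier N" using f z by auto
      show "\<eta> j x (?p j (?e z) (f z)) = (if x = z then f z else \<zero>\<^bsub>N\<^esub>)"
        unfolding \<eta>(2)[OF u[OF z] fz] using fz by (simp add: unit_vector_def)
    qed (use f in auto)
    also have "\<dots> = f x" using f by (intro N.M.finsum_singleton[OF x C.finite_X]) auto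
    finally show ?thesis .
  qed
  have \<theta>\<eta>: "\<theta> j (\<lambda>x. \<eta> j x t) = t" if t: "t \<in> carrier (?T j)" for j t
  proof -
    interpret T: module R "?T j" by (rule mT)
    have "(\<lambda>t. ?p j (?e x) (\<eta> j x t)) \<in> module_hom R (?T j) (?T j)" if "x \<in> X j" for x
      by (rule module_hom_comp[OF \<eta>(1) pure_tensor_hom(2)[OF mL assms(3) u[OF that]]])
    note sm = this
    \<comment> \<open>Linearity in \<open>t\<close> is shown for partial sums first; only then can
      the composite be compared with the identity on pure tensors.\<close>
    have "(\<lambda>t. \<Oplus>\<^bsub>?T j\<^esub>x\<in>Y. ?p j (?e x) (\<eta> j x t)) \<in> module_hom R (?T j) (?T j)" if "finite Y" "Y \<subseteq> X j" for Y
      using that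
    proof (induction Y rule: finite_induct)
      case empty
      show ?case by (rule module_homI) simp_all
    next
      case (insert x Y)
      have x: "x \<in> X j" and Y: "Y \<subseteq> X j" using insert.prems by auto
      have "(\<Oplus>\<^bsub>?T j\<^esub>x\<in>insert x Y. ?p j (?e x) (\<eta> j x t)) = ?p j (?e x) (\<eta> j x t) \<oplus>\<^bsub>?T j\<^esub> (\<Oplus>\<^bsub>?T j\<^esub>x\<in>Y. ?p j (?e x) (\<eta> j x t))"
        if t: "t \<in> carrier (?T j)" for t
        using insert.hyps Y module_homD(1)[OF sm t] x by (intro T.finsum_insert) auto
      then show ?case
        using module_homD[OF module_hom_add_hom[OF mT sm[OF x] insert.IH[OF Y]]]
        by (intro module_homI) auto
    qed
    then have 1: "(\<lambda>t. \<theta> j (\<lambda>x. \<eta> j x t)) \<in> module_hom R (?T j) (?T j)" unfolding \<theta>_def by simp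
    show ?thesis
    proof (rule tensor_hom_eqI[OF mL assms(3) mT 1 module_hom_id _ t])
      fix v n assume v: "v \<in> carrier (?L j)" and n: "n \<in> carrier N"
      have vx: "v x \<in> carrier R" for x using v by (simp add: free_module_carrier)
      have "\<theta> j (\<lambda>x. \<eta> j x (?p j v n)) = (\<Oplus>\<^bsub>?T j\<^esub>x\<in>X j. v x \<odot>\<^bsub>?T j\<^esub> ?p j (?e x) n)"
        unfolding \<theta>_def
        using \<theta>_summand[OF _ n] vx n module_homD(3)[OF pure_tensor_hom(2)[OF mL assms(3) u] vx n]
        by (intro T.finsum_cong') (auto simp: \<eta>(2)[OF v n])
      also have "\<dots> = ?p j v n"
        using free_hom_value[OF mT pure_tensor_hom(1)[OF mL assms(3) n] C.finite_X v] by simp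
      finally show "\<theta> j (\<lambda>x. \<eta> j x (?p j v n)) = ?p j v n" .
    qed
  qed
  have d\<theta>: "?d j (\<theta> j f) = \<theta> (j - 1) (mat_act N (X j) (D j) f)" if f: "f \<in> X j \<rightarrow> carrier N" for j f
  proof -
    interpret T: plain_module R "?T (j - 1)" by (rule plain_module.intro[OF mT])
    have fx: "f x \<in> carrier N" if "x \<in> X j" for x using f that by auto
    have 1: "?d j (?p j (?e x) (f x)) = (\<Oplus>\<^bsub>?T (j - 1)\<^esub>y\<in>X (j - 1). ?p (j - 1) (?e y) (D j x y \<odot>\<^bsub>N\<^esub> f x))"
      if x: "x \<in> X j" for x
    proof -
      have "?d j (?p j (?e x) (f x)) = ?p (j - 1) (cdiff ?F j (?e x)) (f x)"
        by (rule tensor_map_pure[OF mL mL assms(3) dhom u[OF x] fx[OF x]])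
      also have "\<dots> = (\<Oplus>\<^bsub>?T (j - 1)\<^esub>y\<in>X (j - 1). D j x y \<odot>\<^bsub>?T (j - 1)\<^esub> ?p (j - 1) (?e y) (f x))"
        by (rule fin_cpx_hom_diff_unit[OF assms(1,2) x mT pure_tensor_hom(1)[OF mL assms(3) fx[OF x]]])
      also have "\<dots> = (\<Oplus>\<^bsub>?T (j - 1)\<^esub>y\<in>X (j - 1). ?p (j - 1) (?e y) (D j x y \<odot>\<^bsub>N\<^esub> f x))"
        using C.D_closed[OF x] fx[OF x] \<theta>_summand
          module_homD(3)[OF pure_tensor_hom(2)[OF mL assms(3) u] C.D_closed[OF x] fx[OF x]]
        by (intro T.M.finsum_cong') auto
      finally show ?thesis .
    qed
    have cl: "?p (j - 1) (?e y) (D j x y \<odot>\<^bsub>N\<^esub> f x) \<in> carrier (?T (j - 1))" if "x \<in> X j" "y \<in> X (j - 1)" for x y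
      using that C.D_closed fx \<theta>_summand by auto
    have "?d j (\<theta> j f) = (\<Oplus>\<^bsub>?T (j - 1)\<^esub>x\<in>X j. ?d j (?p j (?e x) (f x)))"
      unfolding \<theta>_def using f \<theta>_summand by (intro hom_sum[OF mT Td C.finite_X]) auto
    also have "\<dots> = (\<Oplus>\<^bsub>?T (j - 1)\<^esub>x\<in>X j. \<Oplus>\<^bsub>?T (j - 1)\<^esub>y\<in>X (j - 1). ?p (j - 1) (?e y) (D j x y \<odot>\<^bsub>N\<^esub> f x))"
      using cl by (intro T.M.finsum_cong' refl 1) (auto intro!: T.M.finsum_closed)
    also have "\<dots> = (\<Oplus>\<^bsub>?T (j - 1)\<^esub>y\<in>X (j - 1). \<Oplus>\<^bsub>?T (j - 1)\<^esub>x\<in>X j. ?p (j - 1) (?e y) (D j x y \<odot>\<^bsub>N\<^esub> f x))"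
      using cl by (intro T.finsum_swap C.finite_X) auto
    also have "\<dots> = \<theta> (j - 1) (mat_act N (X j) (D j) f)"
      unfolding \<theta>_def mat_act_def
    proof (intro T.M.finsum_cong' refl)
      fix y assume y: "y \<in> X (j - 1)"
      note ph = pure_tensor_hom(2)[OF mL assms(3) u[OF y]]
      have "?p (j - 1) (?e y) (\<Oplus>\<^bsub>N\<^esub>x\<in>Y. D j x y \<odot>\<^bsub>N\<^esub> f x) = (\<Oplus>\<^bsub>?T (j - 1)\<^esub>x\<in>Y. ?p (j - 1) (?e y) (D j x y \<odot>\<^bsub>N\<^esub> f x))"
        if "finite Y" "Y \<subseteq> X j" for Y using that
      proof (induction Y rule: finite_induct)
        case empty
        then show ?case using module_hom_zero[OF assms(3) mT ph] by simp
      next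
        case (insert x Y)
        have a: "(\<lambda>x. D j x y \<odot>\<^bsub>N\<^esub> f x) \<in> Y \<rightarrow> carrier N" "D j x y \<odot>\<^bsub>N\<^esub> f x \<in> carrier N"
          using insert.prems C.D_closed[OF _ y] fx by auto
        have b: "(\<lambda>x. ?p (j - 1) (?e y) (D j x y \<odot>\<^bsub>N\<^esub> f x)) \<in> Y \<rightarrow> carrier (?T (j - 1))"
          "?p (j - 1) (?e y) (D j x y \<odot>\<^bsub>N\<^esub> f x) \<in> carrier (?T (j - 1))"
          using insert.prems cl[OF _ y] by auto
        show ?case
          using insert a b module_homD(2)[OF ph a(2) N.M.finsum_closed[OF a(1)]] by simp
      qed
      then show "(\<Oplus>\<^bsub>?T (j - 1)\<^esub>x\<in>X j. ?p (j - 1) (?e y) (D j x y \<odot>\<^bsub>N\<^esub> f x)) =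
          ?p (j - 1) (?e y) (\<Oplus>\<^bsub>N\<^esub>x\<in>X j. D j x y \<odot>\<^bsub>N\<^esub> f x)" using C.finite_X by simp
    next
      show "(\<lambda>y. ?p (j - 1) (?e y) (\<Oplus>\<^bsub>N\<^esub>x\<in>X j. D j x y \<odot>\<^bsub>N\<^esub> f x)) \<in> X (j - 1) \<rightarrow> carrier (?T (j - 1))"
        using C.D_closed fx by (auto intro!: \<theta>_summand N.M.finsum_closed)
    qed
    finally show ?thesis .
  qed
  have dfun: "mat_act N (X j) (D j) f \<in> X (j - 1) \<rightarrow> carrier N" if "f \<in> X j \<rightarrow> carrier N" for j f
    using C.diff_in[OF N.carrier_is_submodule that] by auto
  have \<eta>fun: "(\<lambda>x. \<eta> j x t) \<in> X j \<rightarrow> carrier N" if "t \<in> carrier (?T j)" for j t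
    using module_homD(1)[OF \<eta>(1) that] by auto
  have \<theta>0: "\<theta> j f = \<zero>\<^bsub>?T j\<^esub>" if "\<And>x. x \<in> X j \<Longrightarrow> f x = \<zero>\<^bsub>N\<^esub>" for j f
  proof -
    interpret T: module R "?T j" by (rule mT)
    have "\<theta> j f = (\<Oplus>\<^bsub>?T j\<^esub>x\<in>X j. \<zero>\<^bsub>?T j\<^esub>)"
      unfolding \<theta>_def using that module_hom_zero[OF assms(3) mT pure_tensor_hom(2)[OF mL assms(3) u]]
      by (intro T.finsum_cong') auto
    then show ?thesis by simp
  qed
  show ?thesis
    unfolding zero_homology_tensor_complex_iff[OF ch assms(3)] fin_cpx_simps(1) exact_at_def
  proof (intro iffI ballI impI, goal_cases)
    case (1 f)
    have f: "f \<in> X i \<rightarrow> carrier N" by fact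
    have "?d i (\<theta> i f) = \<zero>\<^bsub>?T (i - 1)\<^esub>" unfolding d\<theta>[OF f] using 1(3) by (intro \<theta>0) simp
    then obtain s where s: "s \<in> carrier (?T (i + 1))" "tensor_map R (?L (i + 1)) (?L i) N (cdiff ?F (i + 1)) s = \<theta> i f"
      using bspec[OF 1(1) \<theta>_closed[OF f]] by auto
    show ?case
    proof (intro bexI[OF _ \<eta>fun[OF s(1)]] ballI)
      fix x assume x: "x \<in> X i"
      let ?g = "\<lambda>x. \<eta> (i + 1) x s"
      have "\<theta> i (mat_act N (X (i + 1)) (D (i + 1)) ?g) = \<theta> i f"
        using d\<theta>[OF \<eta>fun[OF s(1)]] \<theta>\<eta>[OF s(1)] s(2) by simp
      then have "\<eta> i x (\<theta> i (mat_act N (X (i + 1)) (D (i + 1)) ?g)) = \<eta> i x (\<theta> i f)" by simp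
      then have "mat_act N (X (i + 1)) (D (i + 1)) ?g x = f x"
        using \<eta>\<theta>[OF _ x] f dfun[OF \<eta>fun[OF s(1)]] by simp
      then show "f x \<ominus>\<^bsub>N\<^esub> mat_act N (X (i + 1)) (D (i + 1)) ?g x \<in> {\<zero>\<^bsub>N\<^esub>}"
        using funcset_mem[OF f x] by simp
    qed
  next
    case (2 t)
    have t: "t \<in> carrier (?T i)" by fact
    let ?f = "\<lambda>x. \<eta> i x t"
    have f: "?f \<in> X i \<rightarrow> carrier N" by (rule \<eta>fun[OF t])
    have "mat_act N (X i) (D i) ?f y \<in> {\<zero>\<^bsub>N\<^esub>}" if y: "y \<in> X (i - 1)" for y
    proof -
      have "mat_act N (X i) (D i) ?f y = \<eta> (i - 1) y (\<theta> (i - 1) (mat_act N (X i) (D i) ?f))"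
        by (rule \<eta>\<theta>[OF dfun[OF f] y, symmetric])
      also have "\<dots> = \<eta> (i - 1) y (?d i t)" using d\<theta>[OF f] \<theta>\<eta>[OF t] by simp
      also have "\<dots> = \<zero>\<^bsub>N\<^esub>" using 2(3) module_hom_zero[OF mT assms(3) \<eta>(1)] by simp
      finally show ?thesis by simp
    qed
    with bspec[OF 2(1) f] obtain g where g: "g \<in> X (i + 1) \<rightarrow> carrier N"
      "\<forall>x\<in>X i. ?f x \<ominus>\<^bsub>N\<^esub> mat_act N (X (i + 1)) (D (i + 1)) g x \<in> {\<zero>\<^bsub>N\<^esub>}" by auto
    have dg: "mat_act N (X (i + 1)) (D (i + 1)) g \<in> X i \<rightarrow> carrier N" using dfun[OF g(1)] by simp
    have "?f x = mat_act N (X (i + 1)) (D (i + 1)) g x" if x: "x \<in> X i" for x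
      using bspec[OF g(2) x] N.minus_eq_zero_iff[OF funcset_mem[OF f x] funcset_mem[OF dg x]] by simp
    then have "\<theta> i ?f = \<theta> i (mat_act N (X (i + 1)) (D (i + 1)) g)" by (rule \<theta>_cong[OF f])
    then have "tensor_map R (?L (i + 1)) (?L i) N (cdiff ?F (i + 1)) (\<theta> (i + 1) g) = t"
      using d\<theta>[OF g(1)] \<theta>\<eta>[OF t] by simp
    then show ?case using \<theta>_closed[OF g(1)] by (rule bexI)
  qed
qed


section \<open>The standard resolution\<close>

lemma combination_value_Nil [simp]: "combination_value R [] = (\<lambda>_. \<zero>\<^bsub>R\<^esub>)"
  and combination_value_Cons [simp]: "combination_value R ((a, b) # l) =
    (combination_value R l)(b := a \<oplus>\<^bsub>R\<^esub> combination_value R l b)"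
  by (simp_all add: combination_value_def)

lemma combination_value_closed:
  assumes "cring R" "l \<in> lists (carrier R \<times> Y)"
  shows "combination_value R l \<in> carrier (free_module R Y)"
  using assms(2)
proof (induction l)
  case Nil
  interpret cring R by fact
  show ?case by (simp add: free_module_carrier)
next
  case (Cons p l)
  interpret cring R by fact
  obtain a b where p: "p = (a, b)" "a \<in> carrier R" "b \<in> Y" using Cons.hyps by auto
  let ?f = "combination_value R l"
  have "{x. (?f(b := a \<oplus>\<^bsub>R\<^esub> ?f b)) x \<noteq> \<zero>\<^bsub>R\<^esub>} \<subseteq> insert b {x. ?f x \<noteq> \<zero>\<^bsub>R\<^esub>}" by auto
  moreover have "finite (insert b {x. ?f x \<noteq> \<zero>\<^bsub>R\<^esub>})" using Cons.IH by (simp add: free_module_carrier)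
  ultimately have "finite {x. (?f(b := a \<oplus>\<^bsub>R\<^esub> ?f b)) x \<noteq> \<zero>\<^bsub>R\<^esub>}" by (rule finite_subset)
  then show ?case using Cons.IH p by (auto simp: free_module_carrier)
qed

text \<open>Exactness of the standard resolution rests on this: its basis elements are lists, so
  each kernel element must be the value of some list. One term is prepended per element of a finite
  set containing the support.\<close>

lemma combination_value_surj:
  fixes f :: "'b \<Rightarrow> 'a"
  assumes "cring R" "f \<in> carrier (free_module R Y)"
  obtains l where "l \<in> lists (carrier R \<times> Y)" "combination_value R l = f"
proof -
  interpret cring R by fact
  have "\<forall>f\<in>carrier (free_module R Y). {x. f x \<noteq> \<zero>\<^bsub>R\<^esub>} \<subseteq> T \<longrightarrow>
      (\<exists>l\<in>lists (carrier R \<times> Y). combination_value R l = f)" if "finite T" for T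
    using that
  proof (induction T rule: finite_induct)
    case empty
    show ?case
    proof (intro ballI impI)
      fix f :: "'b \<Rightarrow> 'a" assume "{x. f x \<noteq> \<zero>\<^bsub>R\<^esub>} \<subseteq> {}"
      then have "f = combination_value R []" by auto
      then show "\<exists>l\<in>lists (carrier R \<times> Y). combination_value R l = f" by (intro bexI[of _ "[]"]) auto
    qed
  next
    case (insert x T)
    show ?case
    proof (intro ballI impI)
      fix f assume f: "f \<in> carrier (free_module R Y)" and sub: "{y. f y \<noteq> \<zero>\<^bsub>R\<^esub>} \<subseteq> insert x T"
      show "\<exists>l\<in>lists (carrier R \<times> Y). combination_value R l = f"
      proof (cases "x \<in> Y")
        case False
        then have "{y. f y \<noteq> \<zero>\<^bsub>R\<^esub>} \<subseteq> T" using f sub by (auto simp: free_module_carrier)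
        then show ?thesis using bspec[OF insert.IH f] by simp
      next
        case True
        let ?f = "f(x := \<zero>\<^bsub>R\<^esub>)"
        have "{y. ?f y \<noteq> \<zero>\<^bsub>R\<^esub>} \<subseteq> {y. f y \<noteq> \<zero>\<^bsub>R\<^esub>}" by auto
        moreover have "finite {y. f y \<noteq> \<zero>\<^bsub>R\<^esub>}" using f by (simp add: free_module_carrier)
        ultimately have "finite {y. ?f y \<noteq> \<zero>\<^bsub>R\<^esub>}" by (rule finite_subset)
        then have f': "?f \<in> carrier (free_module R Y)" using f by (auto simp: free_module_carrier)
        have "{y. ?f y \<noteq> \<zero>\<^bsub>R\<^esub>} \<subseteq> T" using sub by auto
        from mp[OF bspec[OF insert.IH f'] this]
        obtain l where l: "l \<in> lists (carrier R \<times> Y)" "combination_value R l = ?f" by (elim bexE) (rule that)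
        have fx: "f x \<in> carrier R" using f by (simp add: free_module_carrier)
        show ?thesis
          using l fx True by (intro bexI[of _ "(f x, x) # l"]) (auto simp: fun_eq_iff)
      qed
    qed
  qed
  moreover have "finite {x. f x \<noteq> \<zero>\<^bsub>R\<^esub>}" using assms(2) by (simp add: free_module_carrier)
  ultimately have "\<exists>l\<in>lists (carrier R \<times> Y). combination_value R l = f" using assms(2) by simp
  then show thesis by (elim bexE) (rule that)
qed

lemma syz_basis_Suc:
  "s \<in> syz_basis R M (Suc n) \<longleftrightarrow> (\<exists>l. s = Syz l \<and> l \<in> lists (carrier R \<times> syz_basis R M n) \<and>
    (if n = 0 then std_aug R M (combination_value R l) = \<zero>\<^bsub>M\<^esub>
     else std_diff R (combination_value R l) = (\<lambda>_. \<zero>\<^bsub>R\<^esub>)))"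
  by auto

declare syz_basis.simps(2) [simp del]

definition std_basis :: "('a, 'r) ring_scheme \<Rightarrow> ('a, 'm) module \<Rightarrow> int \<Rightarrow> ('a, 'm) syz set" where
  "std_basis R M i = (if i < 0 then {} else syz_basis R M (nat i))"

lemma std_resolution_simps:
  "cobj (std_resolution R M) i = free_module R (std_basis R M i)" "cdiff (std_resolution R M) i = std_diff R"
  by (simp_all add: std_resolution_def std_basis_def)

text \<open>\<open>std_diff\<close> is a sum computed in the free module on the whole index type;
  this lemma allows it to be regarded as a map into the free module on the preceding basis.\<close>

lemma linear_extension_sub_hom:
  assumes "module R M" "submodule A R M" "g \<in> X \<rightarrow> A"
  shows "linear_extension R M g \<in> module_hom R (free_module R X) (M\<lparr>carrier := A\<rparr>)"
proof -
  interpret plain_module R M by (rule plain_module.intro) fact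
  have g: "g \<in> X \<rightarrow> carrier M" using assms(3) submoduleD(1)[OF assms(2)] by auto
  note h = module_homD[OF linear_extension_hom[OF g]]
  show ?thesis
  proof (rule module_homI)
    fix f assume f: "f \<in> carrier (free_module R X)"
    have "{x. f x \<noteq> \<zero>\<^bsub>R\<^esub>} \<subseteq> X" "\<forall>x. f x \<in> carrier R" using f by (auto simp: free_module_carrier)
    then have "(\<Oplus>\<^bsub>M\<^esub>x\<in>{x. f x \<noteq> \<zero>\<^bsub>R\<^esub>}. f x \<odot>\<^bsub>M\<^esub> g x) \<in> A"
      using assms(3) submoduleD(6)[OF assms(2)]
      by (intro finsum_in_submodule[OF assms(2)]) (auto simp: subset_iff Pi_iff)
    then show "linear_extension R M g f \<in> carrier (M\<lparr>carrier := A\<rparr>)"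
      by (simp add: linear_extension_def)
  qed (simp_all add: h del: free_module_simps)
qed

lemma free_module_sub:
  fixes Y :: "'b set"
  assumes "cring R"
  shows "submodule (carrier (free_module R Y)) R (free_module R UNIV)"
proof -
  interpret cring R by fact
  interpret A: module R "free_module R Y" by (rule module_free)
  interpret B: module R "free_module R (UNIV :: 'b set)" by (rule module_free)
  have eq: "free_module R (UNIV :: 'b set)\<lparr>carrier := carrier (free_module R Y)\<rparr> = free_module R Y"
    by (simp add: free_module_def mk_module_def)
  show ?thesis
    by (rule B.module_incl_imp_submodule) (simp_all add: eq A.module_axioms free_module_mono)
qed

lemma free_module_restrict:
  "free_module R UNIV\<lparr>carrier := carrier (free_module R Y)\<rparr> = free_module R Y"
  by (simp add: free_module_def mk_module_def)

lemma std_diff_hom: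
  assumes "cring R" "\<And>s. s \<in> X \<Longrightarrow> syz_boundary R s \<in> carrier (free_module R Y)"
  shows "std_diff R \<in> module_hom R (free_module R X) (free_module R Y)"
  using linear_extension_sub_hom[OF cring.module_free[OF assms(1)] free_module_sub[OF assms(1)], of "syz_boundary R" X Y] assms(2)
  unfolding std_diff_def free_module_restrict by auto

lemma std_diff_unit:
  assumes "cring R" "syz_boundary R s \<in> carrier (free_module R UNIV)"
  shows "std_diff R (unit_vector R s) = syz_boundary R s"
proof -
  interpret cring R by fact
  interpret F: plain_module R "free_module R (UNIV :: ('a, 'c) syz set)" by (rule plain_module.intro[OF module_free])
  show ?thesis unfolding std_diff_def by (rule F.linear_extension_unit[of s "{s}"]) (use assms(2) in auto)
qed

lemma std_resolution_left_resolution: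
  fixes M :: "('a, 'm) module"
  assumes "module R M"
  shows "left_resolution R (std_resolution R M) (std_aug R M) M"
proof -
  interpret M: plain_module R M by (rule plain_module.intro) fact
  let ?B = "std_basis R M" and ?S = "syz_basis R M"
  note cr = M.R.cring_axioms
  have mF: "module R (free_module R Y)" for Y :: "('a, 'm) syz set" by (rule M.module_free)
  have bS: "syz_boundary R (Syz l) = combination_value R l" for l :: "('a \<times> ('a, 'm) syz) list"
    by (simp add: syz_boundary_def)
  have b1: "syz_boundary R s \<in> carrier (free_module R (?S n))" if s: "s \<in> ?S (Suc n)" for s n
  proof -
    obtain l where l: "s = Syz l" "l \<in> lists (carrier R \<times> ?S n)"
      using s unfolding syz_basis_Suc by (elim exE conjE) (rule that)
    show ?thesis unfolding l(1) bS by (rule combination_value_closed[OF cr l(2)])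
  qed
  have b0: "syz_boundary R s = (\<lambda>_. \<zero>\<^bsub>R\<^esub>)" if "s \<in> ?S 0" for s
    using that by (auto simp: syz_boundary_def)
  have zero_in: "(\<lambda>_. \<zero>\<^bsub>R\<^esub>) \<in> carrier (free_module R Y)" for Y :: "('a, 'm) syz set"
    by (simp add: free_module_carrier)
  have bi: "syz_boundary R s \<in> carrier (free_module R (?B (i - 1)))" if s: "s \<in> ?B i" for s i
  proof (cases "i \<le> 0")
    case True
    then have "i = 0" using s by (auto simp: std_basis_def split: if_splits)
    then show ?thesis using s b0 zero_in by (simp add: std_basis_def)
  next
    case False
    define n where "n = nat (i - 1)"
    have i: "i = int (Suc n)" using False by (simp add: n_def)
    show ?thesis using b1[of s n] s by (simp add: i std_basis_def nat_add_distrib)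
  qed
  have bU: "syz_boundary R s \<in> carrier (free_module R UNIV)" if "s \<in> ?B i" for s i
    using bi[OF that] free_module_mono[of "?B (i - 1)" UNIV R] by auto
  have dhom: "std_diff R \<in> module_hom R (free_module R (?B i)) (free_module R (?B (i - 1)))" for i
    by (rule std_diff_hom[OF cr bi])
  have du: "std_diff R (unit_vector R s) = syz_boundary R s" if "s \<in> ?B i" for s i
    by (rule std_diff_unit[OF cr bU[OF that]])
  have zhom: "(\<lambda>_. \<zero>\<^bsub>K\<^esub>) \<in> module_hom R (free_module R Y) K" if "module R K" for K :: "('a, 'k) module" and Y :: "('a, 'm) syz set"
  proof -
    interpret K: module R K by (rule that)
    show ?thesis by (rule module_homI) auto
  qed
  have d0: "std_diff R f = (\<lambda>_. \<zero>\<^bsub>R\<^esub>)" if f: "f \<in> carrier (free_module R (?B 0))" for f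
  proof -
    have "std_diff R f = \<zero>\<^bsub>free_module R (?B (0 - 1))\<^esub>"
      by (rule free_hom_eqI[OF mF dhom zhom[OF mF] _ f]) (use du[of _ 0] b0 in \<open>simp add: std_basis_def\<close>)
    then show ?thesis by simp
  qed
  have dd: "std_diff R (std_diff R f) = (\<lambda>_. \<zero>\<^bsub>R\<^esub>)" if f: "f \<in> carrier (free_module R (?B i))" for f i
  proof -
    have "std_diff R (std_diff R f) = \<zero>\<^bsub>free_module R (?B (i - 1 - 1))\<^esub>"
    proof (rule free_hom_eqI[OF mF module_hom_comp[OF dhom dhom] zhom[OF mF] _ f])
      fix s assume s: "s \<in> ?B i"
      have e: "std_diff R (std_diff R (unit_vector R s)) = std_diff R (syz_boundary R s)" using du[OF s] by simp
      \<comment> \<open>From degree 2 on the condition built into \<open>syz_basis\<close> gives the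
        claim; in degrees 0 and 1 it holds because the differential out of degree 0 is zero.\<close>
      show "std_diff R (std_diff R (unit_vector R s)) = \<zero>\<^bsub>free_module R (?B (i - 1 - 1))\<^esub>"
      proof (cases "i \<le> 1")
        case True
        show ?thesis
        proof (cases "i = 1")
          case True
          then show ?thesis unfolding e using d0 bi[OF s] by simp
        next
          case False
          then have "i = 0" using s True by (auto simp: std_basis_def split: if_splits)
          then have "syz_boundary R s = (\<lambda>_. \<zero>\<^bsub>R\<^esub>)" using s b0 by (simp add: std_basis_def)
          then show ?thesis unfolding e using d0[OF zero_in] by simp
        qed
      next
        case False
        define n where "n = nat (i - 2)"
        have i: "i = int (Suc (Suc n))" using False by (simp add: n_def)
        have "s \<in> ?S (Suc (Suc n))" using s by (simp add: i std_basis_def nat_add_distrib)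
        then show ?thesis unfolding e syz_basis_Suc[of s R M "Suc n"] by (auto simp: bS)
      qed
    qed
    then show ?thesis by simp
  qed
  have ch: "chain_complex R (std_resolution R M)"
    unfolding chain_complex_def std_resolution_simps using mF dhom dd by simp
  let ?a = "\<lambda>s. case s of Gen m \<Rightarrow> m | Syz l \<Rightarrow> \<zero>\<^bsub>M\<^esub>"
  have aP: "?a \<in> ?B 0 \<rightarrow> carrier M" by (auto simp: std_basis_def)
  have ahom: "std_aug R M \<in> module_hom R (free_module R (?B 0)) M"
    unfolding std_aug_def by (rule M.linear_extension_hom[OF aP])
  have au: "std_aug R M (unit_vector R (Gen m)) = m" if "m \<in> carrier M" for m
    unfolding std_aug_def using M.linear_extension_unit[OF _ aP, of "Gen m"] that by (simp add: std_basis_def)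
  have asurj: "std_aug R M ` carrier (free_module R (?B 0)) = carrier M"
  proof
    show "std_aug R M ` carrier (free_module R (?B 0)) \<subseteq> carrier M" using module_homD(1)[OF ahom] by auto
    show "carrier M \<subseteq> std_aug R M ` carrier (free_module R (?B 0))"
    proof
      fix m assume m: "m \<in> carrier M"
      have "unit_vector R (Gen m) \<in> carrier (free_module R (?B 0))"
        by (rule M.unit_vector_closed) (use m in \<open>simp add: std_basis_def\<close>)
      then show "m \<in> std_aug R M ` carrier (free_module R (?B 0))" using au[OF m] by (metis imageI)
    qed
  qed
  have dhom1: "std_diff R \<in> module_hom R (free_module R (?B 1)) (free_module R (?B 0))" using dhom[of 1] by simp
  have ad: "std_aug R M (std_diff R f) = \<zero>\<^bsub>M\<^esub>" if f: "f \<in> carrier (free_module R (?B 1))" for f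
  proof (rule free_hom_eqI[OF assms module_hom_comp[OF dhom1 ahom] zhom[OF assms] _ f])
    fix s assume s: "s \<in> ?B 1"
    then have "s \<in> ?S (Suc 0)" by (simp add: std_basis_def)
    then show "std_aug R M (std_diff R (unit_vector R s)) = \<zero>\<^bsub>M\<^esub>"
      unfolding du[OF s] syz_basis_Suc by (auto simp: bS)
  qed
  \<comment> \<open>A kernel element \<open>f\<close> is the value of some list \<open>l\<close>;
    then \<open>Syz l\<close> is by construction a basis element one degree higher, with boundary
    \<open>f\<close>.\<close>
  have lift: "\<exists>g\<in>carrier (free_module R (?B (int n + 1))). f = std_diff R g"
    if f: "f \<in> carrier (free_module R (?B (int n)))"
      and z: "if n = 0 then std_aug R M f = \<zero>\<^bsub>M\<^esub> else std_diff R f = (\<lambda>_. \<zero>\<^bsub>R\<^esub>)" for f n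
  proof -
    obtain l where l: "l \<in> lists (carrier R \<times> ?S n)" "combination_value R l = f"
      by (rule combination_value_surj[OF cr, of f "?S n"]) (use f in \<open>simp_all add: std_basis_def\<close>)
    have "Syz l \<in> ?S (Suc n)" unfolding syz_basis_Suc using l z by simp
    then have s: "Syz l \<in> ?B (int n + 1)" by (simp add: std_basis_def nat_add_distrib)
    show ?thesis
      using du[OF s] M.unit_vector_closed[OF s] l(2) by (intro bexI[of _ "unit_vector R (Syz l)"]) (simp_all add: bS)
  qed
  show ?thesis
    unfolding left_resolution_def
  proof (intro conjI allI impI)
    show "chain_complex R (std_resolution R M)" by (rule ch)
    show "zero_module (cobj (std_resolution R M) i)" if "i < 0" for i
      using that by (auto simp: zero_module_def std_resolution_simps std_basis_def free_module_carrier fun_eq_iff)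
    show "std_aug R M \<in> module_hom R (cobj (std_resolution R M) 0) M"
      unfolding std_resolution_simps by (rule ahom)
    show "std_aug R M ` carrier (cobj (std_resolution R M) 0) = carrier M"
      unfolding std_resolution_simps by (rule asurj)
    show "{x \<in> carrier (cobj (std_resolution R M) 0). std_aug R M x = \<zero>\<^bsub>M\<^esub>} = boundaries (std_resolution R M) 0"
      unfolding boundaries_def std_resolution_simps
      using lift[of _ 0] ad module_homD(1)[OF dhom1] by auto
    fix i :: int assume i: "0 < i"
    show "cycles (std_resolution R M) i = boundaries (std_resolution R M) i"
    proof
      show "boundaries (std_resolution R M) i \<subseteq> cycles (std_resolution R M) i"
        by (rule boundaries_subset_cycles[OF ch])
      show "cycles (std_resolution R M) i \<subseteq> boundaries (std_resolution R M) i"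
        unfolding cycles_def boundaries_def std_resolution_simps using lift[of _ "nat i"] i by auto
    qed
  qed
qed

section \<open>Finite free resolutions\<close>

definition fin_resolution ::
  "('a, 'r) ring_scheme \<Rightarrow> (int \<Rightarrow> 'x set) \<Rightarrow> (int \<Rightarrow> 'x \<Rightarrow> 'x \<Rightarrow> 'a) \<Rightarrow> (('x \<Rightarrow> 'a) \<Rightarrow> 'm) \<Rightarrow> ('a, 'm) module \<Rightarrow> bool" where
  "fin_resolution R X D e M \<longleftrightarrow> fin_free_complex R X D \<and> (\<forall>i<0. X i = {}) \<and> left_resolution R (fin_cpx R X D) e M"

text \<open>\<open>Tor\<close> is computed from the standard resolution, whose bases are usually
  infinite. Comparison with a finite resolution in both directions turns its vanishing into matrix
  exactness.\<close>

lemma zero_Tor_iff: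
  assumes "module R M" "module R N" "fin_resolution R X D e M"
  shows "zero_module (Tor R i M N) \<longleftrightarrow> exact_at N X D (carrier N) {\<zero>\<^bsub>N\<^esub>} (int i)"
proof -
  have cr: "cring R" using assms(1) by (simp add: module_def)
  have L: "fin_free_complex R X D" "left_resolution R (fin_cpx R X D) e M"
    using assms(3) by (simp_all add: fin_resolution_def)
  note S = std_resolution_left_resolution[OF assms(1)]
  show ?thesis
    unfolding Tor_def zero_homology_tensor_fin_cpx_iff[OF cr L(1) assms(2), symmetric]
    using tensor_complex_independent_of_resolution[OF cr assms(1,2) S L(2) std_resolution_simps(1) fin_cpx_simps(1)]
      tensor_complex_independent_of_resolution[OF cr assms(1,2) L(2) S fin_cpx_simps(1) std_resolution_simps(1)]
    by (rule iffI)
qed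

lemma zero_Ext_iff:
  assumes "module R M" "module R N" "fin_resolution R X D e M"
  shows "zero_module (Ext R i M N) \<longleftrightarrow>
    exact_at N (transpose_basis X) (transpose_diff D) (carrier N) {\<zero>\<^bsub>N\<^esub>} (- int i)"
proof -
  have cr: "cring R" using assms(1) by (simp add: module_def)
  have L: "fin_free_complex R X D" "left_resolution R (fin_cpx R X D) e M"
    using assms(3) by (simp_all add: fin_resolution_def)
  note S = std_resolution_left_resolution[OF assms(1)]
  show ?thesis
    unfolding Ext_def zero_homology_hom_fin_cpx_iff[OF cr L(1) assms(2), symmetric]
    using hom_complex_independent_of_resolution[OF cr assms(1,2) S L(2) std_resolution_simps(1) fin_cpx_simps(1)]
      hom_complex_independent_of_resolution[OF cr assms(1,2) L(2) S fin_cpx_simps(1) std_resolution_simps(1)]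
    by (rule iffI)
qed


lemma coordinate_hom:
  assumes "cring R"
  shows "(\<lambda>f. f z) \<in> module_hom R (free_module R Y) (regular_module R)"
  by (rule module_homI) (simp_all add: free_module_carrier)

text \<open>Matrix entries are recovered from homomorphisms by evaluation at unit vectors, so
  resolutions can be built from maps and then used as matrices.\<close>

lemma
  assumes "cring R" and fin: "\<And>i. finite (X i)"
    and q: "\<And>i. q i \<in> module_hom R (free_module R (X i)) (free_module R (X (i - 1)))"
    and qq: "\<And>i f. f \<in> carrier (free_module R (X i)) \<Longrightarrow> q (i - 1) (q i f) = (\<lambda>_. \<zero>\<^bsub>R\<^esub>)"
  shows fin_free_complex_of_homs: "fin_free_complex R X (\<lambda>i x y. q i (unit_vector R x) y)"
    and fin_cpx_diff_of_homs: "f \<in> carrier (free_module R (X i)) \<Longrightarrow>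
      cdiff (fin_cpx R X (\<lambda>i x y. q i (unit_vector R x) y)) i f = q i f"
proof -
  interpret cring R by fact
  let ?D = "\<lambda>i x y. q i (unit_vector R x) y"
  have qu: "q i (unit_vector R x) \<in> carrier (free_module R (X (i - 1)))" if "x \<in> X i" for i x
    by (rule module_homD(1)[OF q unit_vector_closed[OF that]])
  show ff: "fin_free_complex R X ?D"
    unfolding fin_free_complex_def
  proof (intro allI conjI ballI fin)
    fix i x assume x: "x \<in> X i"
    show "?D i x y \<in> carrier R" for y using qu[OF x] by (simp add: free_module_carrier)
    fix z
    have c: "(\<lambda>f. q (i - 1) f z) \<in> module_hom R (free_module R (X (i - 1))) (regular_module R)"
      by (rule module_hom_comp[OF q coordinate_hom[OF assms(1)]])
    have "q (i - 1) (q i (unit_vector R x)) z = (\<Oplus>\<^bsub>R\<^esub>y\<in>X (i - 1). ?D i x y \<otimes>\<^bsub>R\<^esub> ?D (i - 1) y z)"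
      using free_hom_value[OF module_regular c fin qu[OF x]] by (simp add: finsum_regular)
    then show "(\<Oplus>\<^bsub>R\<^esub>y\<in>X (i - 1). ?D i x y \<otimes>\<^bsub>R\<^esub> ?D (i - 1) y z) = \<zero>\<^bsub>R\<^esub>"
      using qq[OF unit_vector_closed[OF x]] by simp
  qed
  have d: "cdiff (fin_cpx R X ?D) i \<in> module_hom R (free_module R (X i)) (free_module R (X (i - 1)))"
    using chain_complexD(2)[OF chain_complex_fin_cpx[OF assms(1) ff], of i] by (simp only: fin_cpx_simps(1))
  show "cdiff (fin_cpx R X ?D) i f = q i f" if f: "f \<in> carrier (free_module R (X i))"
  proof (rule free_hom_eqI[OF module_free d q _ f])
    fix x assume x: "x \<in> X i"
    show "cdiff (fin_cpx R X ?D) i (unit_vector R x) = q i (unit_vector R x)"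
      unfolding fin_cpx_diff_unit[OF assms(1) ff x] using qu[OF x] by (auto simp: free_module_carrier)
  qed
qed

section \<open>Finite generation over Noetherian rings\<close>

lemma submodule_regular_ideal:
  assumes "cring R" "submodule H R (regular_module R)"
  shows "ideal H R"
proof -
  interpret cring R by fact
  interpret M: module R "regular_module R" by (rule module_regular)
  note H = M.submoduleD[OF assms(2), simplified]
  have inv: "\<ominus>\<^bsub>R\<^esub> x \<in> H" if "x \<in> H" for x
  proof -
    have "\<ominus>\<^bsub>R\<^esub> \<one>\<^bsub>R\<^esub> \<otimes>\<^bsub>R\<^esub> x = \<ominus>\<^bsub>R\<^esub> x" using H(1)[OF that] by (simp add: l_minus)
    then show ?thesis using H(6)[of "\<ominus>\<^bsub>R\<^esub> \<one>\<^bsub>R\<^esub>" x] that by simp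
  qed
  show ?thesis
  proof (rule idealI)
    show "ring R" by (rule ring_axioms)
    show "subgroup H (add_monoid R)"
      by (rule add.subgroupI) (use H inv in auto)
    fix a x assume a: "a \<in> H" and x: "x \<in> carrier R"
    show "x \<otimes>\<^bsub>R\<^esub> a \<in> H" using H(6)[OF x a] .
    then show "a \<otimes>\<^bsub>R\<^esub> x \<in> H" using m_comm[OF x H(1)[OF a]] by simp
  qed
qed

lemma submodule_image_submodule:
  assumes "module R M" "module R N" "f \<in> module_hom R M N" "submodule K R M"
  shows "submodule (f ` K) R N"
proof -
  note K = module.submoduleD(1)[OF assms(1,4)]
  have "f \<in> module_hom R (M\<lparr>carrier := K\<rparr>) N"
    using module_homD[OF assms(3)] K by (intro module_homI) auto
  from submodule_image[OF submodule.submodule_is_module[OF assms(4,1)] assms(2) this]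
  show ?thesis by simp
qed

lemma submodule_Int_kernel:
  assumes "module R M" "module R N" "f \<in> module_hom R M N" "submodule K R M"
  shows "submodule {v \<in> K. f v = \<zero>\<^bsub>N\<^esub>} R M"
proof -
  interpret M: module R M by fact
  interpret N: module R N by fact
  note K = M.submoduleD[OF assms(4)] and L = M.submoduleD[OF submodule_kernel[OF assms(1-3)]]
  have "{v \<in> K. f v = \<zero>\<^bsub>N\<^esub>} = K \<inter> {v \<in> carrier M. f v = \<zero>\<^bsub>N\<^esub>}" using K(1) by auto
  moreover have "submodule (K \<inter> {v \<in> carrier M. f v = \<zero>\<^bsub>N\<^esub>}) R M"
  proof (rule M.submoduleI)
    show "\<zero>\<^bsub>M\<^esub> \<in> K \<inter> {v \<in> carrier M. f v = \<zero>\<^bsub>N\<^esub>}" using K(2) L(2) by simp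
    show "\<ominus>\<^bsub>M\<^esub> x \<in> K \<inter> {v \<in> carrier M. f v = \<zero>\<^bsub>N\<^esub>}" if "x \<in> K \<inter> {v \<in> carrier M. f v = \<zero>\<^bsub>N\<^esub>}" for x
      using K(4)[of x] L(4)[of x] that by simp
    show "x \<oplus>\<^bsub>M\<^esub> y \<in> K \<inter> {v \<in> carrier M. f v = \<zero>\<^bsub>N\<^esub>}"
      if "x \<in> K \<inter> {v \<in> carrier M. f v = \<zero>\<^bsub>N\<^esub>}" "y \<in> K \<inter> {v \<in> carrier M. f v = \<zero>\<^bsub>N\<^esub>}" for x y
      using K(3)[of x y] L(3)[of x y] that by simp
    show "a \<odot>\<^bsub>M\<^esub> x \<in> K \<inter> {v \<in> carrier M. f v = \<zero>\<^bsub>N\<^esub>}"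
      if "a \<in> carrier R" "x \<in> K \<inter> {v \<in> carrier M. f v = \<zero>\<^bsub>N\<^esub>}" for a x
      using K(6)[of a x] L(6)[of a x] that by simp
  qed auto
  ultimately show ?thesis by simp
qed

text \<open>Induction on the basis: the coordinates at the new element \<open>x\<close> form an
  ideal generated by the coordinates of finitely many members of \<open>K\<close>, and the members
  with coordinate zero fall under the induction hypothesis. Spans are taken in the free module on
  the whole type to keep the ambient module fixed.\<close>

lemma noetherian_submodule_free_finitely_generated:
  fixes Y :: "'x set"
  assumes "cring R" "noetherian_ring R" "finite Y"
    and "submodule K R (free_module R UNIV)" "K \<subseteq> carrier (free_module R Y)"
  shows "\<exists>S. finite S \<and> S \<subseteq> K \<and> span_module R (free_module R UNIV) S = K"
  using assms(3-5)
proof (induction Y arbitrary: K rule: finite_induct)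
  case empty
  interpret cring R by fact
  interpret F: module R "free_module R (UNIV :: 'x set)" by (rule module_free)
  have "K \<subseteq> {\<lambda>_. \<zero>\<^bsub>R\<^esub>}" using empty.prems(2) by (auto simp: free_module_carrier subset_iff)
  moreover have "(\<lambda>_. \<zero>\<^bsub>R\<^esub>) \<in> K" using F.submoduleD(2)[OF empty.prems(1)] by simp
  ultimately have K: "K = {\<lambda>_. \<zero>\<^bsub>R\<^esub>}" by auto
  have "span_module R (free_module R UNIV) K \<subseteq> K" by (rule span_module_minimal[OF empty.prems(1)]) simp
  then have "span_module R (free_module R UNIV) K = K" using span_module_superset[of K] by auto
  then show ?case by (intro exI[of _ K]) (simp add: K)
next
  case (insert x Y)
  interpret cring R by fact
  interpret noetherian_ring R by fact
  let ?F = "free_module R (UNIV :: 'x set)" and ?R = "regular_module R"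
  interpret F: module R ?F by (rule module_free)
  let ?c = "\<lambda>f :: 'x \<Rightarrow> 'a. f x"
  have c: "?c \<in> module_hom R ?F ?R" by (rule coordinate_hom) fact
  note K = F.submoduleD[OF insert.prems(1)]
  have "ideal (?c ` K) R"
    by (rule submodule_regular_ideal[OF assms(1) submodule_image_submodule[OF F.module_axioms module_regular c insert.prems(1)]])
  from finetely_gen[OF this] obtain A where A: "A \<subseteq> carrier R" "finite A" "?c ` K = Idl\<^bsub>R\<^esub> A" by auto
  have AK: "A \<subseteq> ?c ` K" unfolding A(3) by (rule genideal_self[OF A(1)])
  obtain B where B: "B \<subseteq> K" "finite B" "A = ?c ` B" using finite_subset_image[OF A(2) AK] by auto
  let ?K = "{v \<in> K. ?c v = \<zero>\<^bsub>R\<^esub>}"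
  have subK: "submodule ?K R ?F"
    using submodule_Int_kernel[OF F.module_axioms module_regular c insert.prems(1)] by simp
  have "?K \<subseteq> carrier (free_module R Y)"
    using insert.prems(2) by (auto simp: free_module_carrier subset_iff)
  from insert.IH[OF subK this] obtain S where S: "finite S" "S \<subseteq> ?K" "span_module R ?F S = ?K" by auto
  let ?S = "S \<union> B"
  have SK: "?S \<subseteq> K" using S(2) B(1) by auto
  have SF: "?S \<subseteq> carrier ?F" using SK K(1) by auto
  note sp = submodule_span[OF F.module_axioms SF]
  note spD = F.submoduleD[OF sp]
  have "ideal (?c ` span_module R ?F ?S) R"
    by (rule submodule_regular_ideal[OF assms(1) submodule_image_submodule[OF F.module_axioms module_regular c sp]])
  moreover have "A \<subseteq> ?c ` span_module R ?F ?S"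
    unfolding B(3) using span_module_superset[of ?S R ?F] by auto
  ultimately have "Idl\<^bsub>R\<^esub> A \<subseteq> ?c ` span_module R ?F ?S" by (rule genideal_minimal)
  then have surj: "?c ` K \<subseteq> ?c ` span_module R ?F ?S" unfolding A(3) .
  have le: "span_module R ?F ?S \<subseteq> K" by (rule span_module_minimal[OF insert.prems(1) SK])
  have "span_module R ?F S \<subseteq> span_module R ?F ?S"
    using span_module_superset[of ?S R ?F] by (intro span_module_minimal[OF sp]) auto
  then have KS: "?K \<subseteq> span_module R ?F ?S" unfolding S(3) .
  have "K \<subseteq> span_module R ?F ?S"
  proof
    fix v assume v: "v \<in> K"
    \<comment> \<open>Subtracting an element of the span with the same coordinate at
      \<open>x\<close> leaves a member of the part already generated by \<open>S\<close>.\<close>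
    then obtain w where w: "w \<in> span_module R ?F ?S" "?c v = ?c w" using surj by auto
    have wK: "w \<in> K" using w(1) le by auto
    have "v \<ominus>\<^bsub>?F\<^esub> w \<in> K" by (rule K(5)[OF v wK])
    moreover have "?c (v \<ominus>\<^bsub>?F\<^esub> w) = \<zero>\<^bsub>R\<^esub>"
    proof -
      interpret R': module R ?R by (rule module_regular)
      have "?c (v \<ominus>\<^bsub>?F\<^esub> w) = ?c v \<ominus>\<^bsub>?R\<^esub> ?c w"
        by (rule module_hom_minus'[OF F.module_axioms module_regular c K(1)[OF v] K(1)[OF wK]])
      also have "\<dots> = \<zero>\<^bsub>R\<^esub>" unfolding w(2) using R'.minus_self[of "?c w"] module_homD(1)[OF c K(1)[OF wK]] by simp
      finally show ?thesis .
    qed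
    ultimately have "v \<ominus>\<^bsub>?F\<^esub> w \<in> span_module R ?F ?S" using KS by auto
    then have "(v \<ominus>\<^bsub>?F\<^esub> w) \<oplus>\<^bsub>?F\<^esub> w \<in> span_module R ?F ?S" by (rule spD(3)[OF _ w(1)])
    moreover have "(v \<ominus>\<^bsub>?F\<^esub> w) \<oplus>\<^bsub>?F\<^esub> w = v"
      using K(1)[OF v] K(1)[OF wK] by (simp add: a_minus_def F.a_assoc F.l_neg del: free_module_simps)
    ultimately show "v \<in> span_module R ?F ?S" by simp
  qed
  with le have "span_module R ?F ?S = K" by auto
  then show ?case using S(1) B(2) SK by (intro exI[of _ ?S]) simp
qed

text \<open>The basis is an interval with prescribed left end \<open>b\<close>, so that bases of
  different resolutions can be kept disjoint later.\<close>

lemma span_eq_image_of_free: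
  fixes b :: nat
  assumes "module R M" "finite S" "S \<subseteq> carrier M"
  obtains k p where "p \<in> module_hom R (free_module R {b..<b + k}) M"
    "p ` carrier (free_module R {b..<b + k}) = span_module R M S"
proof -
  interpret plain_module R M by (rule plain_module.intro) fact
  let ?I = "{b..<b + card S}"
  obtain g where g: "bij_betw g ?I S"
    using finite_same_card_bij[of ?I S] assms(2) by auto
  then have gS: "g ` ?I = S" by (simp add: bij_betw_def)
  then have gM: "g \<in> ?I \<rightarrow> carrier M" using assms(3) by auto
  let ?p = "linear_extension R M g"
  have p: "?p \<in> module_hom R (free_module R ?I) M" by (rule linear_extension_hom[OF gM])
  note sp = submodule_span[OF assms(1,3)]
  have "g \<in> ?I \<rightarrow> span_module R M S" using gS span_module_superset[of S R M] by auto
  from linear_extension_sub_hom[OF assms(1) sp this]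
  have 1: "?p ` carrier (free_module R ?I) \<subseteq> span_module R M S" using module_homD(1) by fastforce
  have "S \<subseteq> ?p ` carrier (free_module R ?I)"
  proof
    fix s assume "s \<in> S"
    then have "s \<in> g ` ?I" by (simp only: gS)
    then obtain i where i: "s = g i" "i \<in> ?I" by (rule imageE)
    then show "s \<in> ?p ` carrier (free_module R ?I)"
      using linear_extension_unit[OF i(2) gM] unit_vector_closed[OF i(2)]
      by (intro image_eqI[of _ _ "unit_vector R i"]) (simp_all add: i(1))
  qed
  then have 2: "span_module R M S \<subseteq> ?p ` carrier (free_module R ?I)"
    by (rule span_module_minimal[OF submodule_image[OF module_free assms(1) p]])
  show thesis by (rule that[OF p]) (use 1 2 in auto)
qed

lemma noetherian_kernel_cover:
  fixes b :: nat and X :: "'x set"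
  assumes "cring R" "noetherian_ring R" "finite X" "submodule K R (free_module R X)"
  obtains k p where "p \<in> module_hom R (free_module R {b..<b + k}) (free_module R X)"
    "p ` carrier (free_module R {b..<b + k}) = K"
proof -
  interpret cring R by fact
  let ?F = "free_module R (UNIV :: 'x set)" and ?X = "free_module R X"
  interpret F: module R ?F by (rule module_free)
  interpret X: module R ?X by (rule module_free)
  note K = X.submoduleD[OF assms(4)]
  have eq: "?F\<lparr>carrier := H\<rparr> = ?X\<lparr>carrier := H\<rparr>" for H by (simp add: free_module_def mk_module_def)
  have up: "submodule H R ?F" if "submodule H R ?X" for H
  proof (rule F.module_incl_imp_submodule)
    show "H \<subseteq> carrier ?F" using X.submoduleD(1)[OF that] free_module_mono[of X UNIV R] by auto
    show "module R (?F\<lparr>carrier := H\<rparr>)"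
      unfolding eq by (rule submodule.submodule_is_module[OF that X.module_axioms])
  qed
  have KX: "K \<subseteq> carrier ?X" using K(1) by auto
  obtain S where S: "finite S" "S \<subseteq> K" "span_module R ?F S = K"
    using noetherian_submodule_free_finitely_generated[OF assms(1-3) up[OF assms(4)] KX] by auto
  have SX: "S \<subseteq> carrier ?X" using S(2) KX by auto
  have "span_module R ?F S \<subseteq> span_module R ?X S"
    by (rule span_module_minimal[OF up[OF submodule_span[OF X.module_axioms SX]] span_module_superset])
  moreover have "span_module R ?X S \<subseteq> K" by (rule span_module_minimal[OF assms(4) S(2)])
  ultimately have spX: "span_module R ?X S = K" using S(3) by auto
  obtain k p where p: "p \<in> module_hom R (free_module R {b..<b + k}) ?X"
    "p ` carrier (free_module R {b..<b + k}) = span_module R ?X S"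
    by (rule span_eq_image_of_free[OF X.module_axioms S(1) SX, of b]) (rule that)
  show thesis by (rule that[OF p(1)]) (simp only: p(2) spX)
qed

text \<open>Each step covers the previous kernel, finitely generated because the ring is Noetherian,
  by a finite free module. The lower bound \<open>b i\<close> on indices in degree \<open>i\<close>
  leaves room for the basis of another resolution.\<close>

lemma noetherian_finite_free_resolution:
  fixes M :: "('a, 'm) module" and b :: "int \<Rightarrow> nat"
  assumes "cring R" "noetherian_ring R" "module R M" "fin_gen_module R M"
  obtains X D e where "fin_resolution R X D e M" "\<And>i. X i \<subseteq> {b i..}"
proof -
  interpret cring R by fact
  let ?Z = "\<lambda>X. free_module R (X :: nat set)"
  \<comment> \<open>A state consists of a basis, the differential out of it and the kernel that
    remains to be covered.\<close>
  define P :: "nat \<Rightarrow> (nat set \<times> ((nat \<Rightarrow> 'a) \<Rightarrow> nat \<Rightarrow> 'a) \<times> (nat \<Rightarrow> 'a) set) \<Rightarrow> bool" where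
    "P n s \<longleftrightarrow> (\<exists>k. fst s = {b (int n)..<b (int n) + k}) \<and> submodule (snd (snd s)) R (?Z (fst s))" for n s
  define Q :: "nat \<Rightarrow> (nat set \<times> ((nat \<Rightarrow> 'a) \<Rightarrow> nat \<Rightarrow> 'a) \<times> (nat \<Rightarrow> 'a) set)
      \<Rightarrow> (nat set \<times> ((nat \<Rightarrow> 'a) \<Rightarrow> nat \<Rightarrow> 'a) \<times> (nat \<Rightarrow> 'a) set) \<Rightarrow> bool" where
    "Q n s t \<longleftrightarrow> fst (snd t) \<in> module_hom R (?Z (fst t)) (?Z (fst s)) \<and>
      fst (snd t) ` carrier (?Z (fst t)) = snd (snd s) \<and>
      snd (snd t) = {f \<in> carrier (?Z (fst t)). fst (snd t) f = (\<lambda>_. \<zero>\<^bsub>R\<^esub>)}" for n s t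
  obtain S where S: "finite S" "S \<subseteq> carrier M" "span_module R M S = carrier M"
    using assms(4) by (auto simp: fin_gen_module_def)
  obtain k0 e where e: "e \<in> module_hom R (?Z {b 0..<b 0 + k0}) M"
    "e ` carrier (?Z {b 0..<b 0 + k0}) = carrier M"
    by (rule span_eq_image_of_free[OF assms(3) S(1,2), of "b 0"]) (rule that, simp_all add: S(3))
  let ?X0 = "{b 0..<b 0 + k0}"
  \<comment> \<open>In degree 0 the differential is zero, but the kernel to be covered is that of
    the augmentation.\<close>
  define s0 where "s0 = (?X0, (\<lambda>_ :: nat \<Rightarrow> 'a. \<lambda>_ :: nat. \<zero>\<^bsub>R\<^esub>), {f \<in> carrier (?Z ?X0). e f = \<zero>\<^bsub>M\<^esub>})"
  have P0: "P 0 s0" unfolding P_def s0_def fst_conv snd_conv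
    using submodule_kernel[OF module_free assms(3) e(1)] by (intro conjI exI[of _ k0]) simp_all
  have step: "\<exists>t. P (Suc n) t \<and> Q n s t" if s: "P n s" for n s
  proof -
    have fin: "finite (fst s)" and K: "submodule (snd (snd s)) R (?Z (fst s))" using s by (auto simp: P_def)
    obtain k p where p: "p \<in> module_hom R (?Z {b (int (Suc n))..<b (int (Suc n)) + k}) (?Z (fst s))"
      "p ` carrier (?Z {b (int (Suc n))..<b (int (Suc n)) + k}) = snd (snd s)"
      by (rule noetherian_kernel_cover[OF assms(1,2) fin K, of "b (int (Suc n))"]) (rule that)
    let ?X = "{b (int (Suc n))..<b (int (Suc n)) + k}"
    let ?t = "(?X, p, {f \<in> carrier (?Z ?X). p f = (\<lambda>_. \<zero>\<^bsub>R\<^esub>)})"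
    have "submodule {f \<in> carrier (?Z ?X). p f = (\<lambda>_. \<zero>\<^bsub>R\<^esub>)} R (?Z ?X)"
      using submodule_kernel[OF module_free module_free p(1)] by simp
    then have "P (Suc n) ?t" unfolding P_def fst_conv snd_conv by (intro conjI exI[of _ k] refl)
    moreover have "Q n s ?t" unfolding Q_def fst_conv snd_conv by (intro conjI p refl)
    ultimately show ?thesis by (intro exI[of _ ?t] conjI)
  qed
  have "\<exists>t. \<forall>n. (P n (t n) \<and> (n = 0 \<longrightarrow> t n = s0)) \<and> Q n (t n) (t (Suc n))"
  proof (rule dependent_nat_choice)
    show "\<exists>x. P 0 x \<and> (0 = (0::nat) \<longrightarrow> x = s0)" using P0 by (intro exI[of _ s0]) simp
    fix s n assume "P n s \<and> (n = 0 \<longrightarrow> s = s0)"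
    then obtain t where "P (Suc n) t" "Q n s t" using step[of n s] by auto
    then show "\<exists>y. (P (Suc n) y \<and> (Suc n = 0 \<longrightarrow> y = s0)) \<and> Q n s y" by (intro exI[of _ t]) simp
  qed
  then obtain t where t: "\<And>n. P n (t n)" "t 0 = s0" "\<And>n. Q n (t n) (t (Suc n))" by auto
  define X where "X i = (if i < 0 then {} else fst (t (nat i)))" for i :: int
  define q where "q i = (if i \<le> 0 then (\<lambda>_ _. \<zero>\<^bsub>R\<^esub>) else fst (snd (t (nat i))))" for i :: int
  have Xb: "X i \<subseteq> {b i..}" for i
    using t(1)[of "nat i"] by (auto simp: X_def P_def)
  have fin: "finite (X i)" for i using t(1)[of "nat i"] by (auto simp: X_def P_def)
  have Qi: "q i \<in> module_hom R (?Z (X i)) (?Z (X (i - 1)))"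
    "q i ` carrier (?Z (X i)) = snd (snd (t (nat (i - 1))))"
    "snd (snd (t (nat i))) = {f \<in> carrier (?Z (X i)). q i f = (\<lambda>_. \<zero>\<^bsub>R\<^esub>)}" if i: "i > 0" for i
  proof -
    define n where "n = nat (i - 1)"
    have n: "nat (i - 1) = n" "nat i = Suc n" using i by (simp_all add: n_def)
    show "q i \<in> module_hom R (?Z (X i)) (?Z (X (i - 1)))"
      "q i ` carrier (?Z (X i)) = snd (snd (t (nat (i - 1))))"
      "snd (snd (t (nat i))) = {f \<in> carrier (?Z (X i)). q i f = (\<lambda>_. \<zero>\<^bsub>R\<^esub>)}"
      using t(3)[of n] i by (simp_all add: Q_def X_def q_def n)
  qed
  have q: "q i \<in> module_hom R (?Z (X i)) (?Z (X (i - 1)))" for i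
  proof (cases "i > 0")
    case False
    then show ?thesis by (intro module_homI) (auto simp: q_def free_module_carrier)
  qed (rule Qi)
  have q0: "q i f = (\<lambda>_. \<zero>\<^bsub>R\<^esub>)" if "i \<le> 0" for i f using that by (simp add: q_def)
  have qq: "q (i - 1) (q i f) = (\<lambda>_. \<zero>\<^bsub>R\<^esub>)" if f: "f \<in> carrier (?Z (X i))" for i f
  proof (cases "i > 1")
    case True
    have "q i f \<in> snd (snd (t (nat (i - 1))))" using Qi(2)[of i] f True by auto
    then show ?thesis using Qi(3)[of "i - 1"] True by auto
  qed (simp add: q0)
  let ?D = "\<lambda>i x y. q i (unit_vector R x) y"
  note ff = fin_free_complex_of_homs[where X = X and q = q, OF assms(1) fin q qq]
  note fd = fin_cpx_diff_of_homs[where X = X and q = q, OF assms(1) fin q qq]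
  have X0: "X 0 = ?X0" by (simp add: X_def t(2) s0_def)
  have bd: "boundaries (fin_cpx R X ?D) i = q (i + 1) ` carrier (?Z (X (i + 1)))" for i
    unfolding boundaries_def fin_cpx_simps(1) using fd[of _ "i + 1"] by auto
  have "left_resolution R (fin_cpx R X ?D) e M"
    unfolding left_resolution_def
  proof (intro conjI allI impI)
    show "chain_complex R (fin_cpx R X ?D)" by (rule chain_complex_fin_cpx[OF assms(1) ff])
    show "zero_module (cobj (fin_cpx R X ?D) i)" if "i < 0" for i
      using that by (auto simp: zero_module_def fin_cpx_simps(1) X_def free_module_carrier fun_eq_iff)
    show "e \<in> module_hom R (cobj (fin_cpx R X ?D) 0) M" unfolding fin_cpx_simps(1) X0 by (rule e(1))
    show "e ` carrier (cobj (fin_cpx R X ?D) 0) = carrier M" unfolding fin_cpx_simps(1) X0 by (rule e(2))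
    show "{x \<in> carrier (cobj (fin_cpx R X ?D) 0). e x = \<zero>\<^bsub>M\<^esub>} = boundaries (fin_cpx R X ?D) 0"
      unfolding bd fin_cpx_simps(1) using Qi(2)[of 1] by (simp add: t(2) s0_def X0)
    fix i :: int assume i: "0 < i"
    have "cycles (fin_cpx R X ?D) i = {f \<in> carrier (?Z (X i)). q i f = (\<lambda>_. \<zero>\<^bsub>R\<^esub>)}"
      unfolding cycles_def fin_cpx_simps(1) using fd[of _ i] by auto
    also have "\<dots> = boundaries (fin_cpx R X ?D) i"
      unfolding bd using Qi(3)[OF i] Qi(2)[of "i + 1"] i by simp
    finally show "cycles (fin_cpx R X ?D) i = boundaries (fin_cpx R X ?D) i" .
  qed
  then have "fin_resolution R X ?D e M" using ff by (simp add: fin_resolution_def X_def)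
  then show thesis by (rule that) (rule Xb)
qed


section \<open>Mapping cones\<close>

lemma free_module_minus:
  assumes "cring R" "v \<in> carrier (free_module R Y)" "w \<in> carrier (free_module R Y)"
  shows "v \<ominus>\<^bsub>free_module R Y\<^esub> w = (\<lambda>x. v x \<ominus>\<^bsub>R\<^esub> w x)"
proof -
  interpret cring R by fact
  interpret F: module R "free_module R Y" by (rule module_free)
  interpret S: module R "regular_module R" by (rule module_regular)
  have rm: "a \<ominus>\<^bsub>regular_module R\<^esub> b = a \<ominus>\<^bsub>R\<^esub> b" for a b
    by (simp add: a_minus_def a_inv_def m_inv_def regular_module_def mk_module_def)
  show ?thesis
    using module_hom_minus'[OF F.module_axioms S.module_axioms coordinate_hom[OF assms(1)] assms(2,3)]
    by (intro HOL.ext) (simp add: rm)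
qed

lemma free_hom_pointwise:
  assumes "cring R" "h \<in> module_hom R (free_module R A) (free_module R B)"
    and u: "u \<in> carrier (free_module R A)" and v: "v \<in> carrier (free_module R A)"
  shows "h (\<lambda>x. u x \<oplus>\<^bsub>R\<^esub> v x) = (\<lambda>x. h u x \<oplus>\<^bsub>R\<^esub> h v x)"
    and "h (\<lambda>x. u x \<ominus>\<^bsub>R\<^esub> v x) = (\<lambda>x. h u x \<ominus>\<^bsub>R\<^esub> h v x)"
    and "h (\<lambda>_. \<zero>\<^bsub>R\<^esub>) = (\<lambda>_. \<zero>\<^bsub>R\<^esub>)"
proof -
  note m = cring.module_free[OF assms(1)]
  show "h (\<lambda>x. u x \<oplus>\<^bsub>R\<^esub> v x) = (\<lambda>x. h u x \<oplus>\<^bsub>R\<^esub> h v x)"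
    using module_homD(2)[OF assms(2) u v] by simp
  show "h (\<lambda>x. u x \<ominus>\<^bsub>R\<^esub> v x) = (\<lambda>x. h u x \<ominus>\<^bsub>R\<^esub> h v x)"
    using module_hom_minus'[OF m m assms(2) u v]
    unfolding free_module_minus[OF assms(1) u v]
      free_module_minus[OF assms(1) module_homD(1)[OF assms(2) u] module_homD(1)[OF assms(2) v]] .
  show "h (\<lambda>_. \<zero>\<^bsub>R\<^esub>) = (\<lambda>_. \<zero>\<^bsub>R\<^esub>)"
    using module_hom_zero[OF m m assms(2)] by simp
qed

lemma fin_resolutionD:
  assumes "fin_resolution R X D e M"
  shows "fin_free_complex R X D" "i < 0 \<Longrightarrow> X i = {}" "left_resolution R (fin_cpx R X D) e M"
    "e \<in> module_hom R (free_module R (X 0)) M" "e ` carrier (free_module R (X 0)) = carrier M"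
    "v \<in> carrier (free_module R (X 0)) \<Longrightarrow> e v = \<zero>\<^bsub>M\<^esub> \<Longrightarrow>
      \<exists>w\<in>carrier (free_module R (X 1)). v = cdiff (fin_cpx R X D) 1 w"
    "w \<in> carrier (free_module R (X 1)) \<Longrightarrow> e (cdiff (fin_cpx R X D) 1 w) = \<zero>\<^bsub>M\<^esub>"
    "j > 0 \<Longrightarrow> v \<in> carrier (free_module R (X j)) \<Longrightarrow> cdiff (fin_cpx R X D) j v = (\<lambda>_. \<zero>\<^bsub>R\<^esub>) \<Longrightarrow>
      \<exists>w\<in>carrier (free_module R (X (j + 1))). v = cdiff (fin_cpx R X D) (j + 1) w"
    "finite (X i)"
proof -
  show 1: "fin_free_complex R X D" "i < 0 \<Longrightarrow> X i = {}" "left_resolution R (fin_cpx R X D) e M"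
    using assms by (simp_all add: fin_resolution_def)
  show "finite (X i)" using 1(1) by (simp add: fin_free_complex_def)
  note L = left_resolutionD[OF 1(3), unfolded fin_cpx_simps(1)]
  show "e \<in> module_hom R (free_module R (X 0)) M" "e ` carrier (free_module R (X 0)) = carrier M"
    by (rule L)+
  show "\<exists>w\<in>carrier (free_module R (X 1)). v = cdiff (fin_cpx R X D) 1 w"
    if "v \<in> carrier (free_module R (X 0))" "e v = \<zero>\<^bsub>M\<^esub>"
    using L(5)[OF that] unfolding boundaries_def fin_cpx_simps(1) by auto
  show "e (cdiff (fin_cpx R X D) 1 w) = \<zero>\<^bsub>M\<^esub>" if "w \<in> carrier (free_module R (X 1))"
    using L(6) boundariesI[of w "fin_cpx R X D" 0] that unfolding fin_cpx_simps(1) by simp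
  show "\<exists>w\<in>carrier (free_module R (X (j + 1))). v = cdiff (fin_cpx R X D) (j + 1) w"
    if "j > 0" "v \<in> carrier (free_module R (X j))" "cdiff (fin_cpx R X D) j v = (\<lambda>_. \<zero>\<^bsub>R\<^esub>)"
    using L(7)[OF that(1), of v] that(2,3) unfolding boundaries_def cycles_def fin_cpx_simps(1) by auto
qed

text \<open>Comparing with the negated resolution of the kernel yields a lift that anticommutes with the differentials, so the
  differential of the cone needs no signs.\<close>

lemma chain_complex_negate:
  assumes "chain_complex R F"
  shows "chain_complex R \<lparr>cobj = cobj F, cdiff = (\<lambda>i x. \<zero>\<^bsub>cobj F (i - 1)\<^esub> \<ominus>\<^bsub>cobj F (i - 1)\<^esub> cdiff F i x)\<rparr>"
  unfolding chain_complex_def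
proof (intro allI conjI ballI, goal_cases)
  note F = chain_complexD[OF assms]
  case (1 i)
  show ?case by (simp add: F)
next
  note F = chain_complexD[OF assms]
  case (2 i)
  interpret A: module R "cobj F (i - 1)" by (rule F(1))
  have "(\<lambda>_. \<zero>\<^bsub>cobj F (i - 1)\<^esub>) \<in> module_hom R (cobj F i) (cobj F (i - 1))" by (rule module_homI) auto
  from module_hom_minus_hom[OF F(1) this F(2)] show ?case by simp
next
  note F = chain_complexD[OF assms]
  case (3 i x)
  interpret A: module R "cobj F (i - 1)" by (rule F(1))
  interpret B: module R "cobj F (i - 2)" by (rule F(1))
  have d: "cdiff F (i - 1) \<in> module_hom R (cobj F (i - 1)) (cobj F (i - 2))" using F(2)[of "i - 1"] by simp
  have x: "x \<in> carrier (cobj F i)" using 3 by simp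
  have c: "cdiff F i x \<in> carrier (cobj F (i - 1))" by (rule module_homD(1)[OF F(2) x])
  show ?case
    using module_hom_minus'[OF F(1) F(1) d A.zero_closed c] F(4)[OF x] module_hom_zero[OF F(1) F(1) d] by simp
qed

text \<open>The inclusion of the kernel of \<open>p\<close> lifts to a map of resolutions, and its
  cone resolves \<open>M\<close>. Disjointness turns the union of bases into a direct sum. The
  listed entries of \<open>D\<close> show the resolution of \<open>G\<close> as a subcomplex with
  the shifted resolution of \<open>K\<close> as quotient.\<close>

lemma mapping_cone_resolution:
  fixes G :: "('a, 'g) module" and M :: "('a, 'm) module" and XG XK :: "int \<Rightarrow> 'x set"
  assumes cr: "cring R" and G: "module R G" and M: "module R M"
    and p: "p \<in> module_hom R G M" and psurj: "p ` carrier G = carrier M"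
    and K: "K = {x \<in> carrier G. p x = \<zero>\<^bsub>M\<^esub>}"
    and rG: "fin_resolution R XG DG eG G" and rK: "fin_resolution R XK DK eK (G\<lparr>carrier := K\<rparr>)"
    and disj: "\<And>i. XG i \<inter> XK (i - 1) = {}"
  obtains D e where "fin_resolution R (\<lambda>i. XG i \<union> XK (i - 1)) D e M"
    "\<And>i x y. x \<in> XG i \<Longrightarrow> y \<in> XG (i - 1) \<Longrightarrow> D i x y = DG i x y"
    "\<And>i x y. x \<in> XG i \<Longrightarrow> y \<in> XK (i - 2) \<Longrightarrow> D i x y = \<zero>\<^bsub>R\<^esub>"
    "\<And>i x y. x \<in> XK (i - 1) \<Longrightarrow> y \<in> XK (i - 2) \<Longrightarrow> D i x y = DK (i - 1) x y"
proof -
  interpret cring R by (rule cr)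
  interpret G: module R G by (rule G)
  interpret M: module R M by (rule M)
  let ?Z = "\<lambda>Y. free_module R (Y :: 'x set)" and ?z = "\<lambda>_ :: 'x. \<zero>\<^bsub>R\<^esub>"
  let ?FG = "fin_cpx R XG DG" and ?FK = "fin_cpx R XK DK"
  note rGD = fin_resolutionD[OF rG] and rKD = fin_resolutionD[OF rK]
  note LG = left_resolutionD[OF rGD(3)] and LK = left_resolutionD[OF rKD(3)]
  have subK: "submodule K R G" unfolding K by (rule submodule_kernel[OF G M p])
  let ?F = "\<lparr>cobj = cobj ?FK, cdiff = (\<lambda>i x. \<zero>\<^bsub>cobj ?FK (i - 1)\<^esub> \<ominus>\<^bsub>cobj ?FK (i - 1)\<^esub> cdiff ?FK i x)\<rparr>"
  define dG where "dG = cdiff ?FG"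
  define dK where "dK = cdiff ?FK"
  have dG: "dG i \<in> module_hom R (?Z (XG i)) (?Z (XG (i - 1)))" for i
    using chain_complexD(2)[OF LG(1), of i] unfolding fin_cpx_simps(1) dG_def .
  have dK: "dK i \<in> module_hom R (?Z (XK i)) (?Z (XK (i - 1)))" for i
    using chain_complexD(2)[OF LK(1), of i] unfolding fin_cpx_simps(1) dK_def .
  have dGdG: "dG (i - 1) (dG i v) = ?z" if "v \<in> carrier (?Z (XG i))" for i v
    using chain_complexD(4)[OF LG(1), of v i] that unfolding fin_cpx_simps(1) dG_def by simp
  have dKdK: "dK (i - 1) (dK i v) = ?z" if "v \<in> carrier (?Z (XK i))" for i v
    using chain_complexD(4)[OF LK(1), of v i] that unfolding fin_cpx_simps(1) dK_def by simp
  have eK: "eK \<in> module_hom R (?Z (XK 0)) G"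
    using module_homD[OF rKD(4)] subK G.submoduleD(1)[OF subK] by (intro module_homI) auto
  have Fd: "cdiff ?F i v = (\<lambda>x. \<ominus>\<^bsub>R\<^esub> dK i v x)" if v: "v \<in> carrier (?Z (XK i))" for i v
  proof -
    have d: "dK i v \<in> carrier (?Z (XK (i - 1)))" by (rule module_homD(1)[OF dK v])
    have z: "?z \<in> carrier (?Z (XK (i - 1)))" by (simp add: free_module_carrier)
    have "dK i v x \<in> carrier R" for x using d by (simp add: free_module_carrier)
    then show ?thesis
      using free_module_minus[OF cr z d] unfolding dK_def by (simp add: fin_cpx_simps(1) a_minus_def)
  qed
  have F1: "eK (cdiff ?F 1 v) = \<zero>\<^bsub>G\<^esub>" if v: "v \<in> carrier (cobj ?F 1)" for v
  proof -
    have v': "v \<in> carrier (?Z (XK 1))" using v by (simp add: fin_cpx_simps(1))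
    have d: "dK 1 v \<in> carrier (?Z (XK 0))" using module_homD(1)[OF dK v'] by simp
    have "cdiff ?F 1 v = \<zero>\<^bsub>?Z (XK 0)\<^esub> \<ominus>\<^bsub>?Z (XK 0)\<^esub> dK 1 v" by (simp add: fin_cpx_simps(1) dK_def)
    then show ?thesis
      using module_hom_minus'[OF module_free G eK _ d, of "\<zero>\<^bsub>?Z (XK 0)\<^esub>"] rKD(7)[OF v'] module_hom_zero[OF module_free G eK]
      by (simp add: dK_def free_module_carrier)
  qed
  have freeF: "cobj ?F i = ?Z (XK i)" for i by (simp add: fin_cpx_simps(1))
  have lowF: "zero_module (cobj ?F i)" if "i < 0" for i using LK(2)[OF that] by simp
  have eKF: "eK \<in> module_hom R (cobj ?F 0) G" using eK by (simp add: fin_cpx_simps(1))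
  obtain f where f0: "\<And>i. f i \<in> module_hom R (cobj ?F i) (cobj ?FG i)"
    "\<And>i x. x \<in> carrier (cobj ?F i) \<Longrightarrow> cdiff ?FG i (f i x) = f (i - 1) (cdiff ?F i x)"
    "\<And>x. x \<in> carrier (cobj ?F 0) \<Longrightarrow> eG (f 0 x) = eK x"
    by (rule comparison_chain_map[where X = XK, OF cr chain_complex_negate[OF LK(1)] freeF lowF rGD(3) G eKF F1])
       (assumption | rule that)+
  have f: "f i \<in> module_hom R (?Z (XK i)) (?Z (XG i))" for i using f0(1)[of i] by (simp add: fin_cpx_simps(1))
  have ef: "eG (f 0 v) = eK v" if "v \<in> carrier (?Z (XK 0))" for v using f0(3) that by (simp add: fin_cpx_simps(1))
  have mem: "v x \<in> carrier R" if "v \<in> carrier (?Z Y)" for v Y x using that by (simp add: free_module_carrier)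
  have supp: "v x = \<zero>\<^bsub>R\<^esub>" if "v \<in> carrier (?Z Y)" "x \<notin> Y" for v Y x using that by (simp add: free_module_carrier)
  have fin: "finite (XG i)" "finite (XK i)" for i using rGD(9) rKD(9) by auto
  have anti: "dG i (f i v) x \<oplus>\<^bsub>R\<^esub> f (i - 1) (dK i v) x = \<zero>\<^bsub>R\<^esub>" if v: "v \<in> carrier (?Z (XK i))" for i v x
  proof -
    have d: "dK i v \<in> carrier (?Z (XK (i - 1)))" by (rule module_homD(1)[OF dK v])
    have z: "?z \<in> carrier (?Z (XK (i - 1)))" by (simp add: free_module_carrier)
    have fd: "f (i - 1) (dK i v) x \<in> carrier R" by (rule mem[OF module_homD(1)[OF f d]])
    have "dG i (f i v) = f (i - 1) (\<lambda>x. \<zero>\<^bsub>R\<^esub> \<ominus>\<^bsub>R\<^esub> dK i v x)"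
      using f0(2)[of v i] v Fd[OF v] mem[OF d] unfolding dG_def by (simp add: fin_cpx_simps(1) a_minus_def)
    also have "\<dots> = (\<lambda>x. f (i - 1) ?z x \<ominus>\<^bsub>R\<^esub> f (i - 1) (dK i v) x)"
      by (rule free_hom_pointwise(2)[OF cr f z d])
    also have "f (i - 1) ?z = ?z" by (rule free_hom_pointwise(3)[OF cr f z z])
    finally have "dG i (f i v) x = \<zero>\<^bsub>R\<^esub> \<ominus>\<^bsub>R\<^esub> f (i - 1) (dK i v) x" by simp
    then show ?thesis using fd by (simp add: a_minus_def l_neg)
  qed
  let ?X = "\<lambda>i. XG i \<union> XK (i - 1)"
  define sG where "sG i v = (\<lambda>x. if x \<in> XG i then v x else \<zero>\<^bsub>R\<^esub>)" for i and v :: "'x \<Rightarrow> 'a"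
  define sK where "sK i v = (\<lambda>x. if x \<in> XK (i - 1) then v x else \<zero>\<^bsub>R\<^esub>)" for i and v :: "'x \<Rightarrow> 'a"
  have sG: "sG i v \<in> carrier (?Z (XG i))" if "v \<in> carrier (?Z Y)" for i v Y
    using mem[OF that] unfolding finite_free_carrier[OF cr fin(1)] sG_def by auto
  have sK: "sK i v \<in> carrier (?Z (XK (i - 1)))" if "v \<in> carrier (?Z Y)" for i v Y
    using mem[OF that] unfolding finite_free_carrier[OF cr fin(2)] sK_def by auto
  have split: "v = (\<lambda>x. sG i v x \<oplus>\<^bsub>R\<^esub> sK i v x)" if v: "v \<in> carrier (?Z (?X i))" for i v
    using mem[OF v] supp[OF v] disj[of i] by (auto simp: sG_def sK_def fun_eq_iff)
  \<comment> \<open>The cone differential sends the pair (a, b) to the pair (dG a + f b, dK b). The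
    components are extracted by \<open>sG\<close> and \<open>sK\<close>, the second sitting one
    degree lower in its own resolution.\<close>
  define q where "q i v = (\<lambda>x. dG i (sG i v) x \<oplus>\<^bsub>R\<^esub> (f (i - 1) (sK i v) x \<oplus>\<^bsub>R\<^esub> dK (i - 1) (sK i v) x))" for i v
  have up: "v \<in> carrier (?Z B)" if "v \<in> carrier (?Z A)" "A \<subseteq> B" for v A B
    using free_module_mono[OF that(2), of R] that(1) by auto
  have parts: "dG i (sG i v) \<in> carrier (?Z (XG (i - 1)))" "f (i - 1) (sK i v) \<in> carrier (?Z (XG (i - 1)))"
    "dK (i - 1) (sK i v) \<in> carrier (?Z (XK (i - 1 - 1)))" if "v \<in> carrier (?Z Y)" for i v Y
    using module_homD(1)[OF dG sG[OF that]] module_homD(1)[OF f sK[OF that]] module_homD(1)[OF dK sK[OF that]] by auto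
  have addc: "(\<lambda>x. u x \<oplus>\<^bsub>R\<^esub> v x) \<in> carrier (?Z Y)" if "u \<in> carrier (?Z Y)" "v \<in> carrier (?Z Y)" for u v Y
  proof -
    interpret F: module R "?Z Y" by (rule module_free)
    show ?thesis using F.a_closed[OF that] by simp
  qed
  have qcl: "q i v \<in> carrier (?Z (?X (i - 1)))" if v: "v \<in> carrier (?Z Y)" for i v Y
    unfolding q_def by (intro addc up[OF parts(1)[OF v]] up[OF parts(2)[OF v]] up[OF parts(3)[OF v]]) auto
  have sGq: "sG (i - 1) (q i v) = (\<lambda>x. dG i (sG i v) x \<oplus>\<^bsub>R\<^esub> f (i - 1) (sK i v) x)" if v: "v \<in> carrier (?Z Y)" for i v Y
  proof (rule HOL.ext)
    fix x
    note c = mem[OF parts(1)[OF v, of i], of x] mem[OF parts(2)[OF v, of i], of x] mem[OF parts(3)[OF v, of i], of x]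
    show "sG (i - 1) (q i v) x = dG i (sG i v) x \<oplus>\<^bsub>R\<^esub> f (i - 1) (sK i v) x"
    proof (cases "x \<in> XG (i - 1)")
      case True
      then have "x \<notin> XK (i - 1 - 1)" using disj[of "i - 1"] by auto
      from supp[OF parts(3)[OF v] this] show ?thesis using True c by (simp add: sG_def q_def)
    next
      case False
      then show ?thesis using supp[OF parts(1)[OF v] False] supp[OF parts(2)[OF v] False] by (simp add: sG_def)
    qed
  qed
  have sKq: "sK (i - 1) (q i v) = dK (i - 1) (sK i v)" if v: "v \<in> carrier (?Z Y)" for i v Y
  proof (rule HOL.ext)
    fix x
    note c = mem[OF parts(1)[OF v, of i], of x] mem[OF parts(2)[OF v, of i], of x] mem[OF parts(3)[OF v, of i], of x]
    show "sK (i - 1) (q i v) x = dK (i - 1) (sK i v) x"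
    proof (cases "x \<in> XK (i - 1 - 1)")
      case True
      then have n: "x \<notin> XG (i - 1)" using disj[of "i - 1"] by auto
      show ?thesis using True c supp[OF parts(1)[OF v] n] supp[OF parts(2)[OF v] n] by (simp add: sK_def q_def)
    next
      case False
      then show ?thesis using supp[OF parts(3)[OF v] False] by (simp add: sK_def)
    qed
  qed
  have qhom: "q i \<in> module_hom R (?Z (?X i)) (?Z (?X (i - 1)))" for i
  proof (rule module_homI)
    show "q i v \<in> carrier (?Z (?X (i - 1)))" if "v \<in> carrier (?Z (?X i))" for v by (rule qcl[OF that])
    fix u assume u: "u \<in> carrier (?Z (?X i))"
    show "q i (u \<oplus>\<^bsub>?Z (?X i)\<^esub> v) = q i u \<oplus>\<^bsub>?Z (?X (i - 1))\<^esub> q i v" if v: "v \<in> carrier (?Z (?X i))" for v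
    proof -
      have "sG i (\<lambda>x. u x \<oplus>\<^bsub>R\<^esub> v x) = (\<lambda>x. sG i u x \<oplus>\<^bsub>R\<^esub> sG i v x)"
        "sK i (\<lambda>x. u x \<oplus>\<^bsub>R\<^esub> v x) = (\<lambda>x. sK i u x \<oplus>\<^bsub>R\<^esub> sK i v x)"
        by (auto simp: sG_def sK_def)
      then show ?thesis
        using mem[OF parts(1)[OF u, of i]] mem[OF parts(2)[OF u, of i]] mem[OF parts(3)[OF u, of i]]
          mem[OF parts(1)[OF v, of i]] mem[OF parts(2)[OF v, of i]] mem[OF parts(3)[OF v, of i]]
        by (simp add: q_def free_hom_pointwise(1)[OF cr dG sG[OF u] sG[OF v]] free_hom_pointwise(1)[OF cr f sK[OF u] sK[OF v]]
            free_hom_pointwise(1)[OF cr dK sK[OF u] sK[OF v]] a_ac)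
    qed
    show "q i (a \<odot>\<^bsub>?Z (?X i)\<^esub> u) = a \<odot>\<^bsub>?Z (?X (i - 1))\<^esub> q i u" if a: "a \<in> carrier R" for a
    proof -
      have "sG i (\<lambda>x. a \<otimes>\<^bsub>R\<^esub> u x) = (\<lambda>x. a \<otimes>\<^bsub>R\<^esub> sG i u x)" "sK i (\<lambda>x. a \<otimes>\<^bsub>R\<^esub> u x) = (\<lambda>x. a \<otimes>\<^bsub>R\<^esub> sK i u x)"
        using a by (auto simp: sG_def sK_def)
      moreover note module_homD(3)[OF dG a sG[OF u]] module_homD(3)[OF f a sK[OF u]] module_homD(3)[OF dK a sK[OF u]]
      ultimately show ?thesis
        using mem[OF parts(1)[OF u, of i]] mem[OF parts(2)[OF u, of i]] mem[OF parts(3)[OF u, of i]] a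
        by (simp add: q_def r_distr)
    qed
  qed
  have qq: "q (i - 1) (q i v) = ?z" if v: "v \<in> carrier (?Z (?X i))" for i v
  proof (rule HOL.ext)
    fix x
    have c: "dG (i - 1) (f (i - 1) (sK i v)) x \<in> carrier R" "f (i - 1 - 1) (dK (i - 1) (sK i v)) x \<in> carrier R"
      by (rule mem[OF module_homD(1)[OF dG parts(2)[OF v]]], rule mem[OF module_homD(1)[OF f parts(3)[OF v]]])
    show "q (i - 1) (q i v) x = \<zero>\<^bsub>R\<^esub>"
      unfolding q_def[of "i - 1" "q i v"] sGq[OF v] sKq[OF v] free_hom_pointwise(1)[OF cr dG parts(1)[OF v] parts(2)[OF v]]
        dGdG[OF sG[OF v]] dKdK[OF sK[OF v]]
      using anti[OF sK[OF v], of i x] c by simp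
  qed
  have finX: "finite (?X i)" for i using fin by simp
  let ?D = "\<lambda>i x y. q i (unit_vector R x) y"
  note ff = fin_free_complex_of_homs[where X = ?X and q = q, OF cr finX qhom qq]
  note fd = fin_cpx_diff_of_homs[where X = ?X and q = q, OF cr finX qhom qq]
  let ?e = "\<lambda>v. p (eG v)"
  have XK1: "XK (- 1) = {}" by (rule rKD(2)) simp
  have e: "?e \<in> module_hom R (?Z (?X 0)) M" using module_hom_comp[OF rGD(4) p] XK1 by simp
  \<comment> \<open>If the \<open>K\<close> component of \<open>v\<close> is \<open>dK w\<close>,
    then by anticommutation the \<open>G\<close> component minus \<open>f w\<close> is a cycle, so
    it is the boundary of some \<open>u\<close>, and \<open>u + w\<close> fills \<open>v\<close>. In
    degree 0 the augmentation replaces the cycle condition.\<close>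
  have fillK: "\<exists>w\<in>carrier (?Z (?X (i + 1))). v = q (i + 1) w"
    if v: "v \<in> carrier (?Z (?X i))" and w: "w \<in> carrier (?Z (XK i))" and vK: "sK i v = dK i w" and i: "i \<ge> 0"
      and z: "i > 0 \<Longrightarrow> q i v = ?z" and z0: "i = 0 \<Longrightarrow> eG (\<lambda>x. sG i v x \<ominus>\<^bsub>R\<^esub> f i w x) = \<zero>\<^bsub>G\<^esub>" for i v w
  proof -
    have fw: "f i w \<in> carrier (?Z (XG i))" by (rule module_homD(1)[OF f w])
    let ?v = "\<lambda>x. sG i v x \<ominus>\<^bsub>R\<^esub> f i w x"
    have v': "?v \<in> carrier (?Z (XG i))"
    proof -
      interpret F: module R "?Z (XG i)" by (rule module_free)
      show ?thesis using F.minus_closed[OF sG[OF v] fw] unfolding free_module_minus[OF cr sG[OF v] fw] .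
    qed
    have "\<exists>u\<in>carrier (?Z (XG (i + 1))). ?v = dG (i + 1) u"
    proof (cases "i = 0")
      case True
      then show ?thesis using rGD(6)[of ?v] v' z0 unfolding dG_def by simp
    next
      case False
      then have i0: "i > 0" using i by simp
      have "dG i ?v = ?z"
      proof (rule HOL.ext)
        fix x
        have "dG i (sG i v) x \<oplus>\<^bsub>R\<^esub> f (i - 1) (sK i v) x = sG (i - 1) (q i v) x" by (simp add: sGq[OF v])
        also have "\<dots> = \<zero>\<^bsub>R\<^esub>" unfolding z[OF i0] by (simp add: sG_def)
        finally have a: "dG i (sG i v) x \<oplus>\<^bsub>R\<^esub> f (i - 1) (dK i w) x = \<zero>\<^bsub>R\<^esub>" unfolding vK .
        have c: "dG i (sG i v) x \<in> carrier R" "f (i - 1) (dK i w) x \<in> carrier R" "dG i (f i w) x \<in> carrier R"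
          using mem[OF parts(1)[OF v]] mem[OF module_homD(1)[OF f module_homD(1)[OF dK w]]] mem[OF module_homD(1)[OF dG fw]] by auto
        have "dG i (sG i v) x = dG i (f i w) x"
          using a anti[OF w, of x] c by (metis add.r_cancel)
        then show "dG i ?v x = \<zero>\<^bsub>R\<^esub>"
          unfolding free_hom_pointwise(2)[OF cr dG sG[OF v] fw] using c by (simp add: a_minus_def r_neg)
      qed
      then show ?thesis using rGD(8)[OF i0 v'] unfolding dG_def by simp
    qed
    then obtain u where u: "u \<in> carrier (?Z (XG (i + 1)))" "?v = dG (i + 1) u" by auto
    let ?w = "\<lambda>x. u x \<oplus>\<^bsub>R\<^esub> w x"
    have w': "?w \<in> carrier (?Z (?X (i + 1)))"
      by (intro addc up[OF u(1)] up[OF w]) auto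
    have dj: "XG (i + 1) \<inter> XK i = {}" using disj[of "i + 1"] by simp
    have sGw: "sG (i + 1) ?w = u"
      using mem[OF u(1)] mem[OF w] supp[OF u(1)] supp[OF w] dj by (fastforce simp: sG_def)
    have sKw: "sK (i + 1) ?w = w"
      using mem[OF u(1)] mem[OF w] supp[OF u(1)] supp[OF w] dj by (fastforce simp: sK_def)
    have "q (i + 1) ?w = v"
    proof (rule HOL.ext)
      fix x
      have c: "sG i v x \<in> carrier R" "sK i v x \<in> carrier R" "f i w x \<in> carrier R"
        using mem[OF sG[OF v]] mem[OF sK[OF v]] mem[OF fw] by auto
      have "q (i + 1) ?w x = (sG i v x \<ominus>\<^bsub>R\<^esub> f i w x) \<oplus>\<^bsub>R\<^esub> (f i w x \<oplus>\<^bsub>R\<^esub> sK i v x)"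
        unfolding q_def sGw sKw u(2)[symmetric] vK by simp
      also have "\<dots> = sG i v x \<oplus>\<^bsub>R\<^esub> sK i v x"
        using c by (simp add: a_minus_def a_assoc r_neg1)
      also have "\<dots> = v x" using fun_cong[OF split[OF v], of x] by simp
      finally show "q (i + 1) ?w x = v x" .
    qed
    then show ?thesis using w' by (intro bexI[of _ ?w]) auto
  qed
  have bd: "boundaries (fin_cpx R ?X ?D) i = q (i + 1) ` carrier (?Z (?X (i + 1)))" for i
    unfolding boundaries_def fin_cpx_simps(1) using fd[of _ "i + 1"] by auto
  have lr: "left_resolution R (fin_cpx R ?X ?D) ?e M"
    unfolding left_resolution_def
  proof (intro conjI allI impI)
    show "chain_complex R (fin_cpx R ?X ?D)" by (rule chain_complex_fin_cpx[OF cr ff])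
    show "zero_module (cobj (fin_cpx R ?X ?D) i)" if "i < 0" for i
      using that rGD(2) rKD(2) by (auto simp: zero_module_def fin_cpx_simps(1) free_module_carrier fun_eq_iff)
    show "?e \<in> module_hom R (cobj (fin_cpx R ?X ?D) 0) M" unfolding fin_cpx_simps(1) by (rule e)
    show "?e ` carrier (cobj (fin_cpx R ?X ?D) 0) = carrier M"
      unfolding fin_cpx_simps(1) using rGD(5) psurj XK1 by (simp add: image_image[symmetric])
    show "{x \<in> carrier (cobj (fin_cpx R ?X ?D) 0). ?e x = \<zero>\<^bsub>M\<^esub>} = boundaries (fin_cpx R ?X ?D) 0"
    proof (intro equalityI subsetI)
      fix v assume "v \<in> {x \<in> carrier (cobj (fin_cpx R ?X ?D) 0). ?e x = \<zero>\<^bsub>M\<^esub>}"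
      then have v: "v \<in> carrier (?Z (?X 0))" "?e v = \<zero>\<^bsub>M\<^esub>" by (auto simp: fin_cpx_simps(1))
      then have vG: "v \<in> carrier (?Z (XG 0))" using XK1 by simp
      have sv: "sG 0 v = v" using supp[OF vG] by (auto simp: sG_def)
      have "eG v \<in> K" unfolding K using v(2) module_homD(1)[OF rGD(4) vG] by simp
      \<comment> \<open>The element \<open>eG v\<close> lies in the kernel of \<open>p\<close>,
        hence comes from the augmentation of the second resolution; then \<open>v - f w\<close> is
        killed by \<open>eG\<close>.\<close>
      then obtain w where w: "w \<in> carrier (?Z (XK 0))" "eG v = eK w" using rKD(5) by auto
      have "eG (\<lambda>x. v x \<ominus>\<^bsub>R\<^esub> f 0 w x) = eG v \<ominus>\<^bsub>G\<^esub> eG (f 0 w)"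
        using module_hom_minus'[OF module_free G rGD(4) vG module_homD(1)[OF f w(1)]]
        unfolding free_module_minus[OF cr vG module_homD(1)[OF f w(1)]] .
      then have z0: "eG (\<lambda>x. sG 0 v x \<ominus>\<^bsub>R\<^esub> f 0 w x) = \<zero>\<^bsub>G\<^esub>"
        using ef[OF w(1)] w(2) module_homD(1)[OF eK w(1)] by (simp add: sv)
      have "sK 0 v = dK 0 w"
        using module_homD(1)[OF dK w(1)] XK1 by (auto simp: sK_def free_module_carrier fun_eq_iff)
      from fillK[OF v(1) w(1) this _ _ z0]
      show "v \<in> boundaries (fin_cpx R ?X ?D) 0" unfolding bd by auto
    next
      fix v assume "v \<in> boundaries (fin_cpx R ?X ?D) 0"
      then obtain u where u: "u \<in> carrier (?Z (?X 1))" "v = q 1 u" unfolding bd by auto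
      have v: "v \<in> carrier (?Z (?X 0))" using qcl[OF u(1), of 1] u(2) by simp
      have z: "dK 0 (sK 1 u) = ?z"
        using parts(3)[OF u(1), of 1] XK1 by (auto simp: free_module_carrier fun_eq_iff)
      have p1: "dG 1 (sG 1 u) \<in> carrier (?Z (XG 0))" "f 0 (sK 1 u) \<in> carrier (?Z (XG 0))" "sK 1 u \<in> carrier (?Z (XK 0))"
        using parts(1,2)[OF u(1), of 1] sK[OF u(1), of 1] by auto
      have "v = dG 1 (sG 1 u) \<oplus>\<^bsub>?Z (XG 0)\<^esub> f 0 (sK 1 u)"
        unfolding u(2) q_def using z mem[OF p1(2)] by simp
      then have "eG v = eG (dG 1 (sG 1 u)) \<oplus>\<^bsub>G\<^esub> eG (f 0 (sK 1 u))"
        using module_homD(2)[OF rGD(4) p1(1,2)] by simp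
      also have "\<dots> = eK (sK 1 u)"
        using rGD(7)[OF sG[OF u(1), of 1]] ef[OF p1(3)] module_homD(1)[OF eK p1(3)] by (simp add: dG_def)
      finally have "eG v \<in> K" using module_homD(1)[OF rKD(4) p1(3)] by simp
      then show "v \<in> {x \<in> carrier (cobj (fin_cpx R ?X ?D) 0). ?e x = \<zero>\<^bsub>M\<^esub>}"
        using v by (simp add: K fin_cpx_simps(1))
    qed
    fix i :: int assume i: "0 < i"
    show "cycles (fin_cpx R ?X ?D) i = boundaries (fin_cpx R ?X ?D) i"
    proof
      show "boundaries (fin_cpx R ?X ?D) i \<subseteq> cycles (fin_cpx R ?X ?D) i"
        by (rule boundaries_subset_cycles[OF chain_complex_fin_cpx[OF cr ff]])
      show "cycles (fin_cpx R ?X ?D) i \<subseteq> boundaries (fin_cpx R ?X ?D) i"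
      proof
        fix v assume "v \<in> cycles (fin_cpx R ?X ?D) i"
        then have v: "v \<in> carrier (?Z (?X i))" and qv: "q i v = ?z"
          using fd[of v i] by (auto simp: cycles_def fin_cpx_simps(1))
        have sv: "sK i v \<in> carrier (?Z (XK (i - 1)))" by (rule sK[OF v])
        have dsv: "dK (i - 1) (sK i v) = ?z" using sKq[OF v, of i] unfolding qv by (simp add: sK_def)
        have "\<exists>w\<in>carrier (?Z (XK i)). sK i v = dK i w"
        proof (cases "i = 1")
          case True
          \<comment> \<open>In degree 1 the \<open>K\<close> component sits at the bottom of its
            resolution, where exactness is tested by \<open>eK\<close>. Applying \<open>eG\<close>
            to the \<open>G\<close> component of \<open>q v = 0\<close> shows that \<open>eK\<close>
            kills it.\<close>
          have s1: "sK 1 v \<in> carrier (?Z (XK 0))" "dG 1 (sG 1 v) \<in> carrier (?Z (XG 0))" "f 0 (sK 1 v) \<in> carrier (?Z (XG 0))"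
            using sv parts(1,2)[OF v, of 1] True by auto
          have "dG 1 (sG 1 v) \<oplus>\<^bsub>?Z (XG 0)\<^esub> f 0 (sK 1 v) = sG 0 (q 1 v)"
            using sGq[OF v, of 1] by simp
          also have "\<dots> = ?z" using qv True by (simp add: sG_def)
          finally have "eG (dG 1 (sG 1 v) \<oplus>\<^bsub>?Z (XG 0)\<^esub> f 0 (sK 1 v)) = \<zero>\<^bsub>G\<^esub>"
            using module_hom_zero[OF module_free G rGD(4)] by simp
          then have "eK (sK 1 v) = \<zero>\<^bsub>G\<^esub>"
            using module_homD(2)[OF rGD(4) s1(2,3)] rGD(7)[OF sG[OF v, of 1]] ef[OF s1(1)] module_homD(1)[OF eK s1(1)]
            by (simp add: dG_def)
          then show ?thesis using rKD(6)[OF s1(1)] True by (simp add: dK_def)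
        next
          case False
          then have "i - 1 > 0" using i by simp
          from rKD(8)[OF this sv] dsv show ?thesis by (simp add: dK_def)
        qed
        then obtain w where "w \<in> carrier (?Z (XK i))" "sK i v = dK i w" by auto
        from fillK[OF v this _ qv] i show "v \<in> boundaries (fin_cpx R ?X ?D) i" unfolding bd by auto
      qed
    qed
  qed
  have uG: "unit_vector R x \<in> carrier (?Z (XG i))" if "x \<in> XG i" for x i by (rule unit_vector_closed[OF that])
  have uK: "unit_vector R x \<in> carrier (?Z (XK i))" if "x \<in> XK i" for x i by (rule unit_vector_closed[OF that])
  have unitG: "q i (unit_vector R x) = dG i (unit_vector R x)" if x: "x \<in> XG i" for i x
  proof -
    have "x \<notin> XK (i - 1)" using x disj[of i] by auto
    then have "sG i (unit_vector R x) = unit_vector R x" "sK i (unit_vector R x) = ?z"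
      using x by (auto simp: sG_def sK_def unit_vector_def fun_eq_iff)
    moreover have "?z \<in> carrier (?Z (XK (i - 1)))" by (simp add: free_module_carrier)
    ultimately show ?thesis
      using free_hom_pointwise(3)[OF cr f] free_hom_pointwise(3)[OF cr dK] mem[OF module_homD(1)[OF dG uG[OF x]]]
      by (simp add: q_def)
  qed
  show thesis
  proof (rule that[of ?D ?e])
    show "fin_resolution R ?X ?D ?e M"
      unfolding fin_resolution_def using ff lr rGD(2) rKD(2) by auto
    show "?D i x y = DG i x y" if "x \<in> XG i" "y \<in> XG (i - 1)" for i x y
      unfolding unitG[OF that(1)] dG_def fin_cpx_diff_unit[OF cr rGD(1) that(1)] using that(2) by simp
    show "?D i x y = \<zero>\<^bsub>R\<^esub>" if "x \<in> XG i" "y \<in> XK (i - 2)" for i x y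
    proof -
      have "y \<notin> XG (i - 1)" using that(2) disj[of "i - 1"] by auto
      then show ?thesis unfolding unitG[OF that(1)] by (rule supp[OF module_homD(1)[OF dG uG[OF that(1)]]])
    qed
    show "?D i x y = DK (i - 1) x y" if x: "x \<in> XK (i - 1)" and y: "y \<in> XK (i - 2)" for i x y
    proof -
      have "x \<notin> XG i" using x disj[of i] by auto
      then have s: "sK i (unit_vector R x) = unit_vector R x"
        using x by (auto simp: sK_def unit_vector_def fun_eq_iff)
      have "?D i x y = sK (i - 1) (q i (unit_vector R x)) y" using y by (simp add: sK_def)
      also have "\<dots> = dK (i - 1) (unit_vector R x) y" unfolding sKq[OF uK[OF x]] s ..
      also have "\<dots> = DK (i - 1) x y"
        unfolding dK_def fin_cpx_diff_unit[OF cr rKD(1) x] using y by simp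
      finally show ?thesis .
    qed
  qed
qed


text \<open>The cone is an extension of complexes, so exactness follows from its two constituents;
  the kernel is consulted one degree lower.\<close>

lemma exact_at_mapping_cone:
  assumes N: "module R N" and A: "submodule A R N" and S: "submodule S R N" "S \<subseteq> A"
    and ffG: "fin_free_complex R XG DG" and ffK: "fin_free_complex R XK DK"
    and ff: "fin_free_complex R (\<lambda>i. XG i \<union> XK (i - 1)) D"
    and disj: "\<And>i. XG i \<inter> XK (i - 1) = {}"
    and D: "\<And>i x y. x \<in> XG i \<Longrightarrow> y \<in> XG (i - 1) \<Longrightarrow> D i x y = DG i x y"
    "\<And>i x y. x \<in> XG i \<Longrightarrow> y \<in> XK (i - 2) \<Longrightarrow> D i x y = \<zero>\<^bsub>R\<^esub>"
    "\<And>i x y. x \<in> XK (i - 1) \<Longrightarrow> y \<in> XK (i - 2) \<Longrightarrow> D i x y = DK (i - 1) x y"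
    and G: "exact_at N XG DG A S i" and K: "exact_at N XK DK A S (i - 1)"
  shows "exact_at N (\<lambda>i. XG i \<union> XK (i - 1)) D A S i"
proof (rule exact_at_extension_of_complexes[where ?X1.0 = XG and ?X2.0 = "\<lambda>i. XK (i - 1)", OF N A S ff refl disj])
  show "D i x y = \<zero>\<^bsub>R\<^esub>" if "x \<in> XG i" "y \<in> XK (i - 1 - 1)" for i x y
    using D(2)[OF that(1), of y] that(2) by simp
  show "exact_at N XG D A S i"
  proof (rule exact_at_shift[where X = XG and D = DG and j = i, OF N A ffG _ _ _ _ _ G])
    show "D (i + 1) x y = DG (i + 1) x y" if "x \<in> XG (i + 1)" "y \<in> XG i" for x y
      using D(1)[OF that(1), of y] that(2) by simp
  qed (simp_all add: D(1))
  show "exact_at N (\<lambda>i. XK (i - 1)) D A S i"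
  proof (rule exact_at_shift[where X = XK and D = DK and j = "i - 1", OF N A ffK _ _ _ _ _ K])
    show "D i x y = DK (i - 1) x y" if "x \<in> XK (i - 1)" "y \<in> XK (i - 1 - 1)" for x y
      using D(3)[OF that(1), of y] that(2) by simp
    show "D (i + 1) x y = DK (i - 1 + 1) x y" if "x \<in> XK (i - 1 + 1)" "y \<in> XK (i - 1)" for x y
      using D(3)[of x "i + 1" y] that by simp
  qed simp_all
qed

text \<open>Transposition reverses the extension: the part coming from the kernel is now the
  subcomplex.\<close>

lemma exact_at_mapping_cone_transpose:
  assumes N: "module R N" and A: "submodule A R N" and S: "submodule S R N" "S \<subseteq> A"
    and ffG: "fin_free_complex R XG DG" and ffK: "fin_free_complex R XK DK"
    and ff: "fin_free_complex R (\<lambda>i. XG i \<union> XK (i - 1)) D"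
    and disj: "\<And>i. XG i \<inter> XK (i - 1) = {}"
    and D: "\<And>i x y. x \<in> XG i \<Longrightarrow> y \<in> XG (i - 1) \<Longrightarrow> D i x y = DG i x y"
    "\<And>i x y. x \<in> XG i \<Longrightarrow> y \<in> XK (i - 2) \<Longrightarrow> D i x y = \<zero>\<^bsub>R\<^esub>"
    "\<And>i x y. x \<in> XK (i - 1) \<Longrightarrow> y \<in> XK (i - 2) \<Longrightarrow> D i x y = DK (i - 1) x y"
    and G: "exact_at N (transpose_basis XG) (transpose_diff DG) A S (- i)"
    and K: "exact_at N (transpose_basis XK) (transpose_diff DK) A S (- (i - 1))"
  shows "exact_at N (transpose_basis (\<lambda>i. XG i \<union> XK (i - 1))) (transpose_diff D) A S (- i)"
proof -
  have cr: "cring R" using N by (simp add: module_def)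
  let ?X1 = "\<lambda>i. XK (- i - 1)"
  show ?thesis
  proof (rule exact_at_extension_of_complexes[where ?X1.0 = ?X1 and ?X2.0 = "\<lambda>i. XG (- i)",
        OF N A S fin_free_complex_transpose[OF cr ff]])
    show "transpose_basis (\<lambda>i. XG i \<union> XK (i - 1)) i = ?X1 i \<union> XG (- i)" for i
      by (auto simp: transpose_basis_def)
    show "?X1 i \<inter> XG (- i) = {}" for i using disj[of "- i"] by auto
    show "transpose_diff D i x y = \<zero>\<^bsub>R\<^esub>" if "x \<in> ?X1 i" "y \<in> XG (- (i - 1))" for i x y
    proof -
      have "- i - 1 = 1 - i - 2" by simp
      with that(1) have "x \<in> XK (1 - i - 2)" by (simp only:)
      then show ?thesis using D(2)[of y "1 - i" x] that(2) by (simp add: transpose_diff_def)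
    qed
    show "exact_at N (\<lambda>i. XG (- i)) (transpose_diff D) A S (- i)"
    proof (rule exact_at_shift[OF N A fin_free_complex_transpose[OF cr ffG] _ _ _ _ _ G])
      show "transpose_diff D (- i) x y = transpose_diff DG (- i) x y"
        if "x \<in> transpose_basis XG (- i)" "y \<in> transpose_basis XG (- i - 1)" for x y
        using D(1)[of y "1 + i" x] that by (simp add: transpose_diff_def transpose_basis_def add.commute)
      show "transpose_diff D (- i + 1) x y = transpose_diff DG (- i + 1) x y"
        if "x \<in> transpose_basis XG (- i + 1)" "y \<in> transpose_basis XG (- i)" for x y
        using D(1)[of y i x] that by (simp add: transpose_diff_def transpose_basis_def)
    qed (simp_all add: transpose_basis_def)
    show "exact_at N ?X1 (transpose_diff D) A S (- i)"
    proof (rule exact_at_shift[OF N A fin_free_complex_transpose[OF cr ffK] _ _ _ _ _ K])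
      show "transpose_diff D (- i) x y = transpose_diff DK (- (i - 1)) x y"
        if "x \<in> transpose_basis XK (- (i - 1))" "y \<in> transpose_basis XK (- (i - 1) - 1)" for x y
        using D(3)[of y "1 + i" x] that by (simp add: transpose_diff_def transpose_basis_def)
      show "transpose_diff D (- i + 1) x y = transpose_diff DK (- (i - 1) + 1) x y"
        if "x \<in> transpose_basis XK (- (i - 1) + 1)" "y \<in> transpose_basis XK (- (i - 1))" for x y
        using D(3)[of y i x] that by (simp add: transpose_diff_def transpose_basis_def)
    qed (simp_all add: transpose_basis_def)
  qed
qed

lemma free_extend:
  assumes "cring R" "finite Y" "f \<in> Y \<rightarrow> carrier R"
  shows "(\<lambda>x. if x \<in> Y then f x else \<zero>\<^bsub>R\<^esub>) \<in> carrier (free_module R Y)"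
  unfolding finite_free_carrier[OF assms(1,2)] using assms(3) by auto

lemma fin_cpx_exact_atI:
  assumes cr: "cring R" and ff: "fin_free_complex R X D"
    and ex: "\<And>v. v \<in> carrier (free_module R (X i)) \<Longrightarrow> cdiff (fin_cpx R X D) i v = (\<lambda>_. \<zero>\<^bsub>R\<^esub>) \<Longrightarrow>
      \<exists>w\<in>carrier (free_module R (X (i + 1))). v = cdiff (fin_cpx R X D) (i + 1) w"
  shows "exact_at (regular_module R) X D (carrier R) {\<zero>\<^bsub>R\<^esub>} i"
proof -
  interpret cring R by (rule cr)
  interpret C: module_complex R "regular_module R" X D
    by (intro module_complex.intro module_complex_axioms.intro cr ff module_regular)
  show ?thesis
    unfolding exact_at_def
  proof (intro ballI impI)
    fix f assume f: "f \<in> X i \<rightarrow> carrier R" and df: "\<forall>y\<in>X (i - 1). mat_act (regular_module R) (X i) (D i) f y \<in> {\<zero>\<^bsub>R\<^esub>}"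
    let ?v = "\<lambda>x. if x \<in> X i then f x else \<zero>\<^bsub>R\<^esub>"
    have v: "?v \<in> carrier (free_module R (X i))" by (rule free_extend[OF cr C.finite_X f])
    have "cdiff (fin_cpx R X D) i ?v = (\<lambda>_. \<zero>\<^bsub>R\<^esub>)"
    proof (rule HOL.ext)
      fix y
      have "mat_act (regular_module R) (X i) (D i) ?v y = mat_act (regular_module R) (X i) (D i) f y" if "y \<in> X (i - 1)"
        using f C.D_closed that by (intro C.mat_act_cong) auto
      then show "cdiff (fin_cpx R X D) i ?v y = \<zero>\<^bsub>R\<^esub>"
        using df by (simp add: fin_cpx_simps(2))
    qed
    from ex[OF v this] obtain w where w: "w \<in> carrier (free_module R (X (i + 1)))" "?v = cdiff (fin_cpx R X D) (i + 1) w" by auto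
    have w': "w \<in> X (i + 1) \<rightarrow> carrier R" using w(1) by (auto simp: free_module_carrier)
    show "\<exists>g\<in>X (i + 1) \<rightarrow> carrier R. \<forall>x\<in>X i. f x \<ominus>\<^bsub>regular_module R\<^esub> mat_act (regular_module R) (X (i + 1)) (D (i + 1)) g x \<in> {\<zero>\<^bsub>R\<^esub>}"
    proof (intro bexI[OF _ w'] ballI)
      fix x assume x: "x \<in> X i"
      have "f x = mat_act (regular_module R) (X (i + 1)) (D (i + 1)) w x"
        using fun_cong[OF w(2), of x] x by (simp add: fin_cpx_simps(2))
      then show "f x \<ominus>\<^bsub>regular_module R\<^esub> mat_act (regular_module R) (X (i + 1)) (D (i + 1)) w x \<in> {\<zero>\<^bsub>R\<^esub>}"
        using C.minus_self[of "f x"] funcset_mem[OF f x] by simp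
    qed
  qed
qed

lemma fin_resolution_exact_at:
  assumes "cring R" "fin_resolution R X D e M" "i > 0"
  shows "exact_at (regular_module R) X D (carrier R) {\<zero>\<^bsub>R\<^esub>} i"
  by (rule fin_cpx_exact_atI[OF assms(1) fin_resolutionD(1)[OF assms(2)] fin_resolutionD(8)[OF assms(2,3)]])

text \<open>By \<open>ker\<close> the map \<open>c\<close> is constant on the fibres of
  \<open>e\<close>, so composing it with any set-theoretic section of \<open>e\<close> gives a
  linear factor.\<close>

lemma hom_factor_through_surjection:
  assumes "module R F" "module R Q" "module R N" and e: "e \<in> module_hom R F Q" "e ` carrier F = carrier Q"
    and c: "c \<in> module_hom R F N" and ker: "\<And>v. v \<in> carrier F \<Longrightarrow> e v = \<zero>\<^bsub>Q\<^esub> \<Longrightarrow> c v = \<zero>\<^bsub>N\<^esub>"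
  obtains h where "h \<in> module_hom R Q N" "\<And>v. v \<in> carrier F \<Longrightarrow> h (e v) = c v"
proof -
  interpret F: module R F by fact
  interpret Q: module R Q by fact
  interpret N: module R N by fact
  define s where "s = inv_into (carrier F) e"
  have s: "s y \<in> carrier F" "e (s y) = y" if "y \<in> carrier Q" for y
    using that unfolding e(2)[symmetric] s_def by (auto intro: inv_into_into f_inv_into_f)
  have h: "c (s (e v)) = c v" if v: "v \<in> carrier F" for v
  proof -
    note ev = module_homD(1)[OF e(1) v]
    have "e (s (e v) \<ominus>\<^bsub>F\<^esub> v) = \<zero>\<^bsub>Q\<^esub>"
      using module_hom_minus'[OF F.module_axioms Q.module_axioms e(1) s(1)[OF ev] v] s(2)[OF ev] ev by simp
    then have "c (s (e v) \<ominus>\<^bsub>F\<^esub> v) = \<zero>\<^bsub>N\<^esub>" by (rule ker[OF F.minus_closed[OF s(1)[OF ev] v]])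
    then show ?thesis
      using module_hom_minus'[OF F.module_axioms N.module_axioms c s(1)[OF ev] v]
        N.minus_eq_zero_iff[OF module_homD(1)[OF c s(1)[OF ev]] module_homD(1)[OF c v]] by simp
  qed
  have "(\<lambda>y. c (s y)) \<in> module_hom R Q N"
  proof (rule module_homI)
    fix y assume y: "y \<in> carrier Q"
    show "c (s y) \<in> carrier N" by (rule module_homD(1)[OF c s(1)[OF y]])
    show "c (s (y \<oplus>\<^bsub>Q\<^esub> z)) = c (s y) \<oplus>\<^bsub>N\<^esub> c (s z)" if z: "z \<in> carrier Q" for z
    proof -
      have "c (s (e (s y \<oplus>\<^bsub>F\<^esub> s z))) = c (s y \<oplus>\<^bsub>F\<^esub> s z)" by (rule h) (simp add: s(1) y z)
      then show ?thesis using module_homD(2)[OF e(1) s(1)[OF y] s(1)[OF z]] module_homD(2)[OF c s(1)[OF y] s(1)[OF z]] s(2) y z by simp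
    qed
    show "c (s (a \<odot>\<^bsub>Q\<^esub> y)) = a \<odot>\<^bsub>N\<^esub> c (s y)" if a: "a \<in> carrier R" for a
    proof -
      have "c (s (e (a \<odot>\<^bsub>F\<^esub> s y))) = c (a \<odot>\<^bsub>F\<^esub> s y)" by (rule h) (simp add: s(1) y a)
      then show ?thesis using module_homD(3)[OF e(1) a s(1)[OF y]] module_homD(3)[OF c a s(1)[OF y]] s(2) y by simp
    qed
  qed
  then show thesis by (rule that) (rule h)
qed

section \<open>Complete resolutions of totally reflexive modules\<close>

lemma dual_module_simps:
  "\<phi> \<in> carrier (dual_module R G) \<longleftrightarrow> \<phi> \<in> module_hom R G (regular_module R) \<and> \<phi> \<in> extensional (carrier G)"
  "x \<in> carrier G \<Longrightarrow> (\<phi> \<oplus>\<^bsub>dual_module R G\<^esub> \<psi>) x = \<phi> x \<oplus>\<^bsub>R\<^esub> \<psi> x"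
  "x \<in> carrier G \<Longrightarrow> (a \<odot>\<^bsub>dual_module R G\<^esub> \<phi>) x = a \<otimes>\<^bsub>R\<^esub> \<phi> x"
  "x \<in> carrier G \<Longrightarrow> \<zero>\<^bsub>dual_module R G\<^esub> x = \<zero>\<^bsub>R\<^esub>"
  by (simp_all add: dual_module_def hom_module_simps)

text \<open>The resolution of the dual occupies the negative degrees, its own degree 0 being placed
  in degree -1; hence the index \<open>- 1 - i\<close>.\<close>

definition splice_basis :: "(int \<Rightarrow> 'x set) \<Rightarrow> (int \<Rightarrow> 'x set) \<Rightarrow> int \<Rightarrow> 'x set" where
  "splice_basis X X' i = (if i \<ge> 0 then X i else X' (- 1 - i))"

text \<open>For \<open>i < 0\<close> the source basis is \<open>X' (- 1 - i)\<close> and the target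
  basis \<open>X' (- i)\<close>, so the matrix is the transpose of \<open>D' (- i)\<close>. The
  matrix \<open>d\<close> joins the two halves in degree 0.\<close>

definition splice_diff ::
  "(int \<Rightarrow> 'x \<Rightarrow> 'x \<Rightarrow> 'a) \<Rightarrow> ('x \<Rightarrow> 'x \<Rightarrow> 'a) \<Rightarrow> (int \<Rightarrow> 'x \<Rightarrow> 'x \<Rightarrow> 'a) \<Rightarrow> int \<Rightarrow> 'x \<Rightarrow> 'x \<Rightarrow> 'a" where
  "splice_diff D d D' i x y = (if i > 0 then D i x y else if i = 0 then d x y else D' (- i) y x)"

text \<open>The complex is a free resolution of \<open>G\<close> continued to the right by the transpose of a free
  resolution of the dual of \<open>G\<close>; the gluing matrix is the evaluation pairing of the generators.\<close>

lemma complete_resolution: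
  fixes G :: "('a, 'g) module" and X X' :: "int \<Rightarrow> 'x set"
  assumes cr: "cring R" and G: "module R G"
    and bij: "bij_betw (biduality_map R G) (carrier G) (carrier (dual_module R (dual_module R G)))"
    and r: "fin_resolution R X D e G" and r': "fin_resolution R X' D' e' (dual_module R G)"
    and ext: "\<And>i. i > 0 \<Longrightarrow> exact_at (regular_module R) (transpose_basis X') (transpose_diff D') (carrier R) {\<zero>\<^bsub>R\<^esub>} (- i)"
  defines "T \<equiv> splice_basis X X'"
    and "DT \<equiv> splice_diff D (\<lambda>x y. e' (unit_vector R y) (e (unit_vector R x))) D'"
  shows "fin_free_complex R T DT" "exact_at (regular_module R) T DT (carrier R) {\<zero>\<^bsub>R\<^esub>} i"
proof -
  interpret cring R by (rule cr)
  interpret G: module R G by (rule G)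
  have mG': "module R (dual_module R G)" unfolding dual_module_def by (rule module_hom_module[OF G module_regular])
  note rD = fin_resolutionD[OF r] and r'D = fin_resolutionD[OF r']
  interpret C: module_complex R "regular_module R" X D
    by (intro module_complex.intro module_complex_axioms.intro cr rD(1) module_regular)
  interpret C': module_complex R "regular_module R" X' D'
    by (intro module_complex.intro module_complex_axioms.intro cr r'D(1) module_regular)
  let ?Z = "\<lambda>Y. free_module R (Y :: 'x set)" and ?R = "regular_module R" and ?u = "unit_vector R"
  define d where "d x y = e' (?u y) (e (?u x))" for x y
  have DT: "DT = splice_diff D d D'" by (simp add: DT_def d_def[abs_def])
  have ev: "e v \<in> carrier G" if "v \<in> carrier (?Z (X 0))" for v by (rule module_homD(1)[OF rD(4) that])
  have e'v: "e' u \<in> module_hom R G ?R" if "u \<in> carrier (?Z (X' 0))" for u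
    using module_homD(1)[OF r'D(4) that] by (simp add: dual_module_simps)
  have uX: "?u x \<in> carrier (?Z (X i))" if "x \<in> X i" for x i by (rule unit_vector_closed[OF that])
  have uX': "?u x \<in> carrier (?Z (X' i))" if "x \<in> X' i" for x i by (rule unit_vector_closed[OF that])
  have h1: "(\<lambda>v. e' u (e v)) \<in> module_hom R (?Z (X 0)) ?R" if "u \<in> carrier (?Z (X' 0))" for u
    by (rule module_hom_comp[OF rD(4) e'v[OF that]])
  have h2: "(\<lambda>u. e' u g) \<in> module_hom R (?Z (X' 0)) ?R" if g: "g \<in> carrier G" for g
  proof (rule module_homI)
    fix u assume u: "u \<in> carrier (?Z (X' 0))"
    show "e' u g \<in> carrier ?R" by (rule module_homD(1)[OF e'v[OF u] g])
    show "e' (u \<oplus>\<^bsub>?Z (X' 0)\<^esub> w) g = e' u g \<oplus>\<^bsub>?R\<^esub> e' w g" if "w \<in> carrier (?Z (X' 0))" for w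
      unfolding module_homD(2)[OF r'D(4) u that] using g by (simp add: dual_module_simps)
    show "e' (a \<odot>\<^bsub>?Z (X' 0)\<^esub> u) g = a \<odot>\<^bsub>?R\<^esub> e' u g" if "a \<in> carrier R" for a
      unfolding module_homD(3)[OF r'D(4) that u] using g by (simp add: dual_module_simps)
  qed
  have dcl: "d x y \<in> carrier R" if "x \<in> X 0" "y \<in> X' 0" for x y
    using module_homD(1)[OF h1[OF uX'[OF that(2)]] uX[OF that(1)]] by (simp add: d_def)
  have val1: "e' u (e v) = mat_act ?R (X 0) (\<lambda>x y. e' u (e (?u x))) v z"
    if u: "u \<in> carrier (?Z (X' 0))" and v: "v \<in> carrier (?Z (X 0))" for u v z
    unfolding free_hom_value[OF module_regular h1[OF u] rD(9) v] mat_act_def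
    using v module_homD(1)[OF h1[OF u] uX]
    by (intro C.M.finsum_cong') (auto simp: free_module_carrier m_comm)
  \<comment> \<open>Here and in \<open>sums0\<close> the products across the seam vanish because
    \<open>e\<close>, respectively \<open>e'\<close>, kills boundaries.\<close>
  have sums1: "(\<Oplus>\<^bsub>R\<^esub>y\<in>X 0. D 1 x y \<otimes>\<^bsub>R\<^esub> d y z) = \<zero>\<^bsub>R\<^esub>" if x: "x \<in> X 1" and z: "z \<in> X' 0" for x z
  proof -
    note h = h1[OF uX'[OF z]]
    have "e' (?u z) (e (cdiff (fin_cpx R X D) 1 (?u x))) = (\<Oplus>\<^bsub>?R\<^esub>y\<in>X (1 - 1). D 1 x y \<odot>\<^bsub>?R\<^esub> e' (?u z) (e (?u y)))"
      by (rule fin_cpx_hom_diff_unit[OF cr rD(1) x module_regular]) (use h in simp)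
    then show ?thesis
      using rD(7)[OF uX[OF x]] module_hom_zero[OF G module_regular e'v[OF uX'[OF z]]] by (simp add: finsum_regular d_def)
  qed
  have sums0: "(\<Oplus>\<^bsub>R\<^esub>y\<in>X' 0. d x y \<otimes>\<^bsub>R\<^esub> D' 1 z y) = \<zero>\<^bsub>R\<^esub>" if x: "x \<in> X 0" and z: "z \<in> X' 1" for x z
  proof -
    note h = h2[OF ev[OF uX[OF x]]]
    have "e' (cdiff (fin_cpx R X' D') 1 (?u z)) (e (?u x)) = (\<Oplus>\<^bsub>?R\<^esub>y\<in>X' (1 - 1). D' 1 z y \<odot>\<^bsub>?R\<^esub> e' (?u y) (e (?u x)))"
      by (rule fin_cpx_hom_diff_unit[OF cr r'D(1) z module_regular]) (use h in simp)
    also have "e' (cdiff (fin_cpx R X' D') 1 (?u z)) (e (?u x)) = \<zero>\<^bsub>R\<^esub>"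
      unfolding r'D(7)[OF uX'[OF z]] using ev[OF uX[OF x]] by (simp add: dual_module_simps)
    finally have "(\<Oplus>\<^bsub>R\<^esub>y\<in>X' 0. D' 1 z y \<otimes>\<^bsub>R\<^esub> d x y) = \<zero>\<^bsub>R\<^esub>" by (simp add: finsum_regular d_def)
    moreover have "(\<Oplus>\<^bsub>R\<^esub>y\<in>X' 0. d x y \<otimes>\<^bsub>R\<^esub> D' 1 z y) = (\<Oplus>\<^bsub>R\<^esub>y\<in>X' 0. D' 1 z y \<otimes>\<^bsub>R\<^esub> d x y)"
      using dcl[OF x] C'.D_closed[OF z] by (intro finsum_cong') (auto intro: m_comm)
    ultimately show ?thesis by simp
  qed
  have tff: "fin_free_complex R (transpose_basis X') (transpose_diff D')" by (rule fin_free_complex_transpose[OF cr r'D(1)])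
  interpret C'': module_complex R "regular_module R" "transpose_basis X'" "transpose_diff D'"
    by (intro module_complex.intro module_complex_axioms.intro cr tff module_regular)
  have Tp: "T i = X i" if "i \<ge> 0" for i using that by (simp add: T_def splice_basis_def)
  have Tn: "T i = transpose_basis X' (i + 1)" if "i < 0" for i
    using that by (simp add: T_def splice_basis_def transpose_basis_def) (metis diff_conv_add_uminus add.commute minus_add_distrib)
  have Tm1: "T (- 1) = X' 0" by (simp add: T_def splice_basis_def)
  have Tm2: "T (- 2) = X' 1" by (simp add: T_def splice_basis_def)
  have Dp: "DT i = D i" if "i > 0" for i using that by (simp add: DT splice_diff_def fun_eq_iff)
  have D0: "DT 0 = d" by (simp add: DT splice_diff_def fun_eq_iff)
  have Dn: "DT i = transpose_diff D' (i + 1)" if "i < 0" for i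
    using that by (simp add: DT splice_diff_def fun_eq_iff transpose_diff_def)
  show ff: "fin_free_complex R T DT"
    unfolding fin_free_complex_def
  proof (intro allI conjI ballI)
    fix i
    show "finite (T i)" using C.finite_X C'.finite_X by (simp add: T_def splice_basis_def)
    consider "i > 1" | "i = 1" | "i = 0" | "i = - 1" | "i < - 1" by linarith
    note cases = this
    show "DT i x y \<in> carrier R" if "x \<in> T i" "y \<in> T (i - 1)" for x y
    proof -
      consider "i > 0" | "i = 0" | "i < 0" by linarith
      then show ?thesis
      proof cases
        case 1
        then show ?thesis using that C.D_closed[of x i y] by (simp add: Tp Dp)
      next
        case 2
        then show ?thesis using that dcl[of x y] by (simp add: Tp Tm1 D0)
      next
        case 3
        then show ?thesis using that C''.D_closed[of x "i + 1" y] by (simp add: Tn Dn)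
      qed
    qed
    show "(\<Oplus>\<^bsub>R\<^esub>y\<in>T (i - 1). DT i x y \<otimes>\<^bsub>R\<^esub> DT (i - 1) y z) = \<zero>\<^bsub>R\<^esub>" if "x \<in> T i" "z \<in> T (i - 2)" for x z
      using cases
    proof cases
      case 1
      then show ?thesis using that C.DD[of x i z] by (simp add: Tp Dp)
    next
      case 2
      then show ?thesis using that sums1[of x z] by (simp add: Tp Dp D0 Tm1)
    next
      case 3
      then show ?thesis using that sums0[of x z] Dn[of "- 1"] by (simp add: Tp D0 Tm1 Tm2 transpose_diff_def)
    next
      case 4
      then show ?thesis using that C''.DD[of x 0 z] Tn[of "- 1"] Tn[of "- 2"] Tn[of "- 3"] Dn[of "- 1"] Dn[of "- 2"] by simp
    next
      case 5
      then show ?thesis using that C''.DD[of x "i + 1" z] by (simp add: Tn Dn)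
    qed
  qed
  interpret TC: module_complex R "regular_module R" T DT
    by (intro module_complex.intro module_complex_axioms.intro cr ff module_regular)
  have carrR: "submodule (carrier R) R ?R" using C.carrier_is_submodule by simp
  \<comment> \<open>Away from the seam, exactness is that of the resolution of \<open>G\<close> in
    positive degrees and the vanishing of \<open>Ext\<close> of the dual below -1. Degrees 0 and -1
    are injectivity and surjectivity of the biduality map.\<close>
  consider "i > 0" | "i = 0" | "i = - 1" | "i < - 1" by linarith
  then show "exact_at ?R T DT (carrier R) {\<zero>\<^bsub>R\<^esub>} i"
  proof cases
    case 1
    show ?thesis
      by (rule exact_at_shift[OF module_regular carrR rD(1) _ _ _ _ _ fin_resolution_exact_at[OF cr r 1]])
         (use 1 in \<open>simp_all add: Tp Dp\<close>)
  next
    case 2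
    show ?thesis
      unfolding exact_at_def 2
    proof (intro ballI impI)
      fix f assume "f \<in> T 0 \<rightarrow> carrier R" and df: "\<forall>y\<in>T (0 - 1). mat_act ?R (T 0) (DT 0) f y \<in> {\<zero>\<^bsub>R\<^esub>}"
      then have f: "f \<in> X 0 \<rightarrow> carrier R" by (simp add: Tp)
      let ?v = "\<lambda>x. if x \<in> X 0 then f x else \<zero>\<^bsub>R\<^esub>"
      have v: "?v \<in> carrier (?Z (X 0))" by (rule free_extend[OF cr C.finite_X f])
      have unit0: "e' (?u y) (e ?v) = \<zero>\<^bsub>R\<^esub>" if y: "y \<in> X' 0" for y
      proof -
        have "mat_act ?R (X 0) (\<lambda>x y'. e' (?u y) (e (?u x))) ?v y = mat_act ?R (X 0) d f y"
          unfolding mat_act_def using f module_homD(1)[OF h1[OF uX'[OF y]] uX]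
          by (intro C.M.finsum_cong') (auto simp: d_def)
        then show ?thesis using val1[OF uX'[OF y] v, of y] df y by (simp add: Tp Tm1 D0)
      qed
      have z: "(\<lambda>_. \<zero>\<^bsub>R\<^esub>) \<in> module_hom R (?Z (X' 0)) ?R" by (rule module_homI) auto
      have all0: "e' u (e ?v) = \<zero>\<^bsub>R\<^esub>" if u: "u \<in> carrier (?Z (X' 0))" for u
        by (rule free_hom_eqI[OF module_regular h2[OF ev[OF v]] z _ u]) (rule unit0)
      \<comment> \<open>The values of \<open>e'\<close> exhaust the dual, so an element on which all
        of them vanish cannot be told from zero by the biduality map.\<close>
      have "biduality_map R G (e ?v) = biduality_map R G \<zero>\<^bsub>G\<^esub>"
        unfolding biduality_map_def
      proof (rule restrict_ext)
        fix \<phi> assume \<phi>: "\<phi> \<in> carrier (dual_module R G)"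
        then obtain u where u: "u \<in> carrier (?Z (X' 0))" "\<phi> = e' u" using r'D(5) by auto
        have "\<phi> \<zero>\<^bsub>G\<^esub> = \<zero>\<^bsub>R\<^esub>" using module_hom_zero[OF G module_regular e'v[OF u(1)]] u(2) by simp
        then show "\<phi> (e ?v) = \<phi> \<zero>\<^bsub>G\<^esub>" using all0[OF u(1)] u(2) by simp
      qed
      then have "e ?v = \<zero>\<^bsub>G\<^esub>"
        using inj_onD[OF bij_betw_imp_inj_on[OF bij], of "e ?v" "\<zero>\<^bsub>G\<^esub>"] ev[OF v] by simp
      from rD(6)[OF v this] obtain w where w: "w \<in> carrier (?Z (X 1))" "?v = cdiff (fin_cpx R X D) 1 w" by auto
      have w': "w \<in> T (0 + 1) \<rightarrow> carrier R" using w(1) by (auto simp: free_module_carrier)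
      show "\<exists>g\<in>T (0 + 1) \<rightarrow> carrier R. \<forall>x\<in>T 0. f x \<ominus>\<^bsub>?R\<^esub> mat_act ?R (T (0 + 1)) (DT (0 + 1)) g x \<in> {\<zero>\<^bsub>R\<^esub>}"
      proof (intro bexI[OF _ w'] ballI)
        fix x assume x: "x \<in> T 0"
        have "f x = mat_act ?R (X 1) (D 1) w x"
          using fun_cong[OF w(2), of x] x by (simp add: fin_cpx_simps(2) Tp)
        then show "f x \<ominus>\<^bsub>?R\<^esub> mat_act ?R (T (0 + 1)) (DT (0 + 1)) w x \<in> {\<zero>\<^bsub>R\<^esub>}"
          using C.minus_self[of "f x"] funcset_mem[OF f, of x] x by (simp add: Tp Dp)
      qed
    qed
  next
    case 3
    show ?thesis
      unfolding exact_at_def 3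
    proof (intro ballI impI)
      fix f assume "f \<in> T (- 1) \<rightarrow> carrier R" and df: "\<forall>y\<in>T (- 1 - 1). mat_act ?R (T (- 1)) (DT (- 1)) f y \<in> {\<zero>\<^bsub>R\<^esub>}"
      then have f: "f \<in> X' 0 \<rightarrow> carrier ?R" by (simp add: Tm1)
      interpret PR: plain_module R ?R by (rule plain_module.intro[OF module_regular])
      let ?c = "linear_extension R ?R f"
      have c: "?c \<in> module_hom R (?Z (X' 0)) ?R" by (rule PR.linear_extension_hom[OF f])
      have cu: "?c (?u y) = f y" if "y \<in> X' 0" for y by (rule PR.linear_extension_unit[OF that f])
      have d'1: "cdiff (fin_cpx R X' D') 1 \<in> module_hom R (?Z (X' 1)) (?Z (X' 0))"
        using chain_complexD(2)[OF chain_complex_fin_cpx[OF cr r'D(1)], of 1] by (simp add: fin_cpx_simps(1))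
      have z: "(\<lambda>_. \<zero>\<^bsub>R\<^esub>) \<in> module_hom R (?Z (X' 1)) ?R" by (rule module_homI) auto
      have cd: "?c (cdiff (fin_cpx R X' D') 1 u) = \<zero>\<^bsub>R\<^esub>" if u: "u \<in> carrier (?Z (X' 1))" for u
      proof (rule free_hom_eqI[OF module_regular module_hom_comp[OF d'1 c] z _ u])
        fix y assume y: "y \<in> X' 1"
        have "?c (cdiff (fin_cpx R X' D') 1 (?u y)) = (\<Oplus>\<^bsub>?R\<^esub>x\<in>X' (1 - 1). D' 1 y x \<odot>\<^bsub>?R\<^esub> ?c (?u x))"
          by (rule fin_cpx_hom_diff_unit[OF cr r'D(1) y module_regular]) (use c in simp)
        also have "\<dots> = mat_act ?R (X' 0) (DT (- 1)) f y"
          unfolding mat_act_def using f cu C'.D_closed[OF y] Dn[of "- 1"]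
          by (intro C.M.finsum_cong') (auto simp: transpose_diff_def)
        also have "\<dots> = \<zero>\<^bsub>R\<^esub>" using df y by (simp add: Tm1 Tm2)
        finally show "?c (cdiff (fin_cpx R X' D') 1 (?u y)) = \<zero>\<^bsub>R\<^esub>" .
      qed
      have ker: "?c v = \<zero>\<^bsub>?R\<^esub>" if "v \<in> carrier (?Z (X' 0))" "e' v = \<zero>\<^bsub>dual_module R G\<^esub>" for v
        using r'D(6)[OF that] cd by auto
      \<comment> \<open>A cocycle on the resolution of the dual factors through a functional on the
        dual. Reflexivity makes it evaluation at some \<open>g\<close>, and a preimage of
        \<open>g\<close> under \<open>e\<close> is the required filling.\<close>
      obtain \<psi> where \<psi>: "\<psi> \<in> module_hom R (dual_module R G) ?R" "\<And>v. v \<in> carrier (?Z (X' 0)) \<Longrightarrow> \<psi> (e' v) = ?c v"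
        by (rule hom_factor_through_surjection[OF module_free mG' module_regular r'D(4,5) c ker]) (assumption+, rule that)
      have "restrict \<psi> (carrier (dual_module R G)) \<in> carrier (dual_module R (dual_module R G))"
        using restrict_module_hom[OF mG' \<psi>(1)] unfolding dual_module_def[of R "dual_module R G"] .
      then have "restrict \<psi> (carrier (dual_module R G)) \<in> biduality_map R G ` carrier G"
        unfolding bij_betw_imp_surj_on[OF bij] .
      then obtain g where g: "g \<in> carrier G" "restrict \<psi> (carrier (dual_module R G)) = biduality_map R G g" by auto
      have "g \<in> e ` carrier (?Z (X 0))" unfolding rD(5) by (rule g(1))
      then obtain v where v: "g = e v" "v \<in> carrier (?Z (X 0))" by (rule imageE)
      have v': "v \<in> T (- 1 + 1) \<rightarrow> carrier R" using v(2) by (auto simp: free_module_carrier)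
      show "\<exists>g\<in>T (- 1 + 1) \<rightarrow> carrier R. \<forall>x\<in>T (- 1). f x \<ominus>\<^bsub>?R\<^esub> mat_act ?R (T (- 1 + 1)) (DT (- 1 + 1)) g x \<in> {\<zero>\<^bsub>R\<^esub>}"
      proof (intro bexI[OF _ v'] ballI)
        fix y assume "y \<in> T (- 1)"
        then have y: "y \<in> X' 0" by (simp add: Tm1)
        have ey: "e' (?u y) \<in> carrier (dual_module R G)" by (rule module_homD(1)[OF r'D(4) uX'[OF y]])
        have "f y = \<psi> (e' (?u y))" using \<psi>(2)[OF uX'[OF y]] cu[OF y] by simp
        also have "\<dots> = e' (?u y) g"
          using fun_cong[OF g(2), of "e' (?u y)"] ey by (simp add: biduality_map_def)
        also have "\<dots> = mat_act ?R (X 0) d v y"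
          unfolding v(1) val1[OF uX'[OF y] v(2), of y] by (simp add: mat_act_def d_def)
        finally have "f y = mat_act ?R (T (- 1 + 1)) (DT (- 1 + 1)) v y" by (simp add: Tp D0)
        then show "f y \<ominus>\<^bsub>?R\<^esub> mat_act ?R (T (- 1 + 1)) (DT (- 1 + 1)) v y \<in> {\<zero>\<^bsub>R\<^esub>}"
          using C.minus_self[of "f y"] funcset_mem[OF f y] by simp
      qed
    qed
  next
    case 4
    have E: "exact_at ?R (transpose_basis X') (transpose_diff D') (carrier R) {\<zero>\<^bsub>R\<^esub>} (i + 1)"
      using ext[of "- i - 1"] 4 by (simp add: add.commute)
    show ?thesis
      by (rule exact_at_shift[OF module_regular carrR tff _ _ _ _ _ E])
         (use 4 in \<open>simp_all add: Tn Dn\<close>)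
  qed
qed


section \<open>Resolutions of modules of finite Gorenstein dimension\<close>

text \<open>A functional is determined by its values on the images of the unit vectors, so the dual
  embeds into a finite free module, whose submodules are finitely generated.\<close>

lemma fin_gen_dual_module:
  fixes G :: "('a, 'g) module" and X :: "int \<Rightarrow> 'x set"
  assumes cr: "cring R" "noetherian_ring R" and G: "module R G" and r: "fin_resolution R X D e G"
  shows "fin_gen_module R (dual_module R G)"
proof -
  interpret cring R by (rule cr)
  let ?G = "dual_module R G" and ?F = "free_module R (UNIV :: 'x set)" and ?u = "unit_vector R"
  have mG: "module R ?G" unfolding dual_module_def by (rule module_hom_module[OF G module_regular])
  interpret G': module R ?G by (rule mG)
  interpret F: module R ?F by (rule module_free)
  note rD = fin_resolutionD[OF r]
  have eu: "e (?u x) \<in> carrier G" if "x \<in> X 0" for x by (rule module_homD(1)[OF rD(4) unit_vector_closed[OF that]])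
  define j where "j \<phi> = (\<lambda>x. if x \<in> X 0 then \<phi> (e (?u x)) else \<zero>\<^bsub>R\<^esub>)" for \<phi>
  have hom: "\<phi> \<in> module_hom R G (regular_module R)" if "\<phi> \<in> carrier ?G" for \<phi> using that by (simp add: dual_module_simps)
  have jc: "j \<phi> \<in> carrier (free_module R (X 0))" if \<phi>: "\<phi> \<in> carrier ?G" for \<phi>
    unfolding j_def using module_homD(1)[OF hom[OF \<phi>] eu] by (intro free_extend[OF cr(1) rD(9)]) auto
  have jF: "j \<in> module_hom R ?G ?F"
  proof (rule module_homI)
    fix \<phi> assume \<phi>: "\<phi> \<in> carrier ?G"
    show "j \<phi> \<in> carrier ?F" using jc[OF \<phi>] free_module_mono[of "X 0" UNIV R] by auto
    show "j (\<phi> \<oplus>\<^bsub>?G\<^esub> \<psi>) = j \<phi> \<oplus>\<^bsub>?F\<^esub> j \<psi>" for \<psi>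
      using eu by (auto simp: j_def dual_module_simps fun_eq_iff)
    show "j (a \<odot>\<^bsub>?G\<^esub> \<phi>) = a \<odot>\<^bsub>?F\<^esub> j \<phi>" if "a \<in> carrier R" for a
      using eu that by (auto simp: j_def dual_module_simps fun_eq_iff)
  qed
  have inj: "\<phi> = \<psi>" if \<phi>: "\<phi> \<in> carrier ?G" and \<psi>: "\<psi> \<in> carrier ?G" and eq: "j \<phi> = j \<psi>" for \<phi> \<psi>
  proof (rule extensionalityI[of _ "carrier G"])
    show "\<phi> \<in> extensional (carrier G)" "\<psi> \<in> extensional (carrier G)" using \<phi> \<psi> by (simp_all add: dual_module_simps)
    fix g assume "g \<in> carrier G"
    then have "g \<in> e ` carrier (free_module R (X 0))" by (simp only: rD(5))
    then obtain v where v: "g = e v" "v \<in> carrier (free_module R (X 0))" by (rule imageE)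
    have "\<phi> (e v) = \<psi> (e v)"
    proof (rule free_hom_eqI[OF module_regular module_hom_comp[OF rD(4) hom[OF \<phi>]] module_hom_comp[OF rD(4) hom[OF \<psi>]] _ v(2)])
      fix x assume x: "x \<in> X 0"
      show "\<phi> (e (?u x)) = \<psi> (e (?u x))" using fun_cong[OF eq, of x] x by (simp add: j_def)
    qed
    then show "\<phi> g = \<psi> g" by (simp only: v(1))
  qed
  have jsub: "submodule (j ` carrier ?G) R ?F" by (rule submodule_image[OF mG F.module_axioms jF])
  have jX: "j ` carrier ?G \<subseteq> carrier (free_module R (X 0))" using jc by auto
  obtain S where S: "finite S" "S \<subseteq> j ` carrier ?G" "span_module R ?F S = j ` carrier ?G"
    using noetherian_submodule_free_finitely_generated[OF cr rD(9) jsub jX] by auto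
  obtain B where B: "B \<subseteq> carrier ?G" "finite B" "S = j ` B" using finite_subset_image[OF S(1,2)] by auto
  note sp = submodule_span[OF mG B(1)]
  have "span_module R ?F S \<subseteq> j ` span_module R ?G B"
    by (rule span_module_minimal[OF submodule_image_submodule[OF mG F.module_axioms jF sp]])
       (use span_module_superset[of B R ?G] B(3) in auto)
  then have sub: "j ` carrier ?G \<subseteq> j ` span_module R ?G B" unfolding S(3) .
  have "carrier ?G \<subseteq> span_module R ?G B"
  proof
    fix \<phi> assume \<phi>: "\<phi> \<in> carrier ?G"
    then have "j \<phi> \<in> j ` span_module R ?G B" using sub by auto
    then obtain \<psi> where \<psi>: "j \<phi> = j \<psi>" "\<psi> \<in> span_module R ?G B" by (rule imageE)
    from inj[OF \<phi> G'.submoduleD(1)[OF sp \<psi>(2)] \<psi>(1)] \<psi>(2) show "\<phi> \<in> span_module R ?G B" by simp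
  qed
  moreover have "span_module R ?G B \<subseteq> carrier ?G" using G'.submoduleD(1)[OF sp] by auto
  ultimately show ?thesis unfolding fin_gen_module_def using B(1,2) by auto
qed

text \<open>The first exactness condition says that \<open>Tor\<^sub>i(M, A / S)\<close> vanishes for \<open>i \<ge> k\<close>, the second that
  \<open>Ext\<^sup>i(M, R)\<close> does. The index type is fixed to \<open>nat\<close> so that mapping cones stay inside it.\<close>

definition good_resolution ::
  "('a, 'r) ring_scheme \<Rightarrow> ('a, 'n) module \<Rightarrow> 'n set \<Rightarrow> 'n set \<Rightarrow> int \<Rightarrow> ('a, 'm) module \<Rightarrow>
    (int \<Rightarrow> nat set) \<Rightarrow> (int \<Rightarrow> nat \<Rightarrow> nat \<Rightarrow> 'a) \<Rightarrow> ((nat \<Rightarrow> 'a) \<Rightarrow> 'm) \<Rightarrow> bool" where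
  "good_resolution R N A S k M X D e \<longleftrightarrow> fin_resolution R X D e M \<and>
    (\<forall>i\<ge>k. exact_at N X D A S i) \<and>
    (\<forall>i\<ge>k. exact_at (regular_module R) (transpose_basis X) (transpose_diff D) (carrier R) {\<zero>\<^bsub>R\<^esub>} (- i))"

text \<open>The hypothesis \<open>acyclic\<close> is the form in which finite projective dimension
  of \<open>A / S\<close> enters: finite free complexes that are exact in every degree stay exact
  with these coefficients. A complete resolution agrees with the resolution of \<open>G\<close> in
  positive degrees, which gives the first condition; the second is the vanishing of
  \<open>Ext\<close> in the definition of total reflexivity.\<close>

lemma totally_reflexive_good_resolution:
  fixes G :: "('a, 'g) module" and b :: "int \<Rightarrow> nat"
  assumes cr: "cring R" "noetherian_ring R" and tr: "totally_reflexive R G"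
    and N: "module R N" and A: "submodule A R N"
    and acyclic: "\<And>(X :: int \<Rightarrow> nat set) D i. fin_free_complex R X D \<Longrightarrow>
      (\<And>i. exact_at (regular_module R) X D (carrier R) {\<zero>\<^bsub>R\<^esub>} i) \<Longrightarrow> exact_at N X D A S i"
  obtains X D e where "good_resolution R N A S 1 G X D e" "\<And>i. X i \<subseteq> {b i..}"
proof -
  interpret cring R by (rule cr)
  have G: "module R G" and fg: "fin_gen_module R G"
    and bij: "bij_betw (biduality_map R G) (carrier G) (carrier (dual_module R (dual_module R G)))"
    and ext: "\<And>i. i > 0 \<Longrightarrow> zero_module (Ext R i G (regular_module R))"
    and ext': "\<And>i. i > 0 \<Longrightarrow> zero_module (Ext R i (dual_module R G) (regular_module R))"
    using tr by (auto simp: totally_reflexive_def)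
  have mG': "module R (dual_module R G)" unfolding dual_module_def by (rule module_hom_module[OF G module_regular])
  obtain X D e where r: "fin_resolution R X D e G" and X: "\<And>i. X i \<subseteq> {b i..}"
    by (rule noetherian_finite_free_resolution[OF cr G fg, of b]) (rule that)
  obtain X' :: "int \<Rightarrow> nat set" and D' e' where r': "fin_resolution R X' D' e' (dual_module R G)"
    by (rule noetherian_finite_free_resolution[OF cr mG' fin_gen_dual_module[OF cr G r], of "\<lambda>_. 0"]) (rule that)
  have E: "exact_at (regular_module R) (transpose_basis X) (transpose_diff D) (carrier R) {\<zero>\<^bsub>R\<^esub>} (- i)" if "i > 0" for i
    using zero_Ext_iff[OF G module_regular r, of "nat i"] ext[of "nat i"] that by simp
  have E': "exact_at (regular_module R) (transpose_basis X') (transpose_diff D') (carrier R) {\<zero>\<^bsub>R\<^esub>} (- i)" if "i > 0" for i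
    using zero_Ext_iff[OF mG' module_regular r', of "nat i"] ext'[of "nat i"] that by simp
  let ?T = "splice_basis X X'" and ?DT = "splice_diff D (\<lambda>x y. e' (unit_vector R y) (e (unit_vector R x))) D'"
  note ff = complete_resolution(1)[OF cr(1) G bij r r' E']
  have ac: "exact_at (regular_module R) ?T ?DT (carrier R) {\<zero>\<^bsub>R\<^esub>} i" for i
    by (rule complete_resolution(2)[OF cr(1) G bij r r' E'])
  have "exact_at N X D A S i" if i: "i > 0" for i
  proof (rule exact_at_shift[where X = ?T and D = ?DT and j = i, OF N A ff _ _ _ _ _ acyclic[OF ff ac]])
    show "D i x y = ?DT i x y" for x y using i by (simp add: splice_diff_def)
    show "D (i + 1) x y = ?DT (i + 1) x y" for x y using i by (simp add: splice_diff_def)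
  qed (use i in \<open>simp_all add: splice_basis_def\<close>)
  then have "good_resolution R N A S 1 G X D e" using r E by (simp add: good_resolution_def)
  then show thesis by (rule that) (rule X)
qed

text \<open>The kernel enters the cone with a shift by one, so its bound \<open>k\<close> becomes
  \<open>k + 1\<close>; as \<open>k\<close> is nonnegative this also covers the bound 1 of the
  totally reflexive module.\<close>

lemma good_resolution_step:
  fixes G :: "('a, 'g) module" and M :: "('a, 'm) module"
  assumes cr: "cring R" "noetherian_ring R" and tr: "totally_reflexive R G"
    and N: "module R N" and A: "submodule A R N" and S: "submodule S R N" "S \<subseteq> A"
    and acyclic: "\<And>(X :: int \<Rightarrow> nat set) D i. fin_free_complex R X D \<Longrightarrow>
      (\<And>i. exact_at (regular_module R) X D (carrier R) {\<zero>\<^bsub>R\<^esub>} i) \<Longrightarrow> exact_at N X D A S i"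
    and M: "module R M" and p: "p \<in> module_hom R G M" "p ` carrier G = carrier M"
    and K: "K = {x \<in> carrier G. p x = \<zero>\<^bsub>M\<^esub>}"
    and gK: "good_resolution R N A S k (G\<lparr>carrier := K\<rparr>) XK DK eK" and k: "k \<ge> 0"
  obtains X D e where "good_resolution R N A S (k + 1) M X D e"
proof -
  interpret cring R by (rule cr)
  have G: "module R G" using tr by (simp add: totally_reflexive_def)
  have rK: "fin_resolution R XK DK eK (G\<lparr>carrier := K\<rparr>)" using gK by (simp add: good_resolution_def)
  note rKD = fin_resolutionD[OF rK]
  \<comment> \<open>The bound exceeds every index that the resolution of the kernel contributes to
    this degree of the cone, which makes the two bases disjoint.\<close>
  define b where "b i = Suc (Max (insert 0 (XK (i - 1))))" for i
  have b: "x < b i" if "x \<in> XK (i - 1)" for x i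
  proof -
    have "x \<le> Max (insert 0 (XK (i - 1)))" by (rule Max_ge) (use rKD(9) that in auto)
    then show ?thesis by (simp only: b_def less_Suc_eq_le)
  qed
  obtain XG DG eG where gG: "good_resolution R N A S 1 G XG DG eG" and XG: "\<And>i. XG i \<subseteq> {b i..}"
    by (rule totally_reflexive_good_resolution[OF cr tr N A acyclic, of b]) (assumption | rule that)+
  have rG: "fin_resolution R XG DG eG G" using gG by (simp add: good_resolution_def)
  have disj: "XG i \<inter> XK (i - 1) = {}" for i using XG[of i] b[of _ i] by fastforce
  obtain D e where r: "fin_resolution R (\<lambda>i. XG i \<union> XK (i - 1)) D e M"
    and D: "\<And>i x y. x \<in> XG i \<Longrightarrow> y \<in> XG (i - 1) \<Longrightarrow> D i x y = DG i x y"
    "\<And>i x y. x \<in> XG i \<Longrightarrow> y \<in> XK (i - 2) \<Longrightarrow> D i x y = \<zero>\<^bsub>R\<^esub>"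
    "\<And>i x y. x \<in> XK (i - 1) \<Longrightarrow> y \<in> XK (i - 2) \<Longrightarrow> D i x y = DK (i - 1) x y"
    by (rule mapping_cone_resolution[OF cr(1) G M p K rG rK disj]) (rule that)
  note ff = fin_resolutionD(1)[OF r] and ffG = fin_resolutionD(1)[OF rG] and ffK = rKD(1)
  have carrR: "submodule (carrier R) R (regular_module R)" "submodule {\<zero>\<^bsub>R\<^esub>} R (regular_module R)" "{\<zero>\<^bsub>R\<^esub>} \<subseteq> carrier R"
    using module.carrier_is_submodule[OF module_regular] module.zero_submodule[OF module_regular] by simp_all
  have "exact_at N (\<lambda>i. XG i \<union> XK (i - 1)) D A S i" if "i \<ge> k + 1" for i
    by (rule exact_at_mapping_cone[where XG = XG and DG = DG and DK = DK and XK = XK, OF N A S ffG ffK ff disj D])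
       (use gG gK that k in \<open>simp_all add: good_resolution_def\<close>)
  moreover have "exact_at (regular_module R) (transpose_basis (\<lambda>i. XG i \<union> XK (i - 1))) (transpose_diff D) (carrier R) {\<zero>\<^bsub>R\<^esub>} (- i)"
    if "i \<ge> k + 1" for i
  proof (rule exact_at_mapping_cone_transpose[where XG = XG and DG = DG and DK = DK and XK = XK,
        OF module_regular carrR ffG ffK ff disj D])
    show "exact_at (regular_module R) (transpose_basis XG) (transpose_diff DG) (carrier R) {\<zero>\<^bsub>R\<^esub>} (- i)"
      using gG that k by (simp add: good_resolution_def)
    have "k \<le> i - 1" using that by simp
    then show "exact_at (regular_module R) (transpose_basis XK) (transpose_diff DK) (carrier R) {\<zero>\<^bsub>R\<^esub>} (- (i - 1))"
      using gK by (simp only: good_resolution_def)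
  qed
  ultimately have "good_resolution R N A S (k + 1) M (\<lambda>i. XG i \<union> XK (i - 1)) D e"
    using r by (simp add: good_resolution_def)
  then show thesis by (rule that)
qed

text \<open>This starts the induction: beyond the left end of a resolution by totally reflexive
  modules the kernel is zero, and empty bases achieve the bound 0.\<close>

lemma good_resolution_zero:
  assumes cr: "cring R" and M: "module R M" and zero: "carrier M = {\<zero>\<^bsub>M\<^esub>}"
  shows "good_resolution R N A S 0 M (\<lambda>_. {}) (\<lambda>_ _ _. \<zero>\<^bsub>R\<^esub>) (\<lambda>_. \<zero>\<^bsub>M\<^esub>)"
proof -
  interpret cring R by (rule cr)
  interpret M: module R M by (rule M)
  let ?F = "fin_cpx R (\<lambda>_. {} :: nat set) (\<lambda>_ _ _. \<zero>\<^bsub>R\<^esub>)"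
  have ff: "fin_free_complex R (\<lambda>_. {} :: nat set) (\<lambda>_ _ _. \<zero>\<^bsub>R\<^esub>)" by (simp add: fin_free_complex_def)
  have c: "carrier (free_module R ({} :: nat set)) = {\<lambda>_. \<zero>\<^bsub>R\<^esub>}"
    by (auto simp: free_module_carrier fun_eq_iff)
  have "left_resolution R ?F (\<lambda>_. \<zero>\<^bsub>M\<^esub>) M"
    unfolding left_resolution_def
    using chain_complex_fin_cpx[OF cr ff] zero
    by (auto simp: fin_cpx_simps c zero_module_def boundaries_def cycles_def intro!: module_homI)
  then show ?thesis using ff
    by (simp add: good_resolution_def fin_resolution_def exact_at_def transpose_basis_def)
qed

text \<open>The modules of boundaries are resolved successively from the left end of a totally
  reflexive resolution. The bound starts at 0 and grows by one with each of the \<open>g + 1\<close>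
  cones, so vanishing holds in all degrees above \<open>g\<close>.\<close>

lemma Gdim_good_resolution:
  fixes M :: "('a, 'm) module"
  assumes cr: "cring R" "noetherian_ring R" and M: "module R M"
    and N: "module R N" and A: "submodule A R N" and S: "submodule S R N" "S \<subseteq> A"
    and acyclic: "\<And>(X :: int \<Rightarrow> nat set) D i. fin_free_complex R X D \<Longrightarrow>
      (\<And>i. exact_at (regular_module R) X D (carrier R) {\<zero>\<^bsub>R\<^esub>} i) \<Longrightarrow> exact_at N X D A S i"
    and g: "Gdim R M = enat g"
  obtains X D e where "good_resolution R N A S (int g + 1) M X D e"
proof -
  define L where "L = {enat n | n. \<exists>(G :: ('a, (nat \<Rightarrow> 'a) set) cpx) \<epsilon>.
      left_resolution R G \<epsilon> M \<and> (\<forall>i>int n. zero_module (cobj G i)) \<and>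
      (\<forall>i\<in>{0..int n}. totally_reflexive R (cobj G i))}"
  have "Inf L = enat g" using g by (simp add: Gdim_def L_def)
  \<comment> \<open>A nonempty set of extended naturals contains its infimum, so a finite Gorenstein
    dimension is attained by an actual resolution.\<close>
  then have "L \<noteq> {}" by (auto simp: Inf_enat_def)
  then have "Inf L \<in> L" by (simp add: Inf_enat_def) (metis LeastI ex_in_conv)
  then have "enat g \<in> L" using \<open>Inf L = enat g\<close> by simp
  then obtain G :: "('a, (nat \<Rightarrow> 'a) set) cpx" and \<epsilon> where
    G: "left_resolution R G \<epsilon> M" "\<forall>i>int g. zero_module (cobj G i)" "\<forall>i\<in>{0..int g}. totally_reflexive R (cobj G i)"
    by (auto simp: L_def)
  note GD = left_resolutionD[OF G(1)] and CD = chain_complexD[OF left_resolutionD(1)[OF G(1)]]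
  have modB: "module R (cobj G i\<lparr>carrier := boundaries G i\<rparr>)" for i
    by (rule submodule.submodule_is_module[OF submodule_boundaries[OF GD(1)] CD(1)])
  have main: "\<exists>X D e. good_resolution R N A S (int k) (cobj G (int g - int k)\<lparr>carrier := boundaries G (int g - int k)\<rparr>) X D e"
    if "k \<le> g" for k
    using that
  proof (induction k)
    case 0
    have "zero_module (cobj G (int g + 1))" using G(2) by simp
    then have "boundaries G (int g) = {\<zero>\<^bsub>cobj G (int g)\<^esub>}"
      using module_hom_zero[OF CD(1) CD(1) CD(3)] by (simp add: boundaries_def zero_module_def)
    then show ?case
      using good_resolution_zero[OF cr(1) modB[of "int g"], of N A S] by (intro exI) simp
  next
    case (Suc k)
    let ?j = "int g - int k"
    have j: "?j > 0" "?j \<le> int g" "int g - int (Suc k) = ?j - 1" using Suc.prems by auto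
    obtain XK DK eK where gK: "good_resolution R N A S (int k) (cobj G ?j\<lparr>carrier := boundaries G ?j\<rparr>) XK DK eK"
      using Suc.IH Suc.prems by auto
    have tr: "totally_reflexive R (cobj G ?j)" using G(3) j by simp
    have d: "cdiff G ?j \<in> module_hom R (cobj G ?j) (cobj G (?j - 1)\<lparr>carrier := boundaries G (?j - 1)\<rparr>)"
      using module_homD[OF CD(2)[of ?j]] by (intro module_homI) (auto simp: boundaries_def)
    have dsurj: "cdiff G ?j ` carrier (cobj G ?j) = carrier (cobj G (?j - 1)\<lparr>carrier := boundaries G (?j - 1)\<rparr>)"
      by (simp add: boundaries_def)
    have cb: "boundaries G ?j = cycles G ?j" using GD(7)[OF j(1)] boundaries_subset_cycles[OF GD(1)] by auto
    have ker: "boundaries G ?j = {x \<in> carrier (cobj G ?j). cdiff G ?j x = \<zero>\<^bsub>cobj G (?j - 1)\<lparr>carrier := boundaries G (?j - 1)\<rparr>\<^esub>}"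
      unfolding cb by (simp add: cycles_def)
    obtain X D e where "good_resolution R N A S (int k + 1) (cobj G (?j - 1)\<lparr>carrier := boundaries G (?j - 1)\<rparr>) X D e"
      by (rule good_resolution_step[OF cr tr N A S acyclic modB d dsurj ker gK]) (assumption | rule that | simp)+
    then show ?case unfolding j(3) by (intro exI) (simp add: add.commute)
  qed
  obtain XK DK eK where gK: "good_resolution R N A S (int g) (cobj G 0\<lparr>carrier := boundaries G 0\<rparr>) XK DK eK"
    using main[of g] by auto
  have tr: "totally_reflexive R (cobj G 0)" using G(3) by simp
  have ker: "boundaries G 0 = {x \<in> carrier (cobj G 0). \<epsilon> x = \<zero>\<^bsub>M\<^esub>}"
    using G(1) by (simp add: left_resolution_def)
  obtain X D e where "good_resolution R N A S (int g + 1) M X D e"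
    by (rule good_resolution_step[OF cr tr N A S acyclic M GD(3,4) ker gK]) (assumption | rule that | simp)+
  then show thesis by (rule that)
qed


section \<open>Coefficients in a quasi-projective resolution\<close>

lemma exact_at_trivial:
  assumes "module R M" "fin_free_complex R X D" "submodule A R M"
  shows "exact_at M X D A A i"
proof -
  interpret C: module_complex R M X D
    by (intro module_complex.intro module_complex_axioms.intro assms)
  note A = C.submoduleD[OF assms(3)]
  show ?thesis
    unfolding exact_at_def
  proof (intro ballI impI)
    fix f assume f: "f \<in> X i \<rightarrow> A"
    have z: "(\<lambda>_. \<zero>\<^bsub>M\<^esub>) \<in> X (i + 1) \<rightarrow> A" using A(2) by auto
    show "\<exists>g\<in>X (i + 1) \<rightarrow> A. \<forall>x\<in>X i. f x \<ominus>\<^bsub>M\<^esub> mat_act M (X (i + 1)) (D (i + 1)) g x \<in> A"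
      by (intro bexI[OF _ z] ballI A(5) C.diff_in'[OF assms(3) z] funcset_mem[OF f])
  qed
qed

text \<open>Each move drops one end of the window and gains a degree at the other; downward moves
  stop when the window begins at \<open>g + 1\<close>. A window beginning at \<open>j\<close>
  contains \<open>j\<close> because \<open>h\<close> is nonnegative.\<close>

lemma window_induct:
  fixes W :: "int \<Rightarrow> bool"
  assumes win: "\<And>i. n \<le> i \<Longrightarrow> i \<le> n + h \<Longrightarrow> W i" and "n > g" and h: "h \<ge> 0"
    and up: "\<And>m. m > g \<Longrightarrow> (\<And>i. m \<le> i \<Longrightarrow> i \<le> m + h \<Longrightarrow> W i) \<Longrightarrow> W (m + h + 1)"
    and down: "\<And>m. m - 1 > g \<Longrightarrow> (\<And>i. m \<le> i \<Longrightarrow> i \<le> m + h \<Longrightarrow> W i) \<Longrightarrow> W (m - 1)"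
    and "j > g"
  shows "W j"
proof -
  define Win where "Win m \<longleftrightarrow> (\<forall>i. m \<le> i \<and> i \<le> m + h \<longrightarrow> W i)" for m
  have base: "Win n" using win by (simp add: Win_def)
  have U: "Win (m + 1)" if "Win m" "m > g" for m
  proof -
    have "W (m + h + 1)" using that by (intro up) (auto simp: Win_def)
    moreover have "i \<le> m + h \<or> i = m + h + 1" if "i \<le> m + 1 + h" for i using that by linarith
    ultimately show ?thesis using that(1) unfolding Win_def by (metis add_le_cancel_left le_add_same_cancel1 order_trans zero_le_one)
  qed
  have L: "Win (m - 1)" if "Win m" "m - 1 > g" for m
  proof -
    have w: "W (m - 1)" using that by (intro down) (auto simp: Win_def)
    have "W i" if "m - 1 \<le> i" "i \<le> m - 1 + h" for i
      using \<open>Win m\<close> w that unfolding Win_def by (cases "i = m - 1") auto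
    then show ?thesis by (simp add: Win_def)
  qed
  have "Win j"
  proof (cases "j \<ge> n")
    case True
    then show ?thesis
    proof (induction j rule: int_ge_induct)
      case (step i)
      then show ?case using U \<open>n > g\<close> by simp
    qed (rule base)
  next
    case False
    then have "j \<le> n" by simp
    then have "g < j \<longrightarrow> Win j"
    proof (induction j rule: int_le_induct)
      case (step i)
      then show ?case using L by simp
    qed (use base in simp)
    then show ?thesis using \<open>j > g\<close> by simp
  qed
  then show ?thesis using h by (simp add: Win_def)
qed

text \<open>Below, the pair \<open>(Z q, B q)\<close> represents the homology in degree \<open>q\<close>, a power of \<open>N\<close>, and \<open>(C q, Z q)\<close> represents
  \<open>B (q - 1)\<close>.\<close>

locale quasi_projective_coefficients =
  fixes R :: "('a, 'r) ring_scheme" and P :: "('a, 'p) cpx" and N :: "('a, 'n) module" and s t :: int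
    and X :: "int \<Rightarrow> 'x set" and D :: "int \<Rightarrow> 'x \<Rightarrow> 'x \<Rightarrow> 'a"
  assumes N: "module R N" and chain: "chain_complex R P" and proj: "\<And>i. projective_module R (cobj P i)"
    and bounded: "bounded_below P" "bounded_above P"
    and homology_cases: "\<And>q. zero_module (homology P q) \<or> (\<exists>a. module_isomorphic R (homology P q) (direct_power N a))"
    and top: "\<not> zero_module (homology P s)" "\<And>q. q > s \<Longrightarrow> zero_module (homology P q)"
    and bot: "\<not> zero_module (homology P t)" "\<And>q. q < t \<Longrightarrow> zero_module (homology P q)"
    and ff: "fin_free_complex R X D"
begin

abbreviation "Z \<equiv> cycles P"
abbreviation "B \<equiv> boundaries P"
abbreviation "C q \<equiv> carrier (cobj P q)"
abbreviation "Null q \<equiv> {\<zero>\<^bsub>cobj P q\<^esub>}"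
abbreviation "V q \<equiv> exact_at (cobj P q) X D"
abbreviation "VR \<equiv> exact_at (regular_module R) X D (carrier R) {\<zero>\<^bsub>R\<^esub>}"
abbreviation "VN \<equiv> exact_at N X D (carrier N) {\<zero>\<^bsub>N\<^esub>}"

lemma cr: "cring R" using N by (simp add: module_def)

lemma module_cobj: "module R (cobj P q)" by (rule chain_complexD(1)[OF chain])

lemma submodules: "submodule (Z q) R (cobj P q)" "submodule (B q) R (cobj P q)" "submodule (C q) R (cobj P q)"
  "submodule (Null q) R (cobj P q)" "B q \<subseteq> Z q" "Z q \<subseteq> C q" "B q \<subseteq> C q" "Null q \<subseteq> B q" "Null q \<subseteq> Z q"
proof -
  interpret module R "cobj P q" by (rule module_cobj)
  show s: "submodule (Z q) R (cobj P q)" "submodule (B q) R (cobj P q)" "submodule (C q) R (cobj P q)"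
    "submodule (Null q) R (cobj P q)" "B q \<subseteq> Z q"
    by (rule submodule_cycles[OF chain] submodule_boundaries[OF chain] carrier_is_submodule zero_submodule
        boundaries_subset_cycles[OF chain])+
  show "Z q \<subseteq> C q" "B q \<subseteq> C q" "Null q \<subseteq> B q" "Null q \<subseteq> Z q"
    using submoduleD(1)[OF s(1)] submoduleD(1)[OF s(2)] submoduleD(2)[OF s(1)] submoduleD(2)[OF s(2)] by auto
qed

lemma module_complex_cobj: "module_complex R (cobj P q) X D"
  by (intro module_complex.intro module_complex_axioms.intro module_cobj ff)

text \<open>The three parts give vanishing for the middle term, the quotient and the submodule of a
  short exact sequence. Part (2) consults degree \<open>i - 1\<close> of the submodule and part (3)
  degree \<open>i + 1\<close> of the quotient.\<close>

lemma extension: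
  assumes "submodule S R (cobj P q)" "submodule A R (cobj P q)" "submodule E R (cobj P q)" "S \<subseteq> A" "A \<subseteq> E"
  shows "V q A S i \<Longrightarrow> V q E A i \<Longrightarrow> V q E S i"
    and "V q E S i \<Longrightarrow> V q A S (i - 1) \<Longrightarrow> V q E A i"
    and "V q E A (i + 1) \<Longrightarrow> V q E S i \<Longrightarrow> V q A S i"
  by (rule module_complex.exact_at_extension[OF module_complex_cobj assms], assumption+,
      rule module_complex.exact_at_quotient[OF module_complex_cobj assms], assumption+,
      rule module_complex.exact_at_sub[OF module_complex_cobj assms], assumption+)

lemma shift: "V q (C q) (Z q) i \<longleftrightarrow> V (q - 1) (B (q - 1)) (Null (q - 1)) i"
proof (rule exact_at_iso[OF module_cobj module_cobj ff submodules(3,1,2,4), where h = "cdiff P q"])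
  show "cdiff P q \<in> module_hom R (cobj P q\<lparr>carrier := C q\<rparr>) (cobj P (q - 1))"
    using chain_complexD(2)[OF chain] by simp
qed (auto simp: boundaries_def cycles_def)

lemma zero_homologyD: "zero_module (homology P q) \<Longrightarrow> Z q = B q"
  using zero_homology_iff[OF chain, of q] submodules(5)[of q] by (simp add: subset_antisym)

text \<open>Projecting cycles to homology and applying the given isomorphism yields a surjection
  from \<open>Z q\<close> onto the power of \<open>N\<close> with kernel \<open>B q\<close>.\<close>

lemma homology_iso:
  assumes "module_isomorphic R (homology P q) (direct_power N a)"
  shows "V q (Z q) (B q) i \<longleftrightarrow>
    exact_at (direct_power N a) X D (carrier (direct_power N a)) {\<zero>\<^bsub>direct_power N a\<^esub>} i"
proof -
  let ?Q = "cobj P q\<lparr>carrier := Z q\<rparr>" and ?K = "direct_power N a"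
  interpret K: module R ?K by (rule module_direct_power[OF N])
  have Q: "module R ?Q" by (rule submodule.submodule_is_module[OF submodules(1) module_cobj])
  have BQ: "submodule (B q) R ?Q" by (rule submodule_in_submodule[OF module_cobj submodules(1,2,5)])
  obtain f where f: "f \<in> module_hom R (homology P q) ?K" "bij_betw f (carrier (homology P q)) (carrier ?K)"
    using assms by (auto simp: module_isomorphic_def)
  have H: "homology P q = quotient_module ?Q (B q)" by (simp add: homology_def)
  note pr = quotient_module_proj[OF Q BQ, folded H]
  let ?h = "\<lambda>z. f (B q +>\<^bsub>?Q\<^esub> z)"
  have h: "?h \<in> module_hom R ?Q ?K" by (rule module_hom_comp[OF pr f(1)])
  have cH: "carrier (homology P q) = (\<lambda>z. B q +>\<^bsub>?Q\<^esub> z) ` Z q"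
    unfolding H quotient_module_simps by simp
  show ?thesis
  proof (rule exact_at_iso[OF module_cobj K.module_axioms ff submodules(1,2) K.carrier_is_submodule K.zero_submodule h])
    show "?h ` Z q = carrier ?K"
      using bij_betw_imp_surj_on[OF f(2)] unfolding cH by (simp add: image_image)
    fix z assume z: "z \<in> Z q"
    have mH: "module R (homology P q)" unfolding H by (rule module_quotient[OF Q BQ])
    interpret H: module R "homology P q" by (rule mH)
    have zH: "\<zero>\<^bsub>homology P q\<^esub> = B q" unfolding H quotient_module_simps ..
    have "?h z = \<zero>\<^bsub>?K\<^esub> \<longleftrightarrow> f (B q +>\<^bsub>?Q\<^esub> z) = f \<zero>\<^bsub>homology P q\<^esub>"
      using module_hom_zero[OF mH K.module_axioms f(1)] by simp
    also have "\<dots> \<longleftrightarrow> B q +>\<^bsub>?Q\<^esub> z = \<zero>\<^bsub>homology P q\<^esub>"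
      using z by (intro inj_on_eq_iff[OF bij_betw_imp_inj_on[OF f(2)]]) (auto simp: cH H.zero_closed[unfolded cH])
    also have "\<dots> \<longleftrightarrow> z \<in> B q"
      unfolding zH using quotient_module_zero_iff[OF Q BQ, of z] z by simp
    finally show "?h z \<in> {\<zero>\<^bsub>?K\<^esub>} \<longleftrightarrow> z \<in> B q" by simp
  qed
qed

lemma direct_power_0: "carrier (direct_power N 0) = {\<zero>\<^bsub>direct_power N 0\<^esub>}"
  by (auto simp: restrict_def)

lemma homology_exact:
  assumes "VN i" shows "V q (Z q) (B q) i"
proof (cases "zero_module (homology P q)")
  case True
  then show ?thesis using exact_at_trivial[OF module_cobj ff submodules(2)] zero_homologyD by simp
next
  case False
  then obtain a where a: "module_isomorphic R (homology P q) (direct_power N a)" using homology_cases by auto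
  have mK: "module R (direct_power N a)" by (rule module_direct_power[OF N])
  show ?thesis
  proof (cases "a = 0")
    case True
    then show ?thesis
      using homology_iso[OF a] direct_power_0 exact_at_trivial[OF mK ff module.zero_submodule[OF mK], of i] by simp
  next
    case False
    then show ?thesis using homology_iso[OF a] exact_at_direct_power[OF N ff, of a i] assms by simp
  qed
qed

text \<open>Nonzero homology forces a positive exponent, so vanishing for that homology returns to
  \<open>N\<close>. For this reason the runs through \<open>P\<close> end at \<open>s\<close> and
  \<open>t\<close>, where homology is known to be nonzero.\<close>

lemma homology_exactD:
  assumes "\<not> zero_module (homology P q)" "V q (Z q) (B q) i" shows "VN i"
proof -
  obtain a where a: "module_isomorphic R (homology P q) (direct_power N a)" using homology_cases assms(1) by auto
  have "a \<noteq> 0"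
  proof
    assume "a = 0"
    then obtain f where f: "f \<in> module_hom R (homology P q) (direct_power N 0)"
      "bij_betw f (carrier (homology P q)) (carrier (direct_power N 0))"
      using a by (auto simp: module_isomorphic_def)
    have "card (carrier (homology P q)) = 1"
      using bij_betw_same_card[OF f(2)] unfolding direct_power_0 by simp
    then obtain z where "carrier (homology P q) = {z}" by (auto simp: card_1_singleton_iff)
    moreover have "\<zero>\<^bsub>homology P q\<^esub> \<in> carrier (homology P q)"
    proof -
      have "module R (homology P q)"
        unfolding homology_def
        by (rule module_quotient[OF submodule.submodule_is_module[OF submodules(1) module_cobj] submodule_in_submodule[OF module_cobj submodules(1,2,5)]])
      then interpret H: module R "homology P q" .
      show ?thesis by simp
    qed
    ultimately show False using assms(1) by (auto simp: zero_module_def)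
  qed
  then show ?thesis using homology_iso[OF a] exact_at_direct_power[OF N ff, of a i] assms(2) by simp
qed

lemma projective_exact: "VR i \<Longrightarrow> V q (C q) (Null q) i"
  by (rule exact_at_projective_module[OF cr ff _ proj])

text \<open>The modules \<open>B q\<close> with \<open>q \<ge> s\<close> have finite projective resolutions, given by the part of \<open>P\<close> above degree \<open>q\<close>.\<close>

lemma boundaries_exact:
  assumes VR: "\<And>i. i \<le> m \<Longrightarrow> VR i" and "q \<ge> s" and "i \<le> m"
  shows "V q (B q) (Null q) i"
proof -
  obtain u where u: "\<And>i. i > u \<Longrightarrow> zero_module (cobj P i)" using bounded(2) by (auto simp: bounded_above_def)
  have big: "V q (B q) (Null q) i" if "q \<ge> u" for q i
  proof -
    have "zero_module (cobj P (q + 1))" using u that by simp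
    then have "B q = Null q"
      using module_hom_zero[OF module_cobj module_cobj chain_complexD(3)[OF chain]] by (simp add: boundaries_def zero_module_def)
    then show ?thesis using exact_at_trivial[OF module_cobj ff submodules(4)] by simp
  qed
  \<comment> \<open>The step from \<open>B q\<close> to \<open>B (q - 1)\<close> consults degree
    \<open>i - 1\<close>, so all degrees up to \<open>m\<close> are treated at once, descending from
    the top of \<open>P\<close>, where the boundaries are zero.\<close>
  have "\<forall>i\<le>m. V q (B q) (Null q) i" if "q \<le> max u s" "q \<ge> s" for q
    using that
  proof (induction q rule: int_le_induct)
    case base
    then show ?case using big by simp
  next
    case (step q)
    have Z: "Z q = B q" using zero_homologyD[OF top(2)] step.prems by simp
    have "V (q - 1) (B (q - 1)) (Null (q - 1)) i" if i: "i \<le> m" for i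
    proof -
      have "V q (B q) (Null q) (i - 1)" using step i by simp
      then have "V q (C q) (Z q) i"
        unfolding Z by (rule extension(2)[OF submodules(4,2,3,8,7) projective_exact[OF VR[OF i]]])
      then show ?thesis unfolding shift .
    qed
    then show ?case by simp
  qed
  then show ?thesis using big assms(2,3) by (cases "q \<le> max u s") auto
qed

text \<open>Below degree \<open>t\<close> the complex is exact, bounded below and consists of projectives, so it splits.\<close>

lemma cycles_retract:
  assumes "q \<le> t"
  shows "\<exists>r\<in>module_hom R (cobj P q) (cobj P q). r ` C q \<subseteq> Z q \<and> (\<forall>x\<in>Z q. r x = x)"
proof -
  obtain l where l: "\<And>i. i < l \<Longrightarrow> zero_module (cobj P i)" using bounded(1) by (auto simp: bounded_below_def)
  have small: "\<exists>r\<in>module_hom R (cobj P q) (cobj P q). r ` C q \<subseteq> Z q \<and> (\<forall>x\<in>Z q. r x = x)" if "q < l" for q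
  proof -
    have "C q = Null q" using l[OF that] by (simp add: zero_module_def)
    then have "C q \<subseteq> Z q" using submodules(9) by simp
    then show ?thesis by (intro bexI[of _ "\<lambda>x. x"] module_hom_id) auto
  qed
  have "\<exists>r\<in>module_hom R (cobj P q) (cobj P q). r ` C q \<subseteq> Z q \<and> (\<forall>x\<in>Z q. r x = x)" if "q \<ge> min (l - 1) t" "q \<le> t" for q
    using that
  proof (induction q rule: int_ge_induct)
    case base
    show ?case
    proof (cases "l - 1 \<le> t")
      case True
      then show ?thesis using small[of "l - 1"] by simp
    next
      case False
      then show ?thesis using small[of t] by simp
    qed
  next
    case (step q)
    then obtain r where r: "r \<in> module_hom R (cobj P q) (cobj P q)" "r ` C q \<subseteq> Z q" "\<forall>x\<in>Z q. r x = x" by auto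
    have Z: "Z q = B q" using zero_homologyD[OF bot(2)] step.prems by simp
    note d = chain_complexD(3)[OF chain, of q]
    have im: "r ` C q \<subseteq> cdiff P (q + 1) ` C (q + 1)" using r(2) unfolding Z boundaries_def .
    obtain k where k: "k \<in> module_hom R (cobj P q) (cobj P (q + 1))" "\<And>x. x \<in> C q \<Longrightarrow> cdiff P (q + 1) (k x) = r x"
      by (rule projective_module_lift[OF proj module_cobj module_cobj d r(1) im]) (rule that)
    interpret M: module R "cobj P (q + 1)" by (rule module_cobj)
    interpret M0: module R "cobj P q" by (rule module_cobj)
    \<comment> \<open>With \<open>k\<close> lifting \<open>r\<close> through the differential,
      \<open>d k d x = r (d x) = d x\<close>, so the new map takes cycles as values; it fixes every
      cycle because \<open>d x\<close> is then zero.\<close>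
    let ?r = "\<lambda>x. x \<ominus>\<^bsub>cobj P (q + 1)\<^esub> k (cdiff P (q + 1) x)"
    have kd: "(\<lambda>x. k (cdiff P (q + 1) x)) \<in> module_hom R (cobj P (q + 1)) (cobj P (q + 1))"
      by (rule module_hom_comp[OF d k(1)])
    have r': "?r \<in> module_hom R (cobj P (q + 1)) (cobj P (q + 1))"
      by (rule module_hom_minus_hom[OF module_cobj module_hom_id kd])
    have "?r x \<in> Z (q + 1)" if x: "x \<in> C (q + 1)" for x
    proof -
      have dx: "cdiff P (q + 1) x \<in> C q" by (rule module_homD(1)[OF d x])
      have "cdiff P (q + 1) x \<in> Z q" unfolding Z boundaries_def using x by simp
      then have "cdiff P (q + 1) (k (cdiff P (q + 1) x)) = cdiff P (q + 1) x" using k(2)[OF dx] r(3) by simp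
      then have "cdiff P (q + 1) (?r x) = \<zero>\<^bsub>cobj P q\<^esub>"
        using module_hom_minus'[OF module_cobj module_cobj d x module_homD(1)[OF kd x]] dx by simp
      then show ?thesis using module_homD(1)[OF r' x] by (simp add: cycles_def)
    qed
    moreover have "?r x = x" if "x \<in> Z (q + 1)" for x
      using that module_hom_zero[OF module_cobj module_cobj k(1)] by (simp add: cycles_def)
    ultimately show ?case using r' by (intro bexI[OF _ r']) auto
  qed
  then show ?thesis using small assms by (cases "q \<ge> min (l - 1) t") auto
qed

text \<open>For \<open>q\<close> at most \<open>t\<close> the cycles are a direct summand of the
  projective module \<open>C q\<close>.\<close>

lemma cycles_exact:
  assumes "VR i" "q \<le> t" shows "V q (Z q) (Null q) i"
proof -
  obtain r where r: "r \<in> module_hom R (cobj P q) (cobj P q)" "r ` C q \<subseteq> Z q" "\<forall>x\<in>Z q. r x = x"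
    using cycles_retract[OF assms(2)] by auto
  have e: "(\<lambda>x. x) \<in> module_hom R (cobj P q\<lparr>carrier := Z q\<rparr>) (cobj P q)"
    using submodules(6)[of q] by (intro module_homI) auto
  show ?thesis
    by (rule exact_at_retract[OF module_cobj module_cobj ff submodules(1,3) e _ _ r(2) _ projective_exact[OF assms(1)]])
       (use r submodules(6)[of q] in auto)
qed

text \<open>The shift in \<open>boundaries_exact\<close> moves to ever lower degrees, so exactness
  over the ring is demanded in all of them, as complete resolutions provide.\<close>

lemma quotient_exact:
  assumes "\<And>i. VR i" shows "V s (C s) (B s) i"
  by (rule extension(2)[OF submodules(4,2,3,8,7) projective_exact boundaries_exact[of i s "i - 1"]]) (use assms in auto)

lemma s_ge_t: "t \<le> s"
  using top bot by (meson not_le)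

text \<open>The window moves up by a descent in \<open>P\<close> from \<open>C s / B s\<close> to
  \<open>C t / B t\<close>, and down by an ascent from \<open>C t / Z t\<close> to
  \<open>C s / Z s\<close>. Positive \<open>Tor\<close> vanishes on the projectives passed on the
  way. The hypothesis \<open>VC\<close> starts the first run and closes the second.\<close>

lemma homological_vanishing:
  assumes VR: "\<And>i. i \<ge> 1 \<Longrightarrow> VR i" and VC: "\<And>i. i \<ge> g + 1 \<Longrightarrow> V s (C s) (B s) i" and g: "g \<ge> 0"
    and n: "n > g" and win: "\<And>i. n \<le> i \<Longrightarrow> i \<le> n + (s - t) \<Longrightarrow> VN i" and "i > g"
  shows "VN i"
proof (rule window_induct[where W = VN and n = n and h = "s - t" and g = g and j = i])
  show "0 \<le> s - t" using s_ge_t by simp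
  \<comment> \<open>The module \<open>C t / Z t\<close> is treated as a quotient of
    \<open>C t\<close> by a summand, which consults degree \<open>i - 1\<close>; that degree must
    still be positive, hence the bound 2.\<close>
  have CZ: "V t (C t) (Z t) i" if "i \<ge> 2" for i
    by (rule extension(2)[OF submodules(4,1,3,9,6) projective_exact cycles_exact]) (use that VR in auto)
  fix m assume m: "m > g" and W: "\<And>i. m \<le> i \<Longrightarrow> i \<le> m + (s - t) \<Longrightarrow> VN i"
  \<comment> \<open>The homology at \<open>q\<close> in degree \<open>m + j\<close> takes
    \<open>C q / B q\<close> to \<open>C q / Z q\<close>, which is \<open>B (q - 1)\<close>; the
    projective \<open>C (q - 1)\<close> then takes it to \<open>C (q - 1) / B (q - 1)\<close> one
    degree higher.\<close>
  have chain_up: "int j \<le> s - t \<Longrightarrow> V (s - int j) (C (s - int j)) (B (s - int j)) (m + 1 + int j)" for j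
  proof (induction j)
    case 0
    then show ?case using VC m by simp
  next
    case (Suc j)
    let ?q = "s - int j" and ?k = "m + 1 + int j"
    have q: "s - int (Suc j) = ?q - 1" "m + 1 + int (Suc j) = ?k + 1" by simp_all
    have "V ?q (Z ?q) (B ?q) (?k - 1)" using homology_exact[OF W[of "m + int j"]] Suc.prems by simp
    then have "V ?q (C ?q) (Z ?q) ?k" using Suc.IH Suc.prems by (intro extension(2)[OF submodules(2,1,3,5,6)]) auto
    then have b: "V (?q - 1) (B (?q - 1)) (Null (?q - 1)) ?k" unfolding shift .
    have p: "V (?q - 1) (C (?q - 1)) (Null (?q - 1)) (?k + 1)"
      by (rule projective_exact[OF VR]) (use m g in simp)
    show ?case unfolding q
      by (rule extension(2)[OF submodules(4,2,3,8,7) p]) (use b in \<open>simp only: add_diff_cancel_right'\<close>)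
  qed
  have e: "V t (C t) (B t) (m + (s - t) + 1)" using chain_up[of "nat (s - t)"] s_ge_t by (simp add: algebra_simps)
  have "V t (Z t) (B t) (m + (s - t) + 1)"
    by (rule extension(3)[OF submodules(2,1,3,5,6) CZ e]) (use m g s_ge_t in simp)
  then show "VN (m + (s - t) + 1)" by (rule homology_exactD[OF bot(1)])
next
  fix m assume m: "m - 1 > g" and W: "\<And>i. m \<le> i \<Longrightarrow> i \<le> m + (s - t) \<Longrightarrow> VN i"
  \<comment> \<open>The same passage backwards: homology takes \<open>C q / Z q\<close> to
    \<open>C q / B q\<close>, and the projective \<open>C q\<close> takes that to
    \<open>B q\<close>, which is \<open>C (q + 1) / Z (q + 1)\<close>, one degree lower.\<close>
  have chain_down: "int j \<le> s - t \<Longrightarrow> V (t + int j) (C (t + int j)) (Z (t + int j)) (m + (s - t) - int j)" for j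
  proof (induction j)
    case 0
    have "V t (C t) (Z t) (m + (s - t))"
      by (rule extension(2)[OF submodules(4,1,3,9,6) projective_exact cycles_exact])
         (use m g s_ge_t in \<open>auto intro!: VR\<close>)
    then show ?case by simp
  next
    case (Suc j)
    let ?q = "t + int j" and ?k = "m + (s - t) - int j"
    have q: "t + int (Suc j) = ?q + 1" "m + (s - t) - int (Suc j) = ?k - 1" by simp_all
    have h: "V ?q (Z ?q) (B ?q) ?k" by (rule homology_exact[OF W]) (use Suc.prems in auto)
    have c: "V ?q (C ?q) (B ?q) ?k" using Suc.IH Suc.prems by (intro extension(1)[OF submodules(2,1,3,5,6) h]) auto
    have p: "V ?q (C ?q) (Null ?q) (?k - 1)" by (rule projective_exact[OF VR]) (use m g Suc.prems in simp)
    have "V ?q (B ?q) (Null ?q) (?k - 1)" by (rule extension(3)[OF submodules(4,2,3,8,7) _ p]) (use c in simp)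
    then show ?case unfolding q shift by simp
  qed
  have e: "V s (C s) (Z s) m" using chain_down[of "nat (s - t)"] s_ge_t by simp
  have "V s (Z s) (B s) (m - 1)"
    by (rule extension(3)[OF submodules(2,1,3,5,6) _ VC]) (use e m in simp_all)
  then show "VN (m - 1)" by (rule homology_exactD[OF top(1)])
qed (use assms in auto)

text \<open>In cohomological degrees the shift through the projectives above \<open>s\<close> goes
  upwards and stays above \<open>g\<close>, so \<open>VR\<close> alone settles both ends. Compared
  with \<open>Tor\<close> the ends exchange roles: upward moves run from \<open>Z t\<close> to the
  homology at \<open>s\<close>, downward moves from \<open>B s\<close> to the homology at
  \<open>t\<close>.\<close>

lemma cohomological_vanishing:
  assumes VR: "\<And>i. i \<ge> g + 1 \<Longrightarrow> VR (- i)"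
    and n: "n > g" and win: "\<And>i. n \<le> i \<Longrightarrow> i \<le> n + (s - t) \<Longrightarrow> VN (- i)" and "i > g"
  shows "VN (- i)"
proof (rule window_induct[where W = "\<lambda>i. VN (- i)" and n = n and h = "s - t" and g = g and j = i])
  show "0 \<le> s - t" using s_ge_t by simp
  have VR': "VR i" if "i \<le> - (g + 1)" for i using VR[of "- i"] that by simp
  have Bs: "V s (B s) (Null s) i" if "i \<le> - (g + 1)" for i
    by (rule boundaries_exact[OF VR' _ that]) auto
  fix m assume m: "m > g" and W: "\<And>i. m \<le> i \<Longrightarrow> i \<le> m + (s - t) \<Longrightarrow> VN (- i)"
  \<comment> \<open>Homology in cohomological degree \<open>m + j\<close> takes vanishing for
    \<open>Z q\<close> to vanishing for \<open>B q\<close>, and the projective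
    \<open>C (q + 1)\<close> takes it to \<open>Z (q + 1)\<close> one degree higher.\<close>
  have chain_up: "int j \<le> s - t \<Longrightarrow> V (t + int j) (Z (t + int j)) (Null (t + int j)) (- (m + 1 + int j))" for j
  proof (induction j)
    case 0
    have "V t (Z t) (Null t) (- (m + 1))" by (rule cycles_exact[OF VR']) (use m in auto)
    then show ?case by simp
  next
    case (Suc j)
    let ?q = "t + int j" and ?k = "- (m + 1 + int j)"
    have q: "t + int (Suc j) = ?q + 1" "- (m + 1 + int (Suc j)) = ?k - 1" by simp_all
    have k1: "?k + 1 = - (m + int j)" by simp
    have h: "V ?q (Z ?q) (B ?q) (?k + 1)" unfolding k1 by (rule homology_exact[OF W]) (use Suc.prems in auto)
    have z: "V ?q (Z ?q) (Null ?q) ?k" using Suc.IH Suc.prems by simp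
    have "V ?q (B ?q) (Null ?q) ?k" by (rule extension(3)[OF submodules(4,2,1,8,5) h z])
    then have b: "V (?q + 1) (C (?q + 1)) (Z (?q + 1)) ?k" unfolding shift by simp
    have p: "V (?q + 1) (C (?q + 1)) (Null (?q + 1)) (?k - 1)" by (rule projective_exact[OF VR']) (use m in simp)
    show ?case unfolding q by (rule extension(3)[OF submodules(4,1,3,9,6) _ p]) (use b in \<open>simp only: diff_add_cancel\<close>)
  qed
  have e: "V s (Z s) (Null s) (- (m + (s - t) + 1))"
    using chain_up[of "nat (s - t)"] s_ge_t by (simp add: algebra_simps)
  have "V s (Z s) (B s) (- (m + (s - t) + 1))"
    by (rule extension(2)[OF submodules(4,2,1,8,5) e Bs]) (use m s_ge_t in simp)
  then show "VN (- (m + (s - t) + 1))" by (rule homology_exactD[OF top(1)])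
next
  have VR': "VR i" if "i \<le> - (g + 1)" for i using VR[of "- i"] that by simp
  have Bs: "V s (B s) (Null s) i" if "i \<le> - (g + 1)" for i
    by (rule boundaries_exact[OF VR' _ that]) auto
  fix m assume m: "m - 1 > g" and W: "\<And>i. m \<le> i \<Longrightarrow> i \<le> m + (s - t) \<Longrightarrow> VN (- i)"
  \<comment> \<open>Homology takes vanishing for \<open>B q\<close> to vanishing for
    \<open>Z q\<close> in the same degree, and the projective \<open>C q\<close> takes it to
    \<open>B (q - 1)\<close> one cohomological degree lower.\<close>
  have chain_down: "int j \<le> s - t \<Longrightarrow> V (s - int j) (B (s - int j)) (Null (s - int j)) (- (m + (s - t) - int j))" for j
  proof (induction j)
    case 0
    have "V s (B s) (Null s) (- (m + (s - t)))" by (rule Bs) (use m s_ge_t in simp)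
    then show ?case by simp
  next
    case (Suc j)
    let ?q = "s - int j" and ?k = "m + (s - t) - int j"
    have q: "s - int (Suc j) = ?q - 1" "- (m + (s - t) - int (Suc j)) = - ?k + 1" by simp_all
    have h: "V ?q (Z ?q) (B ?q) (- ?k)" by (rule homology_exact[OF W]) (use Suc.prems in auto)
    have b: "V ?q (B ?q) (Null ?q) (- ?k)" using Suc.IH Suc.prems by simp
    have z: "V ?q (Z ?q) (Null ?q) (- ?k)" by (rule extension(1)[OF submodules(4,2,1,8,5) b h])
    have p: "V ?q (C ?q) (Null ?q) (- ?k + 1)" by (rule projective_exact[OF VR']) (use m Suc.prems in simp)
    have "V ?q (C ?q) (Z ?q) (- ?k + 1)" by (rule extension(2)[OF submodules(4,1,3,9,6) p]) (use z in simp)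
    then show ?case unfolding q shift .
  qed
  have e: "V t (B t) (Null t) (- m)" using chain_down[of "nat (s - t)"] s_ge_t by simp
  have z: "V t (Z t) (Null t) (- (m - 1))" by (rule cycles_exact[OF VR']) (use m in auto)
  have "V t (Z t) (B t) (- (m - 1))"
    by (rule extension(2)[OF submodules(4,2,1,8,5) z]) (use e in simp)
  then show "VN (- (m - 1))" by (rule homology_exactD[OF bot(1)])
qed (use assms in auto)

end


theorem theorem6p12:
  fixes R :: "('a, 'r) ring_scheme"
    and M :: "('a, 'm) module"
    and N :: "('a, 'n) module"
    and P :: "('a, 'p) cpx"
    and n :: nat
  assumes "cring R" and "noetherian_ring R"
    and "module R M" and "\<not> zero_module M" and "fin_gen_module R M"
    and "module R N" and "\<not> zero_module N"
    and "qpd TYPE('p) R N < \<infinity>"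
    and "n > 0"
    and "finite_quasi_projective_resolution R P N"
    and "Gdim R M < enat n"
  shows "((\<forall>i. n \<le> i \<and> ereal (real i) \<le> ereal (real n) + hsup P - hinf P \<longrightarrow>
              zero_module (Tor R i M N)) \<longrightarrow>
            (\<forall>i. enat i > Gdim R M \<longrightarrow> zero_module (Tor R i M N))) \<and>
         ((\<forall>i. n \<le> i \<and> ereal (real i) \<le> ereal (real n) + hsup P - hinf P \<longrightarrow>
              zero_module (Ext R i M N)) \<longrightarrow>
            (\<forall>i. enat i > Gdim R M \<longrightarrow> zero_module (Ext R i M N)))"
proof -
  interpret cring R by (rule assms(1))
  have cr: "cring R" "noetherian_ring R" by (rule assms)+
  note M = assms(3) and N = assms(6)
  have P: "chain_complex R P" "bounded_below P" "\<And>i. projective_module R (cobj P i)" "bounded_above P"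
    using assms(10) by (simp_all add: finite_quasi_projective_resolution_def quasi_projective_resolution_def)
  have "\<exists>a :: int \<Rightarrow> nat. (\<exists>i. cinf P \<le> ereal (of_int i) \<and> a i \<noteq> 0) \<and>
      (\<forall>i. cinf P \<le> ereal (of_int i) \<longrightarrow> module_isomorphic R (homology P i) (direct_power N (a i)))"
    using assms(10) by (simp add: finite_quasi_projective_resolution_def quasi_projective_resolution_def)
  then obtain a :: "int \<Rightarrow> nat" where a: "\<exists>i. cinf P \<le> ereal (of_int i) \<and> a i \<noteq> 0"
    "\<And>i. cinf P \<le> ereal (of_int i) \<Longrightarrow> module_isomorphic R (homology P i) (direct_power N (a i))"
    by (elim exE conjE) (rule that, auto)
  define H where "H = {i. \<not> zero_module (homology P i)}"
  have below: "zero_module (homology P q)" if "zero_module (cobj P q)" for q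
    unfolding zero_homology_iff[OF P(1)]
    using that module.submoduleD(2)[OF chain_complexD(1)[OF P(1)] submodule_boundaries[OF P(1)], of q]
    by (auto simp: zero_module_def cycles_def)
  \<comment> \<open>The isomorphisms with powers of \<open>N\<close> are given only from
    \<open>cinf P\<close> on; where the module of \<open>P\<close> itself is zero, so is the
    homology.\<close>
  have cases: "zero_module (homology P q) \<or> (\<exists>a. module_isomorphic R (homology P q) (direct_power N a))" for q
  proof (cases "zero_module (cobj P q)")
    case False
    then have "cinf P \<le> ereal (of_int q)" unfolding cinf_def by (intro Inf_lower) auto
    from a(2)[OF this] show ?thesis by (intro disjI2 exI)
  qed (simp add: below)
  obtain l u where lu: "\<And>i. i < l \<Longrightarrow> zero_module (cobj P i)" "\<And>i. i > u \<Longrightarrow> zero_module (cobj P i)"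
    using P(2,4) by (auto simp: bounded_below_def bounded_above_def)
  have "H \<subseteq> {l..u}"
  proof
    fix i assume "i \<in> H"
    then have "\<not> zero_module (cobj P i)" using below[of i] by (auto simp: H_def)
    then show "i \<in> {l..u}" using lu(1)[of i] lu(2)[of i] by (cases "i < l"; cases "u < i") simp_all
  qed
  then have finH: "finite H" by (rule finite_subset) simp
  obtain i0 where i0: "cinf P \<le> ereal (of_int i0)" "a i0 \<noteq> 0" using a(1) by auto
  \<comment> \<open>The exponent at \<open>i0\<close> is positive: if the power of \<open>N\<close>
    had a single element, constant tuples would identify all elements of the nonzero module
    \<open>N\<close>.\<close>
  have "i0 \<in> H"
  proof (rule ccontr)
    assume "i0 \<notin> H"
    then have z: "carrier (homology P i0) = {\<zero>\<^bsub>homology P i0\<^esub>}" by (simp add: H_def zero_module_def)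
    obtain f where f: "bij_betw f (carrier (homology P i0)) (carrier (direct_power N (a i0)))"
      using a(2)[OF i0(1)] by (auto simp: module_isomorphic_def)
    have card: "card (carrier (direct_power N (a i0))) = 1" using bij_betw_same_card[OF f] z by simp
    obtain z' where z': "carrier (direct_power N (a i0)) = {z'}" by (rule card_1_singletonE[OF card])
    have const: "(\<lambda>j\<in>{..<a i0}. x) \<in> carrier (direct_power N (a i0))" if "x \<in> carrier N" for x using that by simp
    have "x = y" if "x \<in> carrier N" "y \<in> carrier N" for x y
    proof -
      have "(\<lambda>j\<in>{..<a i0}. x) = (\<lambda>j\<in>{..<a i0}. y)"
        using const[OF that(1)] const[OF that(2)] unfolding z' by simp
      from fun_cong[OF this, of 0] i0(2) show ?thesis by simp
    qed
    moreover have "\<zero>\<^bsub>N\<^esub> \<in> carrier N" using N by (simp add: module_def abelian_group_def abelian_monoid.zero_closed)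
    ultimately show False using assms(7) by (auto simp: zero_module_def)
  qed
  then have neH: "H \<noteq> {}" by auto
  define s where "s = Max H"
  define t where "t = Min H"
  have sH: "s \<in> H" and tH: "t \<in> H" unfolding s_def t_def using finH neH by auto
  \<comment> \<open>Homology is nonzero in finitely many degrees only, so \<open>hsup P\<close> and
    \<open>hinf P\<close> are integers and the window can be handled by integer arithmetic.\<close>
  have hs: "hsup P = ereal (of_int s)"
    unfolding hsup_def
  proof (rule antisym)
    show "Sup {ereal (of_int i) | i. \<not> zero_module (homology P i)} \<le> ereal (of_int s)"
      using Max_ge[OF finH] by (intro Sup_least) (auto simp: H_def s_def)
    show "ereal (of_int s) \<le> Sup {ereal (of_int i) | i. \<not> zero_module (homology P i)}"
      using sH by (intro Sup_upper) (auto simp: H_def)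
  qed
  have ht: "hinf P = ereal (of_int t)"
    unfolding hinf_def
  proof (rule antisym)
    show "ereal (of_int t) \<le> Inf {ereal (of_int i) | i. \<not> zero_module (homology P i)}"
      using Min_le[OF finH] by (intro Inf_greatest) (auto simp: H_def t_def)
    show "Inf {ereal (of_int i) | i. \<not> zero_module (homology P i)} \<le> ereal (of_int t)"
      using tH by (intro Inf_lower) (auto simp: H_def)
  qed
  \<comment> \<open>The complex is left arbitrary because there are three uses: the complete
    resolutions, the resolution of \<open>M\<close> and its transpose.\<close>
  have coeff: "quasi_projective_coefficients R P N s t X D" if "fin_free_complex R X D"
    for X :: "int \<Rightarrow> nat set" and D
  proof (rule quasi_projective_coefficients.intro)
    show "\<not> zero_module (homology P s)" "\<not> zero_module (homology P t)" using sH tH by (auto simp: H_def)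
    show "zero_module (homology P q)" if "q > s" for q
      using Max_ge[OF finH, of q] that by (force simp: H_def s_def)
    show "zero_module (homology P q)" if "q < t" for q
      using Min_le[OF finH, of q] that by (force simp: H_def t_def)
  qed (rule N P cases that)+
  have mP: "module R (cobj P s)" by (rule chain_complexD(1)[OF P(1)])
  have BC: "boundaries P s \<subseteq> carrier (cobj P s)"
    using module.submoduleD(1)[OF mP submodule_boundaries[OF P(1)]] by auto
  have acyclic: "exact_at (cobj P s) X D (carrier (cobj P s)) (boundaries P s) i"
    if "fin_free_complex R X D" "\<And>i. exact_at (regular_module R) X D (carrier R) {\<zero>\<^bsub>R\<^esub>} i"
    for X :: "int \<Rightarrow> nat set" and D i
    by (rule quasi_projective_coefficients.quotient_exact[OF coeff[OF that(1)] that(2)])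
  obtain g where g: "Gdim R M = enat g" "g < n" using assms(11) by (cases "Gdim R M") auto
  \<comment> \<open>A single resolution serves both parts: \<open>Tor\<close> needs its exactness
    with coefficients in the top quotient of \<open>P\<close>, and \<open>Ext\<close> the exactness
    of its transpose over the ring.\<close>
  obtain X D e where good: "good_resolution R (cobj P s) (carrier (cobj P s)) (boundaries P s) (int g + 1) M X D e"
    by (rule Gdim_good_resolution[OF cr M mP module.carrier_is_submodule[OF mP] submodule_boundaries[OF P(1)] BC acyclic g(1)])
       (assumption | rule that)+
  then have r: "fin_resolution R X D e M"
    and Tor_s: "\<And>i. i \<ge> int g + 1 \<Longrightarrow> exact_at (cobj P s) X D (carrier (cobj P s)) (boundaries P s) i"
    and Ext_R: "\<And>i. i \<ge> int g + 1 \<Longrightarrow>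
      exact_at (regular_module R) (transpose_basis X) (transpose_diff D) (carrier R) {\<zero>\<^bsub>R\<^esub>} (- i)"
    by (simp_all add: good_resolution_def)
  have ff: "fin_free_complex R X D" by (rule fin_resolutionD(1)[OF r])
  interpret T: quasi_projective_coefficients R P N s t X D by (rule coeff[OF ff])
  interpret E: quasi_projective_coefficients R P N s t "transpose_basis X" "transpose_diff D"
    by (rule coeff[OF fin_free_complex_transpose[OF cr(1) ff]])
  have window: "ereal (real i) \<le> ereal (real n) + hsup P - hinf P \<longleftrightarrow> int i \<le> int n + (s - t)" for i
  proof -
    have "ereal (real n) + hsup P - hinf P = ereal (of_int (int n + (s - t)))" unfolding hs ht by simp
    moreover have "real i \<le> of_int (int n + (s - t)) \<longleftrightarrow> int i \<le> int n + (s - t)" by linarith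
    ultimately show ?thesis by simp
  qed
  show ?thesis
  proof (intro conjI impI allI)
    fix i
    assume W: "\<forall>i. n \<le> i \<and> ereal (real i) \<le> ereal (real n) + hsup P - hinf P \<longrightarrow> zero_module (Tor R i M N)"
      and i: "Gdim R M < enat i"
    have "T.VN (int i)"
    proof (rule T.homological_vanishing[where g = "int g" and n = "int n"])
      show "T.VR j" if "j \<ge> 1" for j using fin_resolution_exact_at[OF cr(1) r] that by simp
      show "T.VN j" if "int n \<le> j" "j \<le> int n + (s - t)" for j
        using W[rule_format, of "nat j"] that zero_Tor_iff[OF M N r, of "nat j"] window[of "nat j"] by simp
    qed (use Tor_s g i in simp_all)
    then show "zero_module (Tor R i M N)" unfolding zero_Tor_iff[OF M N r] .
  next
    fix i
    assume W: "\<forall>i. n \<le> i \<and> ereal (real i) \<le> ereal (real n) + hsup P - hinf P \<longrightarrow> zero_module (Ext R i M N)"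
      and i: "Gdim R M < enat i"
    have "E.VN (- int i)"
    proof (rule E.cohomological_vanishing[where g = "int g" and n = "int n"])
      show "E.VN (- j)" if "int n \<le> j" "j \<le> int n + (s - t)" for j
        using W[rule_format, of "nat j"] that zero_Ext_iff[OF M N r, of "nat j"] window[of "nat j"] by simp
    qed (use Ext_R g i in simp_all)
    then show "zero_module (Ext R i M N)" unfolding zero_Ext_iff[OF M N r] .
  qed
qed

end
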